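(* Let $F(x,t)=\gamma(x)+t\xi(x)$ be a $k$-th pseudo cylindrical developable surface with associated functions $p,q,\delta,\rho$ as in the context. Suppose that the striction curve exists for every $x\in I$, i.e. $q(x)=\tilde q(x)x^{Q}$ with $\tilde q$ real analytic and $Q\ge k$; let $t(x)=-\dfrac{\tilde q(x)}{\|\tilde\xi(x)\|}x^{Q-k}$ be the analytic extension of $-q(x)/\delta(x)$ and $\sigma(x)=\delta(x)\bigl(p(x)-(q(x)/\delta(x))'\bigr)=\delta(x)(p(x)+t'(x))$. Then for $x\in I$ the singular point $(x,t(x))$ of $F$ is a cuspidal beaks if and only if $\delta(x)=0$, $\delta'(x)\neq0$, $\rho(x)\neq0$ and $\sigma'(x)\neq0$.
   Context: Let $I\subset\mathbb{R}$ be an open interval containing $0$ (all statements are local at $x=0$, so $I$ may be shrunk), and let $\gamma:I\to\mathbb{R}^3$ with $\gamma(0)=0$ and $\xi:I\to S^2$ be real analytic. The ruled surface is $F:I\times\mathbb{R}\to\mathbb{R}^3$, $F(x,t)=\gamma(x)+t\xi(x)$. It is called $k$-th pseudo cylindrical ($k\in\mathbb{Z}_{\ge 0}$) if $\xi'(x)=\tilde\xi(x)x^{k}$ with $\tilde\xi(0)\neq\mathbf 0$; $I$ is taken so small that $\tilde\xi$ has no zeros on $I$. Put $\xi_d=\tilde\xi/\|\tilde\xi\|$, so $\{\xi,\xi_d,\xi\times\xi_d\}$ is an orthonormal frame; $\delta(x)=\langle\xi'(x),\xi_d(x)\rangle=\|\tilde\xi(x)\|x^{k}$ and $\rho(x)=\det(\xi(x),\xi_d(x),\xi_d'(x))$.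 The functions $p,q,r:I\to\mathbb{R}$ are defined by $\gamma'=p\,\xi+q\,\xi_d+r\,(\xi\times\xi_d)$. $F$ is a developable surface (vanishing Gaussian curvature on the regular part), equivalently $r\equiv 0$. The striction curve is $s(x)=F(x,t(x))$. Two $C^\infty$ map germs $f_i:(\mathbb{R}^2,x_i)\to(\mathbb{R}^3,y_i)$ are $\mathcal{A}$-equivalent if $\psi\circ f_1=f_2\circ\phi$ for diffeomorphism germs $\phi:(\mathbb{R}^2,x_1)\to(\mathbb{R}^2,x_2)$, $\psi:(\mathbb{R}^3,y_1)\to(\mathbb{R}^3,y_2)$. A singular point of a map is a cuspidal beaks if the germ of the map there is $\mathcal{A}$-equivalent to the germ at $0$ of $(u,v)\mapsto(u,-2v^3+u^2v,3v^4-u^2v^2)$. *)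

theory Defs
  imports "HOL-Analysis.Analysis"
begin

definition real_analytic_on :: "(real \<Rightarrow> 'b::real_normed_vector) \<Rightarrow> real set \<Rightarrow> bool" where
  "real_analytic_on f I \<longleftrightarrow>
    (\<forall>a\<in>I. \<exists>r>0. \<exists>c. \<forall>x. \<bar>x - a\<bar> < r \<longrightarrow> (\<lambda>n. (x - a) ^ n *\<^sub>R c n) sums f x)"

(* Only meant for open S and finite-dimensional domains, where continuity of all iterated
   directional derivatives is the usual notion of class C^n. *)
primrec Ck_on :: "nat \<Rightarrow> ('a::real_normed_vector \<Rightarrow> 'b::real_normed_vector) \<Rightarrow> 'a set \<Rightarrow> bool" where
  "Ck_on 0 f S \<longleftrightarrow> continuous_on S f"
| "Ck_on (Suc n) f S \<longleftrightarrow>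
    (\<forall>x\<in>S. f differentiable (at x)) \<and>
    (\<forall>v. Ck_on n (\<lambda>x. frechet_derivative f (at x) v) S)"

definition smooth_on :: "('a::real_normed_vector \<Rightarrow> 'b::real_normed_vector) \<Rightarrow> 'a set \<Rightarrow> bool" where
  "smooth_on f S \<longleftrightarrow> (\<forall>n. Ck_on n f S)"

definition diffeo_on :: "('a::real_normed_vector \<Rightarrow> 'a) \<Rightarrow> 'a set \<Rightarrow> 'a set \<Rightarrow> bool" where
  "diffeo_on f U V \<longleftrightarrow>
    open U \<and> open V \<and> bij_betw f U V \<and> smooth_on f U \<and> smooth_on (inv_into U f) V"

(* The germ of f1 at x1 (with target base point f1 x1) and the germ of f2 at x2 (with target
   base point f2 x2), expressed through representatives of the diffeomorphism germs. *)
definition A_equivalent ::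
  "('a::real_normed_vector \<Rightarrow> 'b::real_normed_vector) \<Rightarrow> 'a \<Rightarrow> ('a \<Rightarrow> 'b) \<Rightarrow> 'a \<Rightarrow> bool" where
  "A_equivalent f1 x1 f2 x2 \<longleftrightarrow>
    (\<exists>\<phi> U1 U2 \<psi> V1 V2.
      diffeo_on \<phi> U1 U2 \<and> x1 \<in> U1 \<and> \<phi> x1 = x2 \<and>
      diffeo_on \<psi> V1 V2 \<and> f1 x1 \<in> V1 \<and> \<psi> (f1 x1) = f2 x2 \<and>
      (\<forall>u\<in>U1. f1 u \<in> V1 \<and> \<psi> (f1 u) = f2 (\<phi> u)))"

definition regular_point :: "(real \<times> real \<Rightarrow> real^3) \<Rightarrow> real \<times> real \<Rightarrow> bool" where
  "regular_point f z \<longleftrightarrow> f differentiable (at z) \<and> inj (frechet_derivative f (at z))"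

definition singular_point :: "(real \<times> real \<Rightarrow> real^3) \<Rightarrow> real \<times> real \<Rightarrow> bool" where
  "singular_point f z \<longleftrightarrow> f differentiable (at z) \<and> \<not> inj (frechet_derivative f (at z))"

definition beaks_model :: "real \<times> real \<Rightarrow> real^3" where
  "beaks_model = (\<lambda>(u, v). vector [u, - 2 * v^3 + u^2 * v, 3 * v^4 - u^2 * v^2])"

definition cuspidal_beaks :: "(real \<times> real \<Rightarrow> real^3) \<Rightarrow> real \<times> real \<Rightarrow> bool" where
  "cuspidal_beaks f z \<longleftrightarrow> singular_point f z \<and> A_equivalent f z beaks_model (0, 0)"

definition partial1 :: "(real \<times> real \<Rightarrow> real^3) \<Rightarrow> real \<times> real \<Rightarrow> real^3" where
  "partial1 f z = vector_derivative (\<lambda>u. f (u, snd z)) (at (fst z))"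

definition partial2 :: "(real \<times> real \<Rightarrow> real^3) \<Rightarrow> real \<times> real \<Rightarrow> real^3" where
  "partial2 f z = vector_derivative (\<lambda>v. f (fst z, v)) (at (snd z))"

definition unit_normal :: "(real \<times> real \<Rightarrow> real^3) \<Rightarrow> real \<times> real \<Rightarrow> real^3" where
  "unit_normal f z =
    (1 / norm (cross3 (partial1 f z) (partial2 f z))) *\<^sub>R (cross3 (partial1 f z) (partial2 f z))"

(* (L N - M^2) / (E G - F^2) in terms of the coefficients of the two fundamental forms;
   meaningful at regular points only. *)
definition gaussian_curvature :: "(real \<times> real \<Rightarrow> real^3) \<Rightarrow> real \<times> real \<Rightarrow> real" where
  "gaussian_curvature f z =
    ((partial1 (partial1 f) z \<bullet> unit_normal f z) * (partial2 (partial2 f) z \<bullet> unit_normal f z)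
       - (partial2 (partial1 f) z \<bullet> unit_normal f z)^2) /
    ((partial1 f z \<bullet> partial1 f z) * (partial2 f z \<bullet> partial2 f z)
       - (partial1 f z \<bullet> partial2 f z)^2)"

definition ruled_surface :: "(real \<Rightarrow> real^3) \<Rightarrow> (real \<Rightarrow> real^3) \<Rightarrow> real \<times> real \<Rightarrow> real^3" where
  "ruled_surface \<gamma> \<xi> = (\<lambda>(x, t). \<gamma> x + t *\<^sub>R \<xi> x)"

definition developable_on :: "real set \<Rightarrow> (real \<times> real \<Rightarrow> real^3) \<Rightarrow> bool" where
  "developable_on I f \<longleftrightarrow>
    (\<forall>x\<in>I. \<forall>t. regular_point f (x, t) \<longrightarrow> gaussian_curvature f (x, t) = 0)"

(* \<zeta> is the factor of \<xi>' = x^k \<zeta>, written \<xi> with a tilde on paper; its analyticity fixes the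
   value \<zeta> 0, which the factorization alone leaves undetermined for k > 0. *)
definition pseudo_cylindrical ::
  "real set \<Rightarrow> nat \<Rightarrow> (real \<Rightarrow> real^3) \<Rightarrow> (real \<Rightarrow> real^3) \<Rightarrow> bool" where
  "pseudo_cylindrical I k \<xi> \<zeta> \<longleftrightarrow>
    real_analytic_on \<zeta> I \<and>
    (\<forall>x\<in>I. vector_derivative \<xi> (at x) = x ^ k *\<^sub>R \<zeta> x) \<and>
    (\<forall>x\<in>I. \<zeta> x \<noteq> 0)"

definition xi_d :: "(real \<Rightarrow> real^3) \<Rightarrow> real \<Rightarrow> real^3" where
  "xi_d \<zeta> x = (1 / norm (\<zeta> x)) *\<^sub>R \<zeta> x"

definition delta :: "(real \<Rightarrow> real^3) \<Rightarrow> (real \<Rightarrow> real^3) \<Rightarrow> real \<Rightarrow> real" where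
  "delta \<xi> \<zeta> x = vector_derivative \<xi> (at x) \<bullet> xi_d \<zeta> x"

definition rho :: "(real \<Rightarrow> real^3) \<Rightarrow> (real \<Rightarrow> real^3) \<Rightarrow> real \<Rightarrow> real" where
  "rho \<xi> \<zeta> x =
    det (vector [\<xi> x, xi_d \<zeta> x, vector_derivative (xi_d \<zeta>) (at x)] :: real^3^3)"

(* The analytic extension of - q / delta for q x = qt x * x^Q with Q \<ge> k. *)
definition striction_param ::
  "(real \<Rightarrow> real^3) \<Rightarrow> nat \<Rightarrow> (real \<Rightarrow> real) \<Rightarrow> nat \<Rightarrow> real \<Rightarrow> real" where
  "striction_param \<zeta> k qt Q x = - (qt x / norm (\<zeta> x)) * x ^ (Q - k)"

definition sigma ::
  "(real \<Rightarrow> real^3) \<Rightarrow> (real \<Rightarrow> real^3) \<Rightarrow> nat \<Rightarrow> (real \<Rightarrow> real) \<Rightarrow> (real \<Rightarrow> real) \<Rightarrow> nat \<Rightarrow> real \<Rightarrow> real"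
where
  "sigma \<xi> \<zeta> k p qt Q x = delta \<xi> \<zeta> x * (p x + deriv (striction_param \<zeta> k qt Q) x)"

end

theory Submission
  imports Defs "HOL-Complex_Analysis.Complex_Analysis"
begin

text \<open>
  Developability forces \<open>r = 0\<close>, so the striction curve \<open>s = \<gamma> + t \<xi>\<close> satisfies \<open>s' = (p + t') \<xi>\<close> and the
  first derivative of the surface is governed by \<open>\<mu>(x, v) = (v - t(x)) \<delta>(x)\<close>.

  Necessity: the model has \<open>f_u \<times> f_v = \<lambda> n\<close> with \<open>\<lambda> = u\<^sup>2 - 6 v\<^sup>2\<close> and \<open>n(0) \<noteq> 0\<close>, so an equivalence
  matches \<open>\<mu>\<close> with \<open>\<lambda>\<close> up to a nonvanishing factor. Hence \<open>\<mu>\<close> vanishes exactly to second order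
  (\<open>\<delta> = 0\<close>, \<open>\<delta>' \<noteq> 0\<close>) and has two transversal zero branches, neither tangent to the kernel (\<open>p + t' \<noteq> 0\<close>);
  as \<open>n\<close> has nonzero derivative along the kernel direction, \<open>\<rho> \<noteq> 0\<close>.

  Sufficiency: here \<open>x = 0\<close> and \<open>k = 1\<close>. In affine coordinates in which \<open>\<xi>(0)\<close> is the first axis,
  with the first coordinate \<open>y\<close> of \<open>s\<close> as parameter, the surface is
  \<open>(U, U b\<^sub>2(y) - n\<^sub>2(y), U b\<^sub>3(y) - n\<^sub>3(y))\<close> with \<open>n\<^sub>j' = y b\<^sub>j'\<close>, where \<open>b\<^sub>2\<close>, \<open>b\<^sub>3\<close> have
  order \<open>2\<close>, \<open>3\<close>. A linear change in the target depending on \<open>U\<close> moves the value of the second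
  coordinate on the curve of self-intersection halfway between its two critical values, as in the model.
  Then a change of parameter turns the second coordinate into \<open>U v\<^sup>2 / 2 - v\<^sup>3 / 3\<close>, the model cubic up to
  scaling and translation. Dividing the third coordinate by this cubic, with Cauchy's integral formula in
  place of the Malgrange preparation theorem, writes it as \<open>H\<^sub>0 + H\<^sub>1 c\<^sub>0 + H\<^sub>2 c\<^sub>0\<^sup>2\<close> with \<open>H\<^sub>i\<close> functions of
  the first two coordinates, \<open>H\<^sub>1(0) \<noteq> 0\<close> and \<open>c\<^sub>0\<close> the third coordinate of the model; this is a
  diffeomorphism of the target applied to the model.
\<close>

section \<open>Smooth functions\<close>

text \<open>The reduction lives in a mixed class: functions on real x complex that are jointly
  smooth and holomorphic in the second variable. Holomorphy makes Cauchy's formula available,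
  smoothness accommodates implicit functions of the real parameter, and symmetry under conjugation
  leads back to real functions. Division yields p0 + p1 v + p2 v^2 with coefficients in (u, c),
  where c is the cubic. To be a function of (u, c, c0) the third coordinate must be critical in v
  where c is, and take equal values at the two nonzero roots of c = 0. The first holds because at
  fixed U both coordinates have derivative (U - y) b_j'(y). The second is what the linear change
  depending on U is for: adding a multiple of the third coordinate keeps the critical points and
  moves the value at the self-intersection relative to the critical values. The recurring constants
  belong to U v^2/2 - v^3/3, with critical values 0 and U^3/6: around its inflection point v = U/2
  it is U^3/12 + U^2 v/4 - v^3/3, which U = sqrt(2/3) u turns into the model cubic, and it takes the
  halfway value U^3/12 again at v = U (1 + sqrt 3)/2 and U (1 - sqrt 3)/2.\<close>

lemma Ck_on_subset: "Ck_on n f S \<Longrightarrow> T \<subseteq> S \<Longrightarrow> Ck_on n f T"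
  by (induction n arbitrary: f) (auto intro: continuous_on_subset)

lemma Ck_on_cong:
  assumes "open S" "\<And>x. x \<in> S \<Longrightarrow> f x = g x" "Ck_on n f S"
  shows "Ck_on n g S"
  using assms(2,3)
proof (induction n arbitrary: f g)
  case 0
  then show ?case by (simp cong: continuous_on_cong)
next
  case (Suc n)
  have d: "g differentiable (at x)" "frechet_derivative f (at x) = frechet_derivative g (at x)" if "x \<in> S" for x
  proof -
    have f: "f differentiable (at x)" using Suc.prems that by simp
    have "(g has_derivative frechet_derivative f (at x)) (at x)"
      using f assms(1) that Suc.prems(1)
      by (intro has_derivative_transform_within_open[of f _ x UNIV S g]) (auto simp: frechet_derivative_works)
    then show "g differentiable (at x)" "frechet_derivative f (at x) = frechet_derivative g (at x)"
      by (auto simp: differentiable_def intro: frechet_derivative_at)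
  qed
  show ?case
    unfolding Ck_on.simps
  proof (intro conjI ballI allI)
    show "Ck_on n (\<lambda>x. frechet_derivative g (at x) v) S" for v
      by (rule Suc.IH[of "\<lambda>x. frechet_derivative f (at x) v"])
        (use Suc.prems(2) in \<open>simp_all add: d(2)\<close>)
  qed (rule d)
qed

lemma Ck_on_SucI:
  assumes "open S" "\<And>x. x \<in> S \<Longrightarrow> (f has_derivative f' x) (at x)"
    "\<And>v. Ck_on n (\<lambda>x. f' x v) S"
  shows "Ck_on (Suc n) f S"
proof -
  have "f' x = frechet_derivative f (at x)" if "x \<in> S" for x
    using assms(2)[OF that] by (rule frechet_derivative_at)
  then have "Ck_on n (\<lambda>x. frechet_derivative f (at x) v) S" for v
    by (intro Ck_on_cong[OF assms(1) _ assms(3)[of v]]) simp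
  then show ?thesis using assms(2) by (auto simp: differentiable_def)
qed

lemma Ck_on_Suc_has_derivative:
  "Ck_on (Suc n) f S \<Longrightarrow> x \<in> S \<Longrightarrow> (f has_derivative frechet_derivative f (at x)) (at x)"
  by (simp add: frechet_derivative_works)

lemma Ck_on_SucD: "Ck_on (Suc n) f S \<Longrightarrow> Ck_on n f S"
proof (induction n arbitrary: f)
  case 0
  then show ?case
    by (simp add: continuous_at_imp_continuous_on differentiable_imp_continuous_within)
next
  case (Suc n)
  show ?case using Suc.prems Suc.IH by (metis Ck_on.simps(2))
qed

lemma Ck_on_local:
  "(\<And>x. x \<in> S \<Longrightarrow> \<exists>T. open T \<and> x \<in> T \<and> Ck_on n f T) \<Longrightarrow> Ck_on n f S"
proof (induction n arbitrary: f)
  case 0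
  then show ?case
    by (metis Ck_on.simps(1) continuous_at_imp_continuous_on continuous_on_eq_continuous_at)
next
  case (Suc n)
  show ?case
    unfolding Ck_on.simps
  proof (intro conjI ballI allI)
    show "f differentiable at x" if "x \<in> S" for x using Suc.prems[OF that] by auto
    show "Ck_on n (\<lambda>x. frechet_derivative f (at x) v) S" for v
      using Suc.prems by (intro Suc.IH) (metis Ck_on.simps(2))
  qed
qed

lemma Ck_on_const: "open S \<Longrightarrow> Ck_on n (\<lambda>x. c) S"
  by (induction n arbitrary: c) auto

lemma Ck_on_bounded_linear:
  assumes "bounded_linear h" "open S"
  shows "Ck_on n h S"
proof (cases n)
  case 0
  then show ?thesis
    using assms linear_continuous_on by auto
next
  case (Suc m)
  show ?thesis
    unfolding Suc by (rule Ck_on_SucI[where f' = "\<lambda>_. h"])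
      (auto simp: assms Ck_on_const intro: bounded_linear_imp_has_derivative)
qed

lemma Ck_on_compose_linear:
  assumes "bounded_linear h" "open S" "Ck_on n f S"
  shows "Ck_on n (\<lambda>x. h (f x)) S"
  using assms(3)
proof (induction n arbitrary: f)
  case 0
  then show ?case
    using bounded_linear.continuous_on[OF assms(1)] by simp
next
  case (Suc n)
  show ?case
    by (rule Ck_on_SucI[where f' = "\<lambda>x v. h (frechet_derivative f (at x) v)"])
      (use Suc assms in \<open>auto intro!: bounded_linear.has_derivative[OF assms(1)] Ck_on_Suc_has_derivative\<close>)
qed

lemma Ck_on_add:
  assumes "open S" "Ck_on n f S" "Ck_on n g S"
  shows "Ck_on n (\<lambda>x. f x + g x) S"
  using assms(2,3)
proof (induction n arbitrary: f g)
  case 0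
  then show ?case by (simp add: continuous_on_add)
next
  case (Suc n)
  show ?case
    by (rule Ck_on_SucI[where f' = "\<lambda>x v. frechet_derivative f (at x) v + frechet_derivative g (at x) v"])
      (use Suc assms in \<open>auto intro!: has_derivative_add Ck_on_Suc_has_derivative\<close>)
qed

lemma Ck_on_sum:
  assumes "open S" "\<And>i. i \<in> I \<Longrightarrow> Ck_on n (f i) S"
  shows "Ck_on n (\<lambda>x. \<Sum>i\<in>I. f i x) S"
  using assms by (induction I rule: infinite_finite_induct) (auto intro: Ck_on_const Ck_on_add)

lemma Ck_on_bilinear:
  assumes "bounded_bilinear h" "open S" "Ck_on n f S" "Ck_on n g S"
  shows "Ck_on n (\<lambda>x. h (f x) (g x)) S"
  using assms(3,4)
proof (induction n arbitrary: f g)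
  case 0
  then show ?case using bounded_bilinear.continuous_on[OF assms(1)] by auto
next
  case (Suc n)
  have "Ck_on n f S" "Ck_on n g S" using Suc.prems Ck_on_SucD by blast+
  then show ?case
    using Suc assms
    by (intro Ck_on_SucI[where f' = "\<lambda>x v. h (f x) (frechet_derivative g (at x) v) + h
        (frechet_derivative f (at x) v) (g x)"])
      (auto intro!: bounded_bilinear.FDERIV[OF assms(1)] Ck_on_Suc_has_derivative Ck_on_add)
qed

lemma Ck_on_compose:
  fixes f :: "'a::real_normed_vector \<Rightarrow> 'b::euclidean_space" and g :: "'b \<Rightarrow> 'c::real_normed_vector"
  assumes "open S" "open T" "f ` S \<subseteq> T" "Ck_on n f S" "Ck_on n g T"
  shows "Ck_on n (\<lambda>x. g (f x)) S"
  using assms(4,5)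
proof (induction n arbitrary: g)
  case 0
  then show ?case using assms(3) continuous_on_compose2 by auto
next
  case (Suc n)
  have f: "Ck_on n f S" using Suc.prems Ck_on_SucD by blast
  have g: "Ck_on n (\<lambda>x. frechet_derivative g (at (f x)) b) S" for b
    using Suc.prems f by (intro Suc.IH[of "\<lambda>y. frechet_derivative g (at y) b"]) auto
  \<comment> \<open>\<open>Ck_on\<close> speaks of derivatives in a fixed direction, but the chain
    rule feeds g' the moving direction f'(x) v. Expanding that direction in the basis leaves a
    finite sum of products of C^n functions.\<close>
  have eq: "frechet_derivative g (at (f x)) (frechet_derivative f (at x) v) =
      (\<Sum>b\<in>Basis. (frechet_derivative f (at x) v \<bullet> b) *\<^sub>R frechet_derivative g (at (f x)) b)" if "x \<in> S" for x v
  proof -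
    have "linear (frechet_derivative g (at (f x)))"
      using Suc.prems(2) assms(3) that by (auto intro: linear_frechet_derivative)
    then show ?thesis
      by (subst (1) euclidean_representation[of "frechet_derivative f (at x) v", symmetric])
        (simp add: linear_sum linear_cmul)
  qed
  show ?case
  proof (rule Ck_on_SucI[where f' = "\<lambda>x v. frechet_derivative g (at (f x)) (frechet_derivative f (at x) v)"])
    show "open S" by fact
    show "((\<lambda>x. g (f x)) has_derivative (\<lambda>v. frechet_derivative g (at (f x)) (frechet_derivative f (at x) v))) (at x)"
      if "x \<in> S" for x
      using that assms(3) Suc.prems
      by (intro has_derivative_compose[of f _ x UNIV g, simplified] Ck_on_Suc_has_derivative) auto
    show "Ck_on n (\<lambda>x. frechet_derivative g (at (f x)) (frechet_derivative f (at x) v)) S" for v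
    proof (rule Ck_on_cong[OF assms(1)])
      show "Ck_on n (\<lambda>x. \<Sum>b\<in>Basis. (frechet_derivative f (at x) v \<bullet> b) *\<^sub>R frechet_derivative g (at (f x)) b) S"
        using g Suc.prems assms(1)
        by (intro Ck_on_sum Ck_on_bilinear[OF bounded_bilinear_scaleR]
           Ck_on_compose_linear[OF bounded_linear_inner_left]) auto
    qed (simp add: eq)
  qed
qed

text \<open>The derivative - x^-1 v x^-1 is a product of two copies of the inverse itself, so the
  induction feeds on its own hypothesis.\<close>

lemma Ck_on_inverse:
  "Ck_on n (inverse :: 'a::real_normed_field \<Rightarrow> 'a) (- {0})"
proof (induction n)
  case 0
  then show ?case by (auto intro!: continuous_intros)
next
  case (Suc n)
  have o: "open (- {0::'a})" by (intro open_Compl closed_singleton)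
  have "Ck_on n (\<lambda>x. - (inverse x * (v * inverse x))) (- {0::'a})" for v
    by (intro Ck_on_compose_linear[OF bounded_linear_minus[OF bounded_linear_ident]]
       Ck_on_bilinear[OF bounded_bilinear_mult] o Suc Ck_on_const)
  then show ?case
    by (intro Ck_on_SucI[where f' = "\<lambda>x v. - (inverse x * v * inverse x)"] o)
      (auto intro!: derivative_eq_intros simp: mult.assoc)
qed

text \<open>As a real derivative, f' is multiplication by \<open>deriv f\<close>, which is again
  holomorphic.\<close>

lemma Ck_on_holomorphic:
  fixes f :: "complex \<Rightarrow> complex"
  assumes "open S" "f holomorphic_on S"
  shows "Ck_on n f S"
  using assms(2)
proof (induction n arbitrary: f)
  case 0
  then show ?case by (simp add: holomorphic_on_imp_continuous_on)
next
  case (Suc n)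
  show ?case
  proof (rule Ck_on_SucI[where f' = "\<lambda>x v. deriv f x * v"])
    show "(f has_derivative (\<lambda>v. deriv f x * v)) (at x)" if "x \<in> S" for x
      using holomorphic_derivI[OF Suc.prems assms(1) that] by (simp add: has_field_derivative_def)
    show "Ck_on n (\<lambda>x. deriv f x * v) S" for v
      using Suc assms by (intro Suc.IH) (auto intro!: holomorphic_intros)
  qed fact
qed

section \<open>Smoothness of germs\<close>

definition smooth_at :: "('a::real_normed_vector \<Rightarrow> 'b::real_normed_vector) \<Rightarrow> 'a \<Rightarrow> bool" where
  "smooth_at f x \<longleftrightarrow> (\<exists>S. open S \<and> x \<in> S \<and> smooth_on f S)"

lemma smooth_on_subset: "smooth_on f S \<Longrightarrow> T \<subseteq> S \<Longrightarrow> smooth_on f T"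
  unfolding smooth_on_def using Ck_on_subset by blast

lemma smooth_on_iff_at:
  assumes "open S"
  shows "smooth_on f S \<longleftrightarrow> (\<forall>x\<in>S. smooth_at f x)"
proof
  show "smooth_on f S \<Longrightarrow> \<forall>x\<in>S. smooth_at f x" using assms by (auto simp: smooth_at_def)
  show "\<forall>x\<in>S. smooth_at f x \<Longrightarrow> smooth_on f S"
    unfolding smooth_on_def smooth_at_def by (intro allI Ck_on_local) blast
qed

lemma smooth_atI: "open S \<Longrightarrow> x \<in> S \<Longrightarrow> (\<And>n. Ck_on n f S) \<Longrightarrow> smooth_at f x"
  unfolding smooth_at_def smooth_on_def by blast

lemma eventually_smooth_at: "smooth_at f x \<Longrightarrow> \<forall>\<^sub>F y in nhds x. smooth_at f y"
  unfolding eventually_nhds by (meson smooth_at_def)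

lemma smooth_at_cong:
  assumes "\<forall>\<^sub>F y in nhds x. f y = g y" "smooth_at f x"
  shows "smooth_at g x"
proof -
  obtain S T where "open S" "x \<in> S" "\<forall>y\<in>S. f y = g y" "open T" "x \<in> T" "smooth_on f T"
    using assms unfolding eventually_nhds smooth_at_def by blast
  then show ?thesis
    by (intro smooth_atI[of "S \<inter> T"] Ck_on_cong[of "S \<inter> T" f g])
      (auto simp: smooth_on_def intro: Ck_on_subset)
qed

lemma smooth_at_imp_has_derivative:
  "smooth_at f x \<Longrightarrow> (f has_derivative frechet_derivative f (at x)) (at x)"
  unfolding smooth_at_def smooth_on_def using Ck_on_Suc_has_derivative by blast

lemma smooth_at_imp_differentiable: "smooth_at f x \<Longrightarrow> f differentiable (at x)"
  using smooth_at_imp_has_derivative differentiable_def by blast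

lemma smooth_at_imp_isCont: "smooth_at f x \<Longrightarrow> isCont f x"
  using smooth_at_imp_has_derivative has_derivative_continuous by blast

lemma smooth_at_frechet_derivative:
  "smooth_at f x \<Longrightarrow> smooth_at (\<lambda>y. frechet_derivative f (at y) v) x"
  unfolding smooth_at_def smooth_on_def by (metis Ck_on.simps(2))

lemma smooth_at_const: "smooth_at (\<lambda>x. c) x"
  by (rule smooth_atI[of UNIV]) (auto intro: Ck_on_const)

lemma smooth_at_bounded_linear: "bounded_linear h \<Longrightarrow> smooth_at h x"
  by (rule smooth_atI[of UNIV]) (auto intro: Ck_on_bounded_linear)

lemma smooth_at_compose_linear:
  "bounded_linear h \<Longrightarrow> smooth_at f x \<Longrightarrow> smooth_at (\<lambda>x. h (f x)) x"
  unfolding smooth_at_def smooth_on_def using Ck_on_compose_linear by blast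

lemma smooth_at_bilinear:
  assumes "bounded_bilinear h" "smooth_at f x" "smooth_at g x"
  shows "smooth_at (\<lambda>x. h (f x) (g x)) x"
proof -
  obtain S T where "open S" "x \<in> S" "smooth_on f S" "open T" "x \<in> T" "smooth_on g T"
    using assms unfolding smooth_at_def by blast
  then show ?thesis
    by (intro smooth_atI[of "S \<inter> T"] Ck_on_bilinear[OF assms(1)])
      (auto simp: smooth_on_def intro: Ck_on_subset)
qed

lemma smooth_at_add:
  assumes "smooth_at f x" "smooth_at g x"
  shows "smooth_at (\<lambda>x. f x + g x) x"
proof -
  obtain S T where "open S" "x \<in> S" "smooth_on f S" "open T" "x \<in> T" "smooth_on g T"
    using assms unfolding smooth_at_def by blast
  then show ?thesis
    by (intro smooth_atI[of "S \<inter> T"] Ck_on_add)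
      (auto simp: smooth_on_def intro: Ck_on_subset)
qed

lemma smooth_at_compose:
  fixes f :: "'a::real_normed_vector \<Rightarrow> 'b::euclidean_space"
  assumes "smooth_at f x" "smooth_at g (f x)"
  shows "smooth_at (\<lambda>x. g (f x)) x"
proof -
  obtain S T where ST: "open S" "x \<in> S" "smooth_on f S" "open T" "f x \<in> T" "smooth_on g T"
    using assms unfolding smooth_at_def by blast
  have "continuous_on S f" using ST(3) unfolding smooth_on_def by (metis Ck_on.simps(1))
  then have o: "open (f -` T \<inter> S)" using ST by (simp add: continuous_on_open_vimage)
  have fg: "Ck_on n f (f -` T \<inter> S)" "Ck_on n g T" for n
    using ST Ck_on_subset[of n f S "f -` T \<inter> S"] by (auto simp: smooth_on_def)
  show ?thesis
    by (rule smooth_atI[OF o]) (use ST(2,5) in simp, rule Ck_on_compose[OF o ST(4) _ fg], auto)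
qed

lemma smooth_at_ident: "smooth_at (\<lambda>x. x) x"
  by (rule smooth_at_bounded_linear[OF bounded_linear_ident])

lemma smooth_at_minus: "smooth_at f x \<Longrightarrow> smooth_at (\<lambda>x. - f x) x"
  by (rule smooth_at_compose_linear[OF bounded_linear_minus[OF bounded_linear_ident]])

lemma smooth_at_diff: "smooth_at f x \<Longrightarrow> smooth_at g x \<Longrightarrow> smooth_at (\<lambda>x. f x - g x) x"
  using smooth_at_add[OF _ smooth_at_minus, of f x g] by simp

lemma smooth_at_mult:
  fixes f g :: "'a::real_normed_vector \<Rightarrow> 'b::real_normed_algebra"
  shows "smooth_at f x \<Longrightarrow> smooth_at g x \<Longrightarrow> smooth_at (\<lambda>x. f x * g x) x"
  by (rule smooth_at_bilinear[OF bounded_bilinear_mult])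

lemma smooth_at_scaleR:
  "smooth_at f x \<Longrightarrow> smooth_at g x \<Longrightarrow> smooth_at (\<lambda>x. f x *\<^sub>R g x) x"
  by (rule smooth_at_bilinear[OF bounded_bilinear_scaleR])

lemma smooth_at_inner:
  "smooth_at f x \<Longrightarrow> smooth_at g x \<Longrightarrow> smooth_at (\<lambda>x. f x \<bullet> g x) x"
  by (rule smooth_at_bilinear[OF bounded_bilinear_inner])

lemma smooth_at_power:
  fixes f :: "'a::real_normed_vector \<Rightarrow> 'b::real_normed_algebra_1"
  shows "smooth_at f x \<Longrightarrow> smooth_at (\<lambda>x. f x ^ n) x"
  by (induction n) (auto intro: smooth_at_const smooth_at_mult)

lemma smooth_at_sum:
  "(\<And>i. i \<in> I \<Longrightarrow> smooth_at (f i) x) \<Longrightarrow> smooth_at (\<lambda>x. \<Sum>i\<in>I. f i x) x"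
  by (induction I rule: infinite_finite_induct) (auto intro: smooth_at_const smooth_at_add)

lemma smooth_at_divide:
  fixes f g :: "'a::real_normed_vector \<Rightarrow> 'b::{real_normed_field,euclidean_space}"
  assumes "smooth_at f x" "smooth_at g x" "g x \<noteq> 0"
  shows "smooth_at (\<lambda>x. f x / g x) x"
proof -
  have "smooth_at inverse (g x)"
    using assms(3) by (intro smooth_atI[of "- {0}"] Ck_on_inverse) auto
  then show ?thesis
    unfolding divide_inverse using assms by (intro smooth_at_mult) (auto intro: smooth_at_compose[of g x inverse])
qed

lemma smooth_at_fst: "smooth_at f x \<Longrightarrow> smooth_at (\<lambda>x. fst (f x)) x"
  by (rule smooth_at_compose_linear[OF bounded_linear_fst])

lemma smooth_at_snd: "smooth_at f x \<Longrightarrow> smooth_at (\<lambda>x. snd (f x)) x"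
  by (rule smooth_at_compose_linear[OF bounded_linear_snd])

lemma smooth_at_Pair:
  assumes "smooth_at f x" "smooth_at g x"
  shows "smooth_at (\<lambda>x. (f x, g x)) x"
proof -
  have 1: "bounded_linear (\<lambda>a::'b. (a, 0::'c))" and 2: "bounded_linear (\<lambda>b::'c. (0::'b, b))"
    by (intro bounded_linear_Pair bounded_linear_ident bounded_linear_zero)+
  show ?thesis
    using smooth_at_add[OF smooth_at_compose_linear[OF 1 assms(1)] smooth_at_compose_linear[OF 2 assms(2)]]
    by simp
qed

lemma smooth_at_of_real:
  "smooth_at f x \<Longrightarrow> smooth_at (\<lambda>x. of_real (f x) :: 'b::{real_normed_algebra_1}) x"
  by (rule smooth_at_compose_linear[OF bounded_linear_of_real])

lemma smooth_at_Re: "smooth_at f x \<Longrightarrow> smooth_at (\<lambda>x. Re (f x)) x"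
  by (rule smooth_at_compose_linear[OF bounded_linear_Re])

lemma smooth_at_holomorphic:
  assumes "open S" "f holomorphic_on S" "x \<in> S"
  shows "smooth_at f x"
  using assms by (intro smooth_atI[of S] Ck_on_holomorphic)

lemmas smooth_intros = smooth_at_const smooth_at_ident smooth_at_minus smooth_at_diff smooth_at_add
  smooth_at_mult smooth_at_scaleR smooth_at_inner smooth_at_power smooth_at_sum smooth_at_divide
  smooth_at_fst smooth_at_snd smooth_at_Pair smooth_at_of_real smooth_at_Re

section \<open>Inverse and implicit functions\<close>

text \<open>Product rule at a zero of one factor: the increment is s'(y - x) c(x) + s'(y - x) (c(y)
  - c(x)) + o(y - x) c(y), and continuity of c makes the last two terms negligible. It serves
  wherever the other factor is only known to be continuous or its derivative is best not
  computed.\<close>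

lemma has_derivative_scaleR_vanishing:
  fixes s :: "'a::real_normed_vector \<Rightarrow> real" and c :: "'a \<Rightarrow> 'b::real_normed_vector"
  assumes "(s has_derivative s') (at x)" "s x = 0" "isCont c x"
  shows "((\<lambda>y. s y *\<^sub>R c y) has_derivative (\<lambda>h. s' h *\<^sub>R c x)) (at x)"
proof -
  have s': "bounded_linear s'" using assms(1) has_derivative_bounded_linear by blast
  obtain K where K: "K > 0" "\<And>h. \<bar>s' h\<bar> \<le> norm h * K"
    using bounded_linear.pos_bounded[OF s'] by auto
  have lim: "((\<lambda>y. (s y - s x - s' (y - x)) /\<^sub>R norm (y - x)) \<longlongrightarrow> 0) (at x)"
    using assms(1) by (simp add: has_derivative_at_within)
  have c: "(c \<longlongrightarrow> c x) (at x)" using assms(3) isCont_def by blast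
  have 1: "((\<lambda>y. ((s y - s x - s' (y - x)) /\<^sub>R norm (y - x)) *\<^sub>R c y) \<longlongrightarrow> 0) (at x)"
    using tendsto_scaleR[OF lim c] by simp
  have 2: "((\<lambda>y. (s' (y - x) / norm (y - x)) *\<^sub>R (c y - c x)) \<longlongrightarrow> 0) (at x)"
  proof (rule Lim_null_comparison)
    show "\<forall>\<^sub>F y in at x. norm ((s' (y - x) / norm (y - x)) *\<^sub>R (c y - c x)) \<le> K * norm (c y - c x)"
    proof (rule always_eventually, rule allI)
      fix y
      have "\<bar>s' (y - x) / norm (y - x)\<bar> \<le> K"
      proof (cases "y = x")
        case True
        have "s' 0 = 0" using s' bounded_linear.linear linear_0 by blast
        then show ?thesis using True K(1) by simp
      next
        case False
        then show ?thesis using K(2)[of "y - x"] by (simp add: divide_simps mult.commute)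
      qed
      then show "norm ((s' (y - x) / norm (y - x)) *\<^sub>R (c y - c x)) \<le> K * norm (c y - c x)"
        unfolding norm_scaleR by (intro mult_right_mono) auto
    qed
    show "((\<lambda>y. K * norm (c y - c x)) \<longlongrightarrow> 0) (at x)"
      using c by (auto intro!: tendsto_eq_intros)
  qed
  have "((\<lambda>y. ((s y - s x - s' (y - x)) /\<^sub>R norm (y - x)) *\<^sub>R c y +
      (s' (y - x) / norm (y - x)) *\<^sub>R (c y - c x)) \<longlongrightarrow> 0 + 0) (at x)"
    by (intro tendsto_add 1 2)
  moreover have "(\<lambda>y. ((s y - s x - s' (y - x)) /\<^sub>R norm (y - x)) *\<^sub>R c y +
      (s' (y - x) / norm (y - x)) *\<^sub>R (c y - c x)) =
      (\<lambda>y. (s y *\<^sub>R c y - s x *\<^sub>R c x - s' (y - x) *\<^sub>R c x) /\<^sub>R norm (y - x))"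
    using assms(2) by (auto simp: algebra_simps divide_inverse)
  ultimately have "((\<lambda>y. (s y *\<^sub>R c y - s x *\<^sub>R c x - s' (y - x) *\<^sub>R c x) /\<^sub>R norm (y - x)) \<longlongrightarrow> 0) (at x)"
    by simp
  then show ?thesis
    using bounded_linear_compose[OF bounded_linear_scaleR_left s']
    by (simp add: has_derivative_at_within)
qed

text \<open>\<open>inverse_function_theorem\<close> supplies a differentiable inverse g. Its
  smoothness rests on the resolvent identity A^-1 - B^-1 = A^-1 (B - A) B^-1 for the derivatives of
  f: it gives continuity of g', then a formula for the derivative of g' through g' and second
  derivatives of f, and finally an induction.\<close>

lemma smooth_inverse_function:
  fixes f :: "'a::euclidean_space \<Rightarrow> 'a"
  assumes "open S" "smooth_on f S" "x0 \<in> S" "(f has_derivative D) (at x0)" "inj D"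
  obtains U V where "open U" "U \<subseteq> S" "x0 \<in> U" "diffeo_on f U V"
proof -
  have Ck: "Ck_on n f S" for n using assms(2) smooth_on_def by blast
  have der: "(f has_derivative frechet_derivative f (at x)) (at x)" if "x \<in> S" for x
    using Ck_on_Suc_has_derivative[OF Ck that] .
  define f' where "f' x = Blinfun (frechet_derivative f (at x))" for x
  have f': "blinfun_apply (f' x) = frechet_derivative f (at x)" if "x \<in> S" for x
    unfolding f'_def by (rule bounded_linear_Blinfun_apply) (use der[OF that] has_derivative_bounded_linear in blast)
  have Ck': "Ck_on n (\<lambda>x. frechet_derivative f (at x) v) S" for n v
    using Ck[of "Suc n"] by simp
  have cont': "continuous_on S f'"
  proof (rule continuous_on_blinfun_componentwise)
    show "continuous_on S (\<lambda>x. blinfun_apply (f' x) i)" for i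
      using Ck'[of 0 i] by (simp add: f' cong: continuous_on_cong)
  qed
  have D: "D = frechet_derivative f (at x0)" using assms(4) frechet_derivative_at by blast
  have "linear D" using assms(4) has_derivative_linear by blast
  then have "linear (inv D)"
    by (rule inj_linear_imp_inv_linear[OF _ assms(5)])
  then have "blinfun_apply (Blinfun (inv D)) = inv D"
    by (intro bounded_linear_Blinfun_apply) (simp add: linear_linear)
  then have "Blinfun (inv D) o\<^sub>L f' x0 = id_blinfun"
    using assms(3,5) by (intro blinfun_eqI) (simp add: f' D[symmetric])
  then obtain U V g g' where UV: "open U" "U \<subseteq> S" "x0 \<in> U" "open V" "f x0 \<in> V" "homeomorphism U V f g"
    and g: "\<And>y. y \<in> V \<Longrightarrow> (g has_derivative g' y) (at y)"
    and g': "\<And>y. y \<in> V \<Longrightarrow> g' y = inv (blinfun_apply (f' (g y)))"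
    and bij: "\<And>y. y \<in> V \<Longrightarrow> bij (blinfun_apply (f' (g y)))"
    using inverse_function_theorem[of S f f' x0 "Blinfun (inv D)"] assms(1,3) der f' cont' by metis
  have gU: "g y \<in> U" "g y \<in> S" "f (g y) = y" if "y \<in> V" for y
    using UV that unfolding homeomorphism_def by auto
  have g'1: "f' (g y) (g' y v) = v" if "y \<in> V" for y v
    unfolding g'[OF that] using bij[OF that] by (simp add: bij_is_surj surj_f_inv_f)
  have g'2: "g' y (f' (g y) v) = v" if "y \<in> V" for y v
    unfolding g'[OF that] using bij[OF that] by (simp add: bij_is_inj inv_f_f)
  have g'lin: "linear (g' y)" if "y \<in> V" for y using g[OF that] has_derivative_linear by blast
  have contg: "continuous_on V g" using UV(6) homeomorphism_def by blast
  have contA: "continuous_on V (\<lambda>y. f' (g y))"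
    by (rule continuous_on_compose2[OF cont' contg]) (use gU in auto)
  \<comment> \<open>The injective map f'(g y0) is bounded below by some B > 0, hence f'(g y) by B/2
    for y near y0. So the inverses g' y are uniformly bounded by 2/B, and the resolvent identity
    bounds g' y v - g' y0 v.\<close>
  have contg': "isCont (\<lambda>y. g' y v) y0" if y0: "y0 \<in> V" for y0 v
  proof -
    have "bij (f' (g y0))" "linear (f' (g y0))"
      using bij[OF y0] blinfun.bounded_linear_right bounded_linear.linear by auto
    then obtain B where B: "B > 0" "\<And>x. B * norm x \<le> norm (f' (g y0) x)"
      using linear_inj_bounded_below_pos bij_is_inj by metis
    have isA: "((\<lambda>y. f' (g y)) \<longlongrightarrow> f' (g y0)) (at y0)"
      using contA UV(4) y0 by (metis at_within_open continuous_on_def)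
    then have "\<forall>\<^sub>F y in at y0. dist (f' (g y)) (f' (g y0)) < B / 2"
      using B(1) by (intro tendstoD) auto
    moreover have "\<forall>\<^sub>F y in at y0. y \<in> V" using UV(4) y0 eventually_at_in_open' by blast
    ultimately have ev: "\<forall>\<^sub>F y in at y0. norm (g' y v - g' y0 v)
        \<le> (2/B) * (norm (f' (g y) - f' (g y0)) * norm (g' y0 v))"
    proof eventually_elim
      case (elim y)
      have bd: "norm (g' y w) \<le> (2/B) * norm w" for w
      proof -
        let ?u = "g' y w"
        have "B * norm ?u \<le> norm (f' (g y0) ?u)" by (rule B)
        also have "f' (g y0) ?u = w - (f' (g y) - f' (g y0)) ?u"
          using g'1[OF elim(2)] by (simp add: blinfun.diff_left)
        also have "norm \<dots> \<le> norm w + norm (f' (g y) - f' (g y0)) * norm ?u"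
          by (rule order_trans[OF norm_triangle_ineq4]) (simp add: norm_blinfun)
        also have "\<dots> \<le> norm w + B/2 * norm ?u"
          using elim(1) by (intro add_mono mult_right_mono) (auto simp: dist_norm)
        finally show ?thesis using B(1) by (simp add: field_simps)
      qed
      have "g' y v - g' y0 v = - g' y ((f' (g y) - f' (g y0)) (g' y0 v))"
        using g'1[OF y0] g'2[OF elim(2)] g'lin[OF elim(2)] by (simp add: blinfun.diff_left linear_diff)
      then have "norm (g' y v - g' y0 v) \<le> (2/B) * norm ((f' (g y) - f' (g y0)) (g' y0 v))"
        using bd by simp
      also have "\<dots> \<le> (2/B) * (norm (f' (g y) - f' (g y0)) * norm (g' y0 v))"
        using B(1) norm_blinfun by (intro mult_left_mono) auto
      finally show ?case .
    qed
    have "((\<lambda>y. (2/B) * (norm (f' (g y) - f' (g y0)) * norm (g' y0 v))) \<longlongrightarrow> 0) (at y0)"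
      using isA B(1) by (auto intro!: tendsto_eq_intros)
    then have "((\<lambda>y. g' y v - g' y0 v) \<longlongrightarrow> 0) (at y0)"
      by (rule Lim_null_comparison[OF ev])
    then show ?thesis unfolding isCont_def by (rule LIM_zero_cancel)
  qed
  define P where "P b x = frechet_derivative f (at x) b" for b x
  define E where "E b c x = frechet_derivative (P b) (at x) c" for b c x
  have CkP: "Ck_on n (P b) S" for n b unfolding P_def using Ck' .
  have CkE: "Ck_on n (E b c) S" for n b c unfolding E_def using CkP[of "Suc n" b] by simp
  have Pder: "(P b has_derivative (\<lambda>h. E b h x)) (at x)" if "x \<in> S" for b x
    unfolding E_def using Ck_on_Suc_has_derivative[OF CkP that] .
  have expand: "F v = (\<Sum>b\<in>Basis. (v \<bullet> b) *\<^sub>R F b)" if "linear F" for F :: "'a \<Rightarrow> 'a" and v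
    by (subst (1) euclidean_representation[of v, symmetric]) (simp add: that linear_sum linear_cmul)
  define G where "G v h y = (\<Sum>i\<in>Basis. ((- (\<Sum>b\<in>Basis. (g' y v \<bullet> b) *\<^sub>R
      (\<Sum>c\<in>Basis. (g' y h \<bullet> c) *\<^sub>R E b c (g y)))) \<bullet> i) *\<^sub>R g' y i)" for v h y
  \<comment> \<open>Resolvent identity again: g' y v = g' y0 v + g' y (k y) with k y = (f'(g y0) -
    f'(g y)) (g' y0 v). As k vanishes at y0, \<open>has_derivative_scaleR_vanishing\<close> applies
    with the continuous factor g'.\<close>
  have derg': "((\<lambda>y. g' y v) has_derivative (\<lambda>h. G v h y0)) (at y0)" if y0: "y0 \<in> V" for v y0
  proof -
    define k where "k y = (\<Sum>b\<in>Basis. (g' y0 v \<bullet> b) *\<^sub>R (P b (g y0) - P b (g y)))" for y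
    have Pg: "((\<lambda>y. P b (g y)) has_derivative (\<lambda>h. \<Sum>c\<in>Basis. (g' y0 h \<bullet> c) *\<^sub>R E b c (g y0))) (at y0)" for b
    proof -
      have "((\<lambda>y. P b (g y)) has_derivative (\<lambda>h. E b (g' y0 h) (g y0))) (at y0)"
        by (rule has_derivative_compose[OF g[OF y0] Pder[OF gU(2)[OF y0]]])
      moreover have "linear (\<lambda>h. E b h (g y0))"
        using Pder[OF gU(2)[OF y0]] has_derivative_linear by blast
      then have "E b (g' y0 h) (g y0) = (\<Sum>c\<in>Basis. (g' y0 h \<bullet> c) *\<^sub>R E b c (g y0))" for h
        by (rule expand)
      ultimately show ?thesis by simp
    qed
    have kder: "(k has_derivative (\<lambda>h. - (\<Sum>b\<in>Basis. (g' y0 v \<bullet> b) *\<^sub>R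
      (\<Sum>c\<in>Basis. (g' y0 h \<bullet> c) *\<^sub>R E b c (g y0))))) (at y0)"
      unfolding k_def
      by (rule has_derivative_eq_rhs[OF has_derivative_sum[OF
          has_derivative_scaleR_right[OF has_derivative_diff[OF has_derivative_const Pg]]]])
        (simp add: sum_negf)
    have rep: "g' y v = g' y0 v + (\<Sum>i\<in>Basis. (k y \<bullet> i) *\<^sub>R g' y i)" if y: "y \<in> V" for y
    proof -
      have lf: "linear (blinfun_apply (f' (g z)))" for z
        using blinfun.bounded_linear_right bounded_linear.linear by blast
      have "k y = f' (g y0) (g' y0 v) - f' (g y) (g' y0 v)"
        unfolding k_def P_def f'[OF gU(2)[OF y0], symmetric] f'[OF gU(2)[OF y], symmetric]
          scaleR_diff_right sum_subtractf
        using expand[OF lf[of y0], of "g' y0 v"] expand[OF lf[of y], of "g' y0 v"] by simp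
      then have "g' y (k y) = g' y v - g' y0 v"
        using g'1[OF y0] g'2[OF y] by (simp add: linear_diff[OF g'lin[OF y]])
      then show ?thesis using expand[OF g'lin[OF y], of "k y"] by simp
    qed
    have "k y0 = 0" by (simp add: k_def)
    have "((\<lambda>y. g' y0 v + (\<Sum>i\<in>Basis. (k y \<bullet> i) *\<^sub>R g' y i)) has_derivative
       (\<lambda>h. 0 + G v h y0)) (at y0)"
      unfolding G_def
      by (intro has_derivative_add has_derivative_const has_derivative_sum
        has_derivative_scaleR_vanishing has_derivative_inner_left kder contg' y0)
        (simp add: \<open>k y0 = 0\<close>)
    then show ?thesis
      using has_derivative_transform_within_open[OF _ UV(4) y0, of _ _ UNIV "\<lambda>y. g' y v"] rep
      by simp
  qed
  \<comment> \<open>The two claims advance together: class n of g and g' gives class n of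
    \<open>G\<close>, the derivative of g', and hence class n + 1 of both.\<close>
  have Ckg: "(\<forall>v. Ck_on n (\<lambda>y. g' y v) V) \<and> Ck_on n g V" for n
  proof (induction n)
    case 0
    show ?case using contg' contg UV(4) by (simp add: continuous_on_eq_continuous_at)
  next
    case (Suc n)
    have gS: "g ` V \<subseteq> S" using gU by auto
    have Eg: "Ck_on n (\<lambda>y. E b c (g y)) V" for b c
      by (rule Ck_on_compose[OF UV(4) assms(1) gS _ CkE]) (use Suc in simp)
    have g'n: "Ck_on n (\<lambda>y. g' y v \<bullet> b) V" for v b
      by (rule Ck_on_compose_linear[OF bounded_linear_inner_left UV(4)]) (use Suc in simp)
    have "Ck_on n (G v h) V" for v h
      unfolding G_def
      by (intro Ck_on_sum Ck_on_bilinear[OF bounded_bilinear_scaleR] UV(4) Eg g'n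
        Ck_on_compose_linear[OF bounded_linear_inner_left]
        Ck_on_compose_linear[OF bounded_linear_minus[OF bounded_linear_ident]])
        (use Suc in simp)
    then have "Ck_on (Suc n) (\<lambda>y. g' y v) V" for v
      by (intro Ck_on_SucI[OF UV(4) derg']) auto
    moreover have "Ck_on (Suc n) g V"
      by (rule Ck_on_SucI[OF UV(4) g]) (use Suc in auto)
    ultimately show ?case by blast
  qed
  have bijUV: "bij_betw f U V"
    using UV(6) unfolding homeomorphism_def by (intro bij_betw_byWitness[where f' = g]) auto
  have "inv_into U f y = g y" if "y \<in> V" for y
    using bijUV gU[OF that] that by (metis bij_betw_inv_into_left)
  then have "smooth_on (inv_into U f) V"
    unfolding smooth_on_def using Ckg Ck_on_cong[OF UV(4), of g "inv_into U f"] by auto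
  then have "diffeo_on f U V"
    unfolding diffeo_on_def using UV bijUV smooth_on_subset[OF assms(2)] by blast
  then show thesis using UV that by blast
qed

lemma Ck_on_imp_continuous_on: "Ck_on n f S \<Longrightarrow> continuous_on S f"
proof (induction n)
  case (Suc n)
  then show ?case using Ck_on_SucD[OF Suc.prems] by simp
qed simp

section \<open>Diffeomorphism germs, recognised by an injective derivative\<close>

definition local_diffeo :: "('a::real_normed_vector \<Rightarrow> 'a) \<Rightarrow> 'a \<Rightarrow> bool" where
  "local_diffeo f x \<longleftrightarrow> smooth_at f x \<and> (\<exists>D. (f has_derivative D) (at x) \<and> inj D)"

lemma local_diffeo_imp_diffeo_on:
  fixes f :: "'a::euclidean_space \<Rightarrow> 'a"
  assumes "local_diffeo f x" "open W" "x \<in> W"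
  obtains U V where "diffeo_on f U V" "x \<in> U" "U \<subseteq> W"
proof -
  obtain S where S: "open S" "x \<in> S" "smooth_on f S"
    using assms(1) unfolding local_diffeo_def smooth_at_def by blast
  obtain D where D: "(f has_derivative D) (at x)" "inj D"
    using assms(1) unfolding local_diffeo_def by blast
  have "open (S \<inter> W)" "smooth_on f (S \<inter> W)" "x \<in> S \<inter> W"
    using S assms smooth_on_subset[of f S "S \<inter> W"] by auto
  then obtain U V where "open U" "U \<subseteq> S \<inter> W" "x \<in> U" "diffeo_on f U V"
    using smooth_inverse_function[of "S \<inter> W" f x D] D by metis
  then show thesis using that by blast
qed

lemma eventually_nhds_isCont:
  assumes "isCont f x" "\<forall>\<^sub>F y in nhds (f x). P y"
  shows "\<forall>\<^sub>F z in nhds x. P (f z)"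
proof -
  have "filterlim f (nhds (f x)) (nhds x)"
    using assms(1) by (simp add: isCont_def tendsto_at_iff_tendsto_nhds)
  then show ?thesis using assms(2) eventually_compose_filterlim by blast
qed

lemma local_diffeo_inverse:
  fixes f :: "'a::euclidean_space \<Rightarrow> 'a"
  assumes "local_diffeo f x"
  obtains g where "local_diffeo g (f x)" "g (f x) = x"
    "\<forall>\<^sub>F y in nhds (f x). f (g y) = y" "\<forall>\<^sub>F z in nhds x. g (f z) = z"
proof -
  obtain U V where UV: "diffeo_on f U V" "x \<in> U"
    using local_diffeo_imp_diffeo_on[OF assms, of UNIV] by auto
  define g where "g = inv_into U f"
  have o: "open U" "open V" and b: "bij_betw f U V" and s: "smooth_on g V"
    using UV unfolding diffeo_on_def g_def by auto
  have fx: "f x \<in> V" using b UV(2) bij_betwE by blast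
  have gf: "g (f z) = z" if "z \<in> U" for z using b that by (simp add: g_def bij_betw_inv_into_left)
  have fg: "f (g y) = y" if "y \<in> V" for y using b that by (simp add: g_def bij_betw_inv_into_right)
  have sg: "smooth_at g (f x)" using s o fx by (auto simp: smooth_at_def)
  obtain D where D: "(f has_derivative D) (at x)" using assms local_diffeo_def by blast
  let ?E = "frechet_derivative g (at (f x))"
  have E: "(g has_derivative ?E) (at (f x))" by (rule smooth_at_imp_has_derivative[OF sg])
  have "((\<lambda>y. f (g y)) has_derivative (\<lambda>h. D (?E h))) (at (f x))"
    by (rule has_derivative_compose[OF E]) (simp add: gf[OF UV(2)] D)
  then have "((\<lambda>y. y) has_derivative (\<lambda>h. D (?E h))) (at (f x))"
    by (rule has_derivative_transform_within_open[OF _ o(2) fx]) (rule fg)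
  then have "(\<lambda>h. D (?E h)) = (\<lambda>h. h)"
    using has_derivative_unique has_derivative_ident by blast
  then have "inj ?E" by (metis injI)
  then have "local_diffeo g (f x)" using sg E local_diffeo_def by blast
  moreover have "\<forall>\<^sub>F y in nhds (f x). f (g y) = y"
    using eventually_nhds_in_open[OF o(2) fx] by eventually_elim (rule fg)
  moreover have "\<forall>\<^sub>F z in nhds x. g (f z) = z"
    using eventually_nhds_in_open[OF o(1) UV(2)] by eventually_elim (rule gf)
  ultimately show thesis using that gf[OF UV(2)] by blast
qed

lemma local_diffeo_compose:
  fixes f :: "'a::euclidean_space \<Rightarrow> 'a"
  assumes "local_diffeo f x" "local_diffeo g (f x)"
  shows "local_diffeo (\<lambda>z. g (f z)) x"
proof -
  obtain D E where D: "(f has_derivative D) (at x)" "inj D" and E: "(g has_derivative E) (at (f x))" "inj E"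
    using assms local_diffeo_def by blast
  have "((\<lambda>z. g (f z)) has_derivative (\<lambda>h. E (D h))) (at x)"
    by (rule has_derivative_compose[OF D(1) E(1)])
  moreover have "inj (\<lambda>h. E (D h))"
    by (rule injI) (rule injD[OF D(2)], rule injD[OF E(2)])
  moreover have "smooth_at (\<lambda>z. g (f z)) x"
    by (rule smooth_at_compose) (use assms in \<open>auto simp: local_diffeo_def\<close>)
  ultimately show ?thesis unfolding local_diffeo_def by blast
qed

lemma local_diffeo_isCont: "local_diffeo f x \<Longrightarrow> isCont f x"
  by (simp add: local_diffeo_def smooth_at_imp_isCont)

lemma A_equivalentI:
  fixes f1 :: "'a::euclidean_space \<Rightarrow> 'b::euclidean_space"
  assumes "local_diffeo \<phi> x1" "local_diffeo \<psi> (f1 x1)" "isCont f1 x1"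
    "\<forall>\<^sub>F z in nhds x1. \<psi> (f1 z) = f2 (\<phi> z)" "\<phi> x1 = x2"
  shows "A_equivalent f1 x1 f2 x2"
proof -
  obtain V1 V2 where V: "diffeo_on \<psi> V1 V2" "f1 x1 \<in> V1"
    using local_diffeo_imp_diffeo_on[OF assms(2), of UNIV] by auto
  then have "open V1" by (simp add: diffeo_on_def)
  then have "\<forall>\<^sub>F z in nhds x1. f1 z \<in> V1"
    using V(2) assms(3) by (intro eventually_nhds_isCont[where f = f1]) (auto intro: eventually_nhds_in_open)
  then have "\<forall>\<^sub>F z in nhds x1. f1 z \<in> V1 \<and> \<psi> (f1 z) = f2 (\<phi> z)"
    using assms(4) eventually_conj by blast
  then obtain W where W: "open W" "x1 \<in> W" "\<And>z. z \<in> W \<Longrightarrow> f1 z \<in> V1 \<and> \<psi> (f1 z) = f2 (\<phi> z)"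
    unfolding eventually_nhds by blast
  obtain U1 U2 where U: "diffeo_on \<phi> U1 U2" "x1 \<in> U1" "U1 \<subseteq> W"
    using local_diffeo_imp_diffeo_on[OF assms(1) W(1,2)] by blast
  show ?thesis unfolding A_equivalent_def
    by (rule exI[of _ \<phi>], rule exI[of _ U1], rule exI[of _ U2], rule exI[of _ \<psi>],
        rule exI[of _ V1], rule exI[of _ V2])
      (use U V W assms(5) in auto)
qed

text \<open>Both germs are brought to a common third germ by source and target changes, and the
  square is closed by inverting \<open>\<alpha>\<close> and \<open>\<psi>2\<close>. This spares any
  computation with explicit inverses when the surface is compared with the model.\<close>

lemma A_equivalent_chain:
  fixes f1 :: "'a::euclidean_space \<Rightarrow> 'b::euclidean_space"
  assumes \<alpha>: "local_diffeo \<alpha> z" and \<beta>: "local_diffeo \<beta> z"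
    and 1: "local_diffeo \<psi>1 (f1 (\<alpha> z))" and 2: "local_diffeo \<psi>2 (f2 (\<beta> z))"
    and c: "isCont f1 (\<alpha> z)" "isCont f2 (\<beta> z)"
    and eq: "\<forall>\<^sub>F w in nhds z. \<psi>1 (f1 (\<alpha> w)) = \<psi>2 (f2 (\<beta> w))"
  shows "A_equivalent f1 (\<alpha> z) f2 (\<beta> z)"
proof -
  obtain a where a: "local_diffeo a (\<alpha> z)" "a (\<alpha> z) = z" "\<forall>\<^sub>F y in nhds (\<alpha> z). \<alpha> (a y) = y"
    using local_diffeo_inverse[OF \<alpha>] by blast
  obtain g where g: "local_diffeo g (\<psi>2 (f2 (\<beta> z)))" "\<forall>\<^sub>F y in nhds (f2 (\<beta> z)). g (\<psi>2 y) = y"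
    using local_diffeo_inverse[OF 2] by blast
  have eqz: "\<psi>1 (f1 (\<alpha> z)) = \<psi>2 (f2 (\<beta> z))" using eq eventually_nhds_x_imp_x by fast
  have "\<forall>\<^sub>F y in nhds (\<alpha> z). \<psi>1 (f1 (\<alpha> (a y))) = \<psi>2 (f2 (\<beta> (a y)))"
    using local_diffeo_isCont[OF a(1)] a(2) eq by (intro eventually_nhds_isCont[where f = a]) auto
  moreover have "isCont \<beta> (a (\<alpha> z))" using local_diffeo_isCont[OF \<beta>] a(2) by simp
  then have "isCont (\<lambda>y. f2 (\<beta> (a y))) (\<alpha> z)"
    using isCont_o2[OF isCont_o2[OF local_diffeo_isCont[OF a(1)], of \<beta>], of f2] c(2) a(2) by simp
  then have "\<forall>\<^sub>F y in nhds (\<alpha> z). g (\<psi>2 (f2 (\<beta> (a y)))) = f2 (\<beta> (a y))"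
    using g(2) a(2) by (intro eventually_nhds_isCont[where f = "\<lambda>y. f2 (\<beta> (a y))"]) auto
  ultimately have ev: "\<forall>\<^sub>F y in nhds (\<alpha> z). g (\<psi>1 (f1 y)) = f2 (\<beta> (a y))"
    using a(3) by eventually_elim metis
  show ?thesis
  proof (rule A_equivalentI[where \<phi> = "\<lambda>y. \<beta> (a y)" and \<psi> = "\<lambda>y. g (\<psi>1 y)"])
    show "local_diffeo (\<lambda>y. \<beta> (a y)) (\<alpha> z)" by (rule local_diffeo_compose[OF a(1)]) (simp add: a \<beta>)
    show "local_diffeo (\<lambda>y. g (\<psi>1 y)) (f1 (\<alpha> z))"
      by (rule local_diffeo_compose[OF 1]) (simp add: g eqz)
    show "\<beta> (a (\<alpha> z)) = \<beta> z" using a(2) by simp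
  qed (fact c(1), fact ev)
qed

text \<open>Inverse function theorem for (z, w) |-> (z, \<Psi>(z, w)). The local uniqueness in the
  last conclusion is what later shows that a solution of an equation with conjugation symmetry is
  real.\<close>

lemma smooth_implicit_function:
  fixes \<Psi> :: "'a::euclidean_space \<times> 'b::euclidean_space \<Rightarrow> 'b"
  assumes "smooth_at \<Psi> (a, b)" "\<Psi> (a, b) = 0"
    and D: "(\<Psi> has_derivative D) (at (a, b))" "inj (\<lambda>k. D (0, k))"
  obtains \<theta> where "smooth_at \<theta> a" "\<theta> a = b" "\<forall>\<^sub>F z in nhds a. \<Psi> (z, \<theta> z) = 0"
    "\<forall>\<^sub>F p in nhds (a, b). \<Psi> p = 0 \<longrightarrow> snd p = \<theta> (fst p)"
proof -
  define f where "f p = (fst p, \<Psi> p)" for p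
  have "(f has_derivative (\<lambda>h. (fst h, D h))) (at (a, b))"
    unfolding f_def by (intro has_derivative_Pair has_derivative_fst has_derivative_ident D(1))
  moreover have "inj (\<lambda>h. (fst h, D h))"
  proof (rule injI)
    fix x y assume eq: "(fst x, D x) = (fst y, D y)"
    have "linear D" using D(1) has_derivative_linear by blast
    then have "D (0, snd x - snd y) = 0"
      using linear_diff[of D x y] eq by (simp add: minus_prod_def)
    moreover have "D (0, 0) = 0" using \<open>linear D\<close> linear_0[of D] by (simp add: zero_prod_def)
    ultimately have "snd x - snd y = 0" using injD[OF D(2), of "snd x - snd y" 0] by simp
    then show "x = y" using eq by (simp add: prod_eq_iff)
  qed
  moreover have "smooth_at f (a, b)"
    unfolding f_def by (intro smooth_intros assms(1))
  ultimately have "local_diffeo f (a, b)" unfolding local_diffeo_def by blast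
  moreover have fab: "f (a, b) = (a, 0)" using assms(2) by (simp add: f_def)
  ultimately obtain g where g: "local_diffeo g (a, 0)" "g (a, 0) = (a, b)"
    "\<forall>\<^sub>F y in nhds (a, 0). f (g y) = y" "\<forall>\<^sub>F z in nhds (a, b). g (f z) = z"
    using local_diffeo_inverse[of f "(a, b)"] unfolding fab by blast
  define \<theta> where "\<theta> z = snd (g (z, 0))" for z
  have "smooth_at \<theta> a"
    unfolding \<theta>_def
    by (rule smooth_at_snd, rule smooth_at_compose[of "\<lambda>z. (z, 0)" a g])
      (use g(1) in \<open>auto simp: local_diffeo_def intro!: smooth_intros\<close>)
  moreover have "\<theta> a = b" using g(2) by (simp add: \<theta>_def)
  moreover have "\<forall>\<^sub>F z in nhds a. \<Psi> (z, \<theta> z) = 0"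
  proof -
    have "isCont (\<lambda>z. (z, 0::'b)) a" by (intro continuous_intros)
    then have "\<forall>\<^sub>F z in nhds a. f (g (z, 0)) = (z, 0)"
      using g(3) by (rule eventually_nhds_isCont)
    then show ?thesis
    proof eventually_elim
      case (elim z)
      then have "(z, \<theta> z) = g (z, 0)" by (auto simp: f_def \<theta>_def prod_eq_iff)
      then show ?case using elim by (simp add: f_def)
    qed
  qed
  moreover have "\<forall>\<^sub>F p in nhds (a, b). \<Psi> p = 0 \<longrightarrow> snd p = \<theta> (fst p)"
    using g(4) by eventually_elim (auto simp: f_def \<theta>_def)
  ultimately show thesis using that by blast
qed

section \<open>Parameter integrals and division\<close>

text \<open>By the Leibniz rule the derivative in direction h is the integral of the derivative of
  \<open>K\<close> in direction (h, 0), an integral of the same kind. The open set \<open>T\<close>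
  gives room around the end points of the interval, where derivatives of \<open>K\<close> are taken
  in all directions.\<close>

lemma Ck_on_integral:
  fixes K :: "'a::euclidean_space \<times> real \<Rightarrow> 'b::euclidean_space"
  assumes "open A" "convex A" "open T" "A \<times> {0..1} \<subseteq> T" "Ck_on n K T"
  shows "Ck_on n (\<lambda>z. integral {0..1} (\<lambda>t. K (z, t))) A"
  using assms(5)
proof (induction n arbitrary: K)
  case 0
  have "continuous_on (A \<times> cbox 0 1) (\<lambda>(x, t). K (x, t))"
    using 0 assms(4) by (simp add: cbox_interval continuous_on_subset)
  then show ?case using integral_continuous_on_param[of A 0 1 "\<lambda>x t. K (x, t)"] by (simp add: cbox_interval)
next
  case (Suc n)
  define fx where "fx z t = Blinfun (\<lambda>h. frechet_derivative K (at (z, t)) (h, 0))" for z t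
  have K: "(K has_derivative frechet_derivative K (at (z, t))) (at (z, t))" if "z \<in> A" "t \<in> {0..1}" for z t
    using Ck_on_Suc_has_derivative[OF Suc.prems] that assms(4) by blast
  have Kz: "((\<lambda>z. K (z, t)) has_derivative (\<lambda>h. frechet_derivative K (at (z, t)) (h, 0))) (at z)"
    if "z \<in> A" "t \<in> {0..1}" for z t
    by (rule has_derivative_compose[where f = "\<lambda>z. (z, t)" and g = K, OF _ K[OF that]])
      (auto intro!: derivative_eq_intros)
  have fx: "blinfun_apply (fx z t) = (\<lambda>h. frechet_derivative K (at (z, t)) (h, 0))"
    if "z \<in> A" "t \<in> {0..1}" for z t
    unfolding fx_def
    by (rule bounded_linear_Blinfun_apply[OF has_derivative_bounded_linear[OF Kz[OF that]]])
  have Ckn: "Ck_on n (\<lambda>p. frechet_derivative K (at p) v) T" for v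
    using Suc.prems unfolding Ck_on.simps by blast
  have contK: "continuous_on T K" by (rule Ck_on_imp_continuous_on[OF Suc.prems])
  have cD: "continuous_on T (\<lambda>p. frechet_derivative K (at p) v)" for v
    by (rule Ck_on_imp_continuous_on[OF Ckn])
  have cfx: "continuous_on (A \<times> cbox 0 1) (\<lambda>(z, t). fx z t)"
  proof (rule continuous_on_blinfun_componentwise)
    fix i :: 'a
    have "continuous_on (A \<times> {0..1}) (\<lambda>p. frechet_derivative K (at p) (i, 0))"
      using cD assms(4) continuous_on_subset by blast
    then show "continuous_on (A \<times> cbox 0 1) (\<lambda>p. blinfun_apply (case p of (z, t) \<Rightarrow> fx z t) i)"
      unfolding cbox_interval by (rule continuous_on_eq) (auto simp: fx)
  qed
  have cz: "continuous_on {0..1} (\<lambda>t. K (z, t))" if "z \<in> A" for z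
    by (rule continuous_on_compose2[OF contK]) (use that assms(4) in \<open>auto intro!: continuous_intros\<close>)
  have der: "((\<lambda>z. integral {0..1} (\<lambda>t. K (z, t))) has_derivative
      (\<lambda>h. integral {0..1} (\<lambda>t. frechet_derivative K (at (z, t)) (h, 0)))) (at z)" if z: "z \<in> A" for z
  proof -
    have "((\<lambda>z. integral (cbox 0 1) (\<lambda>t. K (z, t))) has_derivative
        blinfun_apply (integral (cbox 0 1) (fx z))) (at z within A)"
    proof (rule leibniz_rule[OF _ _ cfx z assms(2)])
      show "((\<lambda>z. K (z, t)) has_derivative blinfun_apply (fx x t)) (at x within A)"
        if "x \<in> A" "t \<in> cbox 0 1" for x t
        using Kz[of x t] fx[of x t] that by (simp add: cbox_interval has_derivative_at_withinI)
      show "(\<lambda>t. K (x, t)) integrable_on cbox 0 1" if "x \<in> A" for x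
        using cz[OF that] by (simp add: cbox_interval integrable_continuous_real)
    qed
    moreover have "blinfun_apply (integral (cbox 0 1) (fx z)) h =
        integral {0..1} (\<lambda>t. frechet_derivative K (at (z, t)) (h, 0))" for h
    proof -
      have "continuous_on (cbox 0 1) (\<lambda>t. (\<lambda>(z, t). fx z t) (z, t))"
        by (rule continuous_on_compose2[OF cfx continuous_on_Pair[OF continuous_on_const continuous_on_id]])
          (use z in auto)
      then have "continuous_on (cbox 0 1) (\<lambda>t. fx z t)" by simp
      then have "blinfun_apply (integral (cbox 0 1) (fx z)) h = integral (cbox 0 1) (\<lambda>t. blinfun_apply (fx z t) h)"
        by (intro blinfun_apply_integral integrable_continuous)
      also have "\<dots> = integral {0..1} (\<lambda>t. frechet_derivative K (at (z, t)) (h, 0))"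
        unfolding cbox_interval by (rule integral_cong) (simp add: fx z)
      finally show ?thesis .
    qed
    then have "blinfun_apply (integral (cbox 0 1) (fx z)) =
        (\<lambda>h. integral {0..1} (\<lambda>t. frechet_derivative K (at (z, t)) (h, 0)))" by (rule ext)
    ultimately show ?thesis using z assms(1) by (simp add: at_within_open[OF z] cbox_interval)
  qed
  show ?case
    by (rule Ck_on_SucI[OF assms(1) der]) (use Suc.IH[OF Ckn] in auto)
qed

lemma smooth_at_integral:
  fixes K :: "'a::euclidean_space \<times> real \<Rightarrow> 'b::euclidean_space"
  assumes "\<And>t. t \<in> {0..1} \<Longrightarrow> smooth_at K (a, t)"
  shows "smooth_at (\<lambda>z. integral {0..1} (\<lambda>t. K (z, t))) a"
proof -
  \<comment> \<open>The largest open set of smoothness of \<open>K\<close>. It contains the compact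
    segment over a, so the tube lemma provides a neighbourhood of a that works for all t at
    once.\<close>
  define T where "T = \<Union>{S. open S \<and> smooth_on K S}"
  have T: "open T" unfolding T_def by (intro open_Union) auto
  have "\<forall>p\<in>T. smooth_at K p" unfolding T_def smooth_at_def by blast
  then have sT: "smooth_on K T" using smooth_on_iff_at[OF T] by blast
  have aT: "{a} \<times> {0..1} \<subseteq> T"
    unfolding T_def using assms by (fastforce simp: smooth_at_def)
  then obtain X where X: "a \<in> X" "open X" "X \<times> {0..1} \<subseteq> T"
    using Elementary_Topology.tube_lemma[OF compact_Icc T aT] by blast
  then obtain e where e: "e > 0" "ball a e \<subseteq> X" using open_contains_ball by blast
  have sub: "ball a e \<times> {0..1} \<subseteq> T" using X(3) e(2) by auto
  show ?thesis
    by (rule smooth_atI[of "ball a e"])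
      (use e(1) sT in \<open>auto simp: smooth_on_def intro!: Ck_on_integral[OF _ _ T sub]\<close>)
qed

text \<open>Holomorphy in the second variable becomes an algebraic condition on the total
  derivative, its linearity over 'k. In this form it passes to limits and through the implicit
  function theorem.\<close>

lemma field_differentiable_slice_iff:
  fixes G :: "real \<times> 'k \<Rightarrow> 'k::real_normed_field"
  assumes "(G has_derivative D) (at (u, v))"
  shows "(\<lambda>z. G (u, z)) field_differentiable at v \<longleftrightarrow> (\<forall>h. D (0, h) = h * D (0, 1))"
proof -
  have "((\<lambda>z. (u, z)) has_derivative (\<lambda>h. (0, h))) (at v)"
    by (auto intro!: derivative_eq_intros)
  then have der: "((\<lambda>z. G (u, z)) has_derivative (\<lambda>h. D (0, h))) (at v)"
    by (rule has_derivative_compose) (rule assms)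
  show ?thesis
  proof
    assume "(\<lambda>z. G (u, z)) field_differentiable at v"
    then obtain d where "((\<lambda>z. G (u, z)) has_derivative (\<lambda>h. d * h)) (at v)"
      unfolding field_differentiable_def has_field_derivative_def by blast
    then have "(\<lambda>h. D (0, h)) = (\<lambda>h. d * h)" using der has_derivative_unique by blast
    then have "D (0, h) = d * h" for h by meson
    from this[of 1] this show "\<forall>h. D (0, h) = h * D (0, 1)" by simp
  next
    assume "\<forall>h. D (0, h) = h * D (0, 1)"
    then have "D (0, h) = D (0, 1) * h" for h by (metis mult.commute)
    then have eq: "(\<lambda>h. D (0, h)) = (\<lambda>h. D (0, 1) * h)" by (rule ext)
    have "((\<lambda>z. G (u, z)) has_field_derivative D (0, 1)) (at v)"
      unfolding has_field_derivative_def using der[unfolded eq] .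
    then show "(\<lambda>z. G (u, z)) field_differentiable at v"
      unfolding field_differentiable_def by blast
  qed
qed

lemma smooth_at_field_differentiable_real:
  fixes G :: "real \<times> real \<Rightarrow> real"
  assumes "smooth_at G p"
  shows "\<forall>\<^sub>F p in nhds p. (\<lambda>z. G (fst p, z)) field_differentiable at (snd p)"
  using eventually_smooth_at[OF assms]
proof eventually_elim
  case (elim p)
  let ?D = "frechet_derivative G (at p)"
  have D: "(G has_derivative ?D) (at (fst p, snd p))"
    using smooth_at_imp_has_derivative[OF elim] by simp
  have "?D (0, h) = h * ?D (0, 1)" for h
    using linear_cmul[OF has_derivative_linear[OF D], of h "(0, 1)"] by simp
  then show ?case using field_differentiable_slice_iff[OF D] by blast
qed

text \<open>The graph of \<open>k\<close> has no interior: each of its points is the limit of points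
  shifted by 1/(n + 1) in the second variable.\<close>

lemma eq_0_limit:
  fixes R :: "real \<times> 'k::real_normed_field \<Rightarrow> 'b::real_normed_vector"
  assumes S: "open S" "p \<in> S" and R: "isCont R p" "\<And>q. q \<in> S \<Longrightarrow> snd q \<noteq> k (fst q) \<Longrightarrow> R q = 0"
  shows "R p = 0"
proof (cases "snd p = k (fst p)")
  case True
  define q where "q n = (fst p, snd p + of_real (inverse (real (Suc n))))" for n
  have "(\<lambda>n. of_real (inverse (real (Suc n))) :: 'k) \<longlonglongrightarrow> of_real 0"
    by (intro tendsto_of_real LIMSEQ_inverse_real_of_nat)
  then have "q \<longlonglongrightarrow> (fst p, snd p + of_real 0)"
    unfolding q_def by (intro tendsto_Pair tendsto_add tendsto_const)
  then have q: "q \<longlonglongrightarrow> p" by simp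
  have "\<forall>\<^sub>F n in sequentially. q n \<in> S"
    using q S by (rule topological_tendstoD)
  then have "\<forall>\<^sub>F n in sequentially. R (q n) = 0"
  proof eventually_elim
    case (elim n)
    have "snd (q n) \<noteq> k (fst (q n))"
      unfolding q_def using True by (simp del: of_nat_Suc)
    then show ?case using R(2) elim by blast
  qed
  then have "(\<lambda>n. R (q n)) \<longlonglongrightarrow> 0" by (rule tendsto_eventually)
  moreover have "(\<lambda>n. R (q n)) \<longlonglongrightarrow> R p"
    by (rule isCont_tendsto_compose[OF R(1) q])
  ultimately show ?thesis using LIMSEQ_unique by blast
qed (use assms in blast)

lemma eventually_eq_0_limit:
  fixes R :: "real \<times> 'k::real_normed_field \<Rightarrow> 'b::real_normed_vector"
  assumes "smooth_at R (0, 0)" "\<forall>\<^sub>F p in nhds (0, 0). snd p \<noteq> k (fst p) \<longrightarrow> R p = 0"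
  shows "\<forall>\<^sub>F p in nhds (0, 0). R p = 0"
proof -
  have "\<forall>\<^sub>F p in nhds (0, 0). smooth_at R p \<and> (snd p \<noteq> k (fst p) \<longrightarrow> R p = 0)"
    using eventually_smooth_at[OF assms(1)] assms(2) by (rule eventually_conj)
  then obtain S where S: "open S" "(0, 0) \<in> S" "\<And>p. p \<in> S \<Longrightarrow> isCont R p"
      "\<And>p. p \<in> S \<Longrightarrow> snd p \<noteq> k (fst p) \<Longrightarrow> R p = 0"
    unfolding eventually_nhds using smooth_at_imp_isCont by blast
  have "R p = 0" if "p \<in> S" for p
    by (rule eq_0_limit[OF S(1) that S(3)[OF that] S(4)])
  then show ?thesis unfolding eventually_nhds using S by blast
qed

text \<open>Hadamard's lemma, for 'k real or complex: G(u, v) = (v - k u) times the integral of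
  dG/dv over the segment from k u to v. In the complex case \<open>fd\<close> turns the derivative
  along the segment into (v - k u) dG/dv. That the quotient stays holomorphic in v allows the
  division to be iterated.\<close>

lemma smooth_division:
  fixes G :: "real \<times> 'k \<Rightarrow> 'k::{real_normed_field, euclidean_space}" and k :: "real \<Rightarrow> 'k"
  assumes G: "smooth_at G (0, 0)" and k: "smooth_at k 0" "k 0 = 0"
    and fd: "\<forall>\<^sub>F p in nhds (0, 0). (\<lambda>z. G (fst p, z)) field_differentiable at (snd p)"
    and zero: "\<forall>\<^sub>F u in nhds 0. G (u, k u) = 0"
  obtains G1 where "smooth_at G1 (0, 0)" "\<forall>\<^sub>F p in nhds (0, 0). G p = (snd p - k (fst p)) * G1 p"
    "\<forall>\<^sub>F p in nhds (0, 0). (\<lambda>z. G1 (fst p, z)) field_differentiable at (snd p)"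
proof -
  define DG where "DG p = frechet_derivative G (at p) (0, 1)" for p
  define seg where "seg q = (fst (fst q), k (fst (fst q)) + of_real (snd q) * (snd (fst q) - k (fst (fst q))))"
    for q :: "(real \<times> 'k) \<times> real"
  define G1 where "G1 p = integral {0..1} (\<lambda>t. DG (seg (p, t)))" for p
  have sDG: "smooth_at DG (0, 0)" unfolding DG_def by (rule smooth_at_frechet_derivative[OF G])
  have ck: "smooth_at (\<lambda>q::(real \<times> 'k) \<times> real. k (fst (fst q))) ((0, 0), t)" for t
    by (rule smooth_at_compose[where g = k]) (auto intro!: smooth_intros k)
  have sseg: "smooth_at seg ((0, 0), t)" for t
    unfolding seg_def by (intro smooth_intros ck)
  have sG1: "smooth_at G1 (0, 0)"
    unfolding G1_def
  proof (rule smooth_at_integral)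
    fix t :: real
    have "seg ((0, 0), t) = (0, 0)" by (simp add: seg_def k)
    then show "smooth_at (\<lambda>q. DG (seg q)) ((0, 0), t)"
      by (intro smooth_at_compose[OF sseg]) (simp add: sDG)
  qed
  have "\<forall>\<^sub>F p in nhds (0, 0). smooth_at G p \<and> smooth_at DG p \<and> (\<lambda>z. G (fst p, z)) field_differentiable at (snd p)"
    by (intro eventually_conj eventually_smooth_at G fd sDG)
  then obtain e where e: "e > 0" "\<And>p. dist p (0, 0) < e \<Longrightarrow>
      smooth_at G p \<and> smooth_at DG p \<and> (\<lambda>z. G (fst p, z)) field_differentiable at (snd p)"
    unfolding eventually_nhds_metric by blast
  have ck2: "isCont (\<lambda>p::real \<times> 'k. k (fst p)) (0, 0)"
    by (rule isCont_o2[where f = fst]) (auto intro!: continuous_intros smooth_at_imp_isCont k)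
  have small: "\<forall>\<^sub>F x in nhds (0 :: 'c::real_normed_vector). norm x < e / 2"
    unfolding eventually_nhds_metric using e(1) by (intro exI[of _ "e / 2"]) auto
  have id: "\<forall>\<^sub>F p in nhds (0, 0). G p = (snd p - k (fst p)) * G1 p"
  proof -
    have "\<forall>\<^sub>F p::real \<times> 'k in nhds (0, 0). norm (fst p) < e / 2"
      by (rule eventually_nhds_isCont[where f = fst], simp) (simp only: fst_conv small)
    moreover have "\<forall>\<^sub>F p::real \<times> 'k in nhds (0, 0). norm (snd p) < e / 2"
      by (rule eventually_nhds_isCont[where f = snd], simp) (simp only: snd_conv small)
    moreover have "\<forall>\<^sub>F p::real \<times> 'k in nhds (0, 0). norm (k (fst p)) < e / 2"
      by (rule eventually_nhds_isCont[where f = "\<lambda>p. k (fst p)", OF ck2]) (simp only: fst_conv k small)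
    moreover have "\<forall>\<^sub>F p::real \<times> 'k in nhds (0, 0). G (fst p, k (fst p)) = 0"
      by (rule eventually_nhds_isCont[where f = fst]) (simp_all add: zero)
    ultimately have "\<forall>\<^sub>F p::real \<times> 'k in nhds (0, 0). norm (fst p) < e / 2 \<and> norm (snd p) < e / 2 \<and>
        norm (k (fst p)) < e / 2 \<and> G (fst p, k (fst p)) = 0"
      by (intro eventually_conj)
    then show ?thesis
    proof eventually_elim
      case (elim p)
      obtain u v where p: "p = (u, v)" by (cases p)
      define w where "w = v - k u"
      have inball: "dist (seg (p, t)) (0, 0) < e" if t: "t \<in> {0..1}" for t
      proof -
        have "norm (k u + of_real t * (v - k u)) = norm ((1 - t) *\<^sub>R k u + t *\<^sub>R v)"
          by (simp add: algebra_simps scaleR_conv_of_real)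
        also have "\<dots> \<le> norm ((1 - t) *\<^sub>R k u) + norm (t *\<^sub>R v)" by (rule norm_triangle_ineq)
        also have "\<dots> = (1 - t) * norm (k u) + t * norm v" using t by simp
        also have "\<dots> \<le> (1 - t) * (e / 2) + t * (e / 2)"
          using t elim by (intro add_mono mult_left_mono) (auto simp: p)
        also have "\<dots> = e / 2" by (simp add: field_simps)
        finally have "norm (k u + of_real t * (v - k u)) \<le> e / 2" .
        moreover have "norm u < e / 2" using elim by (simp add: p)
        ultimately have "norm (u, k u + of_real t * (v - k u)) < e"
          using norm_Pair_le[of u "k u + of_real t * (v - k u)"] by linarith
        then show ?thesis by (simp add: seg_def p dist_norm zero_prod_def[symmetric])
      qed
      have vd: "((\<lambda>t. G (seg (p, t))) has_vector_derivative (w * DG (seg (p, t)))) (at t within {0..1})"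
        if t: "t \<in> {0..1}" for t
      proof -
        have G': "(G has_derivative frechet_derivative G (at (seg (p, t)))) (at (seg (p, t)))"
          using e(2)[OF inball[OF t]] smooth_at_imp_has_derivative by blast
        have "((\<lambda>t. seg (p, t)) has_derivative (\<lambda>h. (0, of_real h * w))) (at t)"
          unfolding seg_def p w_def fst_conv snd_conv
          by (auto intro!: derivative_eq_intros)
        then have 1: "((\<lambda>t. G (seg (p, t))) has_derivative
            (\<lambda>h. frechet_derivative G (at (seg (p, t))) (0, of_real h * w))) (at t)"
          by (rule has_derivative_compose) (rule G')
        have "frechet_derivative G (at (seg (p, t))) (0, h) = h * DG (seg (p, t))" for h
          using field_differentiable_slice_iff[of G _ "fst (seg (p, t))" "snd (seg (p, t))"] G'
            e(2)[OF inball[OF t]] unfolding DG_def prod.collapse by blast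
        then show ?thesis
          using has_derivative_at_withinI[OF 1]
          by (simp add: has_vector_derivative_def scaleR_conv_of_real mult.assoc)
      qed
      have "((\<lambda>t. w * DG (seg (p, t))) has_integral (G (seg (p, 1)) - G (seg (p, 0)))) {0..1}"
        by (rule fundamental_theorem_of_calculus) (use vd in auto)
      moreover have "seg (p, 1) = p" "seg (p, 0) = (u, k u)" by (simp_all add: seg_def p)
      ultimately have 1: "((\<lambda>t. w * DG (seg (p, t))) has_integral G p) {0..1}"
        using elim by (simp add: p)
      have "isCont (\<lambda>t. DG (seg (p, t))) t" if "t \<in> {0..1}" for t
      proof (rule isCont_o2[where g = DG])
        show "isCont (\<lambda>t. seg (p, t)) t" unfolding seg_def fst_conv snd_conv by (intro continuous_intros)
        show "isCont DG (seg (p, t))" using e(2)[OF inball[OF that]] smooth_at_imp_isCont by blast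
      qed
      then have "continuous_on {0..1} (\<lambda>t. DG (seg (p, t)))"
        by (intro continuous_at_imp_continuous_on) blast
      then have "((\<lambda>t. DG (seg (p, t))) has_integral G1 p) {0..1}"
        unfolding G1_def by (intro integrable_integral integrable_continuous_real)
      then have "((\<lambda>t. w * DG (seg (p, t))) has_integral w * G1 p) {0..1}"
        by (rule has_integral_mult_right)
      then show ?case using 1 has_integral_unique by (simp add: w_def p) blast
    qed
  qed
  have fd1: "\<forall>\<^sub>F p in nhds (0, 0). (\<lambda>z. G1 (fst p, z)) field_differentiable at (snd p)"
  proof -
    \<comment> \<open>The defect of 'k-linearity of the derivative of \<open>G1\<close>. Off the
      graph of \<open>k\<close> it vanishes because \<open>G1\<close> is a quotient of
      differentiable functions there; on the graph it vanishes by continuity.\<close>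
    define R where "R h p = frechet_derivative G1 (at p) (0, h) - h * frechet_derivative G1 (at p) (0, 1)" for h p
    have "\<forall>\<^sub>F p in nhds (0, 0). smooth_at G1 p \<and> G p = (snd p - k (fst p)) * G1 p \<and>
        (\<lambda>z. G (fst p, z)) field_differentiable at (snd p)"
      by (intro eventually_conj eventually_smooth_at sG1 id fd)
    then obtain S where S: "open S" "(0, 0) \<in> S"
      and S': "\<And>p. p \<in> S \<Longrightarrow> smooth_at G1 p" "\<And>p. p \<in> S \<Longrightarrow> G p = (snd p - k (fst p)) * G1 p"
        "\<And>p. p \<in> S \<Longrightarrow> (\<lambda>z. G (fst p, z)) field_differentiable at (snd p)"
      unfolding eventually_nhds by blast
    have off: "R h p = 0" if p: "p \<in> S" "snd p \<noteq> k (fst p)" for h p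
    proof -
      obtain u v where uv: "p = (u, v)" by (cases p)
      have D: "(G1 has_derivative frechet_derivative G1 (at p)) (at (u, v))"
        using smooth_at_imp_has_derivative[OF S'(1)[OF p(1)]] by (simp add: uv)
      have oS: "open {z. (u, z) \<in> S \<and> z \<noteq> k u}"
      proof -
        have "{z. (u, z) \<in> S \<and> z \<noteq> k u} = (\<lambda>z. (u, z)) -` S \<inter> - {k u}" by auto
        moreover have "open ((\<lambda>z. (u, z)) -` S)" using S(1) by (intro open_vimage continuous_intros)
        ultimately show ?thesis by (auto intro!: open_Int open_Compl)
      qed
      have vS: "v \<in> {z. (u, z) \<in> S \<and> z \<noteq> k u}" using p uv by simp
      have eqS: "G (u, z) / (z - k u) = G1 (u, z)" if "z \<in> {z. (u, z) \<in> S \<and> z \<noteq> k u}" for z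
        using S'(2)[of "(u, z)"] that by simp
      have "(\<lambda>z. G (u, z) / (z - k u)) field_differentiable at v"
        using S'(3)[OF p(1)] p(2) by (intro derivative_intros field_differentiable_divide) (auto simp: uv)
      then obtain d where d: "((\<lambda>z. G (u, z) / (z - k u)) has_field_derivative d) (at v)"
        unfolding field_differentiable_def by blast
      have "((\<lambda>z. G1 (u, z)) has_field_derivative d) (at v)"
        by (rule has_field_derivative_transform_within_open[OF d oS vS eqS])
      then have "(\<lambda>z. G1 (u, z)) field_differentiable at v"
        unfolding field_differentiable_def by blast
      then have "frechet_derivative G1 (at p) (0, h) = h * frechet_derivative G1 (at p) (0, 1)"
        using field_differentiable_slice_iff[OF D] by blast
      then show ?thesis unfolding R_def by (rule right_minus_eq[THEN iffD2])
    qed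
    have "R h p = 0" if p: "p \<in> S" for h p
    proof (rule eq_0_limit[OF S(1) p _ off])
      show "isCont (R h) p"
        unfolding R_def
        by (intro smooth_at_imp_isCont smooth_intros smooth_at_frechet_derivative S'(1)[OF p])
    qed
    then have *: "frechet_derivative G1 (at p) (0, h) = h * frechet_derivative G1 (at p) (0, 1)" if "p \<in> S" for p h
      using that unfolding R_def by (metis eq_iff_diff_eq_0)
    have "(\<lambda>z. G1 (fst p, z)) field_differentiable at (snd p)" if "p \<in> S" for p
      using field_differentiable_slice_iff[of G1 "frechet_derivative G1 (at p)" "fst p" "snd p"]
        smooth_at_imp_has_derivative[OF S'(1)[OF that]] *[OF that] unfolding prod.collapse by blast
    then show ?thesis unfolding eventually_nhds using S by blast
  qed
  show thesis by (rule that[OF sG1 id fd1])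
qed

lemma smooth_division_real:
  fixes G :: "real \<times> real \<Rightarrow> real"
  assumes "smooth_at G (0, 0)" "smooth_at k 0" "k 0 = 0" "\<forall>\<^sub>F u in nhds 0. G (u, k u) = 0"
  obtains G1 where "smooth_at G1 (0, 0)" "\<forall>\<^sub>F p in nhds (0, 0). G p = (snd p - k (fst p)) * G1 p"
  using smooth_division[OF assms(1-3) smooth_at_field_differentiable_real[OF assms(1)] assms(4)] by blast

text \<open>Differentiating \<Psi>(q, \<theta> q) = 0 in direction (0, h) gives D((0, h), 0) + E(0,
  h) D(0, 1) = 0, from which linearity of \<open>D\<close> over 'k passes to
  \<open>E\<close>.\<close>

lemma implicit_field_differentiable:
  fixes \<Psi> :: "(real \<times> 'k) \<times> 'k \<Rightarrow> 'k::real_normed_field"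
  assumes D: "(\<Psi> has_derivative D) (at ((u, v), \<theta> (u, v)))"
    and lin: "\<And>h. D ((0, h), 0) = h * D ((0, 1), 0)" "\<And>h. D (0, h) = h * D (0, 1)" "D (0, 1) \<noteq> 0"
    and E: "(\<theta> has_derivative E) (at (u, v))"
    and eq: "\<forall>\<^sub>F q in nhds (u, v). \<Psi> (q, \<theta> q) = 0"
  shows "(\<lambda>z. \<theta> (u, z)) field_differentiable at v"
proof -
  have "((\<lambda>q. (q, \<theta> q)) has_derivative (\<lambda>h. (h, E h))) (at (u, v))"
    by (intro has_derivative_Pair has_derivative_ident E)
  then have "((\<lambda>q. \<Psi> (q, \<theta> q)) has_derivative (\<lambda>h. D (h, E h))) (at (u, v))"
    by (rule has_derivative_compose) (rule D)
  moreover obtain S where "open S" "(u, v) \<in> S" "\<And>q. q \<in> S \<Longrightarrow> \<Psi> (q, \<theta> q) = 0"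
    using eq unfolding eventually_nhds by blast
  ultimately have "((\<lambda>q. 0) has_derivative (\<lambda>h. D (h, E h))) (at (u, v))"
    by (rule has_derivative_transform_within_open)
  then have "(\<lambda>h. D (h, E h)) = (\<lambda>h. 0)"
    using has_derivative_unique has_derivative_const by blast
  then have z: "D ((0, h), E (0, h)) = 0" for h by meson
  have "linear D" using D has_derivative_linear by blast
  then have "D ((0, h), E (0, h)) = D ((0, h), 0) + D (0, E (0, h))" for h
    using linear_add[of D "((0, h), 0)" "(0, E (0, h))"] by (simp add: zero_prod_def)
  then have "h * D ((0, 1), 0) + E (0, h) * D (0, 1) = 0" for h
    using z[of h] lin(1)[of h] lin(2)[of "E (0, h)"] by simp
  then have "E (0, h) * D (0, 1) = - (h * D ((0, 1), 0))" for h
    using eq_neg_iff_add_eq_0 by (metis add.commute)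
  then have "E (0, h) = - (h * D ((0, 1), 0)) / D (0, 1)" for h
    using lin(3) by (metis nonzero_mult_div_cancel_right)
  from this[of 1] this have "\<forall>h. E (0, h) = h * E (0, 1)" by simp
  then show ?thesis using field_differentiable_slice_iff[OF E] by blast
qed

section \<open>Division by the cubic of the model\<close>

lemma Cauchy_circle_mean:
  assumes "continuous_on (cball 0 r) f" "f holomorphic_on ball 0 r" "w \<in> ball 0 r"
  shows "((\<lambda>t. f (circlepath 0 r t) / (circlepath 0 r t - w) * circlepath 0 r t) has_integral f w) {0..1}"
proof -
  define k where "k = 2 * of_real pi * \<i>"
  have k: "k \<noteq> 0" by (simp add: k_def)
  have "((\<lambda>u. f u / (u - w)) has_contour_integral (k * f w)) (circlepath 0 r)"
    unfolding k_def by (rule Cauchy_integral_circlepath) (use assms in auto)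
  then have "((\<lambda>t. f (circlepath 0 r t) / (circlepath 0 r t - w) *
      vector_derivative (circlepath 0 r) (at t within {0..1})) has_integral (k * f w)) {0..1}"
    by (simp add: has_contour_integral_def)
  then have "((\<lambda>t. inverse k * (f (circlepath 0 r t) / (circlepath 0 r t - w) *
      vector_derivative (circlepath 0 r) (at t within {0..1}))) has_integral (inverse k * (k * f w))) {0..1}"
    by (rule has_integral_mult_right)
  then have 1: "((\<lambda>t. inverse k * (f (circlepath 0 r t) / (circlepath 0 r t - w) *
      vector_derivative (circlepath 0 r) (at t within {0..1}))) has_integral f w) {0..1}"
    using k by (simp only: mult.assoc[symmetric, of "inverse k" k] left_inverse[OF k] mult_1_left)
  show ?thesis
  proof (rule has_integral_eq[OF _ 1])
    fix t :: real assume t: "t \<in> {0..1}"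
    \<comment> \<open>The velocity of the circle is 2 pi i times the position, so the constant of
      Cauchy's formula cancels and an ordinary integral over [0, 1] remains, ready for
      \<open>smooth_at_integral\<close>.\<close>
    have "vector_derivative (circlepath 0 r) (at t within {0..1}) = k * circlepath 0 r t"
      using t vector_derivative_circlepath01[of t 0 r] by (simp add: circlepath mult_ac k_def)
    then show "inverse k * (f (circlepath 0 r t) / (circlepath 0 r t - w) *
        vector_derivative (circlepath 0 r) (at t within {0..1})) =
        f (circlepath 0 r t) / (circlepath 0 r t - w) * circlepath 0 r t"
      using k by (simp add: field_simps)
  qed
qed

text \<open>If \<open>P(z; u, c) = u\<^sup>2 z - 2 z\<^sup>3 - c\<close> then \<open>P(z; u, P(v; u, 0)) = (z - v) (u\<^sup>2 - 2 (z\<^sup>2 + z v + v\<^sup>2))\<close>,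
  so Cauchy's formula for \<open>h(u, v)\<close> turns into a quadratic polynomial in \<open>v\<close> whose coefficients are
  contour integrals depending on \<open>(u, c)\<close> only.\<close>

lemma cubic_division:
  fixes h :: "real \<times> complex \<Rightarrow> complex"
  assumes "smooth_at h (0, 0)"
    "\<forall>\<^sub>F p in nhds (0, 0). (\<lambda>z. h (fst p, z)) field_differentiable at (snd p)"
  obtains p0 p1 p2 :: "real \<times> real \<Rightarrow> real" where
    "smooth_at p0 (0, 0)" "smooth_at p1 (0, 0)" "smooth_at p2 (0, 0)"
    "\<forall>\<^sub>F (u, v) in nhds (0, 0). Re (h (u, of_real v)) =
       p0 (u, u^2 * v - 2 * v^3) + p1 (u, u^2 * v - 2 * v^3) * v + p2 (u, u^2 * v - 2 * v^3) * v^2"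
proof -
  have "\<forall>\<^sub>F p in nhds (0, 0). smooth_at h p \<and> (\<lambda>z. h (fst p, z)) field_differentiable at (snd p)"
    by (intro eventually_conj eventually_smooth_at assms)
  then obtain e where e: "e > 0" "\<And>p. dist p (0, 0) < e \<Longrightarrow>
      smooth_at h p \<and> (\<lambda>z. h (fst p, z)) field_differentiable at (snd p)"
    unfolding eventually_nhds_metric by blast
  \<comment> \<open>For |u| < r and |z| < 2 r the pair (u, z) has norm below 3 r < e, so the slice
    functions are holomorphic on a disc larger than the one bounded by the circle of radius
    r.\<close>
  define r where "r = e / 4"
  have r: "r > 0" using e by (simp add: r_def)
  have he: "smooth_at h (u, z)" "(\<lambda>z. h (u, z)) field_differentiable at z"
    if "\<bar>u\<bar> < r" "norm z < 2 * r" for u z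
  proof -
    have "norm (u, z) \<le> norm u + norm z" by (rule norm_Pair_le)
    then have "norm (u, z) < e" using that r by (simp add: r_def)
    then have "dist (u, z) (0, 0) < e" by (simp add: zero_prod_def[symmetric])
    then show "smooth_at h (u, z)" "(\<lambda>z. h (u, z)) field_differentiable at z"
      using e(2)[of "(u, z)"] by auto
  qed
  define Z where "Z t = circlepath 0 r t" for t
  have Z: "norm (Z t) = r" for t using r by (simp add: Z_def circlepath norm_mult)
  have Z0: "Z t \<noteq> 0" for t using Z[of t] r by auto
  define P where "P q t = of_real ((fst q)^2) * Z t - 2 * Z t ^ 3 - of_real (snd q)" for q :: "real \<times> real" and t
  define K where "K g q = h (fst (fst q), Z (snd q)) * g (fst q) (Z (snd q)) / P (fst q) (snd q) * Z (snd q)"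
    for g :: "real \<times> real \<Rightarrow> complex \<Rightarrow> complex" and q
  have sZ: "smooth_at (\<lambda>q::(real \<times> real) \<times> real. Z (snd q)) q" for q
  proof -
    have "smooth_at exp z" for z :: complex
      by (rule smooth_at_holomorphic[of UNIV]) (auto intro!: holomorphic_intros)
    then have "smooth_at (\<lambda>q::(real \<times> real) \<times> real. exp (2 * of_real pi * \<i> * complex_of_real (snd q))) q"
      by (rule smooth_at_compose[where g = exp, rotated]) (intro smooth_intros)
    then show ?thesis
      unfolding Z_def circlepath by (intro smooth_at_add smooth_at_mult smooth_at_const)
  qed
  have sK: "smooth_at (K g) ((0, 0), t)" if "\<And>q. smooth_at (\<lambda>q::(real \<times> real) \<times> real. g (fst q) (Z (snd q))) q" for g t
  proof -
    have "smooth_at (\<lambda>q::(real \<times> real) \<times> real. h (fst (fst q), Z (snd q))) ((0, 0), t)"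
      by (rule smooth_at_compose[where g = h])
        (use he(1)[of 0 "Z t"] Z[of t] r sZ in \<open>auto intro!: smooth_intros\<close>)
    then show ?thesis
      unfolding K_def P_def
      by (intro smooth_intros sZ that) (simp_all add: Z0)
  qed
  define I where "I g q = integral {0..1} (\<lambda>t. K g (q, t))" for g q
  have sI: "smooth_at (\<lambda>q. Re (I g q)) (0, 0)"
    if "\<And>q. smooth_at (\<lambda>q::(real \<times> real) \<times> real. g (fst q) (Z (snd q))) q" for g
    unfolding I_def by (intro smooth_at_Re smooth_at_integral sK that)
  \<comment> \<open>The coefficients of 1, v, v^2 in the cofactor u^2 - 2 (z^2 + z v + v^2).\<close>
  define g0 g1 g2 where "g0 = (\<lambda>(q::real \<times> real) z. of_real ((fst q)^2) - 2 * z^2 :: complex)"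
    and "g1 = (\<lambda>(q::real \<times> real) z. - 2 * z :: complex)" and "g2 = (\<lambda>(q::real \<times> real) (z::complex). - 2 :: complex)"
  have s0: "smooth_at (\<lambda>q::(real \<times> real) \<times> real. g0 (fst q) (Z (snd q))) q"
    and s1: "smooth_at (\<lambda>q::(real \<times> real) \<times> real. g1 (fst q) (Z (snd q))) q"
    and s2: "smooth_at (\<lambda>q::(real \<times> real) \<times> real. g2 (fst q) (Z (snd q))) q" for q
    unfolding g0_def g1_def g2_def by (intro smooth_intros sZ)+
  have formula: "h (u, of_real v) = I g0 (u, c) + I g1 (u, c) * of_real v + I g2 (u, c) * of_real v ^ 2"
    if uv: "\<bar>u\<bar> < r / 4" "\<bar>v\<bar> < r / 4" and c: "c = u^2 * v - 2 * v^3" for u v c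
  proof -
    define w where "w = complex_of_real v"
    define A where "A t = of_real (u^2) - 2 * (Z t ^ 2 + Z t * w + w ^ 2)" for t
    have nw: "norm w < r / 4" using uv by (simp add: w_def)
    \<comment> \<open>For |u| and |v| below r/4 the terms of the cofactor other than 2 z^2 amount to
      at most r^2/16 + r^2/2 + r^2/8, which is less than 2 r^2. Hence the denominator P(z; u, c) has
      no zero on the circle.\<close>
    have A: "A t \<noteq> 0" for t
    proof
      assume "A t = 0"
      then have "2 * Z t ^ 2 = of_real (u^2) - 2 * Z t * w - 2 * w ^ 2"
        unfolding A_def by (simp add: algebra_simps)
      then have "norm (2 * Z t ^ 2) = norm (of_real (u^2) - 2 * Z t * w - 2 * w ^ 2)" by simp
      also have "\<dots> \<le> norm (of_real (u^2) :: complex) + norm (2 * Z t * w) + norm (2 * w ^ 2)"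
        by (rule order_trans[OF norm_triangle_ineq4 add_right_mono[OF norm_triangle_ineq4]])
      also have "\<dots> = \<bar>u\<bar>^2 + 2 * r * norm w + 2 * norm w ^ 2"
        by (simp add: norm_mult norm_power Z)
      also have "\<dots> \<le> (r/4)^2 + 2 * r * (r/4) + 2 * (r/4)^2"
        using uv nw r by (intro add_mono power_mono mult_left_mono) auto
      also have "\<dots> < 2 * r^2" using r by (simp add: power2_eq_square)
      finally show False by (simp add: norm_mult norm_power Z)
    qed
    have zw: "Z t - w \<noteq> 0" for t using nw Z[of t] r by auto
    have P: "P (u, c) t = (Z t - w) * A t" for t
      unfolding P_def A_def c w_def by (simp add: algebra_simps power2_eq_square power3_eq_cube)
    have P0: "P (u, c) t \<noteq> 0" for t using P A zw by simp
    have hol: "(\<lambda>z. h (u, z)) field_differentiable at z" if "norm z < 2 * r" for z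
      using he(2) uv(1) that r by simp
    have "((\<lambda>t. h (u, Z t) / (Z t - w) * Z t) has_integral h (u, w)) {0..1}"
      unfolding Z_def
    proof (rule Cauchy_circle_mean)
      show "continuous_on (cball 0 r) (\<lambda>z. h (u, z))"
        using hol r by (auto intro!: continuous_at_imp_continuous_on field_differentiable_imp_continuous_at)
      show "(\<lambda>z. h (u, z)) holomorphic_on ball 0 r"
        unfolding holomorphic_on_def
        by (rule ballI, rule field_differentiable_at_within, rule hol) (use r in auto)
      show "w \<in> ball 0 r" using nw r by simp
    qed
    moreover have "h (u, Z t) / (Z t - w) * Z t = K g0 ((u, c), t) + K g1 ((u, c), t) * w + K g2 ((u, c), t) * w ^ 2" for t
    proof -
      have "h (u, Z t) / (Z t - w) * Z t = h (u, Z t) * A t / P (u, c) t * Z t"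
        using A[of t] zw[of t] unfolding P by simp
      also have "\<dots> = K g0 ((u, c), t) + K g1 ((u, c), t) * w + K g2 ((u, c), t) * w ^ 2"
        unfolding K_def g0_def g1_def g2_def A_def fst_conv snd_conv
        by (simp add: add_divide_distrib diff_divide_distrib algebra_simps)
      finally show ?thesis .
    qed
    ultimately have 1: "((\<lambda>t. K g0 ((u, c), t) + K g1 ((u, c), t) * w + K g2 ((u, c), t) * w ^ 2)
        has_integral h (u, w)) {0..1}" by simp
    have int: "((\<lambda>t. K g ((u, c), t)) has_integral I g (u, c)) {0..1}"
      if g: "\<And>q. smooth_at (\<lambda>q::(real \<times> real) \<times> real. g (fst q) (Z (snd q))) q" for g
    proof -
      have "isCont (\<lambda>t. K g ((u, c), t)) t" for t
      proof (rule isCont_o2[where g = "K g"])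
        have "smooth_at (\<lambda>q::(real \<times> real) \<times> real. h (fst (fst q), Z (snd q))) ((u, c), t)"
          by (rule smooth_at_compose[where g = h])
            (use he(1)[of u "Z t"] Z[of t] r sZ uv in \<open>auto intro!: smooth_intros\<close>)
        then have "smooth_at (K g) ((u, c), t)"
          unfolding K_def P_def
          by (intro smooth_intros sZ g) (use P0[of t] in \<open>simp_all add: P_def\<close>)
        then show "isCont (K g) ((u, c), t)" by (rule smooth_at_imp_isCont)
      qed (intro continuous_intros)
      then show ?thesis
        unfolding I_def by (intro integrable_integral integrable_continuous_real continuous_at_imp_continuous_on) blast
    qed
    have "((\<lambda>t. K g0 ((u, c), t) + K g1 ((u, c), t) * w + K g2 ((u, c), t) * w ^ 2)
        has_integral (I g0 (u, c) + I g1 (u, c) * w + I g2 (u, c) * w ^ 2)) {0..1}"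
      by (intro has_integral_add has_integral_mult_left int s0 s1 s2)
    then show ?thesis using 1 has_integral_unique unfolding w_def by blast
  qed
  have "\<forall>\<^sub>F (u, v) in nhds (0, 0). Re (h (u, of_real v)) =
       Re (I g0 (u, u^2 * v - 2 * v^3)) + Re (I g1 (u, u^2 * v - 2 * v^3)) * v + Re (I g2 (u, u^2 * v - 2 * v^3)) * v^2"
    unfolding eventually_nhds_metric
  proof (intro exI[of _ "r / 4"] conjI allI impI)
    fix p :: "real \<times> real" assume p: "dist p (0, 0) < r / 4"
    obtain u v where uv: "p = (u, v)" by (cases p)
    have "norm (u, v) < r / 4" using p by (simp add: uv zero_prod_def[symmetric])
    then have "\<bar>u\<bar> < r / 4" "\<bar>v\<bar> < r / 4"
      using norm_fst_le[of u v] norm_snd_le[of v u] by auto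
    from formula[OF this refl] show "case p of (u, v) \<Rightarrow> Re (h (u, of_real v)) =
       Re (I g0 (u, u^2 * v - 2 * v^3)) + Re (I g1 (u, u^2 * v - 2 * v^3)) * v + Re (I g2 (u, u^2 * v - 2 * v^3)) * v^2"
      by (simp add: uv del: of_real_power flip: of_real_power)
  qed (use r in simp)
  then show thesis by (intro that[OF sI[OF s0] sI[OF s1] sI[OF s2]])
qed

lemma eq_0_limit_real:
  fixes R :: "real \<Rightarrow> 'b::real_normed_vector"
  assumes "isCont R 0" "\<forall>\<^sub>F u in nhds 0. u \<noteq> 0 \<longrightarrow> R u = 0"
  shows "\<forall>\<^sub>F u in nhds 0. R u = 0"
proof -
  have "\<forall>\<^sub>F u in at 0. R u = 0"
    using assms(2) by (simp add: eventually_at_filter)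
  then have "(R \<longlongrightarrow> 0) (at 0)" by (rule tendsto_eventually)
  moreover have "(R \<longlongrightarrow> R 0) (at 0)" using assms(1) by (simp add: isCont_def)
  ultimately have "R 0 = 0" using tendsto_unique trivial_limit_at by blast
  from assms(2) show ?thesis
    by eventually_elim (use \<open>R 0 = 0\<close> in metis)
qed

lemma smooth_at_slice:
  fixes p :: "real \<times> 'c::euclidean_space \<Rightarrow> 'b::real_normed_vector"
  assumes "smooth_at p (0, k 0)" "smooth_at k (0::real)"
  shows "smooth_at (\<lambda>u. p (u, k u)) 0"
  by (rule smooth_at_compose[where g = p]) (use assms in \<open>auto intro!: smooth_intros\<close>)

lemma eventually_slice:
  fixes k :: "real \<Rightarrow> 'c::topological_space"
  assumes "\<forall>\<^sub>F p in nhds (0, k 0). P p" "isCont k 0"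
  shows "\<forall>\<^sub>F u in nhds 0. P (u, k u)"
proof (rule eventually_nhds_isCont[where f = "\<lambda>u. (u, k u)"])
  show "isCont (\<lambda>u. (u, k u)) 0" using assms(2) by (intro continuous_intros)
qed (use assms(1) in simp)

text \<open>Write c = u^2 v - 2 v^3 and c0 = 3 v^4 - u^2 v^2. Reduction by the cubic gives c0 = u^2
  v^2/2 - 3 c v/2 and c0^2 = 3 u^2 c^2/4 - 7 u^4 c v/8 + (u^6/8 + 9 c^2/4) v^2. Comparing
  coefficients, p0 + p1 v + p2 v^2 is a combination of 1, c0, c0^2 once c divides p1, with quotient
  k say, and c^2 - 2 u^6/27 divides p2 + u^2 k/3. \<open>double\<close> provides the first
  divisibility and \<open>crit\<close> the second.\<close>

lemma beaks_division:
  fixes h p0 p1 p2 :: "real \<times> real \<Rightarrow> real"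
  assumes s: "smooth_at p0 (0, 0)" "smooth_at p1 (0, 0)" "smooth_at p2 (0, 0)"
    and id: "\<forall>\<^sub>F (u, v) in nhds (0, 0). h (u, v) =
       p0 (u, u^2 * v - 2 * v^3) + p1 (u, u^2 * v - 2 * v^3) * v + p2 (u, u^2 * v - 2 * v^3) * v^2"
    and crit: "\<And>s. s \<in> {1, -1} \<Longrightarrow>
      \<forall>\<^sub>F u in nhds 0. ((\<lambda>v. h (u, v)) has_field_derivative 0) (at (s * u / sqrt 6))"
    and double: "\<forall>\<^sub>F u in nhds 0. h (u, u / sqrt 2) = h (u, - u / sqrt 2)"
  obtains H0 H1 H2 :: "real \<times> real \<Rightarrow> real" where
    "smooth_at H0 (0, 0)" "smooth_at H1 (0, 0)" "smooth_at H2 (0, 0)"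
    "\<forall>\<^sub>F (u, v) in nhds (0, 0). h (u, v) =
       H0 (u, u^2 * v - 2 * v^3) + H1 (u, u^2 * v - 2 * v^3) * (3 * v^4 - u^2 * v^2)
       + H2 (u, u^2 * v - 2 * v^3) * (3 * v^4 - u^2 * v^2)^2"
proof -
  define c where "c u v = u^2 * v - 2 * v^3" for u v :: real
  \<comment> \<open>The critical points v = u/sqrt 6 and v = - u/sqrt 6 of c have critical values
    \<kappa> u^3 and - \<kappa> u^3, the roots of c^2 = 2 u^6/27.\<close>
  define \<kappa> where "\<kappa> = 2 / (3 * sqrt 6)"
  have k2: "\<kappa>^2 = 2 / 27" by (simp add: \<kappa>_def power_divide power_mult_distrib)
  have "\<forall>\<^sub>F p in nhds (0, 0). smooth_at p0 p \<and> smooth_at p1 p \<and> smooth_at p2 p"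
    by (intro eventually_conj eventually_smooth_at s)
  then obtain T where T: "open T" "(0, 0) \<in> T"
    and sT: "\<And>p. p \<in> T \<Longrightarrow> smooth_at p0 p \<and> smooth_at p1 p \<and> smooth_at p2 p"
    unfolding eventually_nhds by blast
  obtain S where S: "open S" "(0, 0) \<in> S"
    and idS: "\<And>u v. (u, v) \<in> S \<Longrightarrow> h (u, v) = p0 (u, c u v) + p1 (u, c u v) * v + p2 (u, c u v) * v^2"
    using id unfolding eventually_nhds c_def by blast
  have evS: "\<forall>\<^sub>F p in nhds (0, 0). p \<in> S" and evT: "\<forall>\<^sub>F p in nhds (0, 0). p \<in> T"
    using S T by (auto intro: eventually_nhds_in_open)
  \<comment> \<open>At v = u/sqrt 2 and v = - u/sqrt 2 the cubic c is 0 and v^2 is the same, so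
    equal values of h leave 2 p1(u, 0) v = 0.\<close>
  have p1_0: "\<forall>\<^sub>F u in nhds 0. p1 (u, 0) = 0"
  proof (rule eq_0_limit_real)
    show "isCont (\<lambda>u. p1 (u, 0)) 0"
      by (rule smooth_at_imp_isCont[OF smooth_at_slice[OF _ smooth_at_const]]) (rule s)
    have "\<forall>\<^sub>F u in nhds 0. (u, u / sqrt 2) \<in> S" "\<forall>\<^sub>F u in nhds 0. (u, - u / sqrt 2) \<in> S"
      by (rule eventually_slice; simp add: evS)+
    then show "\<forall>\<^sub>F u in nhds 0. u \<noteq> 0 \<longrightarrow> p1 (u, 0) = 0"
      using double
    proof eventually_elim
      case (elim u)
      define w where "w = u / sqrt 2"
      have w2: "w^2 = u^2 / 2" by (simp add: w_def power_divide)
      have "c u w = w * (u^2 - 2 * w^2)" "c u (- w) = - w * (u^2 - 2 * w^2)"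
        by (simp_all add: c_def power2_eq_square power3_eq_cube algebra_simps)
      then have cw: "c u w = 0" "c u (- w) = 0" by (simp_all add: w2)
      have "h (u, w) = h (u, - w)" "(u, w) \<in> S" "(u, - w) \<in> S" using elim by (simp_all add: w_def)
      then have "p1 (u, 0) * w = 0" using idS[of u w] idS[of u "- w"] by (simp add: cw)
      then show ?case by (auto simp: w_def)
    qed
  qed
  obtain k where k: "smooth_at k (0, 0)" "\<forall>\<^sub>F p in nhds (0, 0). p1 p = (snd p - 0) * k p"
    using smooth_division_real[of p1 "\<lambda>_. 0"] s p1_0 smooth_at_const by blast
  \<comment> \<open>This is c (p2 + u^2 k/3) with p1 = c k; the second divisibility is proved for
    \<open>L\<close> and the factor c is removed afterwards.\<close>
  define L where "L p = snd p * p2 p + (fst p)^2 / 3 * p1 p" for p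
  have sL: "smooth_at L (0, 0)"
    unfolding L_def by (intro smooth_intros s) simp
  \<comment> \<open>At a critical point w the v-derivatives of the coefficients drop out, since
    dc/dv = 0, and \<open>crit\<close> reads p1 + 2 w p2 = 0. There c = 2 u^2 w/3, so
    \<open>L\<close> is u^2/3 times that expression.\<close>
  have curve: "\<forall>\<^sub>F u in nhds 0. L (u, s * \<kappa> * u^3) = 0" if s: "s \<in> {1, -1}" for s
  proof -
    have s2: "s^2 = 1" using s by auto
    have e1: "\<forall>\<^sub>F u in nhds 0. (u, s * u / sqrt 6) \<in> S"
      by (rule eventually_slice) (simp_all add: evS)
    have e2: "\<forall>\<^sub>F u in nhds 0. (u, s * \<kappa> * u^3) \<in> T"
      by (rule eventually_slice) (simp_all add: evT)
    from e1 e2 crit[OF s] show ?thesis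
    proof eventually_elim
      case (elim u)
      define w where "w = s * u / sqrt 6"
      have w2: "w^2 = u^2 / 6" using s2 by (simp add: w_def power_divide power_mult_distrib)
      have "c u w = w * (u^2 - 2 * w^2)" by (simp add: c_def power2_eq_square power3_eq_cube algebra_simps)
      also have "\<dots> = s * \<kappa> * u^3"
        unfolding w2 by (simp add: w_def \<kappa>_def power2_eq_square power3_eq_cube field_simps)
      finally have cw: "c u w = s * \<kappa> * u^3" .
      have c': "(c u has_field_derivative 0) (at w)"
        unfolding c_def using w2 by (auto intro!: derivative_eq_intros)
      have d0: "((\<lambda>v. p (u, c u v)) has_field_derivative 0) (at w)"
        if p: "smooth_at p (u, c u w)" for p :: "real \<times> real \<Rightarrow> real"
      proof -
        obtain d where "((\<lambda>z. p (u, z)) has_field_derivative d) (at (c u w))"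
          using eventually_nhds_x_imp_x[OF smooth_at_field_differentiable_real[OF p]]
          unfolding field_differentiable_def by auto
        from DERIV_chain2[OF this c'] show ?thesis by simp
      qed
      have sp: "smooth_at p0 (u, c u w)" "smooth_at p1 (u, c u w)" "smooth_at p2 (u, c u w)"
        using sT elim(2) unfolding cw by auto
      have "((\<lambda>v. p0 (u, c u v) + p1 (u, c u v) * v + p2 (u, c u v) * v^2) has_field_derivative
          p1 (u, c u w) + p2 (u, c u w) * (2 * w)) (at w)"
        by (auto intro!: derivative_eq_intros d0 sp)
      moreover have "open {v. (u, v) \<in> S}"
        using open_vimage[OF S(1), of "\<lambda>v. (u, v)"] by (simp add: vimage_def continuous_on_Pair)
      ultimately have "((\<lambda>v. h (u, v)) has_field_derivative p1 (u, c u w) + p2 (u, c u w) * (2 * w)) (at w)"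
        by (rule has_field_derivative_transform_within_open)
          (use elim(1) idS in \<open>auto simp: w_def\<close>)
      then have "p1 (u, c u w) + p2 (u, c u w) * (2 * w) = 0"
        using elim(3) DERIV_unique unfolding w_def by blast
      moreover have "s * \<kappa> * u^3 = u^2 / 3 * (2 * w)"
        by (simp add: w_def \<kappa>_def power2_eq_square power3_eq_cube field_simps)
      then have "L (u, s * \<kappa> * u^3) = u^2 / 3 * (p1 (u, c u w) + p2 (u, c u w) * (2 * w))"
        unfolding L_def cw[symmetric] fst_conv snd_conv by (simp add: cw algebra_simps)
      ultimately show ?case by simp
    qed
  qed
  have curvem: "\<forall>\<^sub>F u in nhds 0. L (u, (-1) * \<kappa> * u^3) = 0" by (rule curve) simp
  have sk: "smooth_at (\<lambda>u. s * \<kappa> * u^3) 0" for s by (intro smooth_intros)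
  obtain L1 where L1: "smooth_at L1 (0, 0)" "\<forall>\<^sub>F p in nhds (0, 0). L p = (snd p - 1 * \<kappa> * (fst p)^3) * L1 p"
    using smooth_division_real[OF sL sk[of 1] _ curve[of 1]] by auto
  have "\<forall>\<^sub>F u in nhds 0. L1 (u, (-1) * \<kappa> * u^3) = 0"
  proof (rule eq_0_limit_real)
    show "isCont (\<lambda>u. L1 (u, (-1) * \<kappa> * u^3)) 0"
      by (rule smooth_at_imp_isCont[OF smooth_at_slice[OF _ sk]]) (simp add: L1)
    have "\<forall>\<^sub>F u in nhds 0. L (u, (-1) * \<kappa> * u^3) = (snd (u, (-1) * \<kappa> * u^3) - 1 * \<kappa> * (fst (u, (-1) * \<kappa> * u^3))^3)
        * L1 (u, (-1) * \<kappa> * u^3)"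
      by (rule eventually_slice[where k = "\<lambda>u. (-1) * \<kappa> * u^3"])
        (use L1(2) in simp, intro continuous_intros)
    then show "\<forall>\<^sub>F u in nhds 0. u \<noteq> 0 \<longrightarrow> L1 (u, (-1) * \<kappa> * u^3) = 0"
      using curvem by eventually_elim (auto simp: \<kappa>_def)
  qed
  then obtain L2 where L2: "smooth_at L2 (0, 0)" "\<forall>\<^sub>F p in nhds (0, 0). L1 p = (snd p - (-1) * \<kappa> * (fst p)^3) * L2 p"
    using smooth_division_real[OF L1(1) sk[of "-1"]] by auto
  have LL2: "\<forall>\<^sub>F p in nhds (0, 0). L p = ((snd p)^2 - 2 / 27 * (fst p)^6) * L2 p"
    using L1(2) L2(2)
  proof eventually_elim
    case (elim p)
    have "(snd p - 1 * \<kappa> * (fst p)^3) * (snd p - (-1) * \<kappa> * (fst p)^3) = (snd p)^2 - \<kappa>^2 * (fst p)^6"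
      by (simp add: algebra_simps power2_eq_square eval_nat_numeral)
    then show ?case using elim k2 by (metis mult.assoc)
  qed
  \<comment> \<open>On c = 0 the product equals \<open>L\<close> = u^2 p1/3 = 0 while the factor - 2
    u^6/27 is nonzero for u nonzero, so the missing factor c divides \<open>L2\<close>.\<close>
  have "\<forall>\<^sub>F u in nhds 0. L2 (u, 0) = 0"
  proof (rule eq_0_limit_real)
    show "isCont (\<lambda>u. L2 (u, 0)) 0"
      by (rule smooth_at_imp_isCont[OF smooth_at_slice[OF _ smooth_at_const]]) (rule L2)
    have "\<forall>\<^sub>F u in nhds 0. L (u, 0) = ((snd (u, 0::real))^2 - 2 / 27 * (fst (u, 0::real))^6) * L2 (u, 0)"
      by (rule eventually_slice[where k = "\<lambda>_. 0", OF LL2]) simp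
    then show "\<forall>\<^sub>F u in nhds 0. u \<noteq> 0 \<longrightarrow> L2 (u, 0) = 0"
      using p1_0 by eventually_elim (auto simp: L_def)
  qed
  then obtain L3 where L3: "smooth_at L3 (0, 0)" "\<forall>\<^sub>F p in nhds (0, 0). L2 p = (snd p - 0) * L3 p"
    using smooth_division_real[OF L2(1), of "\<lambda>_. 0"] smooth_at_const by blast
  define R where "R p = p2 p + (fst p)^2 / 3 * k p - ((snd p)^2 - 2 / 27 * (fst p)^6) * L3 p" for p
  have "\<forall>\<^sub>F p in nhds (0, 0). R p = 0"
  proof (rule eventually_eq_0_limit)
    show "smooth_at R (0, 0)" unfolding R_def by (intro smooth_intros s k L3) auto
    show "\<forall>\<^sub>F p in nhds (0, 0). snd p \<noteq> (\<lambda>_. 0) (fst p) \<longrightarrow> R p = 0"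
      using LL2 L3(2) k(2)
    proof eventually_elim
      case (elim p)
      have "snd p * R p = L p - ((snd p)^2 - 2 / 27 * (fst p)^6) * L2 p"
        using elim(2,3) by (simp add: R_def L_def algebra_simps)
      then show ?case using elim(1) by auto
    qed
  qed
  \<comment> \<open>Solution of the triangular system for the coefficients of v^2, v and 1, with the
    reductions of c0 and c0^2 above.\<close>
  define H2 where "H2 p = 4 / 9 * L3 p" for p
  define H1 where "H1 p = - (2 / 3) * (k p + 7 / 8 * (fst p)^4 * H2 p)" for p
  define H0 where "H0 p = p0 p - 3 / 4 * (fst p)^2 * (snd p)^2 * H2 p" for p
  have sH2: "smooth_at H2 (0, 0)" unfolding H2_def by (intro smooth_intros L3)
  have sH1: "smooth_at H1 (0, 0)" unfolding H1_def by (intro smooth_intros k sH2)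
  have sH0: "smooth_at H0 (0, 0)" unfolding H0_def by (intro smooth_intros s sH2)
  have "isCont (\<lambda>p::real \<times> real. (fst p, (fst p)^2 * snd p - 2 * (snd p)^3)) (0, 0)"
    by (intro continuous_intros)
  then have "\<forall>\<^sub>F p::real \<times> real in nhds (0, 0). R (fst p, (fst p)^2 * snd p - 2 * (snd p)^3) = 0 \<and>
      p1 (fst p, (fst p)^2 * snd p - 2 * (snd p)^3) =
        ((fst p)^2 * snd p - 2 * (snd p)^3) * k (fst p, (fst p)^2 * snd p - 2 * (snd p)^3)"
    using eventually_nhds_isCont[where f = "\<lambda>p::real \<times> real. (fst p, (fst p)^2 * snd p - 2 * (snd p)^3)"
       and x = "(0, 0)" and P = "\<lambda>p. R p = 0 \<and> p1 p = snd p * k p"]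
      eventually_conj[OF \<open>\<forall>\<^sub>F p in nhds (0, 0). R p = 0\<close> k(2)] by simp
  then have "\<forall>\<^sub>F (u, v) in nhds (0, 0). h (u, v) =
       H0 (u, u^2 * v - 2 * v^3) + H1 (u, u^2 * v - 2 * v^3) * (3 * v^4 - u^2 * v^2)
       + H2 (u, u^2 * v - 2 * v^3) * (3 * v^4 - u^2 * v^2)^2"
    using evS
  proof eventually_elim
    case (elim p)
    obtain u v where p: "p = (u, v)" by (cases p)
    define d where "d = u^2 * v - 2 * v^3"
    define q0 q1 q2 K l where "q0 = p0 (u, d)" and "q1 = p1 (u, d)" and "q2 = p2 (u, d)"
      and "K = k (u, d)" and "l = L3 (u, d)"
    have q: "q1 = d * K" "q2 = (d^2 - 2 / 27 * u^6) * l - u^2 / 3 * K"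
      using elim(1) unfolding p R_def q0_def q1_def q2_def K_def l_def d_def by auto
    have h: "h (u, v) = q0 + q1 * v + q2 * v^2"
      using idS[of u v] elim(2) unfolding p q0_def q1_def q2_def d_def c_def by simp
    have "q0 + (d * K) * v + ((d^2 - 2 / 27 * u^6) * l - u^2 / 3 * K) * v^2 =
        (q0 - 3 / 4 * u^2 * d^2 * (4 / 9 * l)) + (- (2 / 3) * (K + 7 / 8 * u^4 * (4 / 9 * l))) * (3 * v^4 - u^2 * v^2)
        + (4 / 9 * l) * (3 * v^4 - u^2 * v^2)^2"
      unfolding d_def by (simp add: field_simps power2_eq_square power3_eq_cube eval_nat_numeral)
    then show ?case
      unfolding p H0_def H1_def H2_def prod.case fst_conv snd_conv h q d_def[symmetric]
        q0_def[symmetric] K_def[symmetric] l_def[symmetric] .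
  qed
  then show thesis by (rule that[OF sH0 sH1 sH2])
qed

lemma smooth_division_1:
  fixes f :: "real \<Rightarrow> real"
  assumes "smooth_at f 0" "f 0 = 0"
  obtains g where "smooth_at g 0" "\<forall>\<^sub>F x in nhds 0. f x = x * g x"
proof -
  have "smooth_at (\<lambda>p::real \<times> real. f (snd p)) (0, 0)"
    by (rule smooth_at_compose[where g = f]) (auto intro!: smooth_intros assms)
  then obtain G :: "real \<times> real \<Rightarrow> real" where G: "smooth_at G (0, 0)"
    "\<forall>\<^sub>F p in nhds (0, 0). f (snd p) = (snd p - 0) * G p"
    by (rule smooth_division_real[OF _ smooth_at_const[of 0]]) (use assms(2) in auto)
  have "smooth_at (\<lambda>x. G (0, x)) 0"
    by (rule smooth_at_compose[where g = G]) (auto intro!: smooth_intros G)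
  moreover have "\<forall>\<^sub>F x in nhds 0. f x = x * G (0, x)"
  proof -
    have "isCont (\<lambda>x::real. (0::real, x)) 0" by (intro continuous_intros)
    then show ?thesis
      using eventually_nhds_isCont[where f = "\<lambda>x::real. (0::real, x)" and x = 0 and P = "\<lambda>p. f (snd p)
          = (snd p - 0) * G p"] G(2)
      by simp
  qed
  ultimately show thesis using that by blast
qed

section \<open>A normal form of the cuspidal beaks\<close>

text \<open>The coordinates of the surface after the blow-up x = U y, divided by U^3 and U^4. In
  these variables the self-intersection stays away from the critical points y = 0 and y = 1 as U
  tends to 0, so it is found by the implicit function theorem. The factor U beside
  \<open>\<omega>\<close> compensates for the different weights: before rescaling,
  \<open>\<omega>\<close> is the plain multiple of the third coordinate added to the second.\<close>

lemma double_points: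
  fixes A C D E :: "real \<Rightarrow> real"
  assumes s: "smooth_at A 0" "smooth_at C 0" "smooth_at D 0" "smooth_at E 0"
    and v: "A 0 = 1 / 2" "C 0 = 1 / 3" "D 0 = 1 / 3" "E 0 = 1 / 4"
  defines "f \<equiv> \<lambda>U y. y^2 * A (U * y) - y^3 * C (U * y)"
    and "g \<equiv> \<lambda>U y. y^3 * D (U * y) - y^4 * E (U * y)"
  obtains a b \<omega> :: "real \<Rightarrow> real" where "smooth_at a 0" "smooth_at b 0" "smooth_at \<omega> 0"
    "a 0 = (1 + sqrt 3) / 2" "b 0 = (1 - sqrt 3) / 2"
    "\<forall>\<^sub>F U in nhds 0. g U (a U) = g U (b U)"
    "\<forall>\<^sub>F U in nhds 0. f U (a U) + \<omega> U * U * g U (a U) = (f U 1 + \<omega> U * U * g U 1) / 2"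
    "\<forall>\<^sub>F U in nhds 0. f U (b U) + \<omega> U * U * g U (b U) = (f U 1 + \<omega> U * U * g U 1) / 2"
proof -
  \<comment> \<open>For U = 0 the functions are y^2/2 - y^3/3 and y^3/3 - y^4/4. Two distinct points
    with equal values of both have sum 1 and product - 1/2, so they are the roots of y^2 = y +
    1/2.\<close>
  define a0 b0 where "a0 = (1 + sqrt 3) / 2" and "b0 = (1 - sqrt 3) / 2"
  have q: "a0^2 = a0 + 1 / 2" "b0^2 = b0 + 1 / 2"
    by (simp_all add: a0_def b0_def power2_eq_square field_simps)
  have q3: "a0^3 = 3 / 2 * a0 + 1 / 2" "b0^3 = 3 / 2 * b0 + 1 / 2"
  proof -
    have "x^3 = 3 / 2 * x + 1 / 2" if "x^2 = x + 1 / 2" for x :: real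
    proof -
      have "x^3 = x * x^2" by (simp add: power3_eq_cube power2_eq_square)
      also have "\<dots> = x^2 + x / 2" unfolding that by (simp add: algebra_simps power2_eq_square[symmetric] that)
      finally show ?thesis using that by simp
    qed
    then show "a0^3 = 3 / 2 * a0 + 1 / 2" "b0^3 = 3 / 2 * b0 + 1 / 2" using q by blast+
  qed
  have q4: "a0^4 = 2 * a0 + 3 / 4" "b0^4 = 2 * b0 + 3 / 4"
  proof -
    have "x^4 = 2 * x + 3 / 4" if "x^2 = x + 1 / 2" for x :: real
    proof -
      have "x^4 = (x^2)^2" by simp
      also have "\<dots> = (x + 1 / 2)^2" unfolding that ..
      also have "\<dots> = x^2 + x + 1 / 4" by (simp add: power2_eq_square algebra_simps)
      finally show ?thesis using that by simp
    qed
    then show "a0^4 = 2 * a0 + 3 / 4" "b0^4 = 2 * b0 + 3 / 4" using q by blast+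
  qed
  have f0: "f 0 y = y^2 / 2 - y^3 / 3" and g0: "g 0 y = y^3 / 3 - y^4 / 4" for y
    by (simp_all add: f_def g_def v)
  have sf: "smooth_at (\<lambda>z. f (\<tau> z) (\<upsilon> z)) z0" and sg: "smooth_at (\<lambda>z. g (\<tau> z) (\<upsilon> z)) z0"
    if "smooth_at \<tau> z0" "smooth_at \<upsilon> z0" "\<tau> z0 = 0" for \<tau> \<upsilon> :: "'x::real_normed_vector \<Rightarrow> real" and z0
  proof -
    have "smooth_at (\<lambda>z. B (\<tau> z * \<upsilon> z)) z0" if B: "smooth_at B 0" for B :: "real \<Rightarrow> real"
      by (rule smooth_at_compose[where g = B])
        (use that \<open>smooth_at \<tau> z0\<close> \<open>smooth_at \<upsilon> z0\<close> \<open>\<tau> z0 = 0\<close> in \<open>auto intro: smooth_at_mult\<close>)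
    then show "smooth_at (\<lambda>z. f (\<tau> z) (\<upsilon> z)) z0" "smooth_at (\<lambda>z. g (\<tau> z) (\<upsilon> z)) z0"
      unfolding f_def g_def using s that by (intro smooth_intros; blast)+
  qed
  define \<Psi> where "\<Psi> p = (f (fst p) (fst (snd p)) - f (fst p) (snd (snd p)),
      g (fst p) (fst (snd p)) - g (fst p) (snd (snd p)))"
    for p :: "real \<times> (real \<times> real)"
  have s\<Psi>: "smooth_at \<Psi> (0, (a0, b0))"
    unfolding \<Psi>_def by (intro smooth_at_Pair smooth_at_diff sf sg smooth_intros) auto
  have \<Psi>0: "\<Psi> (0, (a0, b0)) = 0"
    by (simp add: \<Psi>_def f0 g0 q q3 q4 zero_prod_def field_simps)
  define D\<Psi> where "D\<Psi> = frechet_derivative \<Psi> (at (0, (a0, b0)))"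
  have D\<Psi>: "(\<Psi> has_derivative D\<Psi>) (at (0, (a0, b0)))"
    unfolding D\<Psi>_def by (rule smooth_at_imp_has_derivative[OF s\<Psi>])
  have slice: "D\<Psi> (0, k) = (- (1/2) * (fst k - snd k), - (1/2) * (a0 * fst k - b0 * snd k))" for k
  proof -
    have "((\<lambda>k::real \<times> real. (0::real, k)) has_derivative (\<lambda>k. (0, k))) (at (a0, b0))"
      by (auto intro!: derivative_eq_intros)
    then have 1: "((\<lambda>k. \<Psi> (0, k)) has_derivative (\<lambda>k. D\<Psi> (0, k))) (at (a0, b0))"
      by (rule has_derivative_compose) (rule D\<Psi>)
    have eq: "(\<lambda>k. \<Psi> (0, k)) = (\<lambda>k. ((fst k)^2 / 2 - (fst k)^3 / 3 - ((snd k)^2 / 2 - (snd k)^3 / 3),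
        (fst k)^3 / 3 - (fst k)^4 / 4 - ((snd k)^3 / 3 - (snd k)^4 / 4)))"
      by (simp add: \<Psi>_def f0 g0 fun_eq_iff)
    have c: "a0 - a0^2 = - (1/2)" "b0 - b0^2 = - (1/2)" "a0^2 - a0^3 = - (1/2) * a0" "b0^2 - b0^3 = - (1/2) * b0"
      by (simp_all add: q q3)
    have "((\<lambda>k. \<Psi> (0, k)) has_derivative (\<lambda>k. ((a0 - a0^2) * fst k - (b0 - b0^2) * snd k,
        (a0^2 - a0^3) * fst k - (b0^2 - b0^3) * snd k))) (at (a0, b0))"
      unfolding eq by (auto intro!: derivative_eq_intros simp: fun_eq_iff algebra_simps)
    then have "(\<lambda>k. D\<Psi> (0, k)) = (\<lambda>k. ((a0 - a0^2) * fst k - (b0 - b0^2) * snd k,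
        (a0^2 - a0^3) * fst k - (b0^2 - b0^3) * snd k))"
      using has_derivative_unique[OF 1] by blast
    then have "D\<Psi> (0, k) = ((a0 - a0^2) * fst k - (b0 - b0^2) * snd k,
        (a0^2 - a0^3) * fst k - (b0^2 - b0^3) * snd k)" by meson
    then show ?thesis unfolding c by (simp add: field_simps)
  qed
  have "inj (\<lambda>k. D\<Psi> (0, k))"
  proof (rule injI)
    fix k l assume "D\<Psi> (0, k) = D\<Psi> (0, l)"
    then have 1: "fst k - snd k = fst l - snd l" and 2: "a0 * fst k - b0 * snd k = a0 * fst l - b0 * snd l"
      unfolding slice by auto
    define d where "d = fst k - fst l"
    have d: "fst k = fst l + d" "snd k = snd l + d" using 1 by (simp_all add: d_def)
    have "(a0 - b0) * d = 0" using 2 unfolding d by (simp add: algebra_simps)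
    moreover have "a0 - b0 = sqrt 3" by (simp add: a0_def b0_def field_simps)
    ultimately have "d = 0" by simp
    then show "k = l" using d by (simp add: prod_eq_iff)
  qed
  then obtain \<theta> where \<theta>: "smooth_at \<theta> 0" "\<theta> 0 = (a0, b0)" "\<forall>\<^sub>F z in nhds 0. \<Psi> (z, \<theta> z) = 0"
    using smooth_implicit_function[OF s\<Psi> \<Psi>0 D\<Psi>] by blast
  define a b where "a U = fst (\<theta> U)" and "b U = snd (\<theta> U)" for U
  have sab: "smooth_at a 0" "smooth_at b 0" unfolding a_def b_def by (intro smooth_intros \<theta>)+
  have ab0: "a 0 = a0" "b 0 = b0" by (simp_all add: a_def b_def \<theta>)
  have eq: "\<forall>\<^sub>F U in nhds 0. f U (a U) = f U (b U) \<and> g U (a U) = g U (b U)"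
    using \<theta>(3) by eventually_elim (simp add: \<Psi>_def a_def b_def zero_prod_def)
  \<comment> \<open>At U = 0 the value at the double point, 1/12, already lies halfway between the
    critical values 0 and 1/6. The defect is therefore divisible by U, and \<open>\<omega>\<close>
    only has to cancel the quotient, with \<open>den\<close> equal to - 1/16 at 0.\<close>
  define num where "num U = f U 1 / 2 - f U (a U)" for U
  have snum: "smooth_at num 0"
    unfolding num_def divide_inverse by (intro smooth_at_diff smooth_at_mult smooth_at_const sf sab smooth_at_ident) auto
  have "num 0 = 0" unfolding num_def ab0 f0 q q3 by (simp add: field_simps)
  then obtain n1 where n1: "smooth_at n1 0" "\<forall>\<^sub>F U in nhds 0. num U = U * n1 U"
    using smooth_division_1[OF snum] by blast
  define den where "den U = g U (a U) - g U 1 / 2" for U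
  have sden: "smooth_at den 0"
    unfolding den_def divide_inverse by (intro smooth_at_diff smooth_at_mult smooth_at_const sg sab smooth_at_ident) auto
  have den0: "den 0 \<noteq> 0" unfolding den_def ab0 g0 q3 q4 by (simp add: field_simps)
  define \<omega> where "\<omega> U = n1 U / den U" for U
  have s\<omega>: "smooth_at \<omega> 0" unfolding \<omega>_def by (intro smooth_at_divide n1 sden den0)
  have "\<forall>\<^sub>F y in nhds (den 0). y \<in> - {0}"
    using den0 by (intro eventually_nhds_in_open open_Compl closed_singleton) simp
  then have "\<forall>\<^sub>F U in nhds 0. den U \<in> - {0}"
    by (rule eventually_nhds_isCont[OF smooth_at_imp_isCont[OF sden]])
  then have wa: "\<forall>\<^sub>F U in nhds 0. f U (a U) + \<omega> U * U * g U (a U) = (f U 1 + \<omega> U * U * g U 1) / 2"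
    using n1(2)
  proof eventually_elim
    case (elim U)
    then have "\<omega> U * den U = n1 U" by (simp add: \<omega>_def)
    then have "num U = U * (\<omega> U * den U)" using elim by simp
    then show ?case unfolding num_def den_def by (simp add: field_simps)
  qed
  have wb: "\<forall>\<^sub>F U in nhds 0. f U (b U) + \<omega> U * U * g U (b U) = (f U 1 + \<omega> U * U * g U 1) / 2"
    using wa eq by eventually_elim simp
  have "\<forall>\<^sub>F U in nhds 0. g U (a U) = g U (b U)" using eq by eventually_elim simp
  then show thesis using that[OF sab s\<omega> _ _ _ wa wb] ab0 a0_def b0_def by simp
qed

text \<open>Normal form of the plane map \<open>(U, x) \<mapsto> (U, x\<^sup>2 W(U, x))\<close>, whose second component has critical
  points \<open>0\<close> and \<open>U\<close> in \<open>x\<close> with critical values \<open>0\<close> and \<open>U\<^sup>3/6\<close>, like \<open>U v\<^sup>2/2 - v\<^sup>3/3\<close>. The ansatz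
  \<open>x = v (1 + (v - U) \<theta>)\<close> matches the critical points, so the difference of the two functions is
  divisible by \<open>v\<^sup>2 (v - U)\<^sup>2\<close>, and the quotient is an equation for \<open>\<theta>\<close> with invertible linearisation.\<close>

lemma straighten_cubic:
  fixes W :: "real \<times> complex \<Rightarrow> complex"
  assumes sW: "smooth_at W (0, 0)"
    and fd: "\<forall>\<^sub>F p in nhds (0, 0). (\<lambda>z. W (fst p, z)) field_differentiable at (snd p)"
    and cnjW: "\<forall>\<^sub>F p in nhds (0, 0). W (fst p, cnj (snd p)) = cnj (W p)"
    and val: "\<forall>\<^sub>F u in nhds 0. W (u, of_real u) = of_real u / 6"
    and crit: "\<forall>\<^sub>F u in nhds 0. ((\<lambda>z. z^2 * W (u, z)) has_field_derivative 0) (at (of_real u))"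
  obtains \<theta> where "smooth_at \<theta> (0, 0)"
    "\<forall>\<^sub>F p in nhds (0, 0). (\<lambda>z. \<theta> (fst p, z)) field_differentiable at (snd p)"
    "\<forall>\<^sub>F p in nhds (0, 0). (snd p * (1 + (snd p - of_real (fst p)) * \<theta> p))^2
        * W (fst p, snd p * (1 + (snd p - of_real (fst p)) * \<theta> p))
      = of_real (fst p) * (snd p)^2 / 2 - (snd p)^3 / 3"
    "\<forall>\<^sub>F p in nhds (0, 0). cnj (\<theta> (fst p, of_real (snd p))) = \<theta> (fst p, of_real (snd p))"
proof -
  have sr: "smooth_at (\<lambda>u::real. of_real u :: complex) 0" by (intro smooth_intros)
  \<comment> \<open>Two divisions by z - u bring W to the form u/6 - (z - u)/3 + (z - u)^2 W2: the
    constant term is the critical value \<open>val\<close>, the linear one is forced by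
    \<open>crit\<close>.\<close>
  define G where "G p = W p - of_real (fst p) / 6" for p
  have sG: "smooth_at G (0, 0)" unfolding G_def by (intro smooth_intros sW) auto
  have fdG: "\<forall>\<^sub>F p in nhds (0, 0). (\<lambda>z. G (fst p, z)) field_differentiable at (snd p)"
    using fd by eventually_elim (auto simp: G_def intro!: derivative_intros)
  have "\<forall>\<^sub>F u in nhds 0. G (u, of_real u) = 0" using val by eventually_elim (simp add: G_def)
  then obtain W1 where W1: "smooth_at W1 (0, 0)" "\<forall>\<^sub>F p in nhds (0, 0). G p = (snd p - of_real (fst p)) * W1 p"
    "\<forall>\<^sub>F p in nhds (0, 0). (\<lambda>z. W1 (fst p, z)) field_differentiable at (snd p)"
    using smooth_division[OF sG sr _ fdG] by auto
  \<comment> \<open>The derivative of z^2 (u/6 + (z - u) W1) at z = u is u^2 (1/3 + W1), and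
    \<open>crit\<close> makes it 0; the point u = 0 follows by continuity.\<close>
  have W1diag: "\<forall>\<^sub>F u in nhds 0. W1 (u, of_real u) + 1 / 3 = 0"
  proof (rule eq_0_limit_real)
    show "isCont (\<lambda>u. W1 (u, complex_of_real u) + 1 / 3) 0"
      by (intro continuous_intros smooth_at_imp_isCont smooth_at_slice sr) (simp add: W1)
    have "\<forall>\<^sub>F p in nhds (0, 0). G p = (snd p - of_real (fst p)) * W1 p
        \<and> (\<lambda>z. W1 (fst p, z)) field_differentiable at (snd p)"
      using W1(2,3) by (rule eventually_conj)
    then obtain S where S: "open S" "(0, 0) \<in> S" "\<And>p. p \<in> S \<Longrightarrow> G p = (snd p - of_real (fst p)) * W1 p"
       "\<And>p. p \<in> S \<Longrightarrow> (\<lambda>z. W1 (fst p, z)) field_differentiable at (snd p)"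
      unfolding eventually_nhds by blast
    have "\<forall>\<^sub>F p in nhds (0, complex_of_real 0). p \<in> S" using S by (auto intro: eventually_nhds_in_open)
    then have "\<forall>\<^sub>F u in nhds 0. (u, complex_of_real u) \<in> S"
      by (rule eventually_slice) (intro continuous_intros)
    then show "\<forall>\<^sub>F u in nhds 0. u \<noteq> 0 \<longrightarrow> W1 (u, complex_of_real u) + 1 / 3 = 0"
      using crit
    proof eventually_elim
      case (elim u)
      define c where "c = complex_of_real u"
      obtain d where d: "((\<lambda>z. W1 (u, z)) has_field_derivative d) (at c)"
        using S(4)[OF elim(1)] unfolding field_differentiable_def c_def by auto
      have "((\<lambda>z. z^2 * (c / 6 + (z - c) * W1 (u, z))) has_field_derivative
          2 * c * (c / 6) + c^2 * W1 (u, c)) (at c)"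
        by (auto intro!: derivative_eq_intros d)
      moreover have "open {z. (u, z) \<in> S}"
        using open_vimage[OF S(1), of "\<lambda>v. (u, v)"] by (simp add: vimage_def continuous_on_Pair)
      moreover have "c \<in> {z. (u, z) \<in> S}" using elim(1) by (simp add: c_def)
      moreover have "z^2 * (c / 6 + (z - c) * W1 (u, z)) = z^2 * W (u, z)" if "z \<in> {z. (u, z) \<in> S}" for z
        using S(3)[of "(u, z)"] that by (simp add: G_def c_def diff_eq_eq add.commute)
      ultimately have "((\<lambda>z. z^2 * W (u, z)) has_field_derivative 2 * c * (c / 6) + c^2 * W1 (u, c)) (at c)"
        by (rule has_field_derivative_transform_within_open)
      then have "2 * c * (c / 6) + c^2 * W1 (u, c) = 0"
        using elim(2) DERIV_unique unfolding c_def by blast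
      then have "c^2 * (W1 (u, c) + 1 / 3) = 0" by (simp add: algebra_simps power2_eq_square)
      then show ?case by (auto simp: c_def)
    qed
  qed
  define G1 where "G1 p = W1 p + 1 / 3" for p
  have sG1: "smooth_at G1 (0, 0)" unfolding G1_def by (intro smooth_intros W1)
  have fdG1: "\<forall>\<^sub>F p in nhds (0, 0). (\<lambda>z. G1 (fst p, z)) field_differentiable at (snd p)"
    using W1(3) by eventually_elim (auto simp: G1_def intro!: derivative_intros)
  have "\<forall>\<^sub>F u in nhds 0. G1 (u, of_real u) = 0" using W1diag by (simp add: G1_def)
  then obtain W2 where W2: "smooth_at W2 (0, 0)" "\<forall>\<^sub>F p in nhds (0, 0). G1 p = (snd p - of_real (fst p)) * W2 p"
    "\<forall>\<^sub>F p in nhds (0, 0). (\<lambda>z. W2 (fst p, z)) field_differentiable at (snd p)"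
    using smooth_division[OF sG1 sr _ fdG1] by auto
  have WW2: "\<forall>\<^sub>F p in nhds (0, 0). W p = of_real (fst p) / 6 - (snd p - of_real (fst p)) / 3
      + (snd p - of_real (fst p))^2 * W2 p"
    using W1(2) W2(2)
  proof eventually_elim
    case (elim p)
    have "W p = of_real (fst p) / 6 + (snd p - of_real (fst p)) * (G1 p - 1 / 3)"
      using elim(1) by (simp add: G_def G1_def diff_eq_eq add.commute)
    also have "\<dots> = of_real (fst p) / 6 + (snd p - of_real (fst p)) * ((snd p - of_real (fst p)) * W2 p - 1 / 3)"
      using elim(2) by simp
    finally show ?case by (simp add: field_simps power2_eq_square)
  qed
  have scnj: "smooth_at (\<lambda>p. cnj (F p)) x" if "smooth_at F x" for F :: "'x::real_normed_vector \<Rightarrow> complex" and x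
    by (rule smooth_at_compose_linear[OF bounded_linear_cnj that])
  have cnjc: "isCont (\<lambda>p::real \<times> complex. (fst p, cnj (snd p))) (0, 0)"
    by (intro continuous_intros)
  have cnjW2: "\<forall>\<^sub>F p in nhds (0, 0). W2 (fst p, cnj (snd p)) - cnj (W2 p) = 0"
  proof (rule eventually_eq_0_limit)
    have "smooth_at (\<lambda>p::real \<times> complex. W2 (fst p, cnj (snd p))) (0, 0)"
      by (rule smooth_at_compose[where g = W2]) (auto intro!: smooth_intros scnj W2)
    then show "smooth_at (\<lambda>p. W2 (fst p, cnj (snd p)) - cnj (W2 p)) (0, 0)"
      by (intro smooth_at_diff scnj W2)
    have "\<forall>\<^sub>F p::real \<times> complex in nhds (0, 0). W (fst p, cnj (snd p))
        = of_real (fst p) / 6 - (cnj (snd p) - of_real (fst p)) / 3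
      + (cnj (snd p) - of_real (fst p))^2 * W2 (fst p, cnj (snd p))"
      using eventually_nhds_isCont[OF cnjc, of "\<lambda>p. W p = of_real (fst p) / 6 - (snd p - of_real (fst p)) / 3
      + (snd p - of_real (fst p))^2 * W2 p"] WW2 by simp
    then show "\<forall>\<^sub>F p in nhds (0, 0). snd p \<noteq> of_real (fst p) \<longrightarrow> W2 (fst p, cnj (snd p)) - cnj (W2 p) = 0"
      using WW2 cnjW
    proof eventually_elim
      case (elim p)
      have "(cnj (snd p) - of_real (fst p))^2 * W2 (fst p, cnj (snd p)) = cnj ((snd p - of_real (fst p))^2 * W2 p)"
        using elim(1) elim(3) arg_cong[OF elim(2), of cnj] by auto
      then have "(cnj (snd p) - of_real (fst p))^2 * (W2 (fst p, cnj (snd p)) - cnj (W2 p)) = 0"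
        by (simp add: algebra_simps)
      moreover have "cnj (snd p) - of_real (fst p) \<noteq> 0" if "snd p \<noteq> of_real (fst p)"
        using that by (metis complex_cnj_cnj complex_cnj_complex_of_real eq_iff_diff_eq_0)
      ultimately show ?case by (metis mult_eq_0_iff power_not_zero)
    qed
  qed
  define \<theta>0 where "\<theta>0 = W2 (0, 0)"
  have real0: "cnj \<theta>0 = \<theta>0" using eventually_nhds_x_imp_x[OF cnjW2] by (simp add: \<theta>0_def)
  define X where "X q = snd (fst q) * (1 + (snd (fst q) - of_real (fst (fst q))) * snd q)"
      for q :: "(real \<times> complex) \<times> complex"
  \<comment> \<open>The difference of x^2 W(u, x) and u v^2/2 - v^3/3 at x = v (1 + (v - u) t),
    divided by v^2 (v - u)^2, with W written through \<open>W2\<close>. At u = v = 0 it reduces to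
    W2(0, 0) - t, hence the invertible linearisation.\<close>
  define \<Psi> where "\<Psi> q = (let u = of_real (fst (fst q)); v = snd (fst q); t = snd q; s = v - u in
      (1 + v * t)^2 * (1 + s * t)^2 * W2 (fst (fst q), X q) - t / 3 - 2 * t * (1 + v * t) / 3
      + t^2 * (u / 6 - s * (1 + v * t) / 3))" for q :: "(real \<times> complex) \<times> complex"
  have sX: "smooth_at X q" for q unfolding X_def by (intro smooth_intros)
  have X0: "X ((0, 0), t) = 0" for t by (simp add: X_def)
  have sW2X: "smooth_at (\<lambda>q. W2 (fst (fst q), X q)) q" if "smooth_at W2 (fst (fst q), X q)" for q
    by (rule smooth_at_compose[where g = W2]) (auto intro!: smooth_intros sX that)
  have s\<Psi>': "smooth_at \<Psi> q" if "smooth_at W2 (fst (fst q), X q)" for q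
    unfolding \<Psi>_def Let_def by (intro smooth_intros sW2X that) simp_all
  have s\<Psi>: "smooth_at \<Psi> ((0, 0), \<theta>0)" by (rule s\<Psi>') (simp add: X0 W2)
  have slice: "\<Psi> ((0, 0), t) = \<theta>0 - t" for t
    by (simp add: \<Psi>_def X0 \<theta>0_def field_simps)
  have \<Psi>0: "\<Psi> ((0, 0), \<theta>0) = 0" by (simp add: slice)
  define D where "D = frechet_derivative \<Psi> (at ((0, 0), \<theta>0))"
  have D: "(\<Psi> has_derivative D) (at ((0, 0), \<theta>0))"
    unfolding D_def by (rule smooth_at_imp_has_derivative[OF s\<Psi>])
  have D0: "D (0, k) = - k" for k
  proof -
    have "((\<lambda>k::complex. ((0::real, 0::complex), k)) has_derivative (\<lambda>k. (0, k))) (at \<theta>0)"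
      by (auto intro!: derivative_eq_intros simp: zero_prod_def)
    then have "((\<lambda>k. \<Psi> ((0, 0), k)) has_derivative (\<lambda>k. D (0, k))) (at \<theta>0)"
      by (rule has_derivative_compose) (rule D)
    moreover have "((\<lambda>k. \<Psi> ((0, 0), k)) has_derivative (\<lambda>k. - k)) (at \<theta>0)"
      unfolding slice by (auto intro!: derivative_eq_intros)
    ultimately have "(\<lambda>k. D (0, k)) = (\<lambda>k. - k)" by (rule has_derivative_unique)
    then show ?thesis by meson
  qed
  have "inj (\<lambda>k. D (0, k))" by (simp add: D0 inj_def)
  then obtain \<theta> where \<theta>: "smooth_at \<theta> (0, 0)" "\<theta> (0, 0) = \<theta>0" "\<forall>\<^sub>F z in nhds (0, 0). \<Psi> (z, \<theta> z) = 0"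
    "\<forall>\<^sub>F p in nhds ((0, 0), \<theta>0). \<Psi> p = 0 \<longrightarrow> snd p = \<theta> (fst p)"
    using smooth_implicit_function[OF s\<Psi> \<Psi>0 D] by blast
  have c\<theta>: "isCont (\<lambda>z. (z, \<theta> z)) (0, 0)" by (intro continuous_intros smooth_at_imp_isCont \<theta>)
  have cX: "isCont (\<lambda>z. (fst z, X (z, \<theta> z))) (0, 0)"
    unfolding X_def fst_conv snd_conv by (intro continuous_intros smooth_at_imp_isCont \<theta>)
  have evX: "\<forall>\<^sub>F z in nhds (0, 0). Q (fst z, X (z, \<theta> z))" if "\<forall>\<^sub>F p in nhds (0, 0). Q p" for Q
    using eventually_nhds_isCont[OF cX, of Q] that by (simp add: X_def)
  have fd\<theta>: "\<forall>\<^sub>F p in nhds (0, 0). (\<lambda>z. \<theta> (fst p, z)) field_differentiable at (snd p)"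
  proof -
    have "\<forall>\<^sub>F q in nhds ((0, 0), \<theta>0). frechet_derivative \<Psi> (at q) (0, 1) \<in> - {0}"
    proof (rule eventually_nhds_isCont[where f = "\<lambda>q. frechet_derivative \<Psi> (at q) (0, 1)"])
      show "isCont (\<lambda>q. frechet_derivative \<Psi> (at q) (0, 1)) ((0, 0), \<theta>0)"
        by (rule smooth_at_imp_isCont[OF smooth_at_frechet_derivative[OF s\<Psi>]])
      show "\<forall>\<^sub>F y in nhds (frechet_derivative \<Psi> (at ((0, 0), \<theta>0)) (0, 1)). y \<in> - {0}"
        using D0[of 1] by (intro eventually_nhds_in_open open_Compl closed_singleton) (simp add: D_def)
    qed
    then have e1: "\<forall>\<^sub>F z in nhds (0, 0). frechet_derivative \<Psi> (at (z, \<theta> z)) (0, 1) \<in> - {0}"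
      using eventually_nhds_isCont[OF c\<theta>] \<theta>(2) by simp
    have e2: "\<forall>\<^sub>F z in nhds (0, 0). \<forall>\<^sub>F q in nhds z. \<Psi> (q, \<theta> q) = 0"
      using \<theta>(3) by (simp add: eventually_eventually)
    from e1 e2 evX[OF eventually_smooth_at[OF W2(1)]] evX[OF W2(3)] eventually_smooth_at[OF \<theta>(1)]
    show ?thesis
    proof eventually_elim
      case (elim z)
      obtain u v where z: "z = (u, v)" by (cases z)
      define t where "t = \<theta> (u, v)"
      let ?D = "frechet_derivative \<Psi> (at ((u, v), t))"
      have sq: "smooth_at \<Psi> ((u, v), t)"
        by (rule s\<Psi>') (use elim(3) in \<open>simp add: z t_def\<close>)
      have D: "(\<Psi> has_derivative ?D) (at ((u, v), t))" by (rule smooth_at_imp_has_derivative[OF sq])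
      obtain d where d: "((\<lambda>x. W2 (u, x)) has_field_derivative d) (at (X ((u, v), t)))"
        using elim(4) unfolding field_differentiable_def by (auto simp: z t_def)
      have X1: "((\<lambda>w. X ((u, w), t)) has_field_derivative (1 + (v - of_real u) * t) + v * t) (at v)"
        unfolding X_def by (auto intro!: derivative_eq_intros)
      have X2: "((\<lambda>y. X ((u, v), y)) has_field_derivative v * (v - of_real u)) (at t)"
        unfolding X_def by (auto intro!: derivative_eq_intros)
      have lin1: "?D ((0, h), 0) = h * ?D ((0, 1), 0)" for h
      proof -
        have "((\<lambda>p. \<Psi> (p, t)) has_derivative (\<lambda>h. ?D (h, 0))) (at (u, v))"
          by (rule has_derivative_compose[where f = "\<lambda>p. (p, t)", OF _ D]) (auto intro!: derivative_eq_intros)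
        moreover have "(\<lambda>w. \<Psi> ((u, w), t)) field_differentiable at v"
          unfolding \<Psi>_def Let_def fst_conv snd_conv field_differentiable_def
          by (rule exI) (rule derivative_eq_intros DERIV_chain2[OF d X1] refl | simp)+
        ultimately show ?thesis using field_differentiable_slice_iff[of "\<lambda>p. \<Psi> (p, t)"] by blast
      qed
      have lin2: "?D (0, h) = h * ?D (0, 1)" for h
      proof -
        \<comment> \<open>The first component is a dummy real parameter that brings the dependence
          on t alone into the shape of \<open>field_differentiable_slice_iff\<close>.\<close>
        have "((\<lambda>p::real \<times> complex. \<Psi> ((u, v), snd p)) has_derivative (\<lambda>h. ?D (0, snd h))) (at (0, t))"
          by (rule has_derivative_compose[where f = "\<lambda>p. ((u, v), snd p)"])
            (auto intro!: derivative_eq_intros D simp: zero_prod_def)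
        moreover have "(\<lambda>y. \<Psi> ((u, v), snd (0::real, y))) field_differentiable at t"
          unfolding \<Psi>_def Let_def fst_conv snd_conv field_differentiable_def
          by (rule exI) (rule derivative_eq_intros DERIV_chain2[OF d X2] refl | simp)+
        ultimately show ?thesis
          using field_differentiable_slice_iff[of "\<lambda>p::real \<times> complex. \<Psi> ((u, v), snd p)"] by (metis snd_conv)
      qed
      have "(\<lambda>x. \<theta> (u, x)) field_differentiable at v"
      proof (rule implicit_field_differentiable)
        show "(\<Psi> has_derivative ?D) (at ((u, v), \<theta> (u, v)))" using D by (simp add: t_def)
        show "?D ((0, h), 0) = h * ?D ((0, 1), 0)" "?D (0, h) = h * ?D (0, 1)" for h
          by (fact lin1, fact lin2)
        show "?D (0, 1) \<noteq> 0" using elim(1) by (simp add: z t_def)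
        show "(\<theta> has_derivative frechet_derivative \<theta> (at (u, v))) (at (u, v))"
          using smooth_at_imp_has_derivative[OF elim(5)] by (simp add: z)
        show "\<forall>\<^sub>F q in nhds (u, v). \<Psi> (q, \<theta> q) = 0" using elim(2) by (simp add: z)
      qed
      then show ?case by (simp add: z)
    qed
  qed
  have id: "\<forall>\<^sub>F p in nhds (0, 0). (snd p * (1 + (snd p - of_real (fst p)) * \<theta> p))^2
        * W (fst p, snd p * (1 + (snd p - of_real (fst p)) * \<theta> p))
      = of_real (fst p) * (snd p)^2 / 2 - (snd p)^3 / 3"
    using evX[OF WW2] \<theta>(3)
  proof eventually_elim
    case (elim p)
    define u v t where "u = complex_of_real (fst p)" and "v = snd p" and "t = \<theta> p"
    define w where "w = W2 (fst p, X (p, \<theta> p))"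
    have X: "X (p, \<theta> p) = v * (1 + (v - u) * t)" by (simp add: X_def u_def v_def t_def)
    have W: "W (fst p, X (p, \<theta> p)) = u / 6 - (v * (1 + (v - u) * t) - u) / 3 + (v * (1 + (v - u) * t) - u)^2 * w"
      using elim(1) unfolding X[symmetric] w_def fst_conv snd_conv by (simp only: u_def)
    have "(1 + v * t)^2 * (1 + (v - u) * t)^2 * w - t / 3 - 2 * t * (1 + v * t) / 3
      + t^2 * (u / 6 - (v - u) * (1 + v * t) / 3) = 0" (is "?E = 0")
      using elim(2) unfolding \<Psi>_def Let_def w_def u_def v_def t_def by simp
    moreover have "(v * (1 + (v - u) * t))^2 * (u / 6 - (v * (1 + (v - u) * t) - u) / 3 + (v * (1 + (v - u) * t) - u)^2 * w)
       - (u * v^2 / 2 - v^3 / 3) = v^2 * (v - u)^2 * ?E"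
      by (simp add: field_simps power2_eq_square power3_eq_cube)
    ultimately have "(v * (1 + (v - u) * t))^2 * W (fst p, X (p, \<theta> p)) = u * v^2 / 2 - v^3 / 3"
      unfolding W by simp
    then show ?case unfolding X unfolding u_def v_def t_def .
  qed
  \<comment> \<open>For real v the conjugate of \<theta> solves the same equation, because
    \<open>W2\<close> commutes with conjugation, and local uniqueness identifies it with
    \<theta>.\<close>
  have real: "\<forall>\<^sub>F p in nhds (0, 0). cnj (\<theta> (fst p, of_real (snd p))) = \<theta> (fst p, of_real (snd p))"
  proof -
    define j where "j p = (fst p, complex_of_real (snd p))" for p :: "real \<times> real"
    have cj: "isCont j (0, 0)" unfolding j_def by (intro continuous_intros)
    have j0: "j (0, 0) = (0, 0)" by (simp add: j_def)
    have ev: "\<forall>\<^sub>F p in nhds (0, 0). Q (j p)" if "\<forall>\<^sub>F p in nhds (0, 0). Q p" for Q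
      using eventually_nhds_isCont[OF cj, of Q] that by (simp add: j0)
    have "isCont (\<lambda>z. (z, cnj (\<theta> z))) (0, 0)" by (intro continuous_intros smooth_at_imp_isCont \<theta>)
    then have uniq: "\<forall>\<^sub>F z in nhds (0, 0). \<Psi> (z, cnj (\<theta> z)) = 0 \<longrightarrow> cnj (\<theta> z) = \<theta> z"
      using eventually_nhds_isCont[of "(0, 0)" "\<lambda>z. (z, cnj (\<theta> z))" "\<lambda>p. \<Psi> p = 0 \<longrightarrow> snd p = \<theta> (fst p)"] \<theta>(2,4) real0
      by simp
    from ev[OF uniq] ev[OF \<theta>(3)] ev[OF evX[OF cnjW2]] show ?thesis
    proof eventually_elim
      case (elim p)
      obtain u v where p: "p = (u, v)" by (cases p)
      define z where "z = j p"
      have z: "fst z = u" "snd z = of_real v" by (simp_all add: z_def j_def p)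
      have "X (z, cnj (\<theta> z)) = cnj (X (z, \<theta> z))" by (simp add: X_def z)
      then have "W2 (fst z, X (z, cnj (\<theta> z))) = cnj (W2 (fst z, X (z, \<theta> z)))"
        using elim(3) by (simp add: z_def)
      then have "\<Psi> (z, cnj (\<theta> z)) = cnj (\<Psi> (z, \<theta> z))"
        unfolding \<Psi>_def Let_def by (simp add: z)
      then have "cnj (\<theta> z) = \<theta> z" using elim(1,2) by (simp add: z_def)
      then show ?case by (simp add: z_def j_def)
    qed
  qed
  show thesis by (rule that[OF \<theta>(1) fd\<theta> id real])
qed

text \<open>Complexifications of real analytic germs at 0: commuting with conjugation means having
  real Taylor coefficients.\<close>

definition real_holo :: "(complex \<Rightarrow> complex) \<Rightarrow> bool" where
  "real_holo A \<longleftrightarrow> (\<forall>\<^sub>F z in nhds 0. A field_differentiable at z) \<and> (\<forall>\<^sub>F z in nhds 0. A (cnj z) = cnj (A z))"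

lemma real_holo_smooth:
  assumes "real_holo A"
  shows "smooth_at A 0"
proof -
  obtain S where "open S" "0 \<in> S" "\<forall>z\<in>S. A field_differentiable at z"
    using assms unfolding real_holo_def eventually_nhds by blast
  then show ?thesis
    using smooth_at_holomorphic[of S A 0] unfolding holomorphic_on_def
    by (meson field_differentiable_at_within)
qed

lemma real_holo_of_real:
  assumes "real_holo A"
  shows "\<forall>\<^sub>F x in nhds 0. A (of_real x) = of_real (Re (A (of_real x)))"
proof -
  have "isCont complex_of_real 0" by (intro continuous_intros)
  then have "\<forall>\<^sub>F x in nhds 0. A (cnj (of_real x)) = cnj (A (of_real x))"
    using eventually_nhds_isCont[of 0 complex_of_real "\<lambda>z. A (cnj z) = cnj (A z)"] assms
    by (simp add: real_holo_def)
  then show ?thesis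
    by eventually_elim (simp add: complex_eq_iff)
qed

lemma real_holo_smooth_Re: "real_holo A \<Longrightarrow> smooth_at (\<lambda>x. Re (A (of_real x))) (0::real)"
  by (rule smooth_at_Re, rule smooth_at_compose[where g = A])
    (auto intro!: smooth_intros real_holo_smooth)

text \<open>The straightening fixes the values of the second coordinate, and the double points lie
  at the halfway value u^3/12. The straightened cubic takes this value only at v = u r with r a root
  of w^2/2 - w^3/3 = 1/12; so the double point u y(u), whose ratio to u tends to r, must correspond
  to v = u r exactly.\<close>

lemma match_root:
  fixes \<tau> F :: "real \<times> real \<Rightarrow> real" and y :: "real \<Rightarrow> real"
  assumes \<tau>: "smooth_at \<tau> (0, 0)" and y: "smooth_at y 0" "y 0 = r" and r: "r^2 = r + 1 / 2"
    and id: "\<forall>\<^sub>F (u, v) in nhds (0, 0). F (u, v * (1 + (v - u) * \<tau> (u, v))) = u * v^2 / 2 - v^3 / 3"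
    and Fy: "\<forall>\<^sub>F u in nhds 0. F (u, u * y u) = u^3 / 12"
  shows "\<forall>\<^sub>F u in nhds 0. u * r * (1 + (u * r - u) * \<tau> (u, u * r)) = u * y u"
proof -
  define \<Phi> where "\<Phi> p = snd p * (1 + fst p * (snd p - 1) * \<tau> (fst p, fst p * snd p)) - y (fst p)" for p :: "real \<times> real"
  have "smooth_at (\<lambda>p::real \<times> real. \<tau> (fst p, fst p * snd p)) (0, r)"
    by (rule smooth_at_compose[where g = \<tau>]) (auto intro!: smooth_intros \<tau>)
  moreover have "smooth_at (\<lambda>p::real \<times> real. y (fst p)) (0, r)"
    by (rule smooth_at_compose[where g = y]) (auto intro!: smooth_intros y)
  ultimately have s\<Phi>: "smooth_at \<Phi> (0, r)"
    unfolding \<Phi>_def by (intro smooth_intros)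
  have \<Phi>0: "\<Phi> (0, w) = w - r" for w by (simp add: \<Phi>_def y)
  define D where "D = frechet_derivative \<Phi> (at (0, r))"
  have D: "(\<Phi> has_derivative D) (at (0, r))"
    unfolding D_def by (rule smooth_at_imp_has_derivative[OF s\<Phi>])
  have "((\<lambda>k::real. (0::real, k)) has_derivative (\<lambda>k. (0, k))) (at r)"
    by (auto intro!: derivative_eq_intros)
  then have "((\<lambda>k. \<Phi> (0, k)) has_derivative (\<lambda>k. D (0, k))) (at r)"
    by (rule has_derivative_compose) (rule D)
  moreover have "((\<lambda>k. \<Phi> (0, k)) has_derivative (\<lambda>k. k)) (at r)"
    unfolding \<Phi>0 by (auto intro!: derivative_eq_intros)
  ultimately have "(\<lambda>k. D (0, k)) = (\<lambda>k. k)" by (rule has_derivative_unique)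
  then have "inj (\<lambda>k. D (0, k))" by simp
  then obtain w where w: "smooth_at w 0" "w 0 = r" "\<forall>\<^sub>F u in nhds 0. \<Phi> (u, w u) = 0"
    using smooth_implicit_function[OF s\<Phi> _ D] \<Phi>0[of r] by auto
  have cw: "isCont w 0" using w(1) smooth_at_imp_isCont by blast
  have e1: "\<forall>\<^sub>F u in nhds 0. case (u, u * w u) of (u, v) \<Rightarrow> F (u, v * (1 + (v - u) * \<tau> (u, v))) = u * v^2 / 2 - v^3 / 3"
    by (rule eventually_slice[where k = "\<lambda>u. u * w u"]) (use id cw in \<open>auto intro!: continuous_intros\<close>)
  \<comment> \<open>The three roots of w^2/2 - w^3/3 = 1/12 are 1/2, r and 1 - r. They are distinct,
    so a solution w near r is r.\<close>
  have ne: "(r - 1 / 2) * (r - (1 - r)) \<noteq> 0"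
  proof
    assume "(r - 1 / 2) * (r - (1 - r)) = 0"
    then have "r = 1 / 2" by auto
    with r have "(1 / 2)^2 = 1 / 2 + (1 / 2 :: real)" by (simp only:)
    then show False by (simp add: power2_eq_square)
  qed
  have e2: "\<forall>\<^sub>F u in nhds 0. (w u - 1 / 2) * (w u - (1 - r)) \<in> - {0}"
  proof (rule eventually_nhds_isCont[where f = "\<lambda>u. (w u - 1 / 2) * (w u - (1 - r))"])
    show "isCont (\<lambda>u. (w u - 1 / 2) * (w u - (1 - r))) 0" by (intro continuous_intros cw)
    show "\<forall>\<^sub>F y in nhds ((w 0 - 1 / 2) * (w 0 - (1 - r))). y \<in> - {0}"
      using ne w(2) by (intro eventually_nhds_in_open open_Compl closed_singleton) simp
  qed
  from e1 e2 w(3) Fy show ?thesis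
  proof eventually_elim
    case (elim u)
    show ?case
    proof (cases "u = 0")
      case False
      have wy: "w u * (1 + u * (w u - 1) * \<tau> (u, u * w u)) = y u"
        using elim(3) by (simp add: \<Phi>_def)
      then have X: "u * w u * (1 + (u * w u - u) * \<tau> (u, u * w u)) = u * y u"
        by (simp add: algebra_simps flip: wy)
      have "u * (u * w u)^2 / 2 - (u * w u)^3 / 3 = u^3 / 12"
        using elim(1,4) X by simp
      then have "u^3 * ((w u)^2 / 2 - (w u)^3 / 3 - 1 / 12) = 0"
        by (simp add: algebra_simps power2_eq_square power3_eq_cube)
      then have z: "(w u)^2 / 2 - (w u)^3 / 3 - 1 / 12 = 0" using False by simp
      have "(w u - r) * ((w u - 1 / 2) * (w u - (1 - r))) =
          (w u - 1/2) * ((w u)^2 - w u - (r^2 - r))"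
        by (simp add: field_simps power2_eq_square)
      also have "\<dots> = -3 * ((w u)^2 / 2 - (w u)^3 / 3 - 1 / 12)"
        unfolding r by (simp add: field_simps power2_eq_square power3_eq_cube)
      finally have "w u = r" using z elim(2) by simp
      then show ?thesis using X by simp
    qed simp
  qed
qed

text \<open>Comparison of orders in v on the line u = 0. The left side has order 4, which forces
  \<open>H0\<close> to vanish to second order in c = - 2 v^3 and so to contribute from v^6 on; the
  coefficient of v^4 then reads G(0) = 3 H1(0).\<close>

lemma quartic_coefficient_nonzero:
  fixes H0 H1 H2 G :: "real \<Rightarrow> real"
  assumes s: "smooth_at H0 0" "smooth_at H1 0" "smooth_at H2 0" "smooth_at G 0"
    and id: "\<forall>\<^sub>F v in nhds 0. v^4 * G v = H0 (- 2 * v^3) + H1 (- 2 * v^3) * (3 * v^4) + H2 (- 2 * v^3) * (3 * v^4)^2"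
    and "G 0 \<noteq> 0"
  shows "H1 0 \<noteq> 0"
proof -
  have "H0 0 = 0" using eventually_nhds_x_imp_x[OF id] by simp
  then obtain K where K: "smooth_at K 0" "\<forall>\<^sub>F x in nhds 0. H0 x = x * K x"
    using smooth_division_1[OF s(1)] by blast
  have cube: "\<forall>\<^sub>F v in nhds 0. P (- 2 * v^3)" if "\<forall>\<^sub>F x in nhds 0. P x" for P :: "real \<Rightarrow> bool"
    by (rule eventually_nhds_isCont[where f = "\<lambda>v::real. - 2 * v^3"]) (use that in \<open>auto intro!: continuous_intros\<close>)
  have cc: "isCont (\<lambda>v. B (- 2 * v^3)) 0" if "smooth_at B 0" for B :: "real \<Rightarrow> real"
    by (rule isCont_o2[where g = B]) (use that smooth_at_imp_isCont in \<open>auto intro!: continuous_intros\<close>)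
  have cG: "isCont G 0" using s(4) smooth_at_imp_isCont by blast
  have "\<forall>\<^sub>F v in nhds 0. - 2 * K (- 2 * v^3) + 3 * v * H1 (- 2 * v^3) + 9 * v^5 * H2 (- 2 * v^3) - v * G v = 0"
  proof (rule eq_0_limit_real)
    show "isCont (\<lambda>v. - 2 * K (- 2 * v^3) + 3 * v * H1 (- 2 * v^3) + 9 * v^5 * H2 (- 2 * v^3) - v * G v) 0"
      by (intro continuous_intros cc cG K s)
    show "\<forall>\<^sub>F v in nhds 0. v \<noteq> 0 \<longrightarrow> - 2 * K (- 2 * v^3) + 3 * v * H1 (- 2 * v^3) + 9 * v^5 * H2 (- 2 * v^3) - v * G v = 0"
      using id cube[OF K(2)]
    proof eventually_elim
      case (elim v)
      have "v^3 * (- 2 * K (- 2 * v^3) + 3 * v * H1 (- 2 * v^3) + 9 * v^5 * H2 (- 2 * v^3) - v * G v) =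
          (- 2 * v^3) * K (- 2 * v^3) + H1 (- 2 * v^3) * (3 * v^4) + H2 (- 2 * v^3) * (3 * v^4)^2 - v^4 * G v"
        by (simp add: algebra_simps eval_nat_numeral)
      then show ?case using elim by auto
    qed
  qed
  note ev1 = this
  have "K 0 = 0" using eventually_nhds_x_imp_x[OF ev1] by simp
  then obtain L where L: "smooth_at L 0" "\<forall>\<^sub>F x in nhds 0. K x = x * L x"
    using smooth_division_1[OF K(1)] by blast
  have "\<forall>\<^sub>F v in nhds 0. 4 * v^2 * L (- 2 * v^3) + 3 * H1 (- 2 * v^3) + 9 * v^4 * H2 (- 2 * v^3) - G v = 0"
  proof (rule eq_0_limit_real)
    show "isCont (\<lambda>v. 4 * v^2 * L (- 2 * v^3) + 3 * H1 (- 2 * v^3) + 9 * v^4 * H2 (- 2 * v^3) - G v) 0"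
      by (intro continuous_intros cc cG L s)
    show "\<forall>\<^sub>F v in nhds 0. v \<noteq> 0 \<longrightarrow> 4 * v^2 * L (- 2 * v^3) + 3 * H1 (- 2 * v^3) + 9 * v^4 * H2 (- 2 * v^3) - G v = 0"
      using ev1 cube[OF L(2)]
    proof eventually_elim
      case (elim v)
      have "v * (4 * v^2 * L (- 2 * v^3) + 3 * H1 (- 2 * v^3) + 9 * v^4 * H2 (- 2 * v^3) - G v) =
          - 2 * ((- 2 * v^3) * L (- 2 * v^3)) + 3 * v * H1 (- 2 * v^3) + 9 * v^5 * H2 (- 2 * v^3) - v * G v"
        by (simp add: algebra_simps eval_nat_numeral)
      also have "\<dots> = 0" using elim unfolding elim(2)[symmetric] by simp
      finally show ?case by (metis mult_eq_0_iff)
    qed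
  qed
  from eventually_nhds_x_imp_x[OF this] assms(6) show ?thesis by auto
qed

lemma has_field_derivative_Re_of_real:
  assumes "(F has_field_derivative of_real d) (at (of_real v))"
  shows "((\<lambda>v. Re (F (of_real v))) has_field_derivative d) (at v)"
proof -
  have "((\<lambda>v. F (of_real v)) has_derivative (\<lambda>h. of_real d * of_real h)) (at v)"
    by (rule has_derivative_compose[where f = of_real and g = F])
      (use assms in \<open>auto simp: has_field_derivative_def intro!: derivative_eq_intros\<close>)
  from has_derivative_Re[OF this] show ?thesis
    by (simp add: has_field_derivative_def)
qed

text \<open>\<open>f\<close> and \<open>g\<close> are the second and third coordinates of the point
  with first coordinate u on the ruling with parameter y. \<open>\<tau>\<close> describes the change
  of parameter, \<open>\<omega>\<close> and \<open>e\<close> the target change after which the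
  second coordinate is the cubic, and the \<open>H0\<close>, \<open>H1\<close>, \<open>H2\<close>
  assemble into the remaining target change of the model. \<open>rel1\<close> and
  \<open>rel2\<close> are n_j' = y b_j', the trace of developability.\<close>

lemma beaks_normal_form:
  fixes A C D E :: "complex \<Rightarrow> complex"
  assumes rh: "real_holo A" "real_holo C" "real_holo D" "real_holo E"
    and v0: "A 0 = 1 / 2" "C 0 = 1 / 3" "D 0 = 1 / 3" "E 0 = 1 / 4"
    and rel1: "\<forall>\<^sub>F z in nhds 0. deriv (\<lambda>z. z^3 * C z) z = z * deriv (\<lambda>z. z^2 * A z) z"
    and rel2: "\<forall>\<^sub>F z in nhds 0. deriv (\<lambda>z. z^4 * E z) z = z * deriv (\<lambda>z. z^3 * D z) z"
  defines "f \<equiv> \<lambda>u y. u * y^2 * Re (A (of_real y)) - y^3 * Re (C (of_real y))"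
    and "g \<equiv> \<lambda>u y. u * y^3 * Re (D (of_real y)) - y^4 * Re (E (of_real y))"
  obtains \<tau> H0 H1 H2 :: "real \<times> real \<Rightarrow> real" and \<omega> e :: "real \<Rightarrow> real" where
    "smooth_at \<tau> (0, 0)" "smooth_at \<omega> 0" "smooth_at e 0" "e 0 = 1"
    "smooth_at H0 (0, 0)" "smooth_at H1 (0, 0)" "smooth_at H2 (0, 0)" "H1 (0, 0) \<noteq> 0"
    "\<forall>\<^sub>F (u, v) in nhds (0, 0). f u (v * (1 + (v - u) * \<tau> (u, v))) + \<omega> u * g u (v * (1 + (v - u) * \<tau> (u, v)))
        = e u * (u * v^2 / 2 - v^3 / 3)"
    "\<forall>\<^sub>F (u, v) in nhds (0, 0).
        g (sqrt (2/3) * u) ((v + sqrt (2/3) * u / 2) *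
            (1 + (v - sqrt (2/3) * u / 2) * \<tau> (sqrt (2/3) * u, v + sqrt (2/3) * u / 2))) =
       H0 (u, u^2 * v - 2 * v^3) + H1 (u, u^2 * v - 2 * v^3) * (3 * v^4 - u^2 * v^2)
       + H2 (u, u^2 * v - 2 * v^3) * (3 * v^4 - u^2 * v^2)^2"
proof -
  define rA rC rD rE where "rA x = Re (A (of_real x))" and "rC x = Re (C (of_real x))"
    and "rD x = Re (D (of_real x))" and "rE x = Re (E (of_real x))" for x
  have sr: "smooth_at rA 0" "smooth_at rC 0" "smooth_at rD 0" "smooth_at rE 0"
    unfolding rA_def rC_def rD_def rE_def by (intro real_holo_smooth_Re rh)+
  have sc: "smooth_at A 0" "smooth_at C 0" "smooth_at D 0" "smooth_at E 0"
    by (intro real_holo_smooth rh)+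
  have r0: "rA 0 = 1 / 2" "rC 0 = 1 / 3" "rD 0 = 1 / 3" "rE 0 = 1 / 4"
    by (simp_all add: rA_def rC_def rD_def rE_def v0)
  have creal: "\<forall>\<^sub>F x in nhds 0. A (of_real x) = of_real (rA x) \<and> C (of_real x) = of_real (rC x) \<and>
      D (of_real x) = of_real (rD x) \<and> E (of_real x) = of_real (rE x)"
    unfolding rA_def rC_def rD_def rE_def by (intro eventually_conj real_holo_of_real rh)
  obtain a b \<omega> where ab: "smooth_at a 0" "smooth_at b 0" "smooth_at \<omega> 0"
    "a 0 = (1 + sqrt 3) / 2" "b 0 = (1 - sqrt 3) / 2"
    and gab: "\<forall>\<^sub>F U in nhds 0. a U^3 * rD (U * a U) - a U^4 * rE (U * a U) = b U^3 * rD (U * b U) - b U^4 * rE (U * b U)"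
    and fa: "\<forall>\<^sub>F U in nhds 0. a U^2 * rA (U * a U) - a U^3 * rC (U * a U) + \<omega> U * U *
        (a U^3 * rD (U * a U) - a U^4 * rE (U * a U))
       = (1^2 * rA (U * 1) - 1^3 * rC (U * 1) + \<omega> U * U * (1^3 * rD (U * 1) - 1^4 * rE (U * 1))) / 2"
    and fb: "\<forall>\<^sub>F U in nhds 0. b U^2 * rA (U * b U) - b U^3 * rC (U * b U) + \<omega> U * U *
        (b U^3 * rD (U * b U) - b U^4 * rE (U * b U))
       = (1^2 * rA (U * 1) - 1^3 * rC (U * 1) + \<omega> U * U * (1^3 * rD (U * 1) - 1^4 * rE (U * 1))) / 2"
    by (rule double_points[OF sr r0])
  \<comment> \<open>Normalises the critical value: at y = u, the combination of \<open>f\<close> and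
    \<open>g\<close> equals e(u) u^3/6.\<close>
  define e where "e u = 6 * (rA u - rC u + \<omega> u * u * (rD u - rE u))" for u
  have se: "smooth_at e 0" unfolding e_def by (intro smooth_intros sr ab)
  have e0: "e 0 = 1" by (simp add: e_def r0)
  have "\<forall>\<^sub>F y in nhds (e 0). y \<in> - {0}"
    using e0 by (intro eventually_nhds_in_open open_Compl closed_singleton) simp
  then have ene: "\<forall>\<^sub>F u in nhds 0. e u \<in> - {0}"
    by (rule eventually_nhds_isCont[OF smooth_at_imp_isCont[OF se]])
  have fg: "f u y = u * y^2 * rA y - y^3 * rC y" "g u y = u * y^3 * rD y - y^4 * rE y" for u y
    by (simp_all add: f_def g_def rA_def rC_def rD_def rE_def)
  define V where "V u z = u * z^2 * A z - z^3 * C z" for u z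
  define Y where "Y u z = u * z^3 * D z - z^4 * E z" for u z
  have fdh: "\<forall>\<^sub>F z in nhds 0. A field_differentiable at z \<and> C field_differentiable at z \<and>
      D field_differentiable at z \<and> E field_differentiable at z"
    using rh unfolding real_holo_def by (intro eventually_conj) blast+
  have cnjh: "\<forall>\<^sub>F z in nhds 0. A (cnj z) = cnj (A z) \<and> C (cnj z) = cnj (C z) \<and>
      D (cnj z) = cnj (D z) \<and> E (cnj z) = cnj (E z)"
    using rh unfolding real_holo_def by (intro eventually_conj) blast+
  \<comment> \<open>n_j' = z b_j' leaves the derivative (u - z) b_j'(z), so both coordinates are
    critical at z = u, and also at z = 0 where b_j' vanishes.\<close>
  have dVY: "\<forall>\<^sub>F z in nhds 0. \<forall>u. (V u has_field_derivative (u - z) * deriv (\<lambda>z. z^2 * A z) z) (at z) \<and>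
      (Y u has_field_derivative (u - z) * deriv (\<lambda>z. z^3 * D z) z) (at z)"
    using fdh rel1 rel2
  proof eventually_elim
    case (elim z)
    have d: "((\<lambda>z. z^n * B z) has_field_derivative deriv (\<lambda>z. z^n * B z) z) (at z)"
      if "B field_differentiable at z" for n and B :: "complex \<Rightarrow> complex"
    proof -
      have "(\<lambda>z. z^n * B z) field_differentiable at z"
        using that by (intro field_differentiable_mult field_differentiable_power field_differentiable_ident)
      then show ?thesis by (simp add: field_differentiable_derivI)
    qed
    show ?case
    proof (intro allI conjI)
      fix u
      have "((\<lambda>z. u * (z^2 * A z) - z^3 * C z) has_field_derivative
          u * deriv (\<lambda>z. z^2 * A z) z - deriv (\<lambda>z. z^3 * C z) z) (at z)"
        by (intro DERIV_diff DERIV_cmult d) (use elim(1) in auto)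
      then show "(V u has_field_derivative (u - z) * deriv (\<lambda>z. z^2 * A z) z) (at z)"
        unfolding V_def[abs_def] elim(2) by (simp add: algebra_simps)
      have "((\<lambda>z. u * (z^3 * D z) - z^4 * E z) has_field_derivative
          u * deriv (\<lambda>z. z^3 * D z) z - deriv (\<lambda>z. z^4 * E z) z) (at z)"
        by (intro DERIV_diff DERIV_cmult d) (use elim(1) in auto)
      then show "(Y u has_field_derivative (u - z) * deriv (\<lambda>z. z^3 * D z) z) (at z)"
        unfolding Y_def[abs_def] elim(3) by (simp add: algebra_simps)
    qed
  qed
  \<comment> \<open>z^2 W is the normalised second coordinate, in the form expected by
    \<open>straighten_cubic\<close>.\<close>
  define W where "W p = inverse (of_real (e (fst p))) * (of_real (fst p) * A (snd p) - snd p * C (snd p)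
      + of_real (\<omega> (fst p)) * (of_real (fst p) * snd p * D (snd p) - (snd p)^2 * E (snd p)))" for p :: "real \<times> complex"
  have VW: "z^2 * W (u, z) = inverse (of_real (e u)) * (V (of_real u) z + of_real (\<omega> u) * Y (of_real u) z)" for u z
    by (simp add: W_def V_def Y_def algebra_simps eval_nat_numeral)
  have snd0: "\<forall>\<^sub>F p::real \<times> complex in nhds (0, 0). P (snd p)" if "\<forall>\<^sub>F z in nhds 0. P z" for P
    by (rule eventually_nhds_isCont[where f = snd]) (use that in simp_all)
  have fst0: "\<forall>\<^sub>F p::real \<times> real in nhds (0, 0). P (fst p)" if "\<forall>\<^sub>F z in nhds 0. P z" for P
    by (rule eventually_nhds_isCont[where f = fst and P = P]) (use that in simp_all)
  have ofr: "\<forall>\<^sub>F u::real in nhds 0. P (complex_of_real u)" if "\<forall>\<^sub>F z in nhds 0. P z" for P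
    by (rule eventually_nhds_isCont[where f = complex_of_real]) (use that in \<open>simp_all add: continuous_of_real\<close>)
  have s2: "smooth_at (\<lambda>p::real \<times> complex. B (snd p)) (0, 0)" if "smooth_at B 0" for B :: "complex \<Rightarrow> complex"
    by (rule smooth_at_compose[where g = B]) (use that in \<open>auto intro!: smooth_intros\<close>)
  have s1: "smooth_at (\<lambda>p::real \<times> complex. B (fst p)) (0, 0)" if "smooth_at B 0" for B :: "real \<Rightarrow> real"
    by (rule smooth_at_compose[where g = B]) (use that in \<open>auto intro!: smooth_intros\<close>)
  have sW: "smooth_at W (0, 0)"
    unfolding W_def inverse_eq_divide
    by (intro smooth_intros s1 s2 sc ab se) (simp add: e0)
  have fdW: "\<forall>\<^sub>F p in nhds (0, 0). (\<lambda>z. W (fst p, z)) field_differentiable at (snd p)"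
    using snd0[OF fdh]
  proof eventually_elim
    case (elim p)
    show ?case unfolding W_def fst_conv snd_conv
      by (intro field_differentiable_mult field_differentiable_add field_differentiable_diff field_differentiable_power
          field_differentiable_const field_differentiable_ident) (use elim in auto)
  qed
  have cnjW: "\<forall>\<^sub>F p in nhds (0, 0). W (fst p, cnj (snd p)) = cnj (W p)"
    using snd0[OF cnjh] by eventually_elim (simp add: W_def)
  have valW: "\<forall>\<^sub>F u in nhds 0. W (u, of_real u) = of_real u / 6"
    using creal ene
  proof eventually_elim
    case (elim u)
    have "W (u, of_real u) = of_real (inverse (e u) * (u * rA u - u * rC u + \<omega> u * (u * u * rD u - u^2 * rE u)))"
      using elim(1) by (simp add: W_def)
    also have "u * rA u - u * rC u + \<omega> u * (u * u * rD u - u^2 * rE u) = e u * (u / 6)"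
      by (simp add: e_def field_simps power2_eq_square)
    also have "inverse (e u) * (e u * (u / 6)) = u / 6" using elim(2) by simp
    finally show ?case by simp
  qed
  have critW: "\<forall>\<^sub>F u in nhds 0. ((\<lambda>z. z^2 * W (u, z)) has_field_derivative 0) (at (of_real u))"
    using ofr[OF dVY]
  proof eventually_elim
    case (elim u)
    have "((\<lambda>z. inverse (of_real (e u)) * (V (of_real u) z + of_real (\<omega> u) * Y (of_real u) z)) has_field_derivative
        inverse (of_real (e u)) * ((of_real u - of_real u) * deriv (\<lambda>z. z^2 * A z) (of_real u)
          + of_real (\<omega> u) * ((of_real u - of_real u) * deriv (\<lambda>z. z^3 * D z) (of_real u)))) (at (of_real u))"
      by (intro DERIV_cmult DERIV_add elim[THEN spec, THEN conjunct1] elim[THEN spec, THEN conjunct2])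
    then show ?case unfolding VW by simp
  qed
  obtain \<theta> where \<theta>: "smooth_at \<theta> (0, 0)"
    "\<forall>\<^sub>F p in nhds (0, 0). (\<lambda>z. \<theta> (fst p, z)) field_differentiable at (snd p)"
    and id\<theta>: "\<forall>\<^sub>F p in nhds (0, 0). (snd p * (1 + (snd p - of_real (fst p)) * \<theta> p))^2
        * W (fst p, snd p * (1 + (snd p - of_real (fst p)) * \<theta> p))
      = of_real (fst p) * (snd p)^2 / 2 - (snd p)^3 / 3"
    and real\<theta>: "\<forall>\<^sub>F p in nhds (0, 0). cnj (\<theta> (fst p, of_real (snd p))) = \<theta> (fst p, of_real (snd p))"
    by (rule straighten_cubic[OF sW fdW cnjW valW critW])
  define \<tau> where "\<tau> p = Re (\<theta> (fst p, of_real (snd p)))" for p :: "real \<times> real"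
  have s\<tau>: "smooth_at \<tau> (0, 0)"
    unfolding \<tau>_def
    by (rule smooth_at_Re, rule smooth_at_compose[where g = \<theta>]) (auto intro!: smooth_intros \<theta>)
  define X where "X p = snd p * (1 + (snd p - of_real (fst p)) * \<theta> p)" for p :: "real \<times> complex"
  define x where "x u v = v * (1 + (v - u) * \<tau> (u, v))" for u v
  have sX: "smooth_at X (0, 0)" unfolding X_def by (intro smooth_intros \<theta>)
  have X0: "X (0, 0) = 0" by (simp add: X_def)
  have fdX: "\<forall>\<^sub>F p in nhds (0, 0). (\<lambda>z. X (fst p, z)) field_differentiable at (snd p)"
    using \<theta>(2)
  proof eventually_elim
    case (elim p)
    show ?case unfolding X_def fst_conv snd_conv
      by (intro field_differentiable_mult field_differentiable_add field_differentiable_diff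
          field_differentiable_const field_differentiable_ident elim)
  qed
  have evX: "\<forall>\<^sub>F p in nhds (0, 0). P (X p)" if "\<forall>\<^sub>F z in nhds 0. P z" for P
    by (rule eventually_nhds_isCont[OF smooth_at_imp_isCont[OF sX]]) (simp add: X0 that)
  have evr: "\<forall>\<^sub>F p in nhds (0, 0). P (fst p, complex_of_real (snd p))" if "\<forall>\<^sub>F p in nhds (0, 0). P p"
    for P :: "real \<times> complex \<Rightarrow> bool"
    by (rule eventually_nhds_isCont[where f = "\<lambda>p. (fst p, complex_of_real (snd p))" and P = P])
      (use that in \<open>auto intro!: continuous_intros\<close>)
  have cx: "isCont (\<lambda>p. x (fst p) (snd p)) (0, 0)"
    unfolding x_def by (intro continuous_intros) (use smooth_at_imp_isCont[OF s\<tau>] in simp)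
  have evx: "\<forall>\<^sub>F p in nhds (0, 0). P (x (fst p) (snd p))" if "\<forall>\<^sub>F z in nhds 0. P z" for P
    by (rule eventually_nhds_isCont[OF cx]) (simp add: x_def that)
  have Xx: "\<forall>\<^sub>F p in nhds (0, 0). X (fst p, of_real (snd p)) = of_real (x (fst p) (snd p))"
    using real\<theta>
  proof eventually_elim
    case (elim p)
    have "\<theta> (fst p, of_real (snd p)) = of_real (\<tau> p)"
      using elim by (simp add: \<tau>_def complex_eq_iff)
    then show ?case by (simp add: X_def x_def)
  qed
  have P1: "\<forall>\<^sub>F p in nhds (0, 0). f (fst p) (x (fst p) (snd p)) + \<omega> (fst p) * g (fst p) (x (fst p) (snd p))
        = e (fst p) * (fst p * (snd p)^2 / 2 - (snd p)^3 / 3)"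
    using Xx evr[OF id\<theta>] evx[OF creal] fst0[OF ene]
  proof eventually_elim
    case (elim p)
    define u v y where "u = fst p" and "v = snd p" and "y = x u v"
    have "of_real (y^2) * W (u, of_real y) = of_real (u * v^2 / 2 - v^3 / 3)"
      using elim(1,2) by (simp add: X_def u_def v_def y_def)
    moreover have "of_real (y^2) * W (u, of_real y) = of_real (inverse (e u) * (f u y + \<omega> u * g u y))"
      using elim(3) VW[of "of_real y" u] by (simp add: V_def Y_def fg u_def v_def y_def)
    ultimately have "inverse (e u) * (f u y + \<omega> u * g u y) = u * v^2 / 2 - v^3 / 3"
      using of_real_eq_iff by metis
    moreover have "e u \<noteq> 0" using elim(4) by (simp add: u_def)
    ultimately have "f u y + \<omega> u * g u y = e u * (u * v^2 / 2 - v^3 / 3)"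
      by (simp add: field_simps)
    then show ?case by (simp add: u_def v_def y_def)
  qed
  \<comment> \<open>With U = \<beta> u and w = v + U/2, the cubic U w^2/2 - w^3/3 becomes U^3/12 +
    (u^2 v - 2 v^3)/6.\<close>
  define \<beta> where "\<beta> = sqrt (2 / 3)"
  have \<beta>: "\<beta> > 0" "\<beta>^2 = 2 / 3" by (simp_all add: \<beta>_def)
  \<comment> \<open>The third coordinate in straightened and recentred variables, still complex in v
    so that \<open>cubic_division\<close> applies.\<close>
  define h where "h p = (let U = of_real (\<beta> * fst p) in Y U (X (\<beta> * fst p, snd p + U / 2)))" for p :: "real \<times> complex"
  define j where "j p = (\<beta> * fst p, snd p + of_real (\<beta> * fst p) / 2)" for p :: "real \<times> complex"
  have hj: "h p = Y (of_real (fst (j p))) (X (j p))" for p by (simp add: h_def j_def Let_def)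
  have j0: "j (0, 0) = (0, 0)" by (simp add: j_def)
  have sj: "smooth_at j p" for p unfolding j_def by (intro smooth_intros) simp_all
  have evj: "\<forall>\<^sub>F p in nhds (0, 0). P (j p)" if "\<forall>\<^sub>F p in nhds (0, 0). P p" for P
    by (rule eventually_nhds_isCont[OF smooth_at_imp_isCont[OF sj]]) (simp add: j0 that)
  have sXj: "smooth_at (\<lambda>p. X (j p)) (0, 0)"
    by (rule smooth_at_compose[OF sj]) (simp add: j0 sX)
  have sBX: "smooth_at (\<lambda>p. B (X (j p))) (0, 0)" if "smooth_at B 0" for B :: "complex \<Rightarrow> complex"
    by (rule smooth_at_compose[OF sXj]) (simp add: j0 X0 that)
  have sh: "smooth_at h (0, 0)"
    unfolding hj Y_def by (intro smooth_intros sXj sBX sc sj)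
  have dh: "\<forall>\<^sub>F p in nhds (0, 0). \<exists>d. ((\<lambda>z. h (fst p, z)) has_field_derivative
      (of_real (fst (j p)) - X (j p)) * deriv (\<lambda>z. z^3 * D z) (X (j p)) * d) (at (snd p))"
    using evj[OF evX[OF dVY]] evj[OF fdX]
  proof eventually_elim
    case (elim p)
    define U where "U = complex_of_real (\<beta> * fst p)"
    obtain d where d: "((\<lambda>z. X (\<beta> * fst p, z)) has_field_derivative d) (at (snd p + U / 2))"
      using elim(2) unfolding field_differentiable_def by (auto simp: j_def U_def)
    have "((\<lambda>z. z + U / 2) has_field_derivative 1) (at (snd p))"
      by (auto intro!: derivative_eq_intros)
    from DERIV_chain2[OF d this]
    have "((\<lambda>z. X (\<beta> * fst p, z + U / 2)) has_field_derivative d) (at (snd p))" by simp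
    moreover have "(Y U has_field_derivative (U - X (j p)) * deriv (\<lambda>z. z^3 * D z) (X (j p)))
        (at (X (\<beta> * fst p, snd p + U / 2)))"
      using elim(1) by (simp add: j_def U_def)
    ultimately have "((\<lambda>z. Y U (X (\<beta> * fst p, z + U / 2))) has_field_derivative
       (U - X (j p)) * deriv (\<lambda>z. z^3 * D z) (X (j p)) * d) (at (snd p))"
      by (rule DERIV_chain2[rotated])
    then show ?case by (auto simp: h_def Let_def U_def j_def)
  qed
  have fdh': "\<forall>\<^sub>F p in nhds (0, 0). (\<lambda>z. h (fst p, z)) field_differentiable at (snd p)"
    using dh by eventually_elim (auto simp: field_differentiable_def)
  obtain p0 p1 p2 where p: "smooth_at p0 (0, 0)" "smooth_at p1 (0, 0)" "smooth_at p2 (0, 0)"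
    and idp: "\<forall>\<^sub>F (u, v) in nhds (0, 0). Re (h (u, of_real v)) =
       p0 (u, u^2 * v - 2 * v^3) + p1 (u, u^2 * v - 2 * v^3) * v + p2 (u, u^2 * v - 2 * v^3) * v^2"
    by (rule cubic_division[OF sh fdh'])
  define hr where "hr p = Re (h (fst p, of_real (snd p)))" for p :: "real \<times> real"
  have idhr: "\<forall>\<^sub>F (u, v) in nhds (0, 0). hr (u, v) =
       p0 (u, u^2 * v - 2 * v^3) + p1 (u, u^2 * v - 2 * v^3) * v + p2 (u, u^2 * v - 2 * v^3) * v^2"
    using idp by (simp add: hr_def)
  define jr where "jr p = (\<beta> * fst p, snd p + \<beta> * fst p / 2)" for p :: "real \<times> real"
  have evjr: "\<forall>\<^sub>F p in nhds (0, 0). P (jr p)" if "\<forall>\<^sub>F p in nhds (0, 0). P p" for P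
    by (rule eventually_nhds_isCont[where f = jr]) (simp_all add: jr_def that, simp_all add: jr_def[abs_def])
  have jjr: "j (fst p, of_real (snd p)) = (fst (jr p), of_real (snd (jr p)))" for p
    by (simp add: j_def jr_def)
  have hrg: "\<forall>\<^sub>F p in nhds (0, 0). hr p = g (fst (jr p)) (x (fst (jr p)) (snd (jr p)))"
    using evjr[OF Xx] evjr[OF evx[OF creal]]
  proof eventually_elim
    case (elim p)
    then show ?case by (simp add: hr_def hj jjr Y_def fg)
  qed
  have der0: "deriv (\<lambda>z. z^3 * D z) 0 = 0"
  proof -
    obtain d where "(D has_field_derivative d) (at 0)"
      using eventually_nhds_x_imp_x[OF fdh] field_differentiable_def by blast
    then have "((\<lambda>z. z^3 * D z) has_field_derivative 0) (at 0)"
      by (auto intro!: derivative_eq_intros)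
    then show ?thesis by (rule DERIV_imp_deriv)
  qed
  \<comment> \<open>After recentring, v = u/sqrt 6 corresponds to U and v = - u/sqrt 6 to 0, two
    points fixed by the straightening \<open>X\<close>. The derivative of h carries the factor U -
    X, which vanishes at the first, and the factor b_3'(X), which vanishes at the second.\<close>
  have crit: "\<forall>\<^sub>F u in nhds 0. ((\<lambda>v. hr (u, v)) has_field_derivative 0) (at (s * u / sqrt 6))" if s: "s \<in> {1, -1}" for s
  proof -
    have "\<forall>\<^sub>F u in nhds 0. \<exists>d. ((\<lambda>z. h (fst (u, complex_of_real (s * u / sqrt 6)), z)) has_field_derivative
      (of_real (fst (j (u, of_real (s * u / sqrt 6)))) - X (j (u, of_real (s * u / sqrt 6))))
        * deriv (\<lambda>z. z^3 * D z) (X (j (u, of_real (s * u / sqrt 6)))) * d) (at (snd (u, complex_of_real (s * u / sqrt 6))))"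
      by (rule eventually_slice[where k = "\<lambda>u. complex_of_real (s * u / sqrt 6)"])
        (use dh in \<open>auto intro!: continuous_intros\<close>)
    then show ?thesis
    proof eventually_elim
      case (elim u)
      define U where "U = \<beta> * u"
      have \<beta>6: "\<beta> / 2 = 1 / sqrt 6"
      proof -
        have "\<beta> * sqrt 6 = sqrt (2 / 3 * 6)" unfolding \<beta>_def by (rule real_sqrt_mult[symmetric])
        then have "\<beta> * sqrt 6 = 2" by simp
        then show ?thesis by (simp add: field_simps)
      qed
      have jv: "j (u, of_real (s * u / sqrt 6)) = (U, of_real (U / 2 + s * (U / 2)))"
      proof -
        have "s * u / sqrt 6 = s * (\<beta> / 2 * u)" unfolding \<beta>6 by simp
        also have "\<dots> = s * (U / 2)" by (simp add: U_def)
        finally have "s * u / sqrt 6 = s * (U / 2)" .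
        then show ?thesis unfolding j_def fst_conv snd_conv by
            (simp only: U_def of_real_add of_real_divide of_real_numeral) (simp add: add.commute)
      qed
      have "(of_real U - X (U, of_real (U / 2 + s * (U / 2)))) * deriv (\<lambda>z. z^3 * D z)
          (X (U, of_real (U / 2 + s * (U / 2)))) = 0"
      proof (cases "s = 1")
        case True
        then have "U / 2 + s * (U / 2) = U" by simp
        then show ?thesis by (simp add: X_def)
      next
        case False
        then have "U / 2 + s * (U / 2) = 0" using s by auto
        then show ?thesis using der0 by (simp add: X_def)
      qed
      then have "((\<lambda>z. h (u, z)) has_field_derivative of_real 0) (at (of_real (s * u / sqrt 6)))"
        using elim unfolding jv fst_conv snd_conv by (metis mult_zero_left of_real_0)
      from has_field_derivative_Re_of_real[OF this] show ?case by (simp add: hr_def)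
    qed
  qed
  have match: "\<forall>\<^sub>F u in nhds 0. x u (u * r) = u * y u"
    if y: "smooth_at y 0" "y 0 = r" and r: "r^2 = r + 1 / 2"
      and fy: "\<forall>\<^sub>F U in nhds 0. y U^2 * rA (U * y U) - y U^3 * rC (U * y U) + \<omega> U * U *
          (y U^3 * rD (U * y U) - y U^4 * rE (U * y U))
       = (1^2 * rA (U * 1) - 1^3 * rC (U * 1) + \<omega> U * U * (1^3 * rD (U * 1) - 1^4 * rE (U * 1))) / 2" for y r
  proof -
    define F where "F p = inverse (e (fst p)) * (f (fst p) (snd p) + \<omega> (fst p) * g (fst p) (snd p))" for p
    have "\<forall>\<^sub>F (u, v) in nhds (0, 0). F (u, v * (1 + (v - u) * \<tau> (u, v))) = u * v^2 / 2 - v^3 / 3"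
      using P1 fst0[OF ene]
    proof eventually_elim
      case (elim p)
      then show ?case unfolding F_def x_def by (auto simp: split_beta)
    qed
    moreover have "\<forall>\<^sub>F u in nhds 0. F (u, u * y u) = u^3 / 12"
      using fy ene
    proof eventually_elim
      case (elim U)
      have "f U (U * y U) + \<omega> U * g U (U * y U) = U^3 * (y U^2 * rA (U * y U) - y U^3 * rC (U * y U)
          + \<omega> U * U * (y U^3 * rD (U * y U) - y U^4 * rE (U * y U)))"
        by (simp add: fg algebra_simps eval_nat_numeral)
      also have "\<dots> = U^3 * (e U / 12)"
        unfolding elim(1) by (simp add: e_def)
      finally have "f U (U * y U) + \<omega> U * g U (U * y U) = U^3 * (e U / 12)" .
      then show ?case using elim(2) unfolding F_def fst_conv snd_conv by (simp only:) simp
    qed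
    ultimately show ?thesis
      using match_root[OF s\<tau> y r, of F] unfolding x_def by simp
  qed
  \<comment> \<open>Since u/sqrt 2 = U sqrt 3/2, recentring sends v = u/sqrt 2 and v = - u/sqrt 2 to
    U a(0) and U b(0). By \<open>match\<close> these parametrise the double points, where
    \<open>gab\<close> equates the third coordinates.\<close>
  have double: "\<forall>\<^sub>F u in nhds 0. hr (u, u / sqrt 2) = hr (u, - u / sqrt 2)"
  proof -
    have scale: "\<forall>\<^sub>F u in nhds 0. P (\<beta> * u)" if "\<forall>\<^sub>F u in nhds 0. P u" for P :: "real \<Rightarrow> bool"
      by (rule eventually_nhds_isCont[where f = "\<lambda>u. \<beta> * u"]) (use that in \<open>auto intro!: continuous_intros\<close>)
    have q: "(a 0)^2 = a 0 + 1 / 2" "(b 0)^2 = b 0 + 1 / 2"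
      by (simp_all add: ab power2_eq_square field_simps)
    have "\<forall>\<^sub>F u in nhds 0. hr (u, u / sqrt 2) = g (fst (jr (u, u / sqrt 2)))
        (x (fst (jr (u, u / sqrt 2))) (snd (jr (u, u / sqrt 2))))"
      by (rule eventually_slice[where k = "\<lambda>u. u / sqrt 2"]) (use hrg in \<open>auto intro!: continuous_intros\<close>)
    moreover have "\<forall>\<^sub>F u in nhds 0. hr (u, - u / sqrt 2)
        = g (fst (jr (u, - u / sqrt 2))) (x (fst (jr (u, - u / sqrt 2))) (snd (jr (u, - u / sqrt 2))))"
      by (rule eventually_slice[where k = "\<lambda>u. - u / sqrt 2"]) (use hrg in \<open>auto intro!: continuous_intros\<close>)
    ultimately show ?thesis
      using scale[OF match[OF ab(1) refl q(1) fa]] scale[OF match[OF ab(2) refl q(2) fb]] scale[OF gab]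
    proof eventually_elim
      case (elim u)
      define U where "U = \<beta> * u"
      have "\<beta> * sqrt 3 = sqrt (2 / 3 * 3)" unfolding \<beta>_def by (rule real_sqrt_mult[symmetric])
      then have \<beta>3: "\<beta> * sqrt 3 = sqrt 2" by simp
      have "u / sqrt 2 = u * (sqrt 2 / 2)" by (simp add: field_simps)
      also have "\<dots> = U * sqrt 3 / 2" unfolding U_def \<beta>3[symmetric] by simp
      finally have u2: "u / sqrt 2 = U * sqrt 3 / 2" .
      have ja: "jr (u, u / sqrt 2) = (U, U * a 0)" and jb: "jr (u, - u / sqrt 2) = (U, U * b 0)"
        using u2 by (simp_all add: jr_def ab U_def field_simps)
      have xa: "x U (U * a 0) = U * a U" and xb: "x U (U * b 0) = U * b U"
        using elim(3,4) by (simp_all add: U_def)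
      have gU: "g U (U * y) = U^4 * (y^3 * rD (U * y) - y^4 * rE (U * y))" for y
        by (simp add: fg algebra_simps eval_nat_numeral)
      show ?case
        unfolding elim(1,2) ja jb fst_conv snd_conv xa xb gU using elim(5) by (simp add: U_def)
    qed
  qed
  obtain H0 H1 H2 where H: "smooth_at H0 (0, 0)" "smooth_at H1 (0, 0)" "smooth_at H2 (0, 0)"
    and idH: "\<forall>\<^sub>F (u, v) in nhds (0, 0). hr (u, v) =
       H0 (u, u^2 * v - 2 * v^3) + H1 (u, u^2 * v - 2 * v^3) * (3 * v^4 - u^2 * v^2)
       + H2 (u, u^2 * v - 2 * v^3) * (3 * v^4 - u^2 * v^2)^2"
    by (rule beaks_division[OF p idhr crit double])
  have idH': "\<forall>\<^sub>F p in nhds (0, 0). (case p of (u, v) \<Rightarrow>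
       g (\<beta> * u) (x (\<beta> * u) (v + \<beta> * u / 2)) =
       H0 (u, u^2 * v - 2 * v^3) + H1 (u, u^2 * v - 2 * v^3) * (3 * v^4 - u^2 * v^2)
       + H2 (u, u^2 * v - 2 * v^3) * (3 * v^4 - u^2 * v^2)^2)"
    using idH hrg by eventually_elim (auto simp: jr_def)
  \<comment> \<open>For u = 0 the third coordinate is - x^4 E(x) with x = v (1 + v \<tau>), of order
    exactly 4 because E(0) = 1/4.\<close>
  have H1ne: "H1 (0, 0) \<noteq> 0"
  proof (rule quartic_coefficient_nonzero[where ?H0.0 = "\<lambda>c. H0 (0, c)" and ?H1.0 = "\<lambda>c. H1 (0, c)"
        and ?H2.0 = "\<lambda>c. H2 (0, c)" and G = "\<lambda>v. - ((1 + v * \<tau> (0, v))^4 * rE (x 0 v))"])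
    let ?G = "\<lambda>v. - ((1 + v * \<tau> (0, v))^4 * rE (x 0 v))"
    show "smooth_at (\<lambda>c. H0 (0, c)) 0" "smooth_at (\<lambda>c. H1 (0, c)) 0" "smooth_at (\<lambda>c. H2 (0, c)) 0"
      by ((rule smooth_at_compose[where g = H0] smooth_at_compose[where g = H1] smooth_at_compose[where g = H2]);
          simp add: H smooth_at_Pair smooth_at_const smooth_at_ident)+
    have st: "smooth_at (\<lambda>v. \<tau> (0, v)) 0"
      by (rule smooth_at_compose[where g = \<tau>]) (simp_all add: s\<tau> smooth_at_Pair smooth_at_const smooth_at_ident)
    have sx: "smooth_at (\<lambda>v. x 0 v) 0" unfolding x_def by (intro smooth_intros st)
    have "smooth_at (\<lambda>v. rE (x 0 v)) 0"
      by (rule smooth_at_compose[OF sx]) (simp add: x_def sr)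
    then show "smooth_at ?G 0" by (intro smooth_intros st)
    have "isCont (\<lambda>v::real. (0::real, v)) 0" by (intro continuous_intros)
    then have "\<forall>\<^sub>F v in nhds 0. (case (0::real, v) of (u, v) \<Rightarrow>
       g (\<beta> * u) (x (\<beta> * u) (v + \<beta> * u / 2)) =
       H0 (u, u^2 * v - 2 * v^3) + H1 (u, u^2 * v - 2 * v^3) * (3 * v^4 - u^2 * v^2)
       + H2 (u, u^2 * v - 2 * v^3) * (3 * v^4 - u^2 * v^2)^2)"
      by (rule eventually_nhds_isCont) (rule idH')
    then show "\<forall>\<^sub>F v in nhds 0. v^4 * ?G v = H0 (0, - 2 * v^3) + H1 (0, - 2 * v^3) * (3 * v^4) + H2 (0, - 2 * v^3)
        * (3 * v^4)^2"
    proof eventually_elim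
      case (elim v)
      have "g 0 (x 0 v) = v^4 * ?G v" by (simp add: fg x_def power_mult_distrib)
      then show ?case using elim by simp
    qed
    show "?G 0 \<noteq> 0" by (simp add: x_def r0)
  qed
  have "\<forall>\<^sub>F (u, v) in nhds (0, 0). f u (v * (1 + (v - u) * \<tau> (u, v))) + \<omega> u * g u (v * (1 + (v - u) * \<tau> (u, v)))
        = e u * (u * v^2 / 2 - v^3 / 3)"
    using P1 by eventually_elim (simp add: x_def split_beta)
  moreover have "\<forall>\<^sub>F (u, v) in nhds (0, 0).
        g (sqrt (2/3) * u) ((v + sqrt (2/3) * u / 2) *
            (1 + (v - sqrt (2/3) * u / 2) * \<tau> (sqrt (2/3) * u, v + sqrt (2/3) * u / 2))) =
       H0 (u, u^2 * v - 2 * v^3) + H1 (u, u^2 * v - 2 * v^3) * (3 * v^4 - u^2 * v^2)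
       + H2 (u, u^2 * v - 2 * v^3) * (3 * v^4 - u^2 * v^2)^2"
  proof -
    have "x (\<beta> * u) (v + \<beta> * u / 2) = (v + \<beta> * u / 2) * (1 + (v - \<beta> * u / 2) * \<tau> (\<beta> * u, v + \<beta> * u / 2))" for u v
      by (simp add: x_def)
    then show ?thesis using idH' unfolding \<beta>_def by simp
  qed
  ultimately show thesis by (rule that[OF s\<tau> ab(3) se e0 H H1ne])
qed

section \<open>Closure properties of holomorphic germs with real coefficients\<close>

lemma real_holo_isCont: "real_holo A \<Longrightarrow> isCont A 0"
  by (intro smooth_at_imp_isCont real_holo_smooth)

lemma real_holo_const: "real_holo (\<lambda>z. of_real c)"
  by (simp add: real_holo_def)

lemma real_holo_ident: "real_holo (\<lambda>z. z)"
  by (simp add: real_holo_def)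

lemma real_holo_add:
  assumes "real_holo A" "real_holo B"
  shows "real_holo (\<lambda>z. A z + B z)"
proof -
  have "\<forall>\<^sub>F z in nhds 0. (A field_differentiable at z \<and> B field_differentiable at z) \<and> A (cnj z) = cnj (A z)
      \<and> B (cnj z) = cnj (B z)"
    using assms unfolding real_holo_def by (intro eventually_conj) auto
  then show ?thesis
    unfolding real_holo_def by (auto elim!: eventually_mono intro: field_differentiable_add)
qed

lemma real_holo_mult:
  assumes "real_holo A" "real_holo B"
  shows "real_holo (\<lambda>z. A z * B z)"
proof -
  have "\<forall>\<^sub>F z in nhds 0. (A field_differentiable at z \<and> B field_differentiable at z) \<and> A (cnj z) = cnj (A z)
      \<and> B (cnj z) = cnj (B z)"
    using assms unfolding real_holo_def by (intro eventually_conj) auto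
  then show ?thesis
    unfolding real_holo_def by (auto elim!: eventually_mono intro: field_differentiable_mult)
qed

lemma real_holo_compose:
  assumes "real_holo B" "real_holo A" "A 0 = 0"
  shows "real_holo (\<lambda>z. B (A z))"
proof -
  have "\<forall>\<^sub>F z in nhds 0. B field_differentiable at (A z) \<and> B (cnj (A z)) = cnj (B (A z))"
    using assms(1,3) unfolding real_holo_def
    by (intro eventually_nhds_isCont[OF real_holo_isCont[OF assms(2)],
      where P = "\<lambda>z. B field_differentiable at z \<and> B (cnj z) = cnj (B z)"] eventually_conj) auto
  moreover have "\<forall>\<^sub>F z in nhds 0. A field_differentiable at z \<and> A (cnj z) = cnj (A z)"
    using assms(2) unfolding real_holo_def by (intro eventually_conj) auto
  ultimately have "\<forall>\<^sub>F z in nhds 0. (\<lambda>z. B (A z)) field_differentiable at z \<and> B (A (cnj z)) = cnj (B (A z))"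
  proof eventually_elim
    case (elim z)
    then have "(B \<circ> A) field_differentiable at z" by (intro field_differentiable_compose) auto
    then show ?case using elim by (simp add: o_def)
  qed
  then show ?thesis unfolding real_holo_def by (auto elim: eventually_mono)
qed

text \<open>Composition with a function holomorphic near A 0, wherever that is; used for
  \<open>inverse\<close> and \<open>csqrt\<close>, holomorphic off a closed set that avoids the base
  value.\<close>

lemma real_holo_local:
  assumes "open S" "A 0 \<in> S" "B holomorphic_on S" "\<And>z. z \<in> S \<Longrightarrow> B (cnj z) = cnj (B z)" "real_holo A"
  shows "real_holo (\<lambda>z. B (A z))"
proof -
  have "\<forall>\<^sub>F z in nhds 0. A z \<in> S"
    by (rule eventually_nhds_isCont[OF real_holo_isCont[OF assms(5)]])
      (rule eventually_nhds_in_open[OF assms(1,2)])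
  moreover have "\<forall>\<^sub>F z in nhds 0. A field_differentiable at z \<and> A (cnj z) = cnj (A z)"
    using assms(5) unfolding real_holo_def by (intro eventually_conj) auto
  ultimately have "\<forall>\<^sub>F z in nhds 0. (\<lambda>z. B (A z)) field_differentiable at z \<and> B (A (cnj z)) = cnj (B (A z))"
  proof eventually_elim
    case (elim z)
    have "B field_differentiable at (A z)"
      using holomorphic_on_imp_differentiable_at[OF assms(3,1)] elim by blast
    then have "(B \<circ> A) field_differentiable at z" using elim by (intro field_differentiable_compose) auto
    then show ?case using elim assms(4) by (simp add: o_def)
  qed
  then show ?thesis unfolding real_holo_def by (auto elim: eventually_mono)
qed

lemma real_holo_factor:
  assumes A: "real_holo A" and 0: "A 0 = 0"
  obtains B where "real_holo B" "\<forall>\<^sub>F z in nhds 0. A z = z * B z"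
proof -
  obtain S where S: "open S" "0 \<in> S" "\<forall>z\<in>S. A field_differentiable at z"
    using A unfolding real_holo_def eventually_nhds by blast
  define B where "B = (\<lambda>z. if z = 0 then deriv A 0 else (A z - A 0) / (z - 0))"
  have "A holomorphic_on S" unfolding holomorphic_on_def using S(3) by (meson field_differentiable_at_within)
  then have hB: "B holomorphic_on S" unfolding B_def by (rule pole_lemma_open[OF _ S(1)])
  have AB: "A z = z * B z" for z using 0 by (simp add: B_def)
  have "\<forall>\<^sub>F z in nhds 0. B field_differentiable at z"
    unfolding eventually_nhds using S holomorphic_on_imp_differentiable_at[OF hB S(1)] by blast
  moreover have "\<forall>\<^sub>F z in nhds 0. B (cnj z) - cnj (B z) = 0"
  proof -
    have c: "isCont B 0"
      using holomorphic_on_imp_differentiable_at[OF hB S(1,2)] field_differentiable_imp_continuous_at by blast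
    have ev: "\<forall>\<^sub>F z in nhds 0. z \<noteq> 0 \<longrightarrow> B (cnj z) - cnj (B z) = 0"
      using conjunct2[OF A[unfolded real_holo_def]] by eventually_elim (simp add: B_def 0)
    then have "\<forall>\<^sub>F z in at 0. B (cnj z) - cnj (B z) = 0"
      by (simp add: eventually_at_filter)
    then have "((\<lambda>z. B (cnj z) - cnj (B z)) \<longlongrightarrow> 0) (at 0)" by (rule tendsto_eventually)
    moreover have "isCont (\<lambda>z. B (cnj z) - cnj (B z)) 0"
      by (intro continuous_intros isCont_o2[of _ cnj B] c) (use c in simp)
    then have "((\<lambda>z. B (cnj z) - cnj (B z)) \<longlongrightarrow> B (cnj 0) - cnj (B 0)) (at 0)"
      by (simp add: isCont_def)
    ultimately have "B (cnj 0) - cnj (B 0) = 0" using tendsto_unique trivial_limit_at by blast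
    with ev show ?thesis by (auto elim!: eventually_mono)
  qed
  ultimately have "real_holo B" unfolding real_holo_def by (auto elim: eventually_mono)
  then show thesis using that AB by (auto intro: always_eventually)
qed

text \<open>The inverse exists as a smooth map of the real plane. Its derivative is inverse to
  multiplication by a complex number, hence itself such a multiplication, so the inverse is
  holomorphic; it commutes with conjugation because \<open>A\<close> does and inverse images are
  locally unique.\<close>

lemma real_holo_inverse_function:
  assumes A: "real_holo A" and 0: "A 0 = 0" and d: "(A has_field_derivative d) (at 0)" "d \<noteq> 0"
  obtains B where "real_holo B" "B 0 = 0" "\<forall>\<^sub>F z in nhds 0. A (B z) = z" "\<forall>\<^sub>F z in nhds 0. B (A z) = z"
proof -
  have "inj ((*) d)" using d(2) by (simp add: inj_def)
  then have "local_diffeo A 0"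
    using real_holo_smooth[OF A] d(1) unfolding local_diffeo_def has_field_derivative_def by blast
  then obtain B where B: "local_diffeo B (A 0)" "B (A 0) = 0" "\<forall>\<^sub>F y in nhds (A 0). A (B y) = y"
    "\<forall>\<^sub>F z in nhds 0. B (A z) = z"
    by (rule local_diffeo_inverse)
  have B': "smooth_at B 0" "B 0 = 0" "\<forall>\<^sub>F y in nhds 0. A (B y) = y"
    using B 0 by (simp_all add: local_diffeo_def)
  have cB: "isCont B 0" using B'(1) smooth_at_imp_isCont by blast
  have fd: "\<forall>\<^sub>F z in nhds 0. A field_differentiable at z" and cn: "\<forall>\<^sub>F z in nhds 0. A (cnj z) = cnj (A z)"
    using A real_holo_def by auto
  have evB: "\<forall>\<^sub>F y in nhds 0. P (B y)" if "\<forall>\<^sub>F z in nhds 0. P z" for P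
    by (rule eventually_nhds_isCont[OF cB]) (simp add: B' that)
  have "\<forall>\<^sub>F y in nhds 0. \<forall>\<^sub>F w in nhds y. A (B w) = w" using B'(3) by (simp add: eventually_eventually)
  then have "\<forall>\<^sub>F y in nhds 0. B field_differentiable at y"
    using evB[OF fd] eventually_smooth_at[OF B'(1)]
  proof eventually_elim
    case (elim y)
    obtain c where c: "(A has_field_derivative c) (at (B y))" using elim(2) field_differentiable_def by blast
    let ?E = "frechet_derivative B (at y)"
    have "((\<lambda>w. A (B w)) has_derivative (\<lambda>h. c * ?E h)) (at y)"
      by (rule has_derivative_compose[OF smooth_at_imp_has_derivative[OF elim(3)]])
        (use c in \<open>simp add: has_field_derivative_def\<close>)
    moreover obtain S where "open S" "y \<in> S" "\<And>w. w \<in> S \<Longrightarrow> A (B w) = w"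
      using elim(1) unfolding eventually_nhds by blast
    ultimately have "((\<lambda>w. w) has_derivative (\<lambda>h. c * ?E h)) (at y)"
      by (rule has_derivative_transform_within_open)
    then have "(\<lambda>h. c * ?E h) = (\<lambda>h. h)" using has_derivative_unique has_derivative_ident by blast
    then have ce: "c * ?E h = h" for h by meson
    then have "c \<noteq> 0" by (metis mult_zero_left zero_neq_one)
    have "?E h = inverse c * h" for h
    proof -
      have "inverse c * h = inverse c * (c * ?E h)" by (simp only: ce)
      also have "\<dots> = ?E h" using \<open>c \<noteq> 0\<close> by (simp only: mult.assoc[symmetric] left_inverse mult_1_left simp_thms)
      finally show ?thesis ..
    qed
    then have "?E = (*) (inverse c)" by (rule ext)
    then have "(B has_field_derivative inverse c) (at y)"
      using smooth_at_imp_has_derivative[OF elim(3)] by (simp add: has_field_derivative_def)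
    then show ?case using field_differentiable_def by blast
  qed
  moreover have "\<forall>\<^sub>F y in nhds 0. B (cnj y) = cnj (B y)"
  proof -
    have "isCont (\<lambda>y. cnj (B y)) 0" by (intro continuous_intros cB)
    then have "\<forall>\<^sub>F y in nhds 0. B (A (cnj (B y))) = cnj (B y)"
      using eventually_nhds_isCont[of 0 "\<lambda>y. cnj (B y)" "\<lambda>z. B (A z) = z"] B(4) B'(2) by simp
    then show ?thesis using evB[OF cn] B'(3) by eventually_elim simp
  qed
  ultimately show thesis using that[of B] B' B(4) real_holo_def by blast
qed

text \<open>Identity theorem: the points of the positive real axis accumulate at 0.\<close>

lemma real_holo_eqI:
  assumes "real_holo A" "real_holo B" "\<forall>\<^sub>F x::real in nhds 0. A (of_real x) = B (of_real x)"
  shows "\<forall>\<^sub>F z in nhds 0. A z = B z"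
proof -
  have "\<forall>\<^sub>F z in nhds 0. A field_differentiable at z \<and> B field_differentiable at z"
    using assms(1,2) unfolding real_holo_def by (intro eventually_conj) auto
  then obtain e1 where e1: "e1 > 0" "\<And>z. dist z 0 < e1 \<Longrightarrow> A field_differentiable at z \<and> B field_differentiable at z"
    unfolding eventually_nhds_metric by blast
  obtain e2 where e2: "e2 > 0" "\<And>x::real. dist x 0 < e2 \<Longrightarrow> A (of_real x) = B (of_real x)"
    using assms(3) unfolding eventually_nhds_metric by blast
  define e where "e = min e1 e2"
  have e: "e > 0" using e1 e2 by (simp add: e_def)
  have fd: "(\<lambda>z. A z - B z) field_differentiable at z" if "z \<in> ball 0 e" for z
    using e1(2)[of z] that by (auto simp: e_def intro!: field_differentiable_diff)
  have hol: "(\<lambda>z. A z - B z) holomorphic_on ball 0 e"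
    unfolding holomorphic_on_def using fd by (meson field_differentiable_at_within)
  have "A w - B w = 0" if "w \<in> ball 0 e" for w
  proof (rule analytic_continuation[OF hol, where U = "complex_of_real ` {0<..<e}" and \<xi> = 0])
    show "complex_of_real ` {0<..<e} \<subseteq> ball 0 e" by auto
    show "0 islimpt complex_of_real ` {0<..<e}"
    proof (rule islimptI)
      fix T assume T: "(0::complex) \<in> T" "open T"
      then obtain r where r: "r > 0" "ball 0 r \<subseteq> T" using open_contains_ball by blast
      have "complex_of_real (min r e / 2) \<in> T" using r e by (intro subsetD[OF r(2)]) auto
      moreover have "complex_of_real (min r e / 2) \<in> complex_of_real ` {0<..<e}" using r e by (intro imageI) auto
      ultimately show "\<exists>y\<in>complex_of_real ` {0<..<e}. y \<in> T \<and> y \<noteq> 0" using r e by fastforce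
    qed
    show "A z - B z = 0" if "z \<in> complex_of_real ` {0<..<e}" for z
      using that e2(2) by (auto simp: e_def)
  qed (use e that in auto)
  then show ?thesis unfolding eventually_nhds_metric using e by (intro exI[of _ e]) auto
qed

section \<open>Germs of real analytic functions\<close>

text \<open>Analyticity at 0 is encoded by a holomorphic extension, so that quotients, square roots,
  inverse functions and the Cauchy integral all come from complex analysis.\<close>

definition real_ana :: "(real \<Rightarrow> real) \<Rightarrow> bool" where
  "real_ana f \<longleftrightarrow> (\<exists>G. real_holo G \<and> (\<forall>\<^sub>F x in nhds 0. G (of_real x) = of_real (f x)))"

lemma real_anaE:
  assumes "real_ana f"
  obtains G where "real_holo G" "\<forall>\<^sub>F x in nhds 0. G (of_real x) = of_real (f x)" "G 0 = of_real (f 0)"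
proof -
  obtain G where G: "real_holo G" "\<forall>\<^sub>F x in nhds 0. G (of_real x) = of_real (f x)"
    using assms real_ana_def by blast
  show thesis using that[OF G] eventually_nhds_x_imp_x[OF G(2)] by simp
qed

lemma real_ana_smooth:
  assumes "real_ana f"
  shows "smooth_at f 0"
proof -
  obtain G where G: "real_holo G" "\<forall>\<^sub>F x in nhds 0. G (of_real x) = of_real (f x)"
    using assms real_ana_def by blast
  have "\<forall>\<^sub>F x in nhds 0. Re (G (of_real x)) = f x" using G(2) by eventually_elim simp
  then show ?thesis using real_holo_smooth_Re[OF G(1)] by (rule smooth_at_cong)
qed

lemma real_ana_const: "real_ana (\<lambda>x. c)"
  unfolding real_ana_def using real_holo_const[of c] by (intro exI[of _ "\<lambda>z. of_real c"]) auto

lemma real_ana_ident: "real_ana (\<lambda>x. x)"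
  unfolding real_ana_def using real_holo_ident by (intro exI[of _ "\<lambda>z. z"]) auto

lemma real_ana_add:
  assumes "real_ana f" "real_ana g"
  shows "real_ana (\<lambda>x. f x + g x)"
proof -
  obtain F G where "real_holo F" "\<forall>\<^sub>F x in nhds 0. F (of_real x) = of_real (f x)"
    and "real_holo G" "\<forall>\<^sub>F x in nhds 0. G (of_real x) = of_real (g x)"
    using assms real_ana_def by blast
  then have "real_holo (\<lambda>z. F z + G z) \<and> (\<forall>\<^sub>F x in nhds 0. F (of_real x) + G (of_real x) = of_real (f x + g x))"
    by (auto intro: real_holo_add elim: eventually_elim2)
  then show ?thesis unfolding real_ana_def by (intro exI[of _ "\<lambda>z. F z + G z"]) auto
qed

lemma real_ana_mult:
  assumes "real_ana f" "real_ana g"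
  shows "real_ana (\<lambda>x. f x * g x)"
proof -
  obtain F G where "real_holo F" "\<forall>\<^sub>F x in nhds 0. F (of_real x) = of_real (f x)"
    and "real_holo G" "\<forall>\<^sub>F x in nhds 0. G (of_real x) = of_real (g x)"
    using assms real_ana_def by blast
  then have "real_holo (\<lambda>z. F z * G z) \<and> (\<forall>\<^sub>F x in nhds 0. F (of_real x) * G (of_real x) = of_real (f x * g x))"
    by (auto intro: real_holo_mult elim: eventually_elim2)
  then show ?thesis unfolding real_ana_def by (intro exI[of _ "\<lambda>z. F z * G z"]) auto
qed

lemma real_ana_minus: "real_ana f \<Longrightarrow> real_ana (\<lambda>x. - f x)"
  using real_ana_mult[OF real_ana_const[of "-1"]] by simp

lemma real_ana_diff: "real_ana f \<Longrightarrow> real_ana g \<Longrightarrow> real_ana (\<lambda>x. f x - g x)"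
  using real_ana_add[OF _ real_ana_minus] by simp

lemma real_ana_power: "real_ana f \<Longrightarrow> real_ana (\<lambda>x. f x ^ n)"
  by (induction n) (auto intro: real_ana_const real_ana_mult)

lemma real_ana_sum: "(\<And>i. i \<in> I \<Longrightarrow> real_ana (f i)) \<Longrightarrow> real_ana (\<lambda>x. \<Sum>i\<in>I. f i x)"
  by (induction I rule: infinite_finite_induct) (auto intro: real_ana_const real_ana_add)

lemma real_ana_divide:
  assumes "real_ana f" "real_ana g" "g 0 \<noteq> 0"
  shows "real_ana (\<lambda>x. f x / g x)"
proof -
  obtain G where G: "real_holo G" "\<forall>\<^sub>F x in nhds 0. G (of_real x) = of_real (g x)" "G 0 = of_real (g 0)"
    using real_anaE[OF assms(2)] by blast
  have "real_holo (\<lambda>z. inverse (G z))"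
    by (rule real_holo_local[where S = "- {0}"])
      (use G assms(3) in \<open>auto intro!: holomorphic_intros\<close>)
  moreover have "\<forall>\<^sub>F x in nhds 0. inverse (G (of_real x)) = of_real (inverse (g x))"
    using G(2) by eventually_elim simp
  ultimately have "real_ana (\<lambda>x. inverse (g x))"
    unfolding real_ana_def by (intro exI[of _ "\<lambda>z. inverse (G z)"]) auto
  from real_ana_mult[OF assms(1) this] show ?thesis by (simp add: divide_inverse)
qed

lemma real_ana_sqrt:
  assumes "real_ana f" "f 0 > 0"
  shows "real_ana (\<lambda>x. sqrt (f x))"
proof -
  obtain G where G: "real_holo G" "\<forall>\<^sub>F x in nhds 0. G (of_real x) = of_real (f x)" "G 0 = of_real (f 0)"
    using real_anaE[OF assms(1)] by blast
  have "real_holo (\<lambda>z. csqrt (G z))"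
  proof (rule real_holo_local[where S = "- \<real>\<^sub>\<le>\<^sub>0" and A = G and B = csqrt])
    show "csqrt holomorphic_on - \<real>\<^sub>\<le>\<^sub>0"
      unfolding holomorphic_on_def by (auto intro: field_differentiable_within_csqrt)
    show "G 0 \<in> - \<real>\<^sub>\<le>\<^sub>0" using G(3) assms(2) by (simp add: nonpos_Reals_of_real_iff)
    show "csqrt (cnj z) = cnj (csqrt z)" if "z \<in> - \<real>\<^sub>\<le>\<^sub>0" for z
      using cnj_csqrt[of z] that by simp
  qed (use G in \<open>auto intro: closed_nonpos_Reals_complex\<close>)
  moreover have "\<forall>\<^sub>F x in nhds 0. f x \<in> {0<..}"
    by (rule eventually_nhds_isCont[OF smooth_at_imp_isCont[OF real_ana_smooth[OF assms(1)]]])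
      (use assms(2) eventually_nhds_in_open[of "{0<..}" "f 0"] in auto)
  then have "\<forall>\<^sub>F x in nhds 0. csqrt (G (of_real x)) = of_real (sqrt (f x))"
    using G(2)
  proof eventually_elim
    case (elim x)
    have "0 \<le> f x" using elim(1) by simp
    then show ?case unfolding elim(2) by (rule of_real_sqrt[symmetric])
  qed
  ultimately show ?thesis unfolding real_ana_def by (intro exI[of _ "\<lambda>z. csqrt (G z)"]) auto
qed

lemma real_ana_compose:
  assumes "real_ana g" "real_ana f" "f 0 = 0"
  shows "real_ana (\<lambda>x. g (f x))"
proof -
  obtain F where F: "real_holo F" "\<forall>\<^sub>F x in nhds 0. F (of_real x) = of_real (f x)" "F 0 = of_real (f 0)"
    using real_anaE[OF assms(2)] by blast
  obtain G where G: "real_holo G" "\<forall>\<^sub>F x in nhds 0. G (of_real x) = of_real (g x)"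
    using real_anaE[OF assms(1)] by blast
  have "\<forall>\<^sub>F x in nhds 0. G (of_real (f x)) = of_real (g (f x))"
    using eventually_nhds_isCont[OF smooth_at_imp_isCont[OF real_ana_smooth[OF assms(2)]],
        of "\<lambda>x. G (of_real x) = of_real (g x)"] by (simp add: assms(3) G)
  then have "\<forall>\<^sub>F x in nhds 0. G (F (of_real x)) = of_real (g (f x))"
    using F(2) by eventually_elim simp
  moreover have "real_holo (\<lambda>z. G (F z))"
    by (rule real_holo_compose[OF G(1) F(1)]) (simp add: F assms)
  ultimately show ?thesis unfolding real_ana_def by (intro exI[of _ "\<lambda>z. G (F z)"]) auto
qed

lemma real_ana_factor:
  assumes "real_ana f" "f 0 = 0"
  obtains g where "real_ana g" "\<forall>\<^sub>F x in nhds 0. f x = x * g x"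
proof -
  obtain F where F: "real_holo F" "\<forall>\<^sub>F x in nhds 0. F (of_real x) = of_real (f x)" "F 0 = of_real (f 0)"
    using real_anaE[OF assms(1)] by blast
  obtain G where G: "real_holo G" "\<forall>\<^sub>F z in nhds 0. F z = z * G z"
    using real_holo_factor[OF F(1)] F(3) assms(2) by auto
  define g where "g x = Re (G (of_real x))" for x
  have g: "\<forall>\<^sub>F x in nhds 0. G (of_real x) = of_real (g x)"
    unfolding g_def by (rule real_holo_of_real[OF G(1)])
  have "isCont complex_of_real 0" by (intro continuous_intros)
  then have "\<forall>\<^sub>F x in nhds 0. F (of_real x) = of_real x * G (of_real x)"
    using eventually_nhds_isCont[of 0 complex_of_real "\<lambda>z. F z = z * G z"] G(2) by simp
  then have "\<forall>\<^sub>F x in nhds 0. f x = x * g x"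
    using F(2) g
  proof eventually_elim
    case (elim x)
    then have "complex_of_real (f x) = of_real (x * g x)" by simp
    then show ?case using of_real_eq_iff by blast
  qed
  moreover have "real_ana g" using G g real_ana_def by blast
  ultimately show thesis using that by blast
qed

lemma real_ana_inverse_function:
  assumes "real_ana f" "f 0 = 0" "(f has_field_derivative d) (at 0)" "d \<noteq> 0"
  obtains g where "real_ana g" "g 0 = 0" "\<forall>\<^sub>F x in nhds 0. f (g x) = x" "\<forall>\<^sub>F x in nhds 0. g (f x) = x"
proof -
  obtain F where F: "real_holo F" "\<forall>\<^sub>F x in nhds 0. F (of_real x) = of_real (f x)" "F 0 = of_real (f 0)"
    using real_anaE[OF assms(1)] by blast
  obtain D where D: "(F has_field_derivative D) (at 0)"
    using F(1) eventually_nhds_x_imp_x[of "\<lambda>z. F field_differentiable at z" 0]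
    unfolding real_holo_def field_differentiable_def by blast
  have "((\<lambda>x. F (of_real x)) has_derivative (\<lambda>h. D * of_real h)) (at 0)"
    by (rule has_derivative_compose[where f = of_real and g = F])
      (use D in \<open>auto simp: has_field_derivative_def intro!: derivative_eq_intros\<close>)
  moreover obtain S where "open S" "0 \<in> S" "\<And>x. x \<in> S \<Longrightarrow> F (of_real x) = of_real (f x)"
    using F(2) unfolding eventually_nhds by blast
  ultimately have "((\<lambda>x. complex_of_real (f x)) has_derivative (\<lambda>h. D * of_real h)) (at 0)"
    by (rule has_derivative_transform_within_open)
  moreover have "((\<lambda>x. complex_of_real (f x)) has_derivative (\<lambda>h. of_real (d * h))) (at 0)"
    using assms(3) unfolding has_field_derivative_def by (rule has_derivative_of_real)
  ultimately have "(\<lambda>h::real. D * of_real h) = (\<lambda>h. of_real (d * h))" by (rule has_derivative_unique)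
  then have "D * of_real 1 = of_real (d * 1)" by meson
  then have "D \<noteq> 0" using assms(4) by auto
  then obtain G where G: "real_holo G" "G 0 = 0" "\<forall>\<^sub>F z in nhds 0. F (G z) = z" "\<forall>\<^sub>F z in nhds 0. G (F z) = z"
    using real_holo_inverse_function[OF F(1) _ D] F(3) assms(2) by auto
  define g where "g x = Re (G (of_real x))" for x
  have g: "\<forall>\<^sub>F x in nhds 0. G (of_real x) = of_real (g x)"
    unfolding g_def by (rule real_holo_of_real[OF G(1)])
  have ag: "real_ana g" using G g real_ana_def by blast
  have g0: "g 0 = 0" by (simp add: g_def G)
  have ofr: "\<forall>\<^sub>F x in nhds 0. P (complex_of_real x)" if "\<forall>\<^sub>F z in nhds 0. P z" for P
    by (rule eventually_nhds_isCont[where f = complex_of_real]) (use that in \<open>simp_all add: continuous_of_real\<close>)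
  have evg: "\<forall>\<^sub>F x in nhds 0. F (of_real (g x)) = of_real (f (g x))"
    by (rule eventually_nhds_isCont[OF smooth_at_imp_isCont[OF real_ana_smooth[OF ag]],
        where P = "\<lambda>x. F (of_real x) = of_real (f x)"]) (simp add: g0 F)
  have evf: "\<forall>\<^sub>F x in nhds 0. G (of_real (f x)) = of_real (g (f x))"
    by (rule eventually_nhds_isCont[OF smooth_at_imp_isCont[OF real_ana_smooth[OF assms(1)]],
        where P = "\<lambda>x. G (of_real x) = of_real (g x)"]) (simp add: assms(2) g)
  have "\<forall>\<^sub>F x in nhds 0. f (g x) = x"
    using evg ofr[OF G(3)] g
  proof eventually_elim
    case (elim x)
    then have "complex_of_real (f (g x)) = of_real x" by simp
    then show ?case using of_real_eq_iff by blast
  qed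
  moreover have "\<forall>\<^sub>F x in nhds 0. g (f x) = x"
    using evf ofr[OF G(4)] F(2)
  proof eventually_elim
    case (elim x)
    then have "complex_of_real (g (f x)) = of_real x" by simp
    then show ?case using of_real_eq_iff by blast
  qed
  ultimately show thesis using that ag g0 by blast
qed

lemma real_ana_power_series:
  fixes c :: "nat \<Rightarrow> real"
  assumes "r > 0" "\<And>x. \<bar>x\<bar> < r \<Longrightarrow> (\<lambda>n. x ^ n * c n) sums f x"
  shows "real_ana f"
proof -
  define G where "G z = (\<Sum>n. of_real (c n) * z ^ n)" for z :: complex
  have G: "(\<lambda>n. of_real (c n) * z ^ n) sums G z" if "norm z < r" for z :: complex
  proof -
    \<comment> \<open>A real point of convergence beyond |z|; convergence there forces convergence
      of the complexified series at z.\<close>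
    define x where "x = (norm z + r) / 2"
    have x: "norm z < x" "x < r" "0 < x" using that by (auto simp: x_def add_pos_nonneg)
        (use norm_ge_zero[of z] in linarith)
    have "summable (\<lambda>n. x ^ n * c n)" using assms(2)[of x] x sums_summable by force
    then have "summable (\<lambda>n. complex_of_real (x ^ n * c n))" by (rule summable_of_real)
    then have "summable (\<lambda>n. complex_of_real (c n) * of_real x ^ n)" by (simp add: mult.commute)
    then have "summable (\<lambda>n. complex_of_real (c n) * z ^ n)"
      by (rule powser_inside) (use x in simp)
    then show ?thesis unfolding G_def by (rule summable_sums)
  qed
  have hol: "G holomorphic_on ball 0 r"
    by (rule power_series_holomorphic[where a = "\<lambda>n. of_real (c n)"]) (use G in simp)
  have "\<forall>\<^sub>F z in nhds 0. z \<in> ball (0::complex) r"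
    using assms(1) by (intro eventually_nhds_in_open) auto
  then have "\<forall>\<^sub>F z in nhds 0. G field_differentiable at z \<and> G (cnj z) = cnj (G z)"
  proof eventually_elim
    case (elim z)
    have "(\<lambda>n. cnj (of_real (c n) * z ^ n)) sums cnj (G z)"
      using G[of z] elim by (simp only: sums_cnj) simp
    moreover have "(\<lambda>n. cnj (of_real (c n) * z ^ n)) sums G (cnj z)"
      using G[of "cnj z"] elim by simp
    ultimately have "G (cnj z) = cnj (G z)" using sums_unique2 by blast
    then show ?case using holomorphic_on_imp_differentiable_at[OF hol _ elim] by simp
  qed
  then have "real_holo G" unfolding real_holo_def by (auto elim: eventually_mono)
  moreover have "\<forall>\<^sub>F x in nhds 0. x \<in> ball (0::real) r"
    using assms(1) by (intro eventually_nhds_in_open) auto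
  then have "\<forall>\<^sub>F x in nhds 0. G (of_real x) = of_real (f x)"
  proof eventually_elim
    case (elim x)
    have "(\<lambda>n. complex_of_real (x ^ n * c n)) sums of_real (f x)"
      using assms(2)[of x] elim by (intro sums_of_real) auto
    moreover have "(\<lambda>n. complex_of_real (x ^ n * c n)) sums G (of_real x)"
      using G[of "of_real x"] elim by (simp add: mult.commute)
    ultimately show ?case using sums_unique2 by blast
  qed
  ultimately show ?thesis unfolding real_ana_def by blast
qed

text \<open>Bridge to scalar germs at 0: the functional \<open>l\<close> selects a coordinate and
  the shift moves the base point.\<close>

lemma real_analytic_on_imp_real_ana:
  assumes "real_analytic_on f I" "a \<in> I" "bounded_linear l"
  shows "real_ana (\<lambda>x. l (f (a + x)))"
proof -
  obtain r c where r: "r > 0" and c: "\<And>x. \<bar>x - a\<bar> < r \<Longrightarrow> (\<lambda>n. (x - a) ^ n *\<^sub>R c n) sums f x"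
    using assms(1,2) unfolding real_analytic_on_def by blast
  show ?thesis
  proof (rule real_ana_power_series[OF r])
    fix x :: real assume "\<bar>x\<bar> < r"
    then have "(\<lambda>n. x ^ n *\<^sub>R c n) sums f (a + x)" using c[of "a + x"] by simp
    from bounded_linear.sums[OF assms(3) this]
    show "(\<lambda>n. x ^ n * l (c n)) sums l (f (a + x))"
      using bounded_linear.linear[OF assms(3)] by (simp add: linear_cmul)
  qed
qed

lemma real_ana_imp_smooth_at:
  assumes "real_ana (\<lambda>x. f (a + x))"
  shows "smooth_at f a"
proof -
  have "smooth_at (\<lambda>x. f (a + x)) 0" by (rule real_ana_smooth[OF assms])
  then have "smooth_at (\<lambda>y. f (a + (y - a))) a"
    by (intro smooth_at_compose[where f = "\<lambda>y. y - a" and g = "\<lambda>x. f (a + x)"]) (auto intro!: smooth_intros)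
  then show ?thesis by simp
qed

lemma real_analytic_on_imp_smooth_at:
  fixes f :: "real \<Rightarrow> 'b::euclidean_space"
  assumes "real_analytic_on f I" "a \<in> I"
  shows "smooth_at f a"
proof -
  have "smooth_at (\<lambda>x. f x \<bullet> b) a" for b
    by (rule real_ana_imp_smooth_at[OF real_analytic_on_imp_real_ana[OF assms bounded_linear_inner_left]])
  then have "smooth_at (\<lambda>x. \<Sum>b\<in>Basis. (f x \<bullet> b) *\<^sub>R b) a"
    by (intro smooth_at_sum smooth_at_scaleR smooth_at_const)
  then show ?thesis by (simp add: euclidean_representation)
qed

text \<open>A factor x is split off repeatedly. If f = x^j g then j g + x g' = x^(n + 1 - j) h, so
  for j at most n the value g(0) is 0 and another factor splits off; at j = n + 1 the equation
  yields g(0). In this way continuity of \<open>h\<close> at 0 is enough to find the leading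
  coefficient.\<close>

lemma real_ana_derivative_order:
  assumes f: "real_ana f" "f 0 = 0" and der: "\<forall>\<^sub>F x in nhds 0. (f has_field_derivative x ^ n * h x) (at x)"
    and h: "isCont h 0"
  obtains g where "real_ana g" "\<forall>\<^sub>F x in nhds 0. f x = x ^ Suc n * g x" "g 0 = h 0 / (real n + 1)"
proof -
  have dg: "\<forall>\<^sub>F x in nhds 0. x \<noteq> 0 \<longrightarrow> real j * g x + x * deriv g x = x ^ (Suc n - j) * h x"
    if g: "real_ana g" "\<forall>\<^sub>F x in nhds 0. f x = x ^ j * g x" and j: "1 \<le> j" "j \<le> Suc n" for j g
  proof -
    have "\<forall>\<^sub>F x in nhds 0. \<forall>\<^sub>F y in nhds x. f y = y ^ j * g y"
      using g(2) by (simp add: eventually_eventually)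
    then show ?thesis
      using der eventually_smooth_at[OF real_ana_smooth[OF g(1)]]
    proof eventually_elim
      case (elim x)
      show ?case
      proof
        assume x: "x \<noteq> 0"
        obtain S where S: "open S" "x \<in> S" "\<And>y. y \<in> S \<Longrightarrow> f y = y ^ j * g y"
          using elim(1) unfolding eventually_nhds by blast
        have "g differentiable (at x)" using elim(3) smooth_at_imp_differentiable by blast
        then have "(g has_field_derivative deriv g x) (at x)"
          using real_differentiable_def DERIV_imp_deriv by blast
        then have "((\<lambda>y. y ^ j * g y) has_field_derivative (real j * x ^ (j - 1) * g x + deriv g x * x ^ j)) (at x)"
          by (auto intro!: derivative_eq_intros)
        moreover have "((\<lambda>y. y ^ j * g y) has_field_derivative x ^ n * h x) (at x)"
          by (rule has_field_derivative_transform_within_open[OF elim(2) S])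
        ultimately have eq: "real j * x ^ (j - 1) * g x + deriv g x * x ^ j = x ^ n * h x"
          by (rule DERIV_unique)
        obtain i where i: "j = Suc i" using j(1) by (cases j) auto
        have "n = i + (Suc n - j)" using j i by simp
        then have "x ^ n = x ^ i * x ^ (Suc n - j)" by (metis power_add)
        then have "x ^ i * (real j * g x + x * deriv g x) = x ^ i * (x ^ (Suc n - j) * h x)"
          using eq by (simp add: i algebra_simps)
        then show "real j * g x + x * deriv g x = x ^ (Suc n - j) * h x" using x by simp
      qed
    qed
  qed
  \<comment> \<open>The power of 0 is 0 for j at most n, and 1 for j = \<open>Suc n\<close>.\<close>
  have val: "real j * g 0 = 0 ^ (Suc n - j) * h 0"
    if g: "real_ana g" "\<forall>\<^sub>F x in nhds 0. f x = x ^ j * g x" and j: "1 \<le> j" "j \<le> Suc n" for j g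
  proof -
    have sg: "smooth_at g 0" by (rule real_ana_smooth[OF g(1)])
    define g' where "g' x = frechet_derivative g (at x) 1" for x
    have sg': "smooth_at g' 0" unfolding g'_def by (rule smooth_at_frechet_derivative[OF sg])
    have d: "\<forall>\<^sub>F x in nhds 0. deriv g x = g' x"
      using eventually_smooth_at[OF sg]
    proof eventually_elim
      case (elim x)
      have D: "(g has_derivative frechet_derivative g (at x)) (at x)" by (rule smooth_at_imp_has_derivative[OF elim])
      have "frechet_derivative g (at x) h = g' x * h" for h
        using linear_cmul[OF has_derivative_linear[OF D], of h 1] by (simp add: g'_def mult.commute)
      then have "frechet_derivative g (at x) = (*) (g' x)" by (rule ext)
      then have "(g has_field_derivative g' x) (at x)" using D by (simp add: has_field_derivative_def)
      then show ?case by (rule DERIV_imp_deriv)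
    qed
    have "\<forall>\<^sub>F x in nhds 0. real j * g x + x * g' x - x ^ (Suc n - j) * h x = 0"
    proof (rule eq_0_limit_real)
      show "isCont (\<lambda>x. real j * g x + x * g' x - x ^ (Suc n - j) * h x) 0"
        by (intro continuous_intros h smooth_at_imp_isCont sg sg')
      show "\<forall>\<^sub>F x in nhds 0. x \<noteq> 0 \<longrightarrow> real j * g x + x * g' x - x ^ (Suc n - j) * h x = 0"
        using dg[OF g j] d by eventually_elim simp
    qed
    from eventually_nhds_x_imp_x[OF this] show ?thesis by simp
  qed
  have "\<exists>g. real_ana g \<and> (\<forall>\<^sub>F x in nhds 0. f x = x ^ Suc j * g x)" if "j \<le> n" for j
    using that
  proof (induction j)
    case 0
    obtain g where "real_ana g" "\<forall>\<^sub>F x in nhds 0. f x = x * g x" by (rule real_ana_factor[OF f])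
    then show ?case by auto
  next
    case (Suc j)
    then obtain g where g: "real_ana g" "\<forall>\<^sub>F x in nhds 0. f x = x ^ Suc j * g x" by auto
    have "real (Suc j) * g 0 = 0" using val[OF g] Suc.prems by (simp add: power_0_left)
    then have "g 0 = 0" by simp
    then obtain g1 where g1: "real_ana g1" "\<forall>\<^sub>F x in nhds 0. g x = x * g1 x" using real_ana_factor[OF g(1)] by blast
    have "\<forall>\<^sub>F x in nhds 0. f x = x ^ Suc (Suc j) * g1 x"
      using g(2) g1(2) by eventually_elim (simp add: algebra_simps)
    then show ?case using g1 by blast
  qed
  then obtain g where g: "real_ana g" "\<forall>\<^sub>F x in nhds 0. f x = x ^ Suc n * g x" by blast
  have "g 0 = h 0 / (real n + 1)" using val[OF g] by (simp add: field_simps)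
  then show thesis using that g by blast
qed

lemma vector_3_eq: "(vector [a, b, c] :: real^3) = a *\<^sub>R axis 1 1 + b *\<^sub>R axis 2 1 + c *\<^sub>R axis 3 1"
  by (simp add: vec_eq_iff forall_3 axis_def)

lemma smooth_at_vector_3:
  assumes "smooth_at f x" "smooth_at g x" "smooth_at h x"
  shows "smooth_at (\<lambda>x. vector [f x, g x, h x] :: real^3) x"
  unfolding vector_3_eq by (intro smooth_intros assms)

lemma has_derivative_vector_3:
  assumes "(f has_derivative f') F" "(g has_derivative g') F" "(h has_derivative h') F"
  shows "((\<lambda>x. vector [f x, g x, h x] :: real^3) has_derivative (\<lambda>k. vector [f' k, g' k, h' k])) F"
  unfolding vector_3_eq by (intro derivative_intros assms)

lemma real_holo_deriv:
  assumes "real_holo A"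
  shows "real_holo (\<lambda>z. deriv A z)"
proof -
  have "\<forall>\<^sub>F z in nhds 0. A field_differentiable at z" "\<forall>\<^sub>F z in nhds 0. A (cnj z) = cnj (A z)"
    using assms real_holo_def by auto
  then obtain S where S: "open S" "0 \<in> S" "\<And>z. z \<in> S \<Longrightarrow> A field_differentiable at z"
    unfolding eventually_nhds by blast
  have hol: "deriv A holomorphic_on S"
    using S by (intro holomorphic_deriv) (auto simp: holomorphic_on_def intro: field_differentiable_at_within)
  have "\<forall>\<^sub>F z in nhds 0. deriv A field_differentiable at z"
    unfolding eventually_nhds using S holomorphic_on_imp_differentiable_at[OF hol S(1)] by blast
  moreover have "\<forall>\<^sub>F z in nhds 0. deriv A (cnj z) = cnj (deriv A z)"
  proof -
    have "\<forall>\<^sub>F z in nhds 0. \<forall>\<^sub>F w in nhds z. A (cnj w) = cnj (A w)"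
      using assms by (simp add: real_holo_def eventually_eventually)
    moreover have "isCont cnj 0" by (intro continuous_intros)
    then have "\<forall>\<^sub>F z in nhds 0. A field_differentiable at (cnj z)"
      using eventually_nhds_isCont[of 0 cnj "\<lambda>z. A field_differentiable at z"] assms by (simp add: real_holo_def)
    ultimately show ?thesis
    proof eventually_elim
      case (elim z)
      have "(A has_field_derivative deriv A (cnj z)) (at (cnj z))"
        using elim(2) by (simp add: field_differentiable_derivI)
      then have "((cnj \<circ> A \<circ> cnj) has_field_derivative cnj (deriv A (cnj z))) (at z)"
        using has_field_derivative_cnj_cnj[where f = A and z = z] by simp
      moreover obtain T where T: "open T" "z \<in> T" "\<And>w. w \<in> T \<Longrightarrow> A (cnj w) = cnj (A w)"
        using elim(1) unfolding eventually_nhds by blast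
      ultimately have "(A has_field_derivative cnj (deriv A (cnj z))) (at z)"
        using has_field_derivative_transform_within_open[of "cnj \<circ> A \<circ> cnj" _ z T A] by simp
      then have "deriv A z = cnj (deriv A (cnj z))" by (rule DERIV_imp_deriv)
      then show ?case by simp
    qed
  qed
  ultimately show ?thesis unfolding real_holo_def by blast
qed

lemma real_holo_deriv_of_real:
  assumes "real_holo G" "\<forall>\<^sub>F x in nhds 0. G (of_real x) = of_real (f x)"
    "\<forall>\<^sub>F x in nhds 0. (f has_field_derivative f' x) (at x)"
  shows "\<forall>\<^sub>F x in nhds 0. deriv G (of_real x) = of_real (f' x)"
proof -
  have "isCont complex_of_real 0" by (intro continuous_intros)
  then have "\<forall>\<^sub>F x in nhds 0. G field_differentiable at (of_real x)"
    using eventually_nhds_isCont[of 0 complex_of_real "\<lambda>z. G field_differentiable at z"] assms(1)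
    by (simp add: real_holo_def)
  moreover have "\<forall>\<^sub>F x in nhds 0. \<forall>\<^sub>F y in nhds x. G (of_real y) = of_real (f y)"
    using assms(2) by (simp add: eventually_eventually)
  ultimately show ?thesis
    using assms(3)
  proof eventually_elim
    case (elim x)
    have "((\<lambda>x. G (of_real x)) has_derivative (\<lambda>h. deriv G (of_real x) * of_real h)) (at x)"
      by (rule has_derivative_compose[where f = of_real and g = G])
        (use elim(1) in \<open>auto simp: has_field_derivative_def[symmetric] field_differentiable_derivI intro!:
            derivative_eq_intros\<close>)
    moreover obtain S where "open S" "x \<in> S" "\<And>x. x \<in> S \<Longrightarrow> G (of_real x) = of_real (f x)"
      using elim(2) unfolding eventually_nhds by blast
    ultimately have "((\<lambda>x. complex_of_real (f x)) has_derivative (\<lambda>h. deriv G (of_real x) * of_real h)) (at x)"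
      by (rule has_derivative_transform_within_open)
    moreover have "((\<lambda>x. complex_of_real (f x)) has_derivative (\<lambda>h. of_real (f' x * h))) (at x)"
      using elim(3) unfolding has_field_derivative_def by (rule has_derivative_of_real)
    ultimately have "(\<lambda>h::real. deriv G (of_real x) * of_real h) = (\<lambda>h. of_real (f' x * h))"
      by (rule has_derivative_unique)
    then have "deriv G (of_real x) * of_real 1 = of_real (f' x * 1)" by meson
    then show ?case by simp
  qed
qed

lemma real_holo_power: "real_holo A \<Longrightarrow> real_holo (\<lambda>z. A z ^ n)"
  using real_holo_const[of 1] by (induction n) (auto intro: real_holo_mult)

text \<open>Both sides are holomorphic germs which on the real axis are the derivatives prescribed
  by \<open>p\<close> and \<open>q\<close>, so the identity theorem applies. This carries n_j' = y
  b_j' over to the complexifications.\<close>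

lemma deriv_relation:
  fixes p q h :: "real \<Rightarrow> real"
  assumes P: "real_holo P" "\<forall>\<^sub>F x in nhds 0. P (of_real x) = of_real (p x)"
    and Q: "real_holo Q" "\<forall>\<^sub>F x in nhds 0. Q (of_real x) = of_real (q x)"
    and p: "\<forall>\<^sub>F x in nhds 0. ((\<lambda>x. x ^ i * p x) has_field_derivative d x) (at x)"
    and q: "\<forall>\<^sub>F x in nhds 0. ((\<lambda>x. x ^ j * q x) has_field_derivative x * d x) (at x)"
  shows "\<forall>\<^sub>F z in nhds 0. deriv (\<lambda>z. z ^ j * Q z) z = z * deriv (\<lambda>z. z ^ i * P z) z"
proof (rule real_holo_eqI)
  have rP: "real_holo (\<lambda>z. z ^ i * P z)" and rQ: "real_holo (\<lambda>z. z ^ j * Q z)"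
    by (intro real_holo_mult real_holo_power real_holo_ident P Q)+
  show "real_holo (\<lambda>z. deriv (\<lambda>z. z ^ j * Q z) z)" by (rule real_holo_deriv[OF rQ])
  show "real_holo (\<lambda>z. z * deriv (\<lambda>z. z ^ i * P z) z)"
    by (intro real_holo_mult real_holo_ident real_holo_deriv rP)
  have "\<forall>\<^sub>F x in nhds 0. of_real x ^ i * P (of_real x) = of_real (x ^ i * p x)"
    using P(2) by eventually_elim simp
  note 1 = real_holo_deriv_of_real[OF rP this p]
  have "\<forall>\<^sub>F x in nhds 0. of_real x ^ j * Q (of_real x) = of_real (x ^ j * q x)"
    using Q(2) by eventually_elim simp
  note 2 = real_holo_deriv_of_real[OF rQ this q]
  show "\<forall>\<^sub>F x in nhds 0. deriv (\<lambda>z. z ^ j * Q z) (of_real x) = of_real x * deriv (\<lambda>z. z ^ i * P z) (of_real x)"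
    using 1 2 by eventually_elim simp
qed

lemma has_field_derivative_cong_ev:
  assumes "\<forall>\<^sub>F x in nhds 0. (f has_field_derivative d x) (at x)" "\<forall>\<^sub>F x in nhds (0::real). f x = g x"
  shows "\<forall>\<^sub>F x in nhds 0. (g has_field_derivative d x) (at x)"
proof -
  have "\<forall>\<^sub>F x in nhds 0. \<forall>\<^sub>F y in nhds x. f y = g y" using assms(2) by (simp add: eventually_eventually)
  then show ?thesis using assms(1)
  proof eventually_elim
    case (elim x)
    then obtain S where "open S" "x \<in> S" "\<And>y. y \<in> S \<Longrightarrow> f y = g y" unfolding eventually_nhds by blast
    then show ?case using has_field_derivative_transform_within_open[OF elim(2)] by blast
  qed
qed

text \<open>The surface data after an affine change of the target: the first coordinate along the rulings is
  \<open>U\<close> and the point where the ruling touches the edge of regression has first coordinate \<open>y\<close>.\<close>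

lemma ruling_coordinates:
  fixes a t \<xi>1 \<xi>2 \<xi>3 \<zeta>1 \<zeta>2 \<zeta>3 s1 s2 s3 :: "real \<Rightarrow> real"
  assumes ra: "real_ana \<xi>1" "real_ana \<xi>2" "real_ana \<xi>3" "real_ana \<zeta>1" "real_ana \<zeta>2" "real_ana \<zeta>3"
      "real_ana s1" "real_ana s2" "real_ana s3"
    and d\<xi>: "\<forall>\<^sub>F x in nhds 0. (\<xi>1 has_field_derivative x * \<zeta>1 x) (at x)"
      "\<forall>\<^sub>F x in nhds 0. (\<xi>2 has_field_derivative x * \<zeta>2 x) (at x)"
      "\<forall>\<^sub>F x in nhds 0. (\<xi>3 has_field_derivative x * \<zeta>3 x) (at x)"
    and ds: "\<forall>\<^sub>F x in nhds 0. (s1 has_field_derivative a x * \<xi>1 x) (at x)"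
      "\<forall>\<^sub>F x in nhds 0. (s2 has_field_derivative a x * \<xi>2 x) (at x)"
      "\<forall>\<^sub>F x in nhds 0. (s3 has_field_derivative a x * \<xi>3 x) (at x)"
    and a: "isCont a 0" "a 0 \<noteq> 0"
    and \<xi>0: "\<xi>1 0 = 1" "\<xi>2 0 = 0" "\<xi>3 0 = 0" and s0: "s1 0 = 0" "s2 0 = 0" "s3 0 = 0"
    and \<zeta>0: "\<zeta>2 0 = (a 0)^2" "\<zeta>3 0 = 0" and d\<zeta>: "(\<zeta>3 has_field_derivative (a 0)^3) (at 0)"
  obtains A C D E where "real_holo A" "real_holo C" "real_holo D" "real_holo E"
    "A 0 = 1 / 2" "C 0 = 1 / 3" "D 0 = 1 / 3" "E 0 = 1 / 4"
    "\<forall>\<^sub>F z in nhds 0. deriv (\<lambda>z. z^3 * C z) z = z * deriv (\<lambda>z. z^2 * A z) z"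
    "\<forall>\<^sub>F z in nhds 0. deriv (\<lambda>z. z^4 * E z) z = z * deriv (\<lambda>z. z^3 * D z) z"
    "\<forall>\<^sub>F x in nhds 0. \<forall>r. s2 x + r * \<xi>2 x = (s1 x + r * \<xi>1 x) * (s1 x)^2 * Re (A (of_real (s1 x))) - (s1 x)^3 * Re
        (C (of_real (s1 x)))"
    "\<forall>\<^sub>F x in nhds 0. \<forall>r. s3 x + r * \<xi>3 x = (s1 x + r * \<xi>1 x) * (s1 x)^3 * Re (D (of_real (s1 x))) - (s1 x)^4 * Re
        (E (of_real (s1 x)))"
proof -
  have c0: "isCont f 0" if "real_ana f" for f using that real_ana_smooth smooth_at_imp_isCont by blast
  have "\<forall>\<^sub>F y in nhds (\<xi>1 0). y \<in> - {0}"
    using \<xi>0 by (intro eventually_nhds_in_open open_Compl closed_singleton) simp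
  then have ne: "\<forall>\<^sub>F x in nhds 0. \<xi>1 x \<in> - {0}" by (rule eventually_nhds_isCont[OF c0[OF ra(1)]])
  have "(s1 has_field_derivative a 0) (at 0)" using eventually_nhds_x_imp_x[OF ds(1)] \<xi>0 by simp
  \<comment> \<open>The edge of regression moves with speed a(0) in the first coordinate, so that
    coordinate y = s1(x) can replace x as parameter; \<open>X\<close> is the inverse change.\<close>
  then obtain X where X: "real_ana X" "X 0 = 0" "\<forall>\<^sub>F y in nhds 0. s1 (X y) = y" "\<forall>\<^sub>F x in nhds 0. X (s1 x) = x"
    using real_ana_inverse_function[OF ra(7) s0(1) _ a(2)] by blast
  have evX: "\<forall>\<^sub>F y in nhds 0. P (X y)" if "\<forall>\<^sub>F x in nhds 0. P x" for P
    by (rule eventually_nhds_isCont[OF c0[OF X(1)]]) (simp add: X that)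
  have evs: "\<forall>\<^sub>F x in nhds 0. P (s1 x)" if "\<forall>\<^sub>F x in nhds 0. P x" for P
    by (rule eventually_nhds_isCont[OF c0[OF ra(7)]]) (simp add: s0 that)
  define X' where "X' y = 1 / (a (X y) * \<xi>1 (X y))" for y
  have dX: "\<forall>\<^sub>F y in nhds 0. (X has_field_derivative X' y) (at y)"
  proof -
    have "\<forall>\<^sub>F y in nhds 0. \<forall>\<^sub>F w in nhds y. s1 (X w) = w" using X(3) by (simp add: eventually_eventually)
    then show ?thesis using evX[OF ds(1)] eventually_smooth_at[OF real_ana_smooth[OF X(1)]]
    proof eventually_elim
      case (elim y)
      have "X differentiable (at y)" using elim(3) smooth_at_imp_differentiable by blast
      then obtain d where d: "(X has_field_derivative d) (at y)" using real_differentiable_def by blast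
      have 1: "((\<lambda>w. s1 (X w)) has_field_derivative a (X y) * \<xi>1 (X y) * d) (at y)"
        by (rule DERIV_chain2[OF elim(2) d])
      obtain S where S: "open S" "y \<in> S" "\<And>w. w \<in> S \<Longrightarrow> s1 (X w) = w"
        using elim(1) unfolding eventually_nhds by blast
      have "((\<lambda>w. w) has_field_derivative a (X y) * \<xi>1 (X y) * d) (at y)"
        by (rule has_field_derivative_transform_within_open[OF 1 S])
      then have "a (X y) * \<xi>1 (X y) * d = 1" using DERIV_unique DERIV_ident by blast
      then have "d = X' y" unfolding X'_def by (metis mult_eq_0_iff nonzero_mult_div_cancel_left zero_neq_one)
      then show ?case using d by simp
    qed
  qed
  have aX: "isCont (\<lambda>y. a (X y)) 0" by (rule isCont_o2[OF c0[OF X(1)]]) (simp add: X a)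
  have X'0: "X' 0 = 1 / a 0" by (simp add: X'_def X \<xi>0)
  have cX': "isCont X' 0"
    unfolding X'_def
    by (intro continuous_intros aX c0 real_ana_compose[OF ra(1) X(1,2)]) (simp add: X \<xi>0 a)
  obtain \<mu> where \<mu>: "real_ana \<mu>" "\<forall>\<^sub>F y in nhds 0. X y = y * \<mu> y" using real_ana_factor[OF X(1,2)] by blast
  have factor_val: "g 0 = d" if g: "real_ana g" "\<forall>\<^sub>F x in nhds 0. f x
      = x * g x" and d: "(f has_field_derivative d) (at 0)" for f g d
  proof -
    have "g differentiable (at 0)" using g(1) real_ana_smooth smooth_at_imp_differentiable by blast
    then obtain e where e: "(g has_field_derivative e) (at 0)" using real_differentiable_def by blast
    have "((\<lambda>x. x * g x) has_field_derivative g 0) (at 0)" by (auto intro!: derivative_eq_intros e)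
    moreover obtain S where S: "open S" "0 \<in> S" "\<And>x. x \<in> S \<Longrightarrow> f x = x * g x"
      using g(2) unfolding eventually_nhds by blast
    have "((\<lambda>x. x * g x) has_field_derivative d) (at 0)"
      by (rule has_field_derivative_transform_within_open[OF d S])
    ultimately show ?thesis by (rule DERIV_unique)
  qed
  have \<mu>0: "\<mu> 0 = 1 / a 0" using factor_val[OF \<mu> eventually_nhds_x_imp_x[OF dX]] X'0 by simp
  \<comment> \<open>x times these are the derivatives of the slopes \<xi>2/\<xi>1 and \<xi>3/\<xi>1.
    The third vanishes at 0 to one order more, which is why b_3 has order 3 and b_2 order 2.\<close>
  define \<kappa>2 \<kappa>3 where "\<kappa>2 x = (\<zeta>2 x * \<xi>1 x - \<xi>2 x * \<zeta>1 x) / (\<xi>1 x)^2"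
    and "\<kappa>3 x = (\<zeta>3 x * \<xi>1 x - \<xi>3 x * \<zeta>1 x) / (\<xi>1 x)^2" for x
  have r\<kappa>: "real_ana \<kappa>2" "real_ana \<kappa>3"
    unfolding \<kappa>2_def \<kappa>3_def by (intro real_ana_divide real_ana_diff real_ana_mult real_ana_power ra; simp add: \<xi>0)+
  have \<kappa>20: "\<kappa>2 0 = (a 0)^2" and \<kappa>30: "\<kappa>3 0 = 0" by (simp_all add: \<kappa>2_def \<kappa>3_def \<xi>0 \<zeta>0)
  obtain \<kappa> where \<kappa>: "real_ana \<kappa>" "\<forall>\<^sub>F x in nhds 0. \<kappa>3 x = x * \<kappa> x" using real_ana_factor[OF r\<kappa>(2) \<kappa>30] by blast
  have \<kappa>0: "\<kappa> 0 = (a 0)^3"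
  proof (rule factor_val[OF \<kappa>])
    have "\<zeta>1 differentiable (at 0)" using ra(4) real_ana_smooth smooth_at_imp_differentiable by blast
    then obtain e where e: "(\<zeta>1 has_field_derivative e) (at 0)" using real_differentiable_def by blast
    have x1: "(\<xi>1 has_field_derivative 0) (at 0)" and x3: "(\<xi>3 has_field_derivative 0) (at 0)"
      using eventually_nhds_x_imp_x[OF d\<xi>(1)] eventually_nhds_x_imp_x[OF d\<xi>(3)] by simp_all
    show "(\<kappa>3 has_field_derivative (a 0)^3) (at 0)"
      unfolding \<kappa>3_def[abs_def] by (auto intro!: derivative_eq_intros d\<zeta> e x1 x3 simp: \<xi>0 \<zeta>0)
  qed
  \<comment> \<open>In the parameter y the slopes have derivatives y h2 and y^2 h3, by X(y) = y
    \<mu>(y) with \<mu>(0) = 1/a(0). The powers of a(0) assumed of \<zeta>2 and of the derivative of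
    \<zeta>3 make h2 and h3 equal to 1 at 0.\<close>
  define h2 h3 where "h2 y = \<mu> y * \<kappa>2 (X y) * X' y" and "h3 y = (\<mu> y)^2 * \<kappa> (X y) * X' y" for y
  have ch: "isCont h2 0" "isCont h3 0"
    unfolding h2_def h3_def
    by (intro continuous_intros cX' c0 \<mu> real_ana_compose[OF r\<kappa>(1) X(1,2)] real_ana_compose[OF \<kappa>(1) X(1,2)])+
  have h0: "h2 0 = 1" "h3 0 = 1"
    using a(2) by (simp_all add: h2_def h3_def \<mu>0 X \<kappa>20 \<kappa>0 X'0 power2_eq_square power3_eq_cube)
  \<comment> \<open>\<open>B\<close> is the slope of the ruling in the plane of the first and the
    j-th coordinate, and - n its intercept. Since s_j' = B s_1', the term s_1' B cancels in n' and
    n' = s_1 B' remains: the ruling is tangent to the curve s.\<close>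
  define B where "B \<xi> x = \<xi> x / \<xi>1 x" for \<xi> and x :: real
  define n where "n s \<xi> x = - (s x - s1 x * B \<xi> x)" for s \<xi> and x :: real
  have der: "\<forall>\<^sub>F y in nhds 0. ((\<lambda>y. B \<xi> (X y)) has_field_derivative X y *
      ((\<zeta> (X y) * \<xi>1 (X y) - \<xi> (X y) * \<zeta>1 (X y)) / (\<xi>1 (X y))^2) * X' y) (at y) \<and>
      ((\<lambda>y. n s \<xi> (X y)) has_field_derivative y * (X y *
          ((\<zeta> (X y) * \<xi>1 (X y) - \<xi> (X y) * \<zeta>1 (X y)) / (\<xi>1 (X y))^2) * X' y)) (at y)"
    if d1: "\<forall>\<^sub>F x in nhds 0. (\<xi> has_field_derivative x * \<zeta> x) (at x)"
      and d2: "\<forall>\<^sub>F x in nhds 0. (s has_field_derivative a x * \<xi> x) (at x)" for \<xi> \<zeta> s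
    using evX[OF d1] evX[OF d2] evX[OF d\<xi>(1)] evX[OF ds(1)] evX[OF ne] dX X(3)
  proof eventually_elim
    case (elim y)
    define x where "x = X y"
    have ne: "\<xi>1 x \<noteq> 0" using elim(5) by (simp add: x_def)
    define k where "k = (\<zeta> x * \<xi>1 x - \<xi> x * \<zeta>1 x) / (\<xi>1 x)^2"
    have "(B \<xi> has_field_derivative (x * \<zeta> x * \<xi>1 x - \<xi> x * (x * \<zeta>1 x)) / (\<xi>1 x * \<xi>1 x)) (at x)"
      unfolding B_def[abs_def] using ne elim(1,3) by (intro DERIV_divide) (simp_all add: x_def)
    moreover have "(x * \<zeta> x * \<xi>1 x - \<xi> x * (x * \<zeta>1 x)) / (\<xi>1 x * \<xi>1 x) = x * k"
      using ne by (simp add: k_def field_simps power2_eq_square)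
    ultimately have dB: "(B \<xi> has_field_derivative x * k) (at x)" by simp
    have "(n s \<xi> has_field_derivative - (a x * \<xi> x - (a x * \<xi>1 x * B \<xi> x + x * k * s1 x))) (at x)"
      unfolding n_def[abs_def] using elim(2,4)
      by (intro DERIV_minus DERIV_diff DERIV_mult dB) (simp_all add: x_def)
    moreover have "- (a x * \<xi> x - (a x * \<xi>1 x * B \<xi> x + x * k * s1 x)) = y * (x * k)"
      using ne elim(7) by (simp add: B_def x_def)
    ultimately have dn: "(n s \<xi> has_field_derivative y * (x * k)) (at x)" by simp
    show ?case
      using DERIV_chain2[OF dB[unfolded x_def] elim(6)] DERIV_chain2[OF dn[unfolded x_def] elim(6)]
      unfolding x_def k_def by (simp add: mult.assoc)
  qed
  have d2: "\<forall>\<^sub>F y in nhds 0. ((\<lambda>y. B \<xi>2 (X y)) has_field_derivative y ^ 1 * h2 y) (at y)"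
      "\<forall>\<^sub>F y in nhds 0. ((\<lambda>y. n s2 \<xi>2 (X y)) has_field_derivative y ^ 2 * h2 y) (at y)"
  proof -
    have "\<forall>\<^sub>F y in nhds 0. ((\<lambda>y. B \<xi>2 (X y)) has_field_derivative y ^ 1 * h2 y) (at y) \<and>
        ((\<lambda>y. n s2 \<xi>2 (X y)) has_field_derivative y ^ 2 * h2 y) (at y)"
      using der[OF d\<xi>(2) ds(2)] \<mu>(2)
    proof eventually_elim
      case (elim y)
      have "X y * ((\<zeta>2 (X y) * \<xi>1 (X y) - \<xi>2 (X y) * \<zeta>1 (X y)) / (\<xi>1 (X y))^2) * X' y = y ^ 1 * h2 y"
        (is "?l = _")
        unfolding \<kappa>2_def[symmetric] h2_def by (subst (1) elim(2)) simp
      moreover have "y * (y ^ 1 * h2 y) = y ^ 2 * h2 y" by (simp add: power2_eq_square)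
      ultimately have "?l = y ^ 1 * h2 y" "y * ?l = y ^ 2 * h2 y" by metis+
      then show ?case using elim(1) by metis
    qed
    then show "\<forall>\<^sub>F y in nhds 0. ((\<lambda>y. B \<xi>2 (X y)) has_field_derivative y ^ 1 * h2 y) (at y)"
      "\<forall>\<^sub>F y in nhds 0. ((\<lambda>y. n s2 \<xi>2 (X y)) has_field_derivative y ^ 2 * h2 y) (at y)"
      by (auto elim: eventually_mono)
  qed
  have d3: "\<forall>\<^sub>F y in nhds 0. ((\<lambda>y. B \<xi>3 (X y)) has_field_derivative y ^ 2 * h3 y) (at y)"
      "\<forall>\<^sub>F y in nhds 0. ((\<lambda>y. n s3 \<xi>3 (X y)) has_field_derivative y ^ 3 * h3 y) (at y)"
  proof -
    have "\<forall>\<^sub>F y in nhds 0. ((\<lambda>y. B \<xi>3 (X y)) has_field_derivative y ^ 2 * h3 y) (at y) \<and>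
        ((\<lambda>y. n s3 \<xi>3 (X y)) has_field_derivative y ^ 3 * h3 y) (at y)"
      using der[OF d\<xi>(3) ds(3)] \<mu>(2) evX[OF \<kappa>(2)]
    proof eventually_elim
      case (elim y)
      have "X y * ((\<zeta>3 (X y) * \<xi>1 (X y) - \<xi>3 (X y) * \<zeta>1 (X y)) / (\<xi>1 (X y))^2) * X' y = X y * (X y * \<kappa> (X y)) * X' y"
        unfolding \<kappa>3_def[symmetric] elim(3) ..
      also have "\<dots> = (y * \<mu> y) * ((y * \<mu> y) * \<kappa> (X y)) * X' y" using elim(2) by simp
      also have "\<dots> = y ^ 2 * h3 y" unfolding h3_def by (simp add: power2_eq_square)
      finally have "X y * ((\<zeta>3 (X y) * \<xi>1 (X y) - \<xi>3 (X y) * \<zeta>1 (X y)) / (\<xi>1 (X y))^2) * X' y = y ^ 2 * h3 y"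
        (is "?l = _") .
      moreover have "y * (y ^ 2 * h3 y) = y ^ 3 * h3 y" by (simp add: power2_eq_square power3_eq_cube)
      ultimately have "?l = y ^ 2 * h3 y" "y * ?l = y ^ 3 * h3 y" by metis+
      then show ?case using elim(1) by metis
    qed
    then show "\<forall>\<^sub>F y in nhds 0. ((\<lambda>y. B \<xi>3 (X y)) has_field_derivative y ^ 2 * h3 y) (at y)"
      "\<forall>\<^sub>F y in nhds 0. ((\<lambda>y. n s3 \<xi>3 (X y)) has_field_derivative y ^ 3 * h3 y) (at y)"
      by (auto elim: eventually_mono)
  qed
  have rB: "real_ana (\<lambda>y. B \<xi> (X y))" if "real_ana \<xi>" for \<xi>
    unfolding B_def
    by (intro real_ana_divide real_ana_compose[OF that X(1,2)] real_ana_compose[OF ra(1) X(1,2)]) (simp add: X \<xi>0)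
  have rn: "real_ana (\<lambda>y. n s \<xi> (X y))" if "real_ana \<xi>" "real_ana s" for s \<xi>
    unfolding n_def
    by (intro real_ana_minus real_ana_diff real_ana_mult rB that real_ana_compose[OF that(2) X(1,2)]
        real_ana_compose[OF ra(7) X(1,2)])
  have v: "B \<xi>2 (X 0) = 0" "B \<xi>3 (X 0) = 0" "n s2 \<xi>2 (X 0) = 0" "n s3 \<xi>3 (X 0) = 0"
    by (simp_all add: B_def n_def X \<xi>0 s0)
  \<comment> \<open>The leading coefficients 1/2, 1/3, 1/3, 1/4 arise by integrating y, y^2, y^2,
    y^3.\<close>
  obtain \<alpha> where \<alpha>: "real_ana \<alpha>" "\<forall>\<^sub>F y in nhds 0. B \<xi>2 (X y) = y ^ Suc 1 * \<alpha> y" "\<alpha> 0 = h2 0 / (real 1 + 1)"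
    by (rule real_ana_derivative_order[OF rB[OF ra(2)] v(1) d2(1) ch(1)])
  obtain \<gamma> where \<gamma>: "real_ana \<gamma>" "\<forall>\<^sub>F y in nhds 0. n s2 \<xi>2 (X y) = y ^ Suc 2 * \<gamma> y" "\<gamma> 0 = h2 0 / (real 2 + 1)"
    by (rule real_ana_derivative_order[OF rn[OF ra(2,8)] v(3) d2(2) ch(1)])
  obtain \<delta> where \<delta>: "real_ana \<delta>" "\<forall>\<^sub>F y in nhds 0. B \<xi>3 (X y) = y ^ Suc 2 * \<delta> y" "\<delta> 0 = h3 0 / (real 2 + 1)"
    by (rule real_ana_derivative_order[OF rB[OF ra(3)] v(2) d3(1) ch(2)])
  obtain \<epsilon> where \<epsilon>: "real_ana \<epsilon>" "\<forall>\<^sub>F y in nhds 0. n s3 \<xi>3 (X y) = y ^ Suc 3 * \<epsilon> y" "\<epsilon> 0 = h3 0 / (real 3 + 1)"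
    by (rule real_ana_derivative_order[OF rn[OF ra(3,9)] v(4) d3(2) ch(2)])
  obtain A where A: "real_holo A" "\<forall>\<^sub>F x in nhds 0. A (of_real x) = of_real (\<alpha> x)" "A 0
      = of_real (\<alpha> 0)" by (rule real_anaE[OF \<alpha>(1)])
  obtain C where C: "real_holo C" "\<forall>\<^sub>F x in nhds 0. C (of_real x) = of_real (\<gamma> x)" "C 0
      = of_real (\<gamma> 0)" by (rule real_anaE[OF \<gamma>(1)])
  obtain D where D: "real_holo D" "\<forall>\<^sub>F x in nhds 0. D (of_real x) = of_real (\<delta> x)" "D 0
      = of_real (\<delta> 0)" by (rule real_anaE[OF \<delta>(1)])
  obtain E where E: "real_holo E" "\<forall>\<^sub>F x in nhds 0. E (of_real x) = of_real (\<epsilon> x)" "E 0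
      = of_real (\<epsilon> 0)" by (rule real_anaE[OF \<epsilon>(1)])
  have rel1: "\<forall>\<^sub>F z in nhds 0. deriv (\<lambda>z. z ^ Suc 2 * C z) z = z * deriv (\<lambda>z. z ^ Suc 1 * A z) z"
    by (rule deriv_relation[OF A(1,2) C(1,2) has_field_derivative_cong_ev[OF d2(1) \<alpha>(2)]])
      (rule eventually_mono[OF has_field_derivative_cong_ev[OF d2(2) \<gamma>(2)]], simp add: power2_eq_square mult.assoc)
  have rel2: "\<forall>\<^sub>F z in nhds 0. deriv (\<lambda>z. z ^ Suc 3 * E z) z = z * deriv (\<lambda>z. z ^ Suc 2 * D z) z"
    by (rule deriv_relation[OF D(1,2) E(1,2) has_field_derivative_cong_ev[OF d3(1) \<delta>(2)]])
      (rule eventually_mono[OF has_field_derivative_cong_ev[OF d3(2) \<epsilon>(2)]],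
          simp add: power2_eq_square power3_eq_cube mult.assoc)
  have id2: "\<forall>\<^sub>F x in nhds 0. \<forall>r. s2 x + r * \<xi>2 x = (s1 x + r * \<xi>1 x) * (s1 x)^2 * Re (A (of_real (s1 x))) -
      (s1 x)^3 * Re (C (of_real (s1 x)))"
    using X(4) evs[OF \<alpha>(2)] evs[OF \<gamma>(2)] evs[OF A(2)] evs[OF C(2)] ne
  proof eventually_elim
    case (elim x)
    have "B \<xi>2 x = (s1 x)^2 * Re (A (of_real (s1 x)))" "n s2 \<xi>2 x = (s1 x)^3 * Re (C (of_real (s1 x)))"
      using elim(1-5) by (simp_all add: numeral_2_eq_2 numeral_3_eq_3)
    moreover have "s2 x + r * \<xi>2 x = (s1 x + r * \<xi>1 x) * B \<xi>2 x - n s2 \<xi>2 x" for r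
      using elim(6) by (simp add: B_def n_def field_simps)
    ultimately show ?case by (simp add: mult.assoc)
  qed
  have id3: "\<forall>\<^sub>F x in nhds 0. \<forall>r. s3 x + r * \<xi>3 x = (s1 x + r * \<xi>1 x) * (s1 x)^3 * Re (D (of_real (s1 x))) -
      (s1 x)^4 * Re (E (of_real (s1 x)))"
    using X(4) evs[OF \<delta>(2)] evs[OF \<epsilon>(2)] evs[OF D(2)] evs[OF E(2)] ne
  proof eventually_elim
    case (elim x)
    have "B \<xi>3 x = (s1 x)^3 * Re (D (of_real (s1 x)))" "n s3 \<xi>3 x = (s1 x)^4 * Re (E (of_real (s1 x)))"
      using elim(1-5) by (simp_all add: eval_nat_numeral)
    moreover have "s3 x + r * \<xi>3 x = (s1 x + r * \<xi>1 x) * B \<xi>3 x - n s3 \<xi>3 x" for r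
      using elim(6) by (simp add: B_def n_def field_simps)
    ultimately show ?case by (simp add: mult.assoc)
  qed
  show thesis
    by (rule that[OF A(1) C(1) D(1) E(1) _ _ _ _ _ _ id2 id3])
      (use rel1 rel2 A(3) C(3) D(3) E(3) \<alpha>(3) \<gamma>(3) \<delta>(3) \<epsilon>(3) h0 in \<open>simp_all add: numeral_2_eq_2 numeral_3_eq_3
          eval_nat_numeral\<close>)
qed

section \<open>Recognition of the cuspidal beaks\<close>

text \<open>Sufficiency for k = 1 at the origin: \<open>a\<close> stands for p + t', so
  \<open>ds\<close> says that the striction curve moves along the rulings, and \<open>det\<close> is
  the condition \<rho> \<noteq> 0 written with \<zeta>. The proof assembles one source change and
  one target change on either side for \<open>A_equivalent_chain\<close>.\<close>

lemma A_equivalent_beaksI: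
  fixes \<gamma> \<xi> \<zeta> :: "real \<Rightarrow> real^3" and t a :: "real \<Rightarrow> real"
  assumes ana: "\<And>l. bounded_linear l \<Longrightarrow> real_ana (\<lambda>x. l (\<gamma> x))" "\<And>l. bounded_linear l \<Longrightarrow> real_ana (\<lambda>x. l (\<xi> x))"
      "\<And>l. bounded_linear l \<Longrightarrow> real_ana (\<lambda>x. l (\<zeta> x))" "real_ana t"
    and cont: "isCont \<gamma> 0" "isCont \<xi> 0"
    and d\<xi>: "\<forall>\<^sub>F x in nhds 0. (\<xi> has_vector_derivative x *\<^sub>R \<zeta> x) (at x)"
    and ds: "\<forall>\<^sub>F x in nhds 0. ((\<lambda>x. \<gamma> x + t x *\<^sub>R \<xi> x) has_vector_derivative a x *\<^sub>R \<xi> x) (at x)"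
    and a: "isCont a 0" "a 0 \<noteq> 0"
    and d\<zeta>: "(\<zeta> has_vector_derivative \<zeta>') (at 0)"
    and det: "\<xi> 0 \<bullet> cross3 (\<zeta> 0) \<zeta>' \<noteq> 0"
  shows "A_equivalent (ruled_surface \<gamma> \<xi>) (0, t 0) beaks_model (0, 0)"
proof -
  define d where "d = \<xi> 0 \<bullet> cross3 (\<zeta> 0) \<zeta>'"
  have d: "d \<noteq> 0" using det by (simp add: d_def)
  \<comment> \<open>The basis dual to \<xi>(0), \<zeta>(0), \<zeta>', scaled by 1, a(0)^2, a(0)^3 to
    meet the normalisation in \<open>ruling_coordinates\<close>.\<close>
  define l1 l2 l3 where "l1 X = X \<bullet> ((1 / d) *\<^sub>R cross3 (\<zeta> 0) \<zeta>')"
    and "l2 X = X \<bullet> (((a 0)^2 / d) *\<^sub>R cross3 \<zeta>' (\<xi> 0))"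
    and "l3 X = X \<bullet> (((a 0)^3 / d) *\<^sub>R cross3 (\<xi> 0) (\<zeta> 0))" for X :: "real^3"
  have lin: "bounded_linear l1" "bounded_linear l2" "bounded_linear l3"
    unfolding l1_def l2_def l3_def by (intro bounded_linear_inner_left)+
  have linear: "linear l1" "linear l2" "linear l3" using lin bounded_linear.linear by blast+
  have d2: "\<zeta> 0 \<bullet> cross3 \<zeta>' (\<xi> 0) = d" and d3: "\<zeta>' \<bullet> cross3 (\<xi> 0) (\<zeta> 0) = d"
    by (simp_all add: d_def cross3_simps)
  have vals: "l1 (\<xi> 0) = 1" "l2 (\<xi> 0) = 0" "l3 (\<xi> 0) = 0"
     "l1 (\<zeta> 0) = 0" "l2 (\<zeta> 0) = (a 0)^2" "l3 (\<zeta> 0) = 0" "l3 \<zeta>' = (a 0)^3"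
    using d d2 d3 by (simp_all add: l1_def l2_def l3_def dot_cross_self) (simp_all add: d_def)
  \<comment> \<open>Cramer's rule: triple products recover the vector, so the three functionals are
    coordinates.\<close>
  have inj: "X = 0" if "l1 X = 0" "l2 X = 0" "l3 X = 0" for X
  proof -
    have "d *\<^sub>R X = (X \<bullet> cross3 (\<zeta> 0) \<zeta>') *\<^sub>R \<xi> 0 + (X \<bullet> cross3 \<zeta>' (\<xi> 0)) *\<^sub>R \<zeta> 0 + (X \<bullet> cross3 (\<xi> 0) (\<zeta> 0)) *\<^sub>R \<zeta>'"
      unfolding d_def by (simp add: vec_eq_iff forall_3 inner_vec_def sum_3 cross3_def algebra_simps)
    moreover have "X \<bullet> cross3 (\<zeta> 0) \<zeta>' = 0" "X \<bullet> cross3 \<zeta>' (\<xi> 0) = 0" "X \<bullet> cross3 (\<xi> 0) (\<zeta> 0) = 0"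
      using that d a(2) by (simp_all add: l1_def l2_def l3_def)
    ultimately show ?thesis using d by simp
  qed
  define p0 where "p0 = \<gamma> 0 + t 0 *\<^sub>R \<xi> 0"
  define s where "s l x = l (\<gamma> x + t x *\<^sub>R \<xi> x - p0)" for l :: "real^3 \<Rightarrow> real" and x
  have s_eq: "s l x = l (\<gamma> x) + t x * l (\<xi> x) - l p0" if "bounded_linear l" for l x
    using bounded_linear.linear[OF that] by (simp add: s_def linear_add linear_diff linear_cmul)
  have rs: "real_ana (s l)" if "bounded_linear l" for l
    unfolding s_eq[OF that, abs_def] by (intro real_ana_diff real_ana_add real_ana_mult real_ana_const ana that)
  have dl: "\<forall>\<^sub>F x in nhds 0. ((\<lambda>x. l (\<xi> x)) has_field_derivative x * l (\<zeta> x)) (at x)"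
    if l: "bounded_linear l" for l
    using d\<xi>
  proof eventually_elim
    case (elim x)
    from bounded_linear.has_vector_derivative[OF l elim] show ?case
      using bounded_linear.linear[OF l] by (simp add: has_real_derivative_iff_has_vector_derivative linear_cmul)
  qed
  have dsl: "\<forall>\<^sub>F x in nhds 0. (s l has_field_derivative a x * l (\<xi> x)) (at x)"
    if l: "bounded_linear l" for l
    using ds
  proof eventually_elim
    case (elim x)
    have "((\<lambda>x. \<gamma> x + t x *\<^sub>R \<xi> x - p0) has_vector_derivative a x *\<^sub>R \<xi> x - 0) (at x)"
      by (intro has_vector_derivative_diff elim has_vector_derivative_const)
    from bounded_linear.has_vector_derivative[OF l this] show ?case
      using bounded_linear.linear[OF l] unfolding s_def[abs_def]
      by (simp add: has_real_derivative_iff_has_vector_derivative linear_cmul)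
  qed
  have s0: "s l 0 = 0" if "bounded_linear l" for l
    using linear_0[OF bounded_linear.linear[OF that]] by (simp add: s_def p0_def)
  have d\<zeta>3: "((\<lambda>x. l3 (\<zeta> x)) has_field_derivative (a 0)^3) (at 0)"
    using bounded_linear.has_vector_derivative[OF lin(3) d\<zeta>] vals
    by (simp add: has_real_derivative_iff_has_vector_derivative)
  obtain A C D E where holo: "real_holo A" "real_holo C" "real_holo D" "real_holo E"
    and v0: "A 0 = 1 / 2" "C 0 = 1 / 3" "D 0 = 1 / 3" "E 0 = 1 / 4"
    and rel: "\<forall>\<^sub>F z in nhds 0. deriv (\<lambda>z. z^3 * C z) z = z * deriv (\<lambda>z. z^2 * A z) z"
    "\<forall>\<^sub>F z in nhds 0. deriv (\<lambda>z. z^4 * E z) z = z * deriv (\<lambda>z. z^3 * D z) z"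
    and F2: "\<forall>\<^sub>F x in nhds 0. \<forall>r. s l2 x + r * l2 (\<xi> x)
        = (s l1 x + r * l1 (\<xi> x)) * (s l1 x)^2 * Re (A (of_real (s l1 x))) - (s l1 x)^3 * Re (C (of_real (s l1 x)))"
    and F3: "\<forall>\<^sub>F x in nhds 0. \<forall>r. s l3 x + r * l3 (\<xi> x)
        = (s l1 x + r * l1 (\<xi> x)) * (s l1 x)^3 * Re (D (of_real (s l1 x))) - (s l1 x)^4 * Re (E (of_real (s l1 x)))"
    by (rule ruling_coordinates[OF ana(2)[OF lin(1)] ana(2)[OF lin(2)] ana(2)[OF lin(3)]
        ana(3)[OF lin(1)] ana(3)[OF lin(2)] ana(3)[OF lin(3)] rs[OF lin(1)] rs[OF lin(2)] rs[OF lin(3)]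
        dl[OF lin(1)] dl[OF lin(2)] dl[OF lin(3)] dsl[OF lin(1)] dsl[OF lin(2)] dsl[OF lin(3)] a
        vals(1-3) s0[OF lin(1)] s0[OF lin(2)] s0[OF lin(3)] vals(5,6) d\<zeta>3])
  define f where "f u y = u * y^2 * Re (A (of_real y)) - y^3 * Re (C (of_real y))" for u y :: real
  define g where "g u y = u * y^3 * Re (D (of_real y)) - y^4 * Re (E (of_real y))" for u y :: real
  define \<beta> where "\<beta> = sqrt (2 / 3)"
  have \<beta>: "\<beta> > 0" "\<beta>^2 = 2 / 3" by (simp_all add: \<beta>_def)
  obtain \<tau> H0 H1 H2 and \<omega> e :: "real \<Rightarrow> real" where sm: "smooth_at \<tau> (0, 0)" "smooth_at \<omega> 0" "smooth_at e 0"
      and e0: "e 0 = 1"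
    and sH: "smooth_at H0 (0, 0)" "smooth_at H1 (0, 0)" "smooth_at H2 (0, 0)" and H1: "H1 (0, 0) \<noteq> 0"
    and id1: "\<forall>\<^sub>F (u, v) in nhds (0, 0). f u (v * (1 + (v - u) * \<tau> (u, v))) + \<omega> u * g u (v * (1 + (v - u) * \<tau> (u, v)))
        = e u * (u * v^2 / 2 - v^3 / 3)"
    and id2: "\<forall>\<^sub>F (u, v) in nhds (0, 0).
        g (\<beta> * u) ((v + \<beta> * u / 2) * (1 + (v - \<beta> * u / 2) * \<tau> (\<beta> * u, v + \<beta> * u / 2))) =
       H0 (u, u^2 * v - 2 * v^3) + H1 (u, u^2 * v - 2 * v^3) * (3 * v^4 - u^2 * v^2)
       + H2 (u, u^2 * v - 2 * v^3) * (3 * v^4 - u^2 * v^2)^2"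
    unfolding f_def g_def \<beta>_def by (rule beaks_normal_form[OF holo v0 rel])
  define w where "w p = snd p + \<beta> * fst p / 2" for p :: "real \<times> real"
  \<comment> \<open>From the parameters (u, v) of the model to the pair (U, y): U = \<beta> u, and y
    is the straightening applied at v + U/2, measured from the inflection point of the
    cubic.\<close>
  define \<Phi> where "\<Phi> p = (\<beta> * fst p, w p * (1 + (snd p - \<beta> * fst p / 2) * \<tau> (\<beta> * fst p, w p)))" for p :: "real \<times> real"
  have s\<tau>w: "smooth_at (\<lambda>p. \<tau> (\<beta> * fst p, w p)) (0, 0)"
    by (rule smooth_at_compose[where g = \<tau>]) (auto simp: w_def sm intro!: smooth_intros)
  have s\<Phi>: "smooth_at \<Phi> (0, 0)"
    unfolding \<Phi>_def by (intro smooth_intros s\<tau>w) (auto simp: w_def[abs_def] intro!: smooth_intros)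
  have \<Phi>0: "\<Phi> (0, 0) = (0, 0)" by (simp add: \<Phi>_def w_def)
  have ld\<Phi>: "local_diffeo \<Phi> (0, 0)"
  proof -
    define r where "r p = 1 + (snd p - \<beta> * fst p / 2) * \<tau> (\<beta> * fst p, w p)" for p
    have cr: "isCont r (0, 0)"
      unfolding r_def by (intro continuous_intros smooth_at_imp_isCont[OF s\<tau>w]) auto
    have "(w has_derivative (\<lambda>h. snd h + \<beta> * fst h / 2)) (at (0, 0))"
      unfolding w_def by (auto intro!: derivative_eq_intros)
    from has_derivative_scaleR_vanishing[OF this _ cr]
    have "((\<lambda>p. w p * r p) has_derivative (\<lambda>h. snd h + \<beta> * fst h / 2)) (at (0, 0))"
      by (simp add: w_def r_def)
    then have "(\<Phi> has_derivative (\<lambda>h. (\<beta> * fst h, snd h + \<beta> * fst h / 2))) (at (0, 0))"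
      unfolding \<Phi>_def r_def[symmetric]
      by (intro has_derivative_Pair has_derivative_mult_right has_derivative_fst has_derivative_ident)
    moreover have "inj (\<lambda>h. (\<beta> * fst h, snd h + \<beta> * fst h / 2))"
      by (rule injI) (use \<beta>(1) in \<open>auto simp: prod_eq_iff\<close>)
    ultimately show ?thesis using s\<Phi> unfolding local_diffeo_def by blast
  qed
  \<comment> \<open>Coordinates on the surface: the first affine coordinate U of the point, and that
    of the point where its ruling touches the striction curve. They are independent at the singular
    point because a(0) \<noteq> 0.\<close>
  define \<Theta> where "\<Theta> p = (s l1 (fst p) + (snd p - t (fst p)) * l1 (\<xi> (fst p)), s l1 (fst p))" for p :: "real \<times> real"
  have fst_smooth: "smooth_at (\<lambda>p::real \<times> real. h (fst p)) (0, b)" if "real_ana h" for h :: "real \<Rightarrow> real" and b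
    by (rule smooth_at_compose[where g = h]) (auto intro!: smooth_intros real_ana_smooth that)
  have s\<Theta>: "smooth_at \<Theta> (0, t 0)"
    unfolding \<Theta>_def by (intro smooth_intros fst_smooth rs ana lin)
  have \<Theta>0: "\<Theta> (0, t 0) = (0, 0)" by (simp add: \<Theta>_def s0 lin)
  have ld\<Theta>: "local_diffeo \<Theta> (0, t 0)"
  proof -
    have fst_der: "((\<lambda>p::real \<times> real. h (fst p)) has_derivative (\<lambda>k. e * fst k)) (at (0, b))"
      if "(h has_field_derivative e) (at 0)" for h :: "real \<Rightarrow> real" and e b
      by (rule has_derivative_compose[where f = fst and g = h])
        (use that in \<open>auto simp: has_field_derivative_def intro!: derivative_eq_intros\<close>)
    have ds1: "((\<lambda>p::real \<times> real. s l1 (fst p)) has_derivative (\<lambda>k. a 0 * fst k)) (at (0, t 0))"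
      using fst_der eventually_nhds_x_imp_x[OF dsl[OF lin(1)]] vals(1) by simp
    have "t differentiable (at 0)" using real_ana_smooth[OF ana(4)] smooth_at_imp_differentiable by blast
    then obtain b where b: "(t has_field_derivative b) (at 0)" using real_differentiable_def by blast
    have n: "((\<lambda>p. snd p - t (fst p)) has_derivative (\<lambda>k. snd k - b * fst k)) (at (0, t 0))"
      by (intro has_derivative_diff fst_der b has_derivative_snd has_derivative_ident)
    have c: "isCont (\<lambda>p::real \<times> real. l1 (\<xi> (fst p))) (0, t 0)"
      by (intro smooth_at_imp_isCont fst_smooth ana lin)
    from has_derivative_scaleR_vanishing[OF n _ c]
    have "((\<lambda>p. (snd p - t (fst p)) * l1 (\<xi> (fst p))) has_derivative (\<lambda>k. snd k - b * fst k)) (at (0, t 0))"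
      by (simp add: vals)
    then have "(\<Theta> has_derivative (\<lambda>k. (a 0 * fst k + (snd k - b * fst k), a 0 * fst k))) (at (0, t 0))"
      unfolding \<Theta>_def by (intro has_derivative_Pair has_derivative_add ds1)
    moreover have "inj (\<lambda>k. (a 0 * fst k + (snd k - b * fst k), a 0 * fst k))"
      by (rule injI) (use a(2) in \<open>auto simp: prod_eq_iff\<close>)
    ultimately show ?thesis using s\<Theta> unfolding local_diffeo_def by blast
  qed
  obtain I where I: "local_diffeo I (0, 0)" "I (0, 0) = (0, t 0)" "\<forall>\<^sub>F y in nhds (0, 0). \<Theta> (I y) = y"
    using local_diffeo_inverse[OF ld\<Theta>] unfolding \<Theta>0 by blast
  define \<alpha> where "\<alpha> p = I (\<Phi> p)" for p
  have ld\<alpha>: "local_diffeo \<alpha> (0, 0)"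
    unfolding \<alpha>_def by (rule local_diffeo_compose[OF ld\<Phi>]) (simp add: \<Phi>0 I)
  have \<alpha>0: "\<alpha> (0, 0) = (0, t 0)" by (simp add: \<alpha>_def \<Phi>0 I)
  define L where "L l Z = l (Z - p0)" for l :: "real^3 \<Rightarrow> real" and Z
  \<comment> \<open>On the surface the quotient equals U w^2/2 - w^3/3; subtracting U^3/12, its
    value at the inflection point, leaves (u^2 v - 2 v^3)/6.\<close>
  define \<psi>1 where "\<psi>1 Z = (vector [L l1 Z, (L l2 Z + \<omega> (L l1 Z) * L l3 Z) / e (L l1 Z) - (L l1 Z)^3 / 12, L l3 Z]
      :: real^3)" for Z
  have L0: "L l p0 = 0" if "bounded_linear l" for l
    using linear_0[OF bounded_linear.linear[OF that]] by (simp add: L_def)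
  have sL: "smooth_at (L l) p0" if "bounded_linear l" for l
    unfolding L_def by (rule smooth_at_compose_linear[OF that]) (intro smooth_intros)
  have dL: "(L l has_derivative l) (at p0)" if "bounded_linear l" for l
    unfolding L_def
    by (rule bounded_linear.has_derivative[OF that]) (auto intro!: derivative_eq_intros)
  have sb: "smooth_at (\<lambda>Z. b (L l1 Z)) p0" if "smooth_at b 0" for b :: "real \<Rightarrow> real"
    by (rule smooth_at_compose[OF sL[OF lin(1)]]) (simp add: L0 lin that)
  have s\<psi>1: "smooth_at \<psi>1 p0"
    unfolding \<psi>1_def by (intro smooth_at_vector_3 smooth_intros sL lin sb sm) (simp_all add: L0 lin e0)
  have ld\<psi>1: "local_diffeo \<psi>1 p0"
  proof -
    have w3: "((\<lambda>Z. L l3 Z * \<omega> (L l1 Z)) has_derivative (\<lambda>h. l3 h * \<omega> 0)) (at p0)"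
      using has_derivative_scaleR_vanishing[OF dL[OF lin(3)] L0[OF lin(3)] smooth_at_imp_isCont[OF sb[OF sm(2)]]]
      by (simp add: L0 lin)
    have n: "((\<lambda>Z. L l2 Z + \<omega> (L l1 Z) * L l3 Z) has_derivative (\<lambda>h. l2 h + \<omega> 0 * l3 h)) (at p0)"
      using has_derivative_add[OF dL[OF lin(2)] w3] by (simp add: mult.commute)
    have "isCont (\<lambda>Z. inverse (e (L l1 Z))) p0"
      by (intro continuous_intros smooth_at_imp_isCont sb sm) (simp add: L0 lin e0)
    from has_derivative_scaleR_vanishing[OF n _ this]
    have q: "((\<lambda>Z. (L l2 Z + \<omega> (L l1 Z) * L l3 Z) / e (L l1 Z)) has_derivative (\<lambda>h. l2 h + \<omega> 0 * l3 h)) (at p0)"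
      by (simp add: L0 lin e0 divide_inverse)
    have c: "((\<lambda>Z. (L l1 Z)^3 / 12) has_derivative (\<lambda>h. 0)) (at p0)"
      by (auto intro!: derivative_eq_intros dL lin simp: L0 lin)
    have "(\<psi>1 has_derivative (\<lambda>h. vector [l1 h, l2 h + \<omega> 0 * l3 h - 0, l3 h])) (at p0)"
      unfolding \<psi>1_def by (intro has_derivative_vector_3 has_derivative_diff q c dL lin)
    moreover have "inj (\<lambda>h. vector [l1 h, l2 h + \<omega> 0 * l3 h - 0, l3 h] :: real^3)"
    proof (rule injI)
      fix x y :: "real^3"
      assume eq: "(vector [l1 x, l2 x + \<omega> 0 * l3 x - 0, l3 x] :: real^3) = vector [l1 y, l2 y + \<omega> 0 * l3 y - 0, l3 y]"
      have "l1 x = l1 y" "l3 x = l3 y" "l2 x + \<omega> 0 * l3 x = l2 y + \<omega> 0 * l3 y"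
        using arg_cong[OF eq, of "\<lambda>v. vec_nth v 1"] arg_cong[OF eq, of "\<lambda>v. vec_nth v 2"]
          arg_cong[OF eq, of "\<lambda>v. vec_nth v 3"] by simp_all
      then have "l1 x = l1 y" "l3 x = l3 y" "l2 x = l2 y" by auto
      then have "x - y = 0" by (intro inj) (simp_all add: linear_diff linear)
      then show "x = y" by simp
    qed
    ultimately show ?thesis using s\<psi>1 unfolding local_diffeo_def by blast
  qed
  \<comment> \<open>Target change on the side of the model, with the division formula in Horner form
    in its third entry. The derivative at 0 is triangular with diagonal \<beta>, 1/6, H1(0,
    0).\<close>
  define \<psi>2 where "\<psi>2 Y = (vector [\<beta> * vec_nth Y 1, vec_nth Y 2 / 6,
      H0 (vec_nth Y 1, vec_nth Y 2) + vec_nth Y 3 *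
      (H1 (vec_nth Y 1, vec_nth Y 2) + vec_nth Y 3 * H2 (vec_nth Y 1, vec_nth Y 2))] :: real^3)" for Y :: "real^3"
  have snth: "smooth_at (\<lambda>Y::real^3. vec_nth Y i) Y" for i Y by (rule smooth_at_bounded_linear[OF bounded_linear_vec_nth])
  have sH': "smooth_at (\<lambda>Y::real^3. H (vec_nth Y 1, vec_nth Y 2)) 0" if "smooth_at H (0, 0)" for H :: "real \<times> real \<Rightarrow> real"
    by (rule smooth_at_compose[where f = "\<lambda>Y. (vec_nth Y 1, vec_nth Y 2)" and g = H, OF smooth_at_Pair[OF snth snth]])
      (simp add: that)
  have s\<psi>2: "smooth_at \<psi>2 0"
    unfolding \<psi>2_def by (intro smooth_at_vector_3 smooth_intros snth sH' sH) simp
  have ld\<psi>2: "local_diffeo \<psi>2 0"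
  proof -
    have dnth: "((\<lambda>Y::real^3. vec_nth Y i) has_derivative (\<lambda>h. vec_nth h i)) (at 0)" for i
      by (rule bounded_linear_imp_has_derivative[OF bounded_linear_vec_nth])
    have H0': "(H0 has_derivative frechet_derivative H0 (at (0, 0))) (at (vec_nth (0::real^3) 1, vec_nth (0::real^3) 2))"
      using smooth_at_imp_has_derivative[OF sH(1)] by simp
    have 1: "((\<lambda>Y::real^3. H0 (vec_nth Y 1, vec_nth Y 2)) has_derivative
        (\<lambda>h. frechet_derivative H0 (at (0, 0)) (vec_nth h 1, vec_nth h 2))) (at 0)"
      by (rule has_derivative_compose[OF has_derivative_Pair[OF dnth dnth] H0'])
    have "isCont (\<lambda>Y::real^3. H1 (vec_nth Y 1, vec_nth Y 2) + vec_nth Y 3 * H2 (vec_nth Y 1, vec_nth Y 2)) 0"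
      by (intro smooth_at_imp_isCont smooth_intros sH' sH snth)
    from has_derivative_scaleR_vanishing[OF dnth _ this]
    have 2: "((\<lambda>Y::real^3. vec_nth Y 3 * (H1 (vec_nth Y 1, vec_nth Y 2) + vec_nth Y 3 * H2
        (vec_nth Y 1, vec_nth Y 2))) has_derivative (\<lambda>h. vec_nth h 3 * H1 (0, 0))) (at 0)"
      by simp
    have der: "(\<psi>2 has_derivative (\<lambda>h. vector [\<beta> * vec_nth h 1, vec_nth h 2 / 6,
        frechet_derivative H0 (at (0, 0)) (vec_nth h 1, vec_nth h 2) + vec_nth h 3 * H1 (0, 0)])) (at 0)"
      unfolding \<psi>2_def
      by (intro has_derivative_vector_3 has_derivative_add 1 2)
        (auto intro!: derivative_eq_intros dnth)
    have "inj (\<lambda>h::real^3. vector [\<beta> * vec_nth h 1, vec_nth h 2 / 6,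
        frechet_derivative H0 (at (0, 0)) (vec_nth h 1, vec_nth h 2) + vec_nth h 3 * H1 (0, 0)] :: real^3)"
      by (rule injI) (use \<beta>(1) H1 in \<open>auto simp: vec_eq_iff forall_3\<close>)
    then show ?thesis using der s\<psi>2 unfolding local_diffeo_def by blast
  qed
  have b0: "beaks_model (0, 0) = 0" by (simp add: beaks_model_def vec_eq_iff forall_3)
  have F0: "ruled_surface \<gamma> \<xi> (\<alpha> (0, 0)) = p0" by (simp add: \<alpha>0 ruled_surface_def p0_def)
  have cF: "isCont (ruled_surface \<gamma> \<xi>) (\<alpha> (0, 0))"
  proof -
    have "isCont (\<lambda>p. \<gamma> (fst p) + snd p *\<^sub>R \<xi> (fst p)) (0, t 0)"
      by (intro continuous_intros isCont_o2[where f = fst and g = \<gamma>] isCont_o2[where f = fst and g = \<xi>]) (use cont in auto)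
    then show ?thesis unfolding \<alpha>0 ruled_surface_def case_prod_beta' .
  qed
  have cB: "isCont beaks_model (0, 0)"
    unfolding beaks_model_def vector_3_eq case_prod_beta' by (intro continuous_intros)
  have c\<Phi>: "isCont \<Phi> (0, 0)" and c\<alpha>: "isCont \<alpha> (0, 0)" using ld\<Phi> ld\<alpha> local_diffeo_isCont by blast+
  have e1: "\<forall>\<^sub>F p in nhds (0, 0). \<Theta> (\<alpha> p) = \<Phi> p"
    using eventually_nhds_isCont[OF c\<Phi>, of "\<lambda>y. \<Theta> (I y) = y"] I(3) by (simp add: \<Phi>0 \<alpha>_def)
  have "isCont (\<lambda>p. fst (\<alpha> p)) (0, 0)" by (intro continuous_intros c\<alpha>)
  then have e2: "\<forall>\<^sub>F p in nhds (0, 0). P (fst (\<alpha> p))" if "\<forall>\<^sub>F x in nhds 0. P x" for P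
    by (rule eventually_nhds_isCont) (simp add: \<alpha>0 that)
  have e3: "\<forall>\<^sub>F p in nhds (0, 0). case (\<beta> * fst p, w p) of (u, v) \<Rightarrow>
      f u (v * (1 + (v - u) * \<tau> (u, v))) + \<omega> u * g u (v * (1 + (v - u) * \<tau> (u, v))) = e u * (u * v^2 / 2 - v^3 / 3)"
    by (rule eventually_nhds_isCont[where f = "\<lambda>p. (\<beta> * fst p, w p)"])
      (use id1 in \<open>auto simp: w_def intro!: continuous_intros\<close>)
  have ene: "\<forall>\<^sub>F p::real \<times> real in nhds (0, 0). e (\<beta> * fst p) \<in> - {0}"
  proof (rule eventually_nhds_isCont[where f = "\<lambda>p. e (\<beta> * fst p)"])
    show "isCont (\<lambda>p::real \<times> real. e (\<beta> * fst p)) (0, 0)"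
      by (rule isCont_o2[where f = "\<lambda>p. \<beta> * fst p"])
          (use smooth_at_imp_isCont[OF sm(3)] in \<open>auto intro!: continuous_intros\<close>)
    show "\<forall>\<^sub>F y in nhds (e (\<beta> * fst (0::real, 0::real))). y \<in> - {0}"
      using e0 by (intro eventually_nhds_in_open open_Compl closed_singleton) simp
  qed
  have "\<forall>\<^sub>F p in nhds (0, 0). \<psi>1 (ruled_surface \<gamma> \<xi> (\<alpha> p)) = \<psi>2 (beaks_model p)"
    using e1 e2[OF F2] e2[OF F3] e3 id2 ene
  proof eventually_elim
    case (elim p)
    obtain u v where p: "p = (u, v)" by (cases p)
    obtain x r where xr: "\<alpha> p = (x, r)" by (cases "\<alpha> p")
    define U W where "U = \<beta> * u" and "W = v + U / 2"
    define y where "y = W * (1 + (W - U) * \<tau> (U, W))"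
    have \<Phi>: "\<Phi> p = (U, y)" by (simp add: \<Phi>_def p w_def U_def W_def y_def)
    have x1: "s l1 x + (r - t x) * l1 (\<xi> x) = U" and xy: "s l1 x = y"
      using elim(1) unfolding xr \<Phi> \<Theta>_def by auto
    have LF: "L l (ruled_surface \<gamma> \<xi> (x, r)) = s l x + (r - t x) * l (\<xi> x)" if "bounded_linear l" for l
      using bounded_linear.linear[OF that]
      by (simp add: L_def ruled_surface_def s_def linear_add linear_diff linear_cmul algebra_simps)
    have L1: "L l1 (ruled_surface \<gamma> \<xi> (\<alpha> p)) = U" using LF[OF lin(1)] x1 by (simp add: xr)
    have L2: "L l2 (ruled_surface \<gamma> \<xi> (\<alpha> p)) = f U y"
      using LF[OF lin(2)] elim(2) x1 xy by (simp add: xr f_def)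
    have L3: "L l3 (ruled_surface \<gamma> \<xi> (\<alpha> p)) = g U y"
      using LF[OF lin(3)] elim(3) x1 xy by (simp add: xr g_def)
    have fg: "f U y + \<omega> U * g U y = e U * (U * W^2 / 2 - W^3 / 3)"
      using elim(4) by (simp add: p w_def U_def W_def y_def)
    have eU: "e U \<noteq> 0" using elim(6) by (simp add: p U_def)
    have "U * W^2 / 2 - W^3 / 3 - U^3 / 12 = U^2 * v / 4 - v^3 / 3"
      unfolding W_def by (simp add: field_simps power2_eq_square power3_eq_cube)
    also have "U^2 = 2 / 3 * u^2" by (simp add: U_def power_mult_distrib \<beta>)
    finally have c: "U * W^2 / 2 - W^3 / 3 - U^3 / 12 = (u^2 * v - 2 * v^3) / 6" by (simp add: field_simps)
    have WU: "W - U = v - U / 2" by (simp add: W_def)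
    have gid: "g U y = H0 (u, u^2 * v - 2 * v^3) + H1 (u, u^2 * v - 2 * v^3) * (3 * v^4 - u^2 * v^2)
       + H2 (u, u^2 * v - 2 * v^3) * (3 * v^4 - u^2 * v^2)^2"
    proof -
      have y': "y = (v + \<beta> * u / 2) * (1 + (v - \<beta> * u / 2) * \<tau> (\<beta> * u, v + \<beta> * u / 2))"
        unfolding y_def WU by (simp only: W_def U_def)
      show ?thesis using elim(5) by (simp only: p prod.case y' U_def)
    qed
    have sc: "e U * (U * W^2 / 2 - W^3 / 3) / e U - U^3 / 12 = (u^2 * v - 2 * v^3) / 6"
      unfolding c[symmetric] using nonzero_mult_div_cancel_left[OF eU] by simp
    have beaks: "beaks_model p = vector [u, u^2 * v - 2 * v^3, 3 * v^4 - u^2 * v^2]"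
      by (simp add: beaks_model_def p)
    have horner: "b0 + b1 * q + b2 * q^2 = b0 + q * (b1 + q * b2)" for b0 b1 b2 q :: real
      by (simp add: algebra_simps power2_eq_square)
    have "\<psi>1 (ruled_surface \<gamma> \<xi> (\<alpha> p)) = vector [U, (u^2 * v - 2 * v^3) / 6, g U y]"
      unfolding \<psi>1_def L1 L2 L3 fg sc ..
    also have "\<dots> = \<psi>2 (beaks_model p)"
      unfolding gid horner beaks \<psi>2_def vector_3 by (simp only: U_def)
    finally show ?case .
  qed
  then have "A_equivalent (ruled_surface \<gamma> \<xi>) (\<alpha> (0, 0)) beaks_model (id (0, 0))"
    by (intro A_equivalent_chain[where \<alpha> = \<alpha> and \<beta> = id and ?\<psi>1.0 = \<psi>1 and ?\<psi>2.0 = \<psi>2])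
      (use ld\<alpha> ld\<psi>1 ld\<psi>2 F0 b0 cF cB in \<open>auto simp: local_diffeo_def id_def smooth_at_ident intro!: exI[of _ "\<lambda>x. x"]\<close>)
  then show ?thesis by (simp add: \<alpha>0)
qed

section \<open>Invariants of the cuspidal beaks\<close>

lemma diffeo_on_imp_local_diffeo:
  fixes f :: "'a::euclidean_space \<Rightarrow> 'a"
  assumes "diffeo_on f U V" "x \<in> U"
  shows "local_diffeo f x" "local_diffeo (inv_into U f) (f x)"
proof -
  define g where "g = inv_into U f"
  have o: "open U" "open V" and b: "bij_betw f U V" and s: "smooth_on f U" "smooth_on g V"
    using assms(1) unfolding diffeo_on_def g_def by auto
  have fx: "f x \<in> V" using b assms(2) bij_betwE by blast
  have gf: "g (f z) = z" if "z \<in> U" for z using b that by (simp add: g_def bij_betw_inv_into_left)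
  have fg: "f (g y) = y" if "y \<in> V" for y using b that by (simp add: g_def bij_betw_inv_into_right)
  have sf: "smooth_at f x" and sg: "smooth_at g (f x)"
    using s o fx assms(2) by (auto simp: smooth_at_def)
  let ?D = "frechet_derivative f (at x)" and ?E = "frechet_derivative g (at (f x))"
  have D: "(f has_derivative ?D) (at x)" and E: "(g has_derivative ?E) (at (f x))"
    by (rule smooth_at_imp_has_derivative[OF sf], rule smooth_at_imp_has_derivative[OF sg])
  have "((\<lambda>z. g (f z)) has_derivative (\<lambda>h. ?E (?D h))) (at x)"
    by (rule has_derivative_compose[OF D E])
  then have "((\<lambda>z. z) has_derivative (\<lambda>h. ?E (?D h))) (at x)"
    by (rule has_derivative_transform_within_open[OF _ o(1) assms(2)]) (rule gf)
  then have "(\<lambda>h. ?E (?D h)) = (\<lambda>h. h)" using has_derivative_unique has_derivative_ident by blast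
  then have "inj ?D" by (metis injI)
  then show "local_diffeo f x" using sf D local_diffeo_def by blast
  have "((\<lambda>y. f (g y)) has_derivative (\<lambda>h. ?D (?E h))) (at (f x))"
    by (rule has_derivative_compose[OF E]) (simp add: gf[OF assms(2)] D)
  then have "((\<lambda>y. y) has_derivative (\<lambda>h. ?D (?E h))) (at (f x))"
    by (rule has_derivative_transform_within_open[OF _ o(2) fx]) (rule fg)
  then have "(\<lambda>h. ?D (?E h)) = (\<lambda>h. h)" using has_derivative_unique has_derivative_ident by blast
  then have "inj ?E" by (metis injI)
  then show "local_diffeo (inv_into U f) (f x)" using sg E local_diffeo_def g_def by blast
qed

definition beaks_normal :: "real \<times> real \<Rightarrow> real^3" where
  "beaks_normal w = vector [- 2 * fst w * (snd w)^2, 2 * snd w, 1]"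

text \<open>Signed area density of the model along \<open>beaks_normal\<close>. Its zeros are the
  two lines u^2 = 6 v^2, and it is nonzero on the kernel direction (0, 1) at the origin.\<close>

definition beaks_lambda :: "real \<times> real \<Rightarrow> real" where
  "beaks_lambda w = (fst w)^2 - 6 * (snd w)^2"

lemma beaks_model_has_derivative:
  "(beaks_model has_derivative (\<lambda>h. vector [fst h, 2 * fst w * snd w * fst h + beaks_lambda w * snd h,
     - 2 * fst w * (snd w)^2 * fst h - 2 * snd w * beaks_lambda w * snd h])) (at w)"
proof -
  have "((\<lambda>p::real \<times> real. - 2 * snd p^3 + fst p^2 * snd p) has_derivative
      (\<lambda>h. 2 * fst w * snd w * fst h + beaks_lambda w * snd h)) (at w)"
    by (auto intro!: derivative_eq_intros simp: beaks_lambda_def fun_eq_iff algebra_simps)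
  moreover have "((\<lambda>p::real \<times> real. 3 * snd p^4 - fst p^2 * snd p^2) has_derivative
      (\<lambda>h. - 2 * fst w * (snd w)^2 * fst h - 2 * snd w * beaks_lambda w * snd h)) (at w)"
    by (auto intro!: derivative_eq_intros simp: beaks_lambda_def fun_eq_iff algebra_simps power2_eq_square power3_eq_cube)
  ultimately show ?thesis
    unfolding beaks_model_def case_prod_beta' by (intro has_derivative_vector_3 has_derivative_fst has_derivative_ident)
qed

lemma beaks_cross:
  "cross3 (vector [fst h, 2 * fst w * snd w * fst h + beaks_lambda w * snd h,
      - 2 * fst w * (snd w)^2 * fst h - 2 * snd w * beaks_lambda w * snd h])
    (vector [fst k, 2 * fst w * snd w * fst k + beaks_lambda w * snd k,
      - 2 * fst w * (snd w)^2 * fst k - 2 * snd w * beaks_lambda w * snd k]) =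
    ((fst h * snd k - snd h * fst k) * beaks_lambda w) *\<^sub>R beaks_normal w"
  by (simp add: cross3_def beaks_normal_def vec_eq_iff forall_3 algebra_simps power2_eq_square)

lemma beaks_normal_orthogonal:
  "beaks_normal w \<bullet> vector [fst h, 2 * fst w * snd w * fst h + beaks_lambda w * snd h,
      - 2 * fst w * (snd w)^2 * fst h - 2 * snd w * beaks_lambda w * snd h] = 0"
  by (simp add: beaks_normal_def inner_vec_def sum_3 algebra_simps power2_eq_square)

text \<open>Expansion of c in the frame a, b, a x b by the Gram matrix of a and b, whose determinant
  is |a x b|^2; coplanarity removes the third component.\<close>

lemma span_if_coplanar:
  fixes a b c :: "real^3"
  assumes "a \<bullet> cross3 b c = 0" "cross3 a b \<noteq> 0"
  obtains \<alpha> \<beta> where "c = \<alpha> *\<^sub>R a + \<beta> *\<^sub>R b"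
proof -
  define W where "W = cross3 a b"
  have cW: "c \<bullet> W = 0" using assms(1) unfolding W_def by (simp add: cross3_def inner_vec_def sum_3 algebra_simps)
  have id: "(W \<bullet> W) *\<^sub>R c = ((b \<bullet> b) * (a \<bullet> c) - (a \<bullet> b) * (b \<bullet> c)) *\<^sub>R a +
      ((a \<bullet> a) * (b \<bullet> c) - (a \<bullet> b) * (a \<bullet> c)) *\<^sub>R b + (c \<bullet> W) *\<^sub>R W"
    unfolding W_def by (simp add: cross3_def vec_eq_iff forall_3 inner_vec_def sum_3 algebra_simps)
  have ne: "W \<bullet> W \<noteq> 0" using assms(2) by (simp add: W_def)
  have "c = (1 / (W \<bullet> W)) *\<^sub>R ((W \<bullet> W) *\<^sub>R c)" using ne by simp
  also have "\<dots> = (((b \<bullet> b) * (a \<bullet> c) - (a \<bullet> b) * (b \<bullet> c)) / (W \<bullet> W)) *\<^sub>R a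
      + (((a \<bullet> a) * (b \<bullet> c) - (a \<bullet> b) * (a \<bullet> c)) / (W \<bullet> W)) *\<^sub>R b"
    unfolding id cW by (simp add: scaleR_add_right)
  finally show thesis by (rule that)
qed

lemma ruled_surface_has_derivative:
  assumes "(\<gamma> has_vector_derivative \<gamma>') (at x)" "(\<xi> has_vector_derivative \<xi>') (at x)"
  shows "(ruled_surface \<gamma> \<xi> has_derivative (\<lambda>h. fst h *\<^sub>R (\<gamma>' + r *\<^sub>R \<xi>') + snd h *\<^sub>R \<xi> x)) (at (x, r))"
proof -
  have c: "((\<lambda>z. f (fst z)) has_derivative (\<lambda>h. fst h *\<^sub>R f')) (at (x, r))"
    if "(f has_vector_derivative f') (at x)" for f :: "real \<Rightarrow> real^3" and f'
    by (rule has_derivative_compose[where f = fst and g = f])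
      (use that in \<open>auto simp: has_vector_derivative_def intro!: derivative_eq_intros\<close>)
  have "((\<lambda>z. \<gamma> (fst z) + snd z *\<^sub>R \<xi> (fst z)) has_derivative
      (\<lambda>h. fst h *\<^sub>R \<gamma>' + (snd (x, r) *\<^sub>R (fst h *\<^sub>R \<xi>') + snd h *\<^sub>R \<xi> (fst (x, r))))) (at (x, r))"
    by (intro has_derivative_add has_derivative_scaleR c assms has_derivative_snd has_derivative_ident)
  then show ?thesis
    unfolding ruled_surface_def case_prod_beta'
    by (rule has_derivative_eq_rhs) (simp add: fun_eq_iff algebra_simps)
qed

lemma quotient_limit:
  fixes f :: "real \<Rightarrow> 'b::real_normed_vector"
  assumes "(f has_vector_derivative f') (at 0)" "f 0 = 0"
  shows "((\<lambda>h. f h /\<^sub>R h) \<longlongrightarrow> f') (at 0)"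
proof -
  have "((\<lambda>h. norm (f h - h *\<^sub>R f') / \<bar>h\<bar>) \<longlongrightarrow> 0) (at 0)"
    using assms by (simp add: has_vector_derivative_def has_derivative_at)
  moreover have "\<forall>\<^sub>F h in at 0. norm (f h - h *\<^sub>R f') / \<bar>h\<bar> = norm (f h /\<^sub>R h - f')"
    unfolding eventually_at_filter
  proof (intro always_eventually allI impI)
    fix h :: real assume h: "h \<noteq> 0"
    have "f h /\<^sub>R h - f' = inverse h *\<^sub>R (f h - h *\<^sub>R f')" using h by (simp add: scaleR_diff_right)
    then show "norm (f h - h *\<^sub>R f') / \<bar>h\<bar> = norm (f h /\<^sub>R h - f')" by (simp add: divide_inverse)
  qed
  ultimately have "((\<lambda>h. norm (f h /\<^sub>R h - f')) \<longlongrightarrow> 0) (at 0)" using tendsto_cong by fastforce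
  then show ?thesis by (simp add: LIM_zero_iff tendsto_norm_zero_iff)
qed

text \<open>Each condition is read off along its own curve through the singular point: the ruling,
  the preimage of the u-axis, the striction curve and a line tangent to the kernel. First
  derivatives of the data at x0 are all that enters, and \<xi>, d may be any independent
  pair.\<close>

lemma A_equivalent_beaksD:
  fixes \<gamma> \<xi> d :: "real \<Rightarrow> real^3" and p t \<delta> :: "real \<Rightarrow> real"
  assumes A: "A_equivalent (ruled_surface \<gamma> \<xi>) (x0, t x0) beaks_model (0, 0)"
    and d\<gamma>: "\<forall>\<^sub>F x in nhds x0. (\<gamma> has_vector_derivative p x *\<^sub>R \<xi> x - (t x * \<delta> x) *\<^sub>R d x) (at x)"
    and d\<xi>: "\<forall>\<^sub>F x in nhds x0. (\<xi> has_vector_derivative \<delta> x *\<^sub>R d x) (at x)"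
    and dd: "(d has_vector_derivative d1) (at x0)"
    and dt: "(t has_field_derivative b) (at x0)"
    and d\<delta>: "(\<delta> has_field_derivative \<delta>1) (at x0)"
    and indep: "cross3 (\<xi> x0) (d x0) \<noteq> 0"
  shows "\<delta> x0 = 0" "\<delta>1 \<noteq> 0" "p x0 + b \<noteq> 0" "\<xi> x0 \<bullet> cross3 (d x0) d1 \<noteq> 0"
proof -
  define F where "F = ruled_surface \<gamma> \<xi>"
  define z0 where "z0 = (x0, t x0)"
  obtain \<phi> U1 U2 \<psi> V1 V2 where \<phi>: "diffeo_on \<phi> U1 U2" "z0 \<in> U1" "\<phi> z0 = (0, 0)"
    and \<psi>: "diffeo_on \<psi> V1 V2" "F z0 \<in> V1"
    and eq: "\<And>u. u \<in> U1 \<Longrightarrow> F u \<in> V1 \<and> \<psi> (F u) = beaks_model (\<phi> u)"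
    using A unfolding A_equivalent_def F_def z0_def by auto
  have oU: "open U1" using \<phi>(1) by (simp add: diffeo_on_def)
  have ld\<phi>: "local_diffeo \<phi> z" if "z \<in> U1" for z using diffeo_on_imp_local_diffeo(1)[OF \<phi>(1) that] .
  have ld\<psi>: "local_diffeo \<psi> y" if "y \<in> V1" for y using diffeo_on_imp_local_diffeo(1)[OF \<psi>(1) that] .
  have s\<phi>: "smooth_at \<phi> z0" using ld\<phi>[OF \<phi>(2)] local_diffeo_def by blast
  have s\<psi>: "smooth_at \<psi> (F z0)" using ld\<psi>[OF \<psi>(2)] local_diffeo_def by blast
  define P where "P z = frechet_derivative \<phi> (at z)" for z
  define \<Psi> where "\<Psi> y = frechet_derivative \<psi> (at y)" for y
  have P: "(\<phi> has_derivative P z) (at z)" if "z \<in> U1" for z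
    using ld\<phi>[OF that] unfolding P_def local_diffeo_def by (blast intro: smooth_at_imp_has_derivative)
  have \<Psi>: "(\<psi> has_derivative \<Psi> y) (at y)" if "y \<in> V1" for y
    using ld\<psi>[OF that] unfolding \<Psi>_def local_diffeo_def by (blast intro: smooth_at_imp_has_derivative)
  have injP: "inj (P z0)"
    using ld\<phi>[OF \<phi>(2)] unfolding P_def local_diffeo_def by (metis frechet_derivative_at)
  have inj\<Psi>: "inj (\<Psi> (F z0))"
    using ld\<psi>[OF \<psi>(2)] unfolding \<Psi>_def local_diffeo_def by (metis frechet_derivative_at)
  have linP: "linear (P z0)" using P[OF \<phi>(2)] has_derivative_linear by blast
  have lin\<Psi>: "linear (\<Psi> y)" if "y \<in> V1" for y using \<Psi>[OF that] has_derivative_linear by blast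
  define \<mu> where "\<mu> z = (snd z - t (fst z)) * \<delta> (fst z)" for z
  define Fx where "Fx z = p (fst z) *\<^sub>R \<xi> (fst z) + \<mu> z *\<^sub>R d (fst z)" for z
  define G where "G h w = (vector [fst h, 2 * fst w * snd w * fst h + beaks_lambda w * snd h,
      - 2 * fst w * (snd w)^2 * fst h - 2 * snd w * beaks_lambda w * snd h] :: real^3)" for h w :: "real \<times> real"
  have dF: "(F has_derivative (\<lambda>h. fst h *\<^sub>R Fx z + snd h *\<^sub>R \<xi> (fst z))) (at z)"
    if "(\<gamma> has_vector_derivative p (fst z) *\<^sub>R \<xi> (fst z) - (t (fst z) * \<delta> (fst z)) *\<^sub>R d (fst z)) (at (fst z))"
      "(\<xi> has_vector_derivative \<delta> (fst z) *\<^sub>R d (fst z)) (at (fst z))" for z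
    using ruled_surface_has_derivative[OF that, of "snd z"]
    unfolding F_def Fx_def \<mu>_def by (simp add: algebra_simps)
  have "isCont fst z0" by (intro continuous_intros)
  then have evfst: "\<forall>\<^sub>F z in nhds z0. Q (fst z)" if "\<forall>\<^sub>F x in nhds x0. Q x" for Q
    by (rule eventually_nhds_isCont) (simp add: z0_def that)
  have evU: "\<forall>\<^sub>F z in nhds z0. z \<in> U1" using oU \<phi>(2) by (rule eventually_nhds_in_open)
  have chain: "\<forall>\<^sub>F z in nhds z0. z \<in> U1 \<and> (\<forall>h. G (P z h) (\<phi> z) = \<Psi> (F z) (fst h *\<^sub>R Fx z + snd h *\<^sub>R \<xi> (fst z)))"
    using evfst[OF d\<gamma>] evfst[OF d\<xi>] evU
  proof eventually_elim
    case (elim z)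
    have "((\<lambda>u. beaks_model (\<phi> u)) has_derivative (\<lambda>h. G (P z h) (\<phi> z))) (at z)"
      unfolding G_def by (rule has_derivative_compose[OF P[OF elim(3)] beaks_model_has_derivative])
    moreover have "((\<lambda>u. \<psi> (F u)) has_derivative (\<lambda>h. \<Psi> (F z) (fst h *\<^sub>R Fx z + snd h *\<^sub>R \<xi> (fst z)))) (at z)"
      using eq[OF elim(3)] by (intro has_derivative_compose[OF dF[OF elim(1,2)] \<Psi>]) auto
    then have "((\<lambda>u. beaks_model (\<phi> u)) has_derivative (\<lambda>h. \<Psi> (F z) (fst h *\<^sub>R Fx z + snd h *\<^sub>R \<xi> (fst z)))) (at z)"
      by (rule has_derivative_transform_within_open[OF _ oU elim(3)]) (use eq in auto)
    ultimately have "(\<lambda>h. G (P z h) (\<phi> z)) = (\<lambda>h. \<Psi> (F z) (fst h *\<^sub>R Fx z + snd h *\<^sub>R \<xi> (fst z)))"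
      by (rule has_derivative_unique)
    then show ?case using elim(3) by meson
  qed
  define J where "J z = fst (P z (1, 0)) * snd (P z (0, 1)) - snd (P z (1, 0)) * fst (P z (0, 1))" for z
  \<comment> \<open>The cross product of the images under \<psi>' replaces the cofactor matrix of
    \<psi>' applied to d x \<xi>; it is nonzero because \<psi>' is injective.\<close>
  define N where "N z = cross3 (\<Psi> (F z) (d (fst z))) (\<Psi> (F z) (\<xi> (fst z)))" for z
  have key: "\<forall>\<^sub>F z in nhds z0. (J z * beaks_lambda (\<phi> z)) *\<^sub>R beaks_normal (\<phi> z) = \<mu> z *\<^sub>R N z"
    using chain
  proof eventually_elim
    case (elim z)
    have V: "F z \<in> V1" using eq elim by blast
    have 1: "G (P z (1, 0)) (\<phi> z) = \<Psi> (F z) (Fx z)" and 2: "G (P z (0, 1)) (\<phi> z) = \<Psi> (F z) (\<xi> (fst z))"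
      using elim by simp_all
    have "(J z * beaks_lambda (\<phi> z)) *\<^sub>R beaks_normal (\<phi> z) = cross3 (G (P z (1, 0)) (\<phi> z)) (G (P z (0, 1)) (\<phi> z))"
      unfolding G_def beaks_cross J_def ..
    also have "\<dots> = \<mu> z *\<^sub>R N z"
      unfolding 1 2 Fx_def N_def
      by (simp add: linear_add[OF lin\<Psi>[OF V]] linear_cmul[OF lin\<Psi>[OF V]] cross_add_left cross_mult_left)
    finally show ?case .
  qed
  have G1: "vec_nth (G h w) 1 = fst h" for h w by (simp add: G_def)
  have G_lin: "fst h = 0" if "G h w = 0" for h w using G1[of h w] unfolding that by simp
  have J0: "J z0 \<noteq> 0"
  proof
    assume J: "J z0 = 0"
    define A B where "A = P z0 (1, 0)" and "B = P z0 (0, 1)"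
    have lc: "P z0 (\<alpha>, \<beta>) = \<alpha> *\<^sub>R A + \<beta> *\<^sub>R B" for \<alpha> \<beta>
      using linear_add[OF linP, of "(\<alpha>, 0)" "(0, \<beta>)"] linear_cmul[OF linP, of \<alpha> "(1, 0)"]
          linear_cmul[OF linP, of \<beta> "(0, 1)"]
      by (simp add: A_def B_def)
    have ker: "P z0 h = 0 \<Longrightarrow> h = 0" for h using linear_injective_0[OF linP] injP by blast
    have J': "fst A * snd B = snd A * fst B" using J by (simp add: J_def A_def B_def)
    have kerA: "P z0 (fst B, - fst A) = 0" "P z0 (snd B, - snd A) = 0"
      unfolding lc using J' by (simp_all add: prod_eq_iff algebra_simps)
    have "fst A = 0" "snd A = 0"
      using ker[OF kerA(1)] ker[OF kerA(2)] by (simp_all add: zero_prod_def)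
    then have "P z0 (1, 0) = 0" unfolding A_def[symmetric] by (simp add: prod_eq_iff)
    then have "(1::real, 0::real) = 0" by (rule ker)
    then show False by (simp add: zero_prod_def)
  qed
  have dF0: "(F has_derivative (\<lambda>h. fst h *\<^sub>R Fx z0 + snd h *\<^sub>R \<xi> x0)) (at z0)"
    using dF[of z0] eventually_nhds_x_imp_x[OF d\<gamma>] eventually_nhds_x_imp_x[OF d\<xi>] by (simp add: z0_def)
  have \<mu>0: "\<mu> z0 = 0" by (simp add: \<mu>_def z0_def)
  have Fx0: "Fx z0 = p x0 *\<^sub>R \<xi> x0" by (simp add: Fx_def \<mu>0) (simp add: z0_def)
  have cF: "isCont F z0" using dF0 has_derivative_continuous by blast
  have c\<xi>: "isCont \<xi> x0" using eventually_nhds_x_imp_x[OF d\<xi>] has_vector_derivative_continuous by blast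
  have cd: "isCont d x0" using dd has_vector_derivative_continuous by blast
  have s\<Psi>: "smooth_at (\<lambda>y. \<Psi> y v) (F z0)" for v
    unfolding \<Psi>_def by (rule smooth_at_frechet_derivative[OF s\<psi>])
  have \<Psi>_expand: "\<Psi> y v = (\<Sum>i\<in>Basis. (v \<bullet> i) *\<^sub>R \<Psi> y i)" if "y \<in> V1" for y v
    by (subst (1) euclidean_representation[of v, symmetric])
      (simp add: linear_sum[OF lin\<Psi>[OF that]] linear_cmul[OF lin\<Psi>[OF that]])
  \<comment> \<open>Continuity of \<psi>' is known in fixed directions, so the moving direction is
    expanded in the basis.\<close>
  have c1: "isCont (\<lambda>z. \<Sum>i\<in>Basis. (v (fst z) \<bullet> i) *\<^sub>R \<Psi> (F z) i) z0" if "isCont v x0" for v :: "real \<Rightarrow> real^3"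
  proof -
    have "isCont (\<lambda>z. \<Psi> (F z) i) z0" for i
      by (rule isCont_o2[OF cF]) (rule smooth_at_imp_isCont[OF s\<Psi>])
    moreover have "isCont (\<lambda>z. v (fst z)) z0"
      by (rule isCont_o2[where f = fst]) (use that in \<open>auto simp: z0_def\<close>)
    ultimately show ?thesis by (intro continuous_intros)
  qed
  have c2: "\<forall>\<^sub>F z in nhds z0. (\<Sum>i\<in>Basis. (v (fst z) \<bullet> i) *\<^sub>R \<Psi> (F z) i) = \<Psi> (F z) (v (fst z))" for v :: "real \<Rightarrow> real^3"
    using evU by eventually_elim (use \<Psi>_expand eq in auto)
  have c\<Psi>v: "isCont (\<lambda>z. \<Psi> (F z) (v (fst z))) z0" if "isCont v x0" for v :: "real \<Rightarrow> real^3"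
    by (rule isCont_cong[OF c2, THEN iffD1, OF c1[OF that]])
  have cN: "isCont N z0"
    unfolding N_def by (rule continuous_cross[OF c\<Psi>v[OF cd] c\<Psi>v[OF c\<xi>]])
  have N0: "N z0 \<noteq> 0"
  proof
    assume "N z0 = 0"
    then have "collinear {0, \<Psi> (F z0) (d x0), \<Psi> (F z0) (\<xi> x0)}"
      by (simp add: N_def z0_def cross_eq_0)
    then obtain \<alpha> \<beta> :: real where "(\<alpha>, \<beta>) \<noteq> (0, 0)" "\<alpha> *\<^sub>R \<Psi> (F z0) (\<xi> x0) + \<beta> *\<^sub>R \<Psi> (F z0) (d x0) = 0"
    proof -
      assume that: "\<And>\<alpha> \<beta>. (\<alpha>, \<beta>) \<noteq> (0, 0) \<Longrightarrow> \<alpha> *\<^sub>R \<Psi> (F z0) (\<xi> x0) + \<beta> *\<^sub>R \<Psi> (F z0) (d x0) = 0 \<Longrightarrow> thesis"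
      assume "collinear {0, \<Psi> (F z0) (d x0), \<Psi> (F z0) (\<xi> x0)}"
      then consider "\<Psi> (F z0) (d x0) = 0" | "\<Psi> (F z0) (\<xi> x0) = 0" | c where "\<Psi> (F z0) (\<xi> x0) = c *\<^sub>R \<Psi> (F z0) (d x0)"
        unfolding collinear_lemma by blast
      then show thesis
      proof cases
        case 1 then show ?thesis using that[of 0 1] by simp
      next
        case 2 then show ?thesis using that[of 1 0] by simp
      next
        case 3 then show ?thesis using that[of 1 "- c"] by simp
      qed
    qed
    then have "\<Psi> (F z0) (\<alpha> *\<^sub>R \<xi> x0 + \<beta> *\<^sub>R d x0) = 0"
      by (simp add: linear_add[OF lin\<Psi>[OF \<psi>(2)]] linear_cmul[OF lin\<Psi>[OF \<psi>(2)]])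
    then have 0: "\<alpha> *\<^sub>R \<xi> x0 + \<beta> *\<^sub>R d x0 = 0"
      using linear_injective_0[OF lin\<Psi>[OF \<psi>(2)]] inj\<Psi> by blast
    have "\<beta> *\<^sub>R cross3 (\<xi> x0) (d x0) = cross3 (\<xi> x0) (\<alpha> *\<^sub>R \<xi> x0 + \<beta> *\<^sub>R d x0)"
      by (simp add: cross_add_right cross_mult_right)
    then have "\<beta> = 0" unfolding 0 using indep by simp
    have "\<alpha> *\<^sub>R cross3 (\<xi> x0) (d x0) = cross3 (\<alpha> *\<^sub>R \<xi> x0 + \<beta> *\<^sub>R d x0) (d x0)"
      by (simp add: cross_add_left cross_mult_left)
    then have "\<alpha> = 0" unfolding 0 using indep by simp
    then show False using \<open>(\<alpha>, \<beta>) \<noteq> (0, 0)\<close> \<open>\<beta> = 0\<close> by simp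
  qed
  have cP: "isCont (\<lambda>z. P z h) z0" for h
    unfolding P_def by (intro smooth_at_imp_isCont smooth_at_frechet_derivative s\<phi>)
  have cJ: "isCont J z0" unfolding J_def by (intro continuous_intros cP)
  have c\<phi>: "isCont \<phi> z0" using s\<phi> smooth_at_imp_isCont by blast
  have cn: "isCont beaks_normal w" for w
    unfolding beaks_normal_def vector_3_eq by (intro continuous_intros)
  have n0: "beaks_normal (0, 0) \<noteq> 0" by (simp add: beaks_normal_def vec_eq_iff forall_3)
  have nne: "beaks_normal w \<noteq> 0" for w by (simp add: beaks_normal_def vec_eq_iff forall_3)
  have dlam: "(beaks_lambda has_derivative (\<lambda>h. 0)) (at (0, 0))"
    unfolding beaks_lambda_def by (auto intro!: derivative_eq_intros)
  have lam0: "beaks_lambda (0, 0) = 0" by (simp add: beaks_lambda_def)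
  have alongcurve: "((\<lambda>\<tau>. J (z \<tau>)) \<longlongrightarrow> J z0) (at 0)" "((\<lambda>\<tau>. N (z \<tau>)) \<longlongrightarrow> N z0) (at 0)"
      "((\<lambda>\<tau>. beaks_normal (\<phi> (z \<tau>))) \<longlongrightarrow> beaks_normal (0, 0)) (at 0)"
      "\<And>Q. \<forall>\<^sub>F z in nhds z0. Q z \<Longrightarrow> \<forall>\<^sub>F \<tau> in nhds 0. Q (z \<tau>)"
    if "isCont z 0" "z 0 = z0" for z :: "real \<Rightarrow> real \<times> real"
  proof -
    have lim: "(z \<longlongrightarrow> z0) (at 0)" using that by (simp add: isCont_def)
    show "((\<lambda>\<tau>. J (z \<tau>)) \<longlongrightarrow> J z0) (at 0)" by (rule isCont_tendsto_compose[OF cJ lim])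
    show "((\<lambda>\<tau>. N (z \<tau>)) \<longlongrightarrow> N z0) (at 0)" by (rule isCont_tendsto_compose[OF cN lim])
    have "((\<lambda>\<tau>. \<phi> (z \<tau>)) \<longlongrightarrow> (0, 0)) (at 0)" using isCont_tendsto_compose[OF c\<phi> lim] \<phi>(3) by simp
    then show "((\<lambda>\<tau>. beaks_normal (\<phi> (z \<tau>))) \<longlongrightarrow> beaks_normal (0, 0)) (at 0)"
      by (rule isCont_tendsto_compose[OF cn])
    show "\<forall>\<^sub>F \<tau> in nhds 0. Q (z \<tau>)" if "\<forall>\<^sub>F z in nhds z0. Q z" for Q
      using eventually_nhds_isCont[of 0 z Q] that \<open>isCont z 0\<close> \<open>z 0 = z0\<close> by simp
  qed
  show \<delta>0: "\<delta> x0 = 0"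
  proof -
    \<comment> \<open>Along the ruling \<mu> is linear with slope \<delta>(x0), whereas \<lambda>
      has zero derivative at the origin.\<close>
    define z where "z \<tau> = (x0, t x0 + \<tau>)" for \<tau> :: real
    have z: "isCont z 0" "z 0 = z0" unfolding z_def by (auto simp: z0_def intro!: continuous_intros)
    have "(z has_derivative (\<lambda>h. (0, h))) (at 0)"
      unfolding z_def by (auto intro!: derivative_eq_intros)
    then have "((\<lambda>\<tau>. \<phi> (z \<tau>)) has_derivative (\<lambda>h. P z0 (0, h))) (at 0)"
      by (rule has_derivative_compose) (simp add: z P \<phi>)
    then have "((\<lambda>\<tau>. beaks_lambda (\<phi> (z \<tau>))) has_derivative (\<lambda>h. 0)) (at 0)"
      by (rule has_derivative_compose) (simp add: z \<phi> dlam)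
    then have "((\<lambda>\<tau>. beaks_lambda (\<phi> (z \<tau>))) has_vector_derivative 0) (at 0)"
      by (simp add: has_vector_derivative_def)
    then have lq: "((\<lambda>\<tau>. beaks_lambda (\<phi> (z \<tau>)) /\<^sub>R \<tau>) \<longlongrightarrow> 0) (at 0)"
      by (rule quotient_limit) (simp add: z \<phi> lam0)
    have "((\<lambda>\<tau>. (J (z \<tau>) * (beaks_lambda (\<phi> (z \<tau>)) /\<^sub>R \<tau>)) *\<^sub>R beaks_normal (\<phi> (z \<tau>))) \<longlongrightarrow> (J z0 * 0) *\<^sub>R
        beaks_normal (0, 0)) (at 0)"
      by (intro tendsto_intros alongcurve z lq)
    moreover have "\<forall>\<^sub>F \<tau> in at 0. (J (z \<tau>) * (beaks_lambda (\<phi> (z \<tau>)) /\<^sub>R \<tau>)) *\<^sub>R beaks_normal (\<phi> (z \<tau>)) = \<delta> x0 *\<^sub>R N (z \<tau>)"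
    proof -
      have "\<forall>\<^sub>F \<tau> in nhds 0. \<tau> \<noteq> 0 \<longrightarrow> (J (z \<tau>) * (beaks_lambda (\<phi> (z \<tau>)) /\<^sub>R \<tau>)) *\<^sub>R beaks_normal (\<phi> (z \<tau>))
          = \<delta> x0 *\<^sub>R N (z \<tau>)"
        using alongcurve(4)[OF z key]
      proof eventually_elim
        case (elim \<tau>)
        show ?case
        proof
          assume \<tau>: "\<tau> \<noteq> 0"
          have "(J (z \<tau>) * (beaks_lambda (\<phi> (z \<tau>)) /\<^sub>R \<tau>)) *\<^sub>R beaks_normal (\<phi> (z \<tau>)) =
              inverse \<tau> *\<^sub>R ((J (z \<tau>) * beaks_lambda (\<phi> (z \<tau>))) *\<^sub>R beaks_normal (\<phi> (z \<tau>)))"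
            by (simp add: mult_ac)
          also have "\<dots> = \<delta> x0 *\<^sub>R N (z \<tau>)"
            unfolding elim using \<tau> by (simp add: \<mu>_def z_def)
          finally show "(J (z \<tau>) * (beaks_lambda (\<phi> (z \<tau>)) /\<^sub>R \<tau>)) *\<^sub>R beaks_normal (\<phi> (z \<tau>)) = \<delta> x0 *\<^sub>R N (z \<tau>)" .
        qed
      qed
      then show ?thesis by (simp add: eventually_at_filter)
    qed
    ultimately have "((\<lambda>\<tau>. \<delta> x0 *\<^sub>R N (z \<tau>)) \<longlongrightarrow> 0) (at 0)"
      using tendsto_cong by fastforce
    moreover have "((\<lambda>\<tau>. \<delta> x0 *\<^sub>R N (z \<tau>)) \<longlongrightarrow> \<delta> x0 *\<^sub>R N z0) (at 0)"
      by (intro tendsto_intros alongcurve z)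
    ultimately have "\<delta> x0 *\<^sub>R N z0 = 0" using tendsto_unique trivial_limit_at by blast
    then show ?thesis using N0 by simp
  qed
  show \<delta>1: "\<delta>1 \<noteq> 0"
  proof
    assume 0: "\<delta>1 = 0"
    define g where "g = inv_into U1 \<phi>"
    have g: "local_diffeo g (0, 0)" using diffeo_on_imp_local_diffeo(2)[OF \<phi>(1,2)] \<phi>(3) by (simp add: g_def)
    have bij: "bij_betw \<phi> U1 U2" and oU2: "open U2" using \<phi>(1) by (auto simp: diffeo_on_def)
    have g0: "g (0, 0) = z0" using bij_betw_inv_into_left[OF bij \<phi>(2)] \<phi>(3) by (simp add: g_def)
    have U2: "(0, 0) \<in> U2" using bij_betwE[OF bij] \<phi>(2,3) by metis
    \<comment> \<open>Along the preimage of the u-axis \<lambda> is exactly \<epsilon>^2. If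
      \<delta>' vanished too, \<mu> would be o(\<epsilon>^2), being a product of two functions of
      orders \<epsilon> and o(\<epsilon>).\<close>
    define z where "z \<epsilon> = g (\<epsilon>, 0)" for \<epsilon> :: real
    define Dg where "Dg = frechet_derivative g (at (0, 0))"
    have Dg: "(g has_derivative Dg) (at (0, 0))"
      unfolding Dg_def using g local_diffeo_def smooth_at_imp_has_derivative by blast
    have dz: "(z has_derivative (\<lambda>h. Dg (h, 0))) (at 0)"
      unfolding z_def by (rule has_derivative_compose[where f = "\<lambda>\<epsilon>. (\<epsilon>, 0)", OF _ Dg]) (auto intro!: derivative_eq_intros)
    have z: "isCont z 0" "z 0 = z0" using dz has_derivative_continuous g0 by (auto simp: z_def)
    have zv: "(z has_vector_derivative Dg (1, 0)) (at 0)"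
    proof -
      have "(\<lambda>h. Dg (h, 0)) = (\<lambda>h. h *\<^sub>R Dg (1, 0))"
        using linear_cmul[OF has_derivative_linear[OF Dg], of _ "(1, 0)", symmetric] by (intro ext) simp
      with dz show ?thesis unfolding has_vector_derivative_def by metis
    qed
    have zf: "((\<lambda>\<epsilon>. fst (z \<epsilon>)) has_field_derivative fst (Dg (1, 0))) (at 0)"
      and zs: "((\<lambda>\<epsilon>. snd (z \<epsilon>)) has_field_derivative snd (Dg (1, 0))) (at 0)"
      using bounded_linear.has_vector_derivative[OF bounded_linear_fst zv]
          bounded_linear.has_vector_derivative[OF bounded_linear_snd zv]
      by (simp_all add: has_real_derivative_iff_has_vector_derivative)
    have z0f: "fst (z 0) = x0" "snd (z 0) = t x0" by (simp_all add: z z0_def)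
    have "((\<lambda>\<epsilon>. \<delta> (fst (z \<epsilon>))) has_field_derivative \<delta>1 * fst (Dg (1, 0))) (at 0)"
      by (rule DERIV_chain2[OF _ zf]) (simp add: z0f d\<delta>)
    then have q1: "((\<lambda>\<epsilon>. \<delta> (fst (z \<epsilon>)) /\<^sub>R \<epsilon>) \<longlongrightarrow> 0) (at 0)"
      using quotient_limit[of "\<lambda>\<epsilon>. \<delta> (fst (z \<epsilon>))" "\<delta>1 * fst (Dg (1, 0))"]
      by (simp add: has_real_derivative_iff_has_vector_derivative 0 z0f \<delta>0)
    have "((\<lambda>\<epsilon>. snd (z \<epsilon>) - t (fst (z \<epsilon>))) has_field_derivative snd (Dg (1, 0)) - b * fst (Dg (1, 0))) (at 0)"
      by (intro DERIV_diff zs DERIV_chain2[OF _ zf]) (simp add: z0f dt)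
    then have q2: "((\<lambda>\<epsilon>. (snd (z \<epsilon>) - t (fst (z \<epsilon>))) /\<^sub>R \<epsilon>) \<longlongrightarrow> snd (Dg (1, 0)) - b * fst (Dg (1, 0))) (at 0)"
      by (intro quotient_limit) (simp_all add: has_real_derivative_iff_has_vector_derivative z0f)
    have "((\<lambda>\<epsilon>. (((snd (z \<epsilon>) - t (fst (z \<epsilon>))) /\<^sub>R \<epsilon>) * (\<delta> (fst (z \<epsilon>)) /\<^sub>R \<epsilon>)) *\<^sub>R N (z \<epsilon>))
        \<longlongrightarrow> ((snd (Dg (1, 0)) - b * fst (Dg (1, 0))) * 0) *\<^sub>R N z0) (at 0)"
      by (intro tendsto_intros alongcurve z q1 q2)
    moreover have "\<forall>\<^sub>F \<epsilon> in at 0. (((snd (z \<epsilon>) - t (fst (z \<epsilon>))) /\<^sub>R \<epsilon>) * (\<delta> (fst (z \<epsilon>)) /\<^sub>R \<epsilon>)) *\<^sub>R N (z \<epsilon>)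
        = J (z \<epsilon>) *\<^sub>R beaks_normal (\<phi> (z \<epsilon>))"
    proof -
      have "isCont (\<lambda>\<epsilon>::real. (\<epsilon>, 0::real)) 0" by (intro continuous_intros)
      then have "\<forall>\<^sub>F \<epsilon> in nhds 0. (\<epsilon>, 0) \<in> U2"
        by (rule eventually_nhds_isCont) (use oU2 U2 in \<open>auto intro: eventually_nhds_in_open\<close>)
      then have "\<forall>\<^sub>F \<epsilon> in nhds 0. \<epsilon> \<noteq> 0 \<longrightarrow> (((snd (z \<epsilon>) - t (fst (z \<epsilon>))) /\<^sub>R \<epsilon>) * (\<delta> (fst (z \<epsilon>)) /\<^sub>R \<epsilon>)) *\<^sub>R N (z \<epsilon>)
        = J (z \<epsilon>) *\<^sub>R beaks_normal (\<phi> (z \<epsilon>))"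
        using alongcurve(4)[OF z key]
      proof eventually_elim
        case (elim \<epsilon>)
        have \<phi>z: "\<phi> (z \<epsilon>) = (\<epsilon>, 0)" using bij_betw_inv_into_right[OF bij elim(1)] by (simp add: z_def g_def)
        show ?case
        proof
          assume e: "\<epsilon> \<noteq> 0"
          have "(((snd (z \<epsilon>) - t (fst (z \<epsilon>))) /\<^sub>R \<epsilon>) * (\<delta> (fst (z \<epsilon>)) /\<^sub>R \<epsilon>)) *\<^sub>R N (z \<epsilon>)
              = (inverse \<epsilon>)^2 *\<^sub>R (\<mu> (z \<epsilon>) *\<^sub>R N (z \<epsilon>))"
            by (simp add: \<mu>_def power2_eq_square mult_ac)
          also have "\<dots> = J (z \<epsilon>) *\<^sub>R beaks_normal (\<phi> (z \<epsilon>))"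
          proof -
            have "(inverse \<epsilon>)\<^sup>2 * (J (z \<epsilon>) * beaks_lambda (\<phi> (z \<epsilon>))) = J (z \<epsilon>)"
              using e by (simp add: \<phi>z beaks_lambda_def power_inverse)
            then show ?thesis unfolding elim(2)[symmetric] by (simp add: mult_ac)
          qed
          finally show "(((snd (z \<epsilon>) - t (fst (z \<epsilon>))) /\<^sub>R \<epsilon>) * (\<delta> (fst (z \<epsilon>)) /\<^sub>R \<epsilon>)) *\<^sub>R N (z \<epsilon>)
            = J (z \<epsilon>) *\<^sub>R beaks_normal (\<phi> (z \<epsilon>))" .
        qed
      qed
      then show ?thesis by (simp add: eventually_at_filter)
    qed
    ultimately have "((\<lambda>\<epsilon>. J (z \<epsilon>) *\<^sub>R beaks_normal (\<phi> (z \<epsilon>))) \<longlongrightarrow> 0) (at 0)"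
      using tendsto_cong by fastforce
    moreover have "((\<lambda>\<epsilon>. J (z \<epsilon>) *\<^sub>R beaks_normal (\<phi> (z \<epsilon>))) \<longlongrightarrow> J z0 *\<^sub>R beaks_normal (0, 0)) (at 0)"
      by (intro tendsto_intros alongcurve z)
    ultimately have "J z0 *\<^sub>R beaks_normal (0, 0) = 0" using tendsto_unique trivial_limit_at by blast
    then show False using J0 n0 by simp
  qed
  have fz0: "fst z0 = x0" by (simp add: z0_def)
  have ker0: "fst (P z0 h) = 0" if "fst h *\<^sub>R Fx z0 + snd h *\<^sub>R \<xi> x0 = 0" for h
  proof -
    have "G (P z0 h) (\<phi> z0) = \<Psi> (F z0) 0"
      using conjunct2[OF eventually_nhds_x_imp_x[OF chain], rule_format, of h] that fz0 by simp
    then have "G (P z0 h) (\<phi> z0) = 0" using linear_0[OF lin\<Psi>[OF \<psi>(2)]] by simp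
    then show ?thesis by (rule G_lin)
  qed
  show a0: "p x0 + b \<noteq> 0"
  proof
    assume pb: "p x0 + b = 0"
    \<comment> \<open>On the striction curve \<mu> = 0, so its image lies in \<lambda> = 0, and the
      tangent w satisfies \<lambda>(w) = 0 as \<lambda> is homogeneous. If p + t' = 0, the curve is
      tangent to the kernel, which \<phi>' maps to the v-axis; then \<lambda>(w) = - 6 w_2^2 forces
      w = 0.\<close>
    define z where "z \<tau> = (x0 + \<tau>, t (x0 + \<tau>))" for \<tau> :: real
    have dt0: "((\<lambda>\<tau>. t (x0 + \<tau>)) has_derivative (\<lambda>h. b * h)) (at 0)"
      by (rule has_derivative_compose[where f = "\<lambda>\<tau>. x0 + \<tau>" and g = t])
        (use dt in \<open>auto simp: has_field_derivative_def intro!: derivative_eq_intros\<close>)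
    have dz: "(z has_derivative (\<lambda>h. (h, b * h))) (at 0)"
      unfolding z_def by (intro has_derivative_Pair dt0) (auto intro!: derivative_eq_intros)
    have z: "isCont z 0" "z 0 = z0" using dz has_derivative_continuous by (auto simp: z_def z0_def)
    define w where "w = P z0 (1, b)"
    have "((\<lambda>\<tau>. \<phi> (z \<tau>)) has_derivative (\<lambda>h. P z0 (h, b * h))) (at 0)"
      by (rule has_derivative_compose[OF dz]) (simp add: z P \<phi>)
    moreover have "P z0 (h, b * h) = h *\<^sub>R w" for h
      using linear_cmul[OF linP, of h "(1, b)"] by (simp add: w_def mult.commute)
    ultimately have dw: "((\<lambda>\<tau>. \<phi> (z \<tau>)) has_vector_derivative w) (at 0)"
      by (simp add: has_vector_derivative_def)
    have "((\<lambda>\<tau>. \<phi> (z \<tau>) /\<^sub>R \<tau>) \<longlongrightarrow> w) (at 0)"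
      by (rule quotient_limit[OF dw]) (simp add: z \<phi> zero_prod_def)
    then have "((\<lambda>\<tau>. beaks_lambda (\<phi> (z \<tau>) /\<^sub>R \<tau>)) \<longlongrightarrow> beaks_lambda w) (at 0)"
      by (rule isCont_tendsto_compose[rotated]) (auto simp: beaks_lambda_def intro!: continuous_intros)
    moreover have "\<forall>\<^sub>F \<tau> in at 0. beaks_lambda (\<phi> (z \<tau>) /\<^sub>R \<tau>) = 0"
    proof -
      have "\<forall>\<^sub>F y in nhds (J z0). y \<in> - {0}"
        using J0 by (intro eventually_nhds_in_open open_Compl closed_singleton) simp
      then have "\<forall>\<^sub>F z in nhds z0. J z \<in> - {0}" by (rule eventually_nhds_isCont[OF cJ])
      from alongcurve(4)[OF z this] alongcurve(4)[OF z key]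
      have "\<forall>\<^sub>F \<tau> in nhds 0. beaks_lambda (\<phi> (z \<tau>) /\<^sub>R \<tau>) = 0"
      proof eventually_elim
        case (elim \<tau>)
        have "\<mu> (z \<tau>) = 0" by (simp add: \<mu>_def z_def)
        then have "beaks_lambda (\<phi> (z \<tau>)) = 0" using elim nne by simp
        moreover have "beaks_lambda (\<phi> (z \<tau>) /\<^sub>R \<tau>) = (inverse \<tau>)^2 * beaks_lambda (\<phi> (z \<tau>))"
          by (simp add: beaks_lambda_def power_mult_distrib algebra_simps)
        ultimately show ?case by simp
      qed
      then show ?thesis by (simp add: eventually_at_filter eventually_mono)
    qed
    then have "((\<lambda>\<tau>. beaks_lambda (\<phi> (z \<tau>) /\<^sub>R \<tau>)) \<longlongrightarrow> 0) (at 0)" by (rule tendsto_eventually)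
    ultimately have "beaks_lambda w = 0" using tendsto_unique trivial_limit_at by blast
    moreover have "fst w = 0"
      unfolding w_def by (rule ker0) (simp add: Fx0 pb flip: scaleR_add_left)
    ultimately have "w = 0" by (simp add: beaks_lambda_def prod_eq_iff)
    then have "(1::real, b) = 0" unfolding w_def using linear_injective_0[OF linP] injP by blast
    then show False by (simp add: zero_prod_def)
  qed
  show "\<xi> x0 \<bullet> cross3 (d x0) d1 \<noteq> 0"
  proof
    assume cop: "\<xi> x0 \<bullet> cross3 (d x0) d1 = 0"
    obtain \<alpha> \<beta> where d1: "d1 = \<alpha> *\<^sub>R \<xi> x0 + \<beta> *\<^sub>R d x0" by (rule span_if_coplanar[OF cop indep])
    define p0 where "p0 = p x0"
    \<comment> \<open>A line tangent to the kernel. The normal of the model annihilates the images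
      of \<xi> and d along it; differentiating these relations at 0 relates the motion of the normal
      to d'.\<close>
    define z where "z \<tau> = (x0 + \<tau>, t x0 - p0 * \<tau>)" for \<tau> :: real
    have dz: "(z has_derivative (\<lambda>h. (h, - p0 * h))) (at 0)"
      unfolding z_def by (auto intro!: derivative_eq_intros)
    have z: "isCont z 0" "z 0 = z0" using dz has_derivative_continuous by (auto simp: z_def z0_def)
    have kerF: "h *\<^sub>R Fx z0 + (- p0 * h) *\<^sub>R \<xi> x0 = 0" for h by (simp add: Fx0 p0_def)
    have dFz: "((\<lambda>\<tau>. F (z \<tau>)) has_derivative (\<lambda>h. 0)) (at 0)"
      using has_derivative_compose[OF dz, of F "\<lambda>h. fst h *\<^sub>R Fx z0 + snd h *\<^sub>R \<xi> x0"] dF0 kerF by (simp add: z)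
    define w where "w = P z0 (1, - p0)"
    have w1: "fst w = 0" unfolding w_def by (rule ker0) (use kerF[of 1] in simp)
    have "w \<noteq> 0"
    proof
      assume "w = 0"
      then have "(1::real, - p0) = 0" unfolding w_def using linear_injective_0[OF linP] injP by blast
      then show False by (simp add: zero_prod_def)
    qed
    then have w2: "snd w \<noteq> 0" using w1 by (auto simp: prod_eq_iff)
    have "((\<lambda>\<tau>. \<phi> (z \<tau>)) has_derivative (\<lambda>h. P z0 (h, - p0 * h))) (at 0)"
      by (rule has_derivative_compose[OF dz]) (simp add: z P \<phi>)
    moreover have "P z0 (h, - p0 * h) = h *\<^sub>R w" for h
      using linear_cmul[OF linP, of h "(1, - p0)"] by (simp add: w_def mult.commute)
    ultimately have d\<phi>z: "((\<lambda>\<tau>. \<phi> (z \<tau>)) has_derivative (\<lambda>h. h *\<^sub>R w)) (at 0)" by simp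
    have "(beaks_normal has_derivative (\<lambda>h. vector [0, 2 * snd h, 0])) (at (0, 0))"
      unfolding beaks_normal_def
      by (intro has_derivative_vector_3) (auto intro!: derivative_eq_intros)
    then have "((\<lambda>\<tau>. beaks_normal (\<phi> (z \<tau>))) has_derivative (\<lambda>h. vector [0, 2 * snd (h *\<^sub>R w), 0])) (at 0)"
      by (intro has_derivative_compose[OF d\<phi>z]) (simp add: z \<phi>)
    then have dn: "((\<lambda>\<tau>. beaks_normal (\<phi> (z \<tau>))) has_vector_derivative vector [0, 2 * snd w, 0]) (at 0)"
      unfolding has_vector_derivative_def
      by (rule has_derivative_eq_rhs) (simp add: fun_eq_iff vec_eq_iff forall_3)
    define \<Psi>0 where "\<Psi>0 = \<Psi> (F z0)"
    have lin0: "linear \<Psi>0" unfolding \<Psi>0_def by (rule lin\<Psi>[OF \<psi>(2)])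
    have d\<Psi>: "((\<lambda>\<tau>. \<Psi> (F (z \<tau>)) (v (x0 + \<tau>))) has_vector_derivative \<Psi>0 v') (at 0)"
      if v: "(v has_vector_derivative v') (at x0)" for v :: "real \<Rightarrow> real^3" and v'
    proof -
      \<comment> \<open>F along this line has zero derivative at 0, so \<psi>' is stationary to
        first order and only the vector v contributes.\<close>
      have i: "((\<lambda>\<tau>. \<Psi> (F (z \<tau>)) e) has_vector_derivative 0) (at 0)" for e
      proof -
        let ?D = "frechet_derivative (\<lambda>y. \<Psi> y e) (at (F z0))"
        have D: "((\<lambda>y. \<Psi> y e) has_derivative ?D) (at (F z0))" by (rule smooth_at_imp_has_derivative[OF s\<Psi>])
        have "((\<lambda>\<tau>. \<Psi> (F (z \<tau>)) e) has_derivative (\<lambda>h. ?D 0)) (at 0)"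
          by (rule has_derivative_compose[OF dFz]) (simp add: z D)
        moreover have "?D 0 = 0" using linear_0[OF has_derivative_linear[OF D]] .
        ultimately show ?thesis by (simp add: has_vector_derivative_def)
      qed
      have vx: "((\<lambda>\<tau>. v (x0 + \<tau>) \<bullet> e) has_field_derivative v' \<bullet> e) (at 0)" for e
      proof -
        have "((\<lambda>x. v x \<bullet> e) has_field_derivative v' \<bullet> e) (at (x0 + 0))"
          using bounded_linear.has_vector_derivative[OF bounded_linear_inner_left v]
          by (simp add: has_real_derivative_iff_has_vector_derivative)
        moreover have "((\<lambda>\<tau>. x0 + \<tau>) has_field_derivative 1) (at 0)" by (auto intro!: derivative_eq_intros)
        ultimately have "((\<lambda>\<tau>. v (x0 + \<tau>) \<bullet> e) has_field_derivative (v' \<bullet> e) * 1) (at 0)"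
          by (rule DERIV_chain2[where g = "\<lambda>\<tau>. x0 + \<tau>"])
        then show ?thesis by simp
      qed
      have "((\<lambda>\<tau>. \<Sum>e\<in>Basis. (v (x0 + \<tau>) \<bullet> e) *\<^sub>R \<Psi> (F (z \<tau>)) e) has_vector_derivative
          (\<Sum>e\<in>Basis. (v (x0 + 0) \<bullet> e) *\<^sub>R 0 + (v' \<bullet> e) *\<^sub>R \<Psi> (F (z 0)) e)) (at 0)"
        by (intro has_vector_derivative_sum has_vector_derivative_scaleR vx i)
      moreover have "(\<Sum>e\<in>Basis. (v (x0 + 0) \<bullet> e) *\<^sub>R 0 + (v' \<bullet> e) *\<^sub>R \<Psi> (F (z 0)) e) = \<Psi>0 v'"
        using \<Psi>_expand[OF \<psi>(2), of v'] by (simp add: z \<Psi>0_def)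
      ultimately have s: "((\<lambda>\<tau>. \<Sum>e\<in>Basis. (v (x0 + \<tau>) \<bullet> e) *\<^sub>R \<Psi> (F (z \<tau>)) e) has_vector_derivative \<Psi>0 v') (at 0)"
        by simp
      obtain S where S: "open S" "0 \<in> S" "\<And>\<tau>. \<tau> \<in> S \<Longrightarrow> z \<tau> \<in> U1"
        using alongcurve(4)[OF z evU] unfolding eventually_nhds by blast
      show ?thesis
      proof (rule has_vector_derivative_transform_within_open[OF s S(1,2)])
        fix \<tau> assume "\<tau> \<in> S"
        then have "F (z \<tau>) \<in> V1" using S(3) eq by blast
        then show "(\<Sum>e\<in>Basis. (v (x0 + \<tau>) \<bullet> e) *\<^sub>R \<Psi> (F (z \<tau>)) e) = \<Psi> (F (z \<tau>)) (v (x0 + \<tau>))"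
          by (rule \<Psi>_expand[symmetric])
      qed
    qed
    have d\<xi>0: "(\<xi> has_vector_derivative 0) (at x0)" using eventually_nhds_x_imp_x[OF d\<xi>] \<delta>0 by simp
    define g where "g v \<tau> = beaks_normal (\<phi> (z \<tau>)) \<bullet> \<Psi> (F (z \<tau>)) (v (x0 + \<tau>))" for v :: "real \<Rightarrow> real^3" and \<tau>
    have n00: "beaks_normal (\<phi> (z 0)) = axis 3 1"
      by (simp add: z \<phi> beaks_normal_def vec_eq_iff forall_3 axis_def)
    have dg: "(g v has_field_derivative 2 * snd w * vec_nth (\<Psi>0 (v x0)) 2 + vec_nth (\<Psi>0 v') 3) (at 0)"
      if "(v has_vector_derivative v') (at x0)" for v v'
    proof -
      have "(g v has_vector_derivative beaks_normal (\<phi> (z 0)) \<bullet> \<Psi>0 v' + vector [0, 2 * snd w, 0] \<bullet> \<Psi> (F (z 0))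
          (v (x0 + 0))) (at 0)"
        unfolding g_def[abs_def]
        by (rule bounded_bilinear.has_vector_derivative[OF bounded_bilinear_inner dn d\<Psi>[OF that]])
      moreover have "beaks_normal (\<phi> (z 0)) \<bullet> \<Psi>0 v' + vector [0, 2 * snd w, 0] \<bullet> \<Psi> (F (z 0)) (v (x0 + 0))
          = 2 * snd w * vec_nth (\<Psi>0 (v x0)) 2 + vec_nth (\<Psi>0 v') 3"
        unfolding n00 by (simp add: inner_axis' z \<Psi>0_def[symmetric]) (simp add: inner_vec_def sum_3)
      ultimately show ?thesis by (simp add: has_real_derivative_iff_has_vector_derivative)
    qed
    have g00: "g v 0 = vec_nth (\<Psi>0 (v x0)) 3" for v
      unfolding g_def n00 by (simp add: inner_axis' z \<Psi>0_def)
    have gz: "\<forall>\<^sub>F \<tau> in nhds 0. g \<xi> \<tau> = 0 \<and> \<mu> (z \<tau>) * g d \<tau> = 0"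
      using alongcurve(4)[OF z chain]
    proof eventually_elim
      case (elim \<tau>)
      have V: "F (z \<tau>) \<in> V1" using elim eq by blast
      have o: "beaks_normal (\<phi> (z \<tau>)) \<bullet> G h (\<phi> (z \<tau>)) = 0" for h unfolding G_def by (rule beaks_normal_orthogonal)
      have fz: "fst (z \<tau>) = x0 + \<tau>" by (simp add: z_def)
      have 1: "G (P (z \<tau>) (1, 0)) (\<phi> (z \<tau>)) = \<Psi> (F (z \<tau>)) (Fx (z \<tau>))"
        and 2: "G (P (z \<tau>) (0, 1)) (\<phi> (z \<tau>)) = \<Psi> (F (z \<tau>)) (\<xi> (x0 + \<tau>))"
        using elim fz by simp_all
      have gx: "g \<xi> \<tau> = 0" unfolding g_def 2[symmetric] by (rule o)
      have "0 = beaks_normal (\<phi> (z \<tau>)) \<bullet> \<Psi> (F (z \<tau>)) (Fx (z \<tau>))" unfolding 1[symmetric] using o by simp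
      also have "\<dots> = p (x0 + \<tau>) * g \<xi> \<tau> + \<mu> (z \<tau>) * g d \<tau>"
        unfolding Fx_def fz g_def
        by (simp add: linear_add[OF lin\<Psi>[OF V]] linear_cmul[OF lin\<Psi>[OF V]] inner_add_right)
      finally show ?case using gx by simp
    qed
    have zero: "2 * snd w * vec_nth (\<Psi>0 (v x0)) 2 + vec_nth (\<Psi>0 v') 3 = 0 \<and> vec_nth (\<Psi>0 (v x0)) 3 = 0"
      if v: "(v has_vector_derivative v') (at x0)" and ev: "\<forall>\<^sub>F \<tau> in nhds 0. \<tau> \<noteq> 0 \<longrightarrow> g v \<tau> = 0" for v v'
    proof -
      have "isCont (g v) 0" using dg[OF v] DERIV_isCont by blast
      then have e: "\<forall>\<^sub>F \<tau> in nhds 0. g v \<tau> = 0" using ev by (rule eq_0_limit_real)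
      then obtain S where S: "open S" "0 \<in> S" "\<And>\<tau>. \<tau> \<in> S \<Longrightarrow> g v \<tau> = 0" unfolding eventually_nhds by blast
      have "((\<lambda>\<tau>. 0) has_field_derivative 2 * snd w * vec_nth (\<Psi>0 (v x0)) 2 + vec_nth (\<Psi>0 v') 3) (at 0)"
        by (rule has_field_derivative_transform_within_open[OF dg[OF v] S])
      then have "2 * snd w * vec_nth (\<Psi>0 (v x0)) 2 + vec_nth (\<Psi>0 v') 3 = 0"
        using DERIV_unique DERIV_const by blast
      then show ?thesis using eventually_nhds_x_imp_x[OF e] g00 by simp
    qed
    have ev\<xi>: "\<forall>\<^sub>F \<tau> in nhds 0. \<tau> \<noteq> 0 \<longrightarrow> g \<xi> \<tau> = 0" using gz by (auto elim: eventually_mono)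
    \<comment> \<open>By what is already proved, \<mu>/\<tau>^2 tends to - (p + t') \<delta>', which
      is nonzero. So the normal is orthogonal to the image of d for small \<tau> \<noteq> 0.\<close>
    have \<mu>ne: "\<forall>\<^sub>F \<tau> in at 0. \<mu> (z \<tau>) \<noteq> 0"
    proof -
      have "((\<lambda>\<tau>. \<delta> (x0 + \<tau>)) has_field_derivative \<delta>1 * 1) (at 0)"
        by (rule DERIV_chain2[where g = "\<lambda>\<tau>. x0 + \<tau>"]) (use d\<delta> in \<open>auto intro!: derivative_eq_intros\<close>)
      then have q1: "((\<lambda>\<tau>. \<delta> (x0 + \<tau>) /\<^sub>R \<tau>) \<longlongrightarrow> \<delta>1) (at 0)"
        by (intro quotient_limit) (simp_all add: has_real_derivative_iff_has_vector_derivative \<delta>0)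
      have "((\<lambda>\<tau>. t (x0 + \<tau>)) has_field_derivative b * 1) (at 0)"
        by (rule DERIV_chain2[where g = "\<lambda>\<tau>. x0 + \<tau>"]) (use dt in \<open>auto intro!: derivative_eq_intros\<close>)
      then have "((\<lambda>\<tau>. t x0 - p0 * \<tau> - t (x0 + \<tau>)) has_field_derivative - (p0 + b)) (at 0)"
        by (auto intro!: derivative_eq_intros)
      then have q2: "((\<lambda>\<tau>. (t x0 - p0 * \<tau> - t (x0 + \<tau>)) /\<^sub>R \<tau>) \<longlongrightarrow> - (p0 + b)) (at 0)"
        by (intro quotient_limit) (simp_all add: has_real_derivative_iff_has_vector_derivative)
      have "((\<lambda>\<tau>. ((t x0 - p0 * \<tau> - t (x0 + \<tau>)) /\<^sub>R \<tau>) * (\<delta> (x0 + \<tau>) /\<^sub>R \<tau>)) \<longlongrightarrow> - (p0 + b) * \<delta>1) (at 0)"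
        by (intro tendsto_mult q1 q2)
      moreover have "- (p0 + b) * \<delta>1 \<noteq> 0" using a0 \<delta>1 by (simp add: p0_def)
      ultimately have "\<forall>\<^sub>F \<tau> in at 0. ((t x0 - p0 * \<tau> - t (x0 + \<tau>)) /\<^sub>R \<tau>) * (\<delta> (x0 + \<tau>) /\<^sub>R \<tau>) \<noteq> 0"
        by (rule tendsto_imp_eventually_ne)
      then show ?thesis by eventually_elim (auto simp: \<mu>_def z_def)
    qed
    have evd: "\<forall>\<^sub>F \<tau> in nhds 0. \<tau> \<noteq> 0 \<longrightarrow> g d \<tau> = 0"
    proof -
      have "\<forall>\<^sub>F \<tau> in nhds 0. \<tau> \<noteq> 0 \<longrightarrow> \<mu> (z \<tau>) \<noteq> 0" using \<mu>ne by (simp add: eventually_at_filter)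
      then show ?thesis using gz by eventually_elim auto
    qed
    have z\<xi>: "vec_nth (\<Psi>0 (\<xi> x0)) 2 = 0" "vec_nth (\<Psi>0 (\<xi> x0)) 3 = 0"
      using zero[OF d\<xi>0 ev\<xi>] w2 linear_0[OF lin0] by simp_all
    have zd: "2 * snd w * vec_nth (\<Psi>0 (d x0)) 2 + vec_nth (\<Psi>0 d1) 3 = 0" "vec_nth (\<Psi>0 (d x0)) 3 = 0"
      using zero[OF dd evd] by simp_all
    \<comment> \<open>If d' lies in the span of \<xi> and d, its image has third component 0, hence
      the image of d has second component 0. The images of \<xi> and d are then both multiples of
      the first axis, against their independence.\<close>
    have "vec_nth (\<Psi>0 d1) 3 = 0"
      unfolding d1 using z\<xi> zd(2) by (simp add: linear_add[OF lin0] linear_cmul[OF lin0])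
    then have "vec_nth (\<Psi>0 (d x0)) 2 = 0" using zd(1) w2 by simp
    then have "N z0 = 0"
      unfolding N_def \<Psi>0_def[symmetric] using z\<xi> zd(2)
      by (simp add: z0_def cross3_def vec_eq_iff forall_3)
    then show False using N0 by simp
  qed
qed

section \<open>The developable surface in its moving frame, and the equivalence\<close>

lemma real_ana_norm:
  fixes f :: "real \<Rightarrow> 'b::euclidean_space"
  assumes "real_analytic_on f I" "a \<in> I" "f a \<noteq> 0"
  shows "real_ana (\<lambda>x. norm (f (a + x)))"
proof -
  have "norm (f (a + x)) = sqrt (\<Sum>b\<in>Basis. (f (a + x) \<bullet> b) * (f (a + x) \<bullet> b))" for x
    by (simp add: norm_eq_sqrt_inner euclidean_inner[symmetric])
  moreover have "real_ana (\<lambda>x. sqrt (\<Sum>b\<in>Basis. (f (a + x) \<bullet> b) * (f (a + x) \<bullet> b)))"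
    by (intro real_ana_sqrt real_ana_sum real_ana_mult
        real_analytic_on_imp_real_ana[OF assms(1,2) bounded_linear_inner_left])
      (use assms(3) in \<open>simp add: euclidean_inner[symmetric]\<close>)
  ultimately show ?thesis by simp
qed

lemma smooth_at_vector_derivative:
  assumes "smooth_at f (x::real)"
  shows "smooth_at (\<lambda>y. vector_derivative f (at y)) x"
proof -
  have "\<forall>\<^sub>F y in nhds x. smooth_at f y" by (rule eventually_smooth_at[OF assms])
  then have "\<forall>\<^sub>F y in nhds x. frechet_derivative f (at y) 1 = vector_derivative f (at y)"
  proof eventually_elim
    case (elim y)
    have "(f has_derivative (\<lambda>h. h *\<^sub>R vector_derivative f (at y))) (at y)"
      using smooth_at_imp_differentiable[OF elim] vector_derivative_works has_vector_derivative_def by blast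
    from frechet_derivative_at[OF this, symmetric] show ?case by simp
  qed
  then show ?thesis using smooth_at_frechet_derivative[OF assms] by (rule smooth_at_cong)
qed

lemma smooth_at_has_vector_derivative:
  "smooth_at f (x::real) \<Longrightarrow> (f has_vector_derivative vector_derivative f (at x)) (at x)"
  using smooth_at_imp_differentiable vector_derivative_works by blast

text \<open>If the triple product is nonzero, (y, 0) is a regular point. There N = 0, as the surface
  is linear in t, so the curvature has the sign of - M^2, and M is the component of \<xi>' along the
  normal, which is nonzero.\<close>

lemma developable_imp_coplanar:
  assumes dev: "developable_on I (ruled_surface \<gamma> \<xi>)" and I: "open I" "y \<in> I"
    and d\<gamma>: "\<And>y. y \<in> I \<Longrightarrow> (\<gamma> has_vector_derivative \<gamma>' y) (at y)"
    and d\<xi>: "\<And>y. y \<in> I \<Longrightarrow> (\<xi> has_vector_derivative \<xi>' y) (at y)"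
  shows "\<gamma>' y \<bullet> cross3 (\<xi> y) (\<xi>' y) = 0"
proof (rule ccontr)
  assume ne: "\<gamma>' y \<bullet> cross3 (\<xi> y) (\<xi>' y) \<noteq> 0"
  let ?F = "ruled_surface \<gamma> \<xi>"
  define W where "W = cross3 (\<gamma>' y) (\<xi> y)"
  have W: "W \<bullet> \<xi>' y \<noteq> 0"
    using ne unfolding W_def by (simp add: cross3_def inner_vec_def sum_3 algebra_simps)
  then have W0: "W \<noteq> 0" by auto
  have p1: "partial1 ?F (x, v) = \<gamma>' x + v *\<^sub>R \<xi>' x" if "x \<in> I" for x v
    unfolding partial1_def ruled_surface_def
    by (rule vector_derivative_at) (auto intro!: derivative_eq_intros d\<gamma> d\<xi> that)
  have p2: "partial2 ?F (x, v) = \<xi> x" for x v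
    unfolding partial2_def ruled_surface_def
    by (rule vector_derivative_at) (auto intro!: derivative_eq_intros)
  have p22: "partial2 (partial2 ?F) (y, 0) = 0"
    unfolding partial2_def[of "partial2 ?F"] p2 fst_conv by (rule vector_derivative_at) (auto intro!: derivative_eq_intros)
  have p12: "partial2 (partial1 ?F) (y, 0) = \<xi>' y"
    unfolding partial2_def[of "partial1 ?F"] fst_conv p1[OF I(2)]
    by (rule vector_derivative_at) (auto intro!: derivative_eq_intros)
  have D: "(?F has_derivative (\<lambda>h. fst h *\<^sub>R \<gamma>' y + snd h *\<^sub>R \<xi> y)) (at (y, 0))"
    using ruled_surface_has_derivative[OF d\<gamma>[OF I(2)] d\<xi>[OF I(2)], of 0] by simp
  have "inj (\<lambda>h::real \<times> real. fst h *\<^sub>R \<gamma>' y + snd h *\<^sub>R \<xi> y)"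
    unfolding linear_injective_0[OF has_derivative_linear[OF D]]
  proof (intro allI impI)
    fix h :: "real \<times> real" assume h: "fst h *\<^sub>R \<gamma>' y + snd h *\<^sub>R \<xi> y = 0"
    have "fst h *\<^sub>R W = cross3 (fst h *\<^sub>R \<gamma>' y + snd h *\<^sub>R \<xi> y) (\<xi> y)"
      by (simp add: W_def cross_add_left cross_mult_left)
    then have "fst h = 0" unfolding h using W0 by simp
    have "snd h *\<^sub>R W = cross3 (\<gamma>' y) (fst h *\<^sub>R \<gamma>' y + snd h *\<^sub>R \<xi> y)"
      by (simp add: W_def cross_add_right cross_mult_right)
    then have "snd h = 0" unfolding h using W0 by simp
    with \<open>fst h = 0\<close> show "h = 0" by (simp add: prod_eq_iff)
  qed
  then have "regular_point ?F (y, 0)"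
    using D frechet_derivative_at[OF D] by (auto simp: regular_point_def differentiable_def)
  then have K: "gaussian_curvature ?F (y, 0) = 0" using dev I(2) by (simp add: developable_on_def)
  have den: "(\<gamma>' y \<bullet> \<gamma>' y) * (\<xi> y \<bullet> \<xi> y) - (\<gamma>' y \<bullet> \<xi> y)^2 = W \<bullet> W"
    unfolding W_def by (simp add: cross3_def inner_vec_def sum_3 algebra_simps power2_eq_square)
  have "\<xi>' y \<bullet> W = 0"
    using K W0 unfolding gaussian_curvature_def unit_normal_def p22 p12 p2 p1[OF I(2)]
    by (simp add: den W_def[symmetric])
  then show False using W by (simp add: inner_commute)
qed

text \<open>For y \<noteq> 0 this is the derivative of |\<xi>|^2 = 1 divided by y^k; at y = 0, where
  \<xi>' may vanish, it follows by continuity of \<zeta>.\<close>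

lemma unit_xi_orthogonal:
  assumes "pseudo_cylindrical I k \<xi> \<zeta>" "real_analytic_on \<xi> I" "open I" "\<forall>y\<in>I. \<xi> y \<in> sphere 0 1" "y \<in> I"
  shows "\<xi> y \<bullet> \<zeta> y = 0"
proof -
  have s\<xi>: "smooth_at \<xi> y" if "y \<in> I" for y by (rule real_analytic_on_imp_smooth_at[OF assms(2) that])
  have s\<zeta>: "smooth_at \<zeta> y" if "y \<in> I" for y
    using assms(1) that real_analytic_on_imp_smooth_at unfolding pseudo_cylindrical_def by blast
  have *: "\<xi> y \<bullet> \<zeta> y = 0" if y: "y \<in> I" "y \<noteq> 0" for y
  proof -
    have d: "(\<xi> has_vector_derivative y ^ k *\<^sub>R \<zeta> y) (at y)"
      using smooth_at_has_vector_derivative[OF s\<xi>[OF y(1)]] assms(1) y(1) by (simp add: pseudo_cylindrical_def)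
    have "((\<lambda>y. \<xi> y \<bullet> \<xi> y) has_vector_derivative \<xi> y \<bullet> (y ^ k *\<^sub>R \<zeta> y) + (y ^ k *\<^sub>R \<zeta> y) \<bullet> \<xi> y) (at y)"
      by (rule bounded_bilinear.has_vector_derivative[OF bounded_bilinear_inner d d])
    moreover have "((\<lambda>y. \<xi> y \<bullet> \<xi> y) has_vector_derivative 0) (at y)"
    proof (rule has_vector_derivative_transform_within_open[OF _ assms(3) y(1)])
      show "((\<lambda>y. 1 :: real) has_vector_derivative 0) (at y)" by simp
      show "1 = \<xi> z \<bullet> \<xi> z" if "z \<in> I" for z
        using assms(4) that by (simp add: norm_eq_1)
    qed
    ultimately have "\<xi> y \<bullet> (y ^ k *\<^sub>R \<zeta> y) + (y ^ k *\<^sub>R \<zeta> y) \<bullet> \<xi> y = 0" by (rule vector_derivative_unique_at)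
    then show ?thesis using y(2) by (simp add: inner_commute)
  qed
  show ?thesis
  proof (cases "y = 0")
    case True
    have "\<forall>\<^sub>F z in nhds 0. z \<in> I" using assms(3,5) True by (simp add: eventually_nhds_in_open)
    then have "\<forall>\<^sub>F z in nhds 0. z \<noteq> 0 \<longrightarrow> \<xi> z \<bullet> \<zeta> z = 0" by eventually_elim (use * in auto)
    moreover have "isCont (\<lambda>z. \<xi> z \<bullet> \<zeta> z) 0"
      by (intro smooth_at_imp_isCont smooth_at_inner s\<xi> s\<zeta>) (use assms(5) True in auto)
    ultimately have "\<forall>\<^sub>F z in nhds 0. \<xi> z \<bullet> \<zeta> z = 0" by (intro eq_0_limit_real)
    then show ?thesis using eventually_nhds_x_imp_x True by blast
  qed (use * assms(5) in auto)
qed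

theorem corollary3p14:
  fixes I :: "real set" and \<gamma> \<xi> \<zeta> :: "real \<Rightarrow> real^3"
    and p q r qt :: "real \<Rightarrow> real" and k Q :: nat and x :: real
  assumes "open I" and "is_interval I" and "0 \<in> I"
    and "real_analytic_on \<gamma> I" and "\<gamma> 0 = 0"
    and "real_analytic_on \<xi> I" and "\<forall>y\<in>I. \<xi> y \<in> sphere 0 1"
    and "pseudo_cylindrical I k \<xi> \<zeta>"
    and "\<forall>y\<in>I. vector_derivative \<gamma> (at y) =
           p y *\<^sub>R \<xi> y + q y *\<^sub>R xi_d \<zeta> y + r y *\<^sub>R cross3 (\<xi> y) (xi_d \<zeta> y)"
    and "developable_on I (ruled_surface \<gamma> \<xi>)"
    and "real_analytic_on qt I" and "\<forall>y\<in>I. q y = qt y * y ^ Q" and "Q \<ge> k"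
    and "x \<in> I"
  shows "cuspidal_beaks (ruled_surface \<gamma> \<xi>) (x, striction_param \<zeta> k qt Q x) \<longleftrightarrow>
    delta \<xi> \<zeta> x = 0 \<and> deriv (delta \<xi> \<zeta>) x \<noteq> 0 \<and> rho \<xi> \<zeta> x \<noteq> 0 \<and>
    deriv (sigma \<xi> \<zeta> k p qt Q) x \<noteq> 0"
proof -
  note I = assms(1) and xI = \<open>x \<in> I\<close>
  define d where "d = xi_d \<zeta>"
  define t where "t = striction_param \<zeta> k qt Q"
  define \<delta> where "\<delta> = delta \<xi> \<zeta>"
  define a where "a y = p y + deriv t y" for y
  define \<nu> where "\<nu> y = cross3 (\<xi> y) (d y)" for y
  have pc: "real_analytic_on \<zeta> I" "\<And>y. y \<in> I \<Longrightarrow> vector_derivative \<xi> (at y) = y ^ k *\<^sub>R \<zeta> y" "\<And>y. y \<in> I \<Longrightarrow> \<zeta> y \<noteq> 0"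
    using assms(8) by (auto simp: pseudo_cylindrical_def)
  have s\<gamma>: "smooth_at \<gamma> y" and s\<xi>: "smooth_at \<xi> y" and s\<zeta>: "smooth_at \<zeta> y" if "y \<in> I" for y
    using that assms(4,6) pc(1) real_analytic_on_imp_smooth_at by blast+
  have evI: "\<forall>\<^sub>F y in nhds z. y \<in> I" if "z \<in> I" for z using I that by (rule eventually_nhds_in_open)
  have an: "real_ana (\<lambda>z. norm (\<zeta> (y + z)))" if "y \<in> I" for y by (rule real_ana_norm[OF pc(1) that pc(3)[OF that]])
  have sn: "smooth_at (\<lambda>z. norm (\<zeta> z)) y" if "y \<in> I" for y by (rule real_ana_imp_smooth_at[OF an[OF that]])
  have at: "real_ana (\<lambda>z. t (y + z))" if y: "y \<in> I" for y
  proof -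
    have "real_ana (\<lambda>z. qt (y + z))" by (rule real_analytic_on_imp_real_ana[OF assms(11) y bounded_linear_ident])
    then show ?thesis unfolding t_def striction_param_def
      by (intro real_ana_mult real_ana_minus real_ana_divide an[OF y] real_ana_power real_ana_add real_ana_const
          real_ana_ident)
        (use pc(3)[OF y] in auto)
  qed
  have st: "smooth_at t y" if "y \<in> I" for y by (rule real_ana_imp_smooth_at[OF at[OF that]])
  have sd: "smooth_at d y" if "y \<in> I" for y
    unfolding d_def xi_d_def[abs_def]
    by (intro smooth_at_scaleR smooth_at_divide smooth_at_const sn s\<zeta> that) (use pc(3)[OF that] in auto)
  have \<delta>_eq: "\<delta> y = y ^ k * norm (\<zeta> y)" if "y \<in> I" for y
    using pc(2)[OF that] pc(3)[OF that]
    by (simp add: \<delta>_def delta_def xi_d_def dot_square_norm power2_eq_square)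
  have d_norm: "norm (\<zeta> y) *\<^sub>R d y = \<zeta> y" if "y \<in> I" for y using pc(3)[OF that] by (simp add: d_def xi_d_def)
  have dt: "(t has_field_derivative deriv t y) (at y)" if "y \<in> I" for y
    using smooth_at_imp_differentiable[OF st[OF that]] real_differentiableE DERIV_imp_deriv by metis
  have d\<xi>: "(\<xi> has_vector_derivative \<delta> y *\<^sub>R d y) (at y)" if "y \<in> I" for y
    using smooth_at_has_vector_derivative[OF s\<xi>[OF that]] d_norm[OF that] pc(2)[OF that]
    by (simp add: \<delta>_eq[OF that]) (metis scaleR_scaleR)
  have \<xi>1: "\<xi> y \<bullet> \<xi> y = 1" if "y \<in> I" for y using assms(7) that by (simp add: norm_eq_1)
  have d1: "d y \<bullet> d y = 1" if "y \<in> I" for y using pc(3)[OF that] by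
      (simp add: d_def xi_d_def dot_square_norm power2_eq_square)
  have \<xi>d: "\<xi> y \<bullet> d y = 0" if "y \<in> I" for y
    using unit_xi_orthogonal[OF assms(8,6,1,7) that] by (simp add: d_def xi_d_def)
  have \<nu>1: "\<nu> y \<bullet> \<nu> y = 1" if "y \<in> I" for y
    using \<xi>1[OF that] d1[OF that] \<xi>d[OF that] by (simp add: \<nu>_def dot_cross inner_commute)
  have \<nu>\<xi>: "\<nu> y \<bullet> \<xi> y = 0" "\<xi> y \<bullet> \<nu> y = 0" and \<nu>d: "d y \<bullet> \<nu> y = 0" for y
    by (simp_all add: \<nu>_def dot_cross_self)
  define \<gamma>' where "\<gamma>' y = vector_derivative \<gamma> (at y)" for y
  have d\<gamma>: "(\<gamma> has_vector_derivative \<gamma>' y) (at y)" if "y \<in> I" for y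
    unfolding \<gamma>'_def by (rule smooth_at_has_vector_derivative[OF s\<gamma>[OF that]])
  have \<gamma>': "\<gamma>' y = p y *\<^sub>R \<xi> y + q y *\<^sub>R d y + r y *\<^sub>R \<nu> y" if "y \<in> I" for y
    using assms(9) that by (simp add: \<gamma>'_def d_def \<nu>_def)
  have s\<gamma>': "smooth_at \<gamma>' y" if "y \<in> I" for y
    unfolding \<gamma>'_def[abs_def] by (rule smooth_at_vector_derivative[OF s\<gamma>[OF that]])
  have r_eq: "r y = \<gamma>' y \<bullet> \<nu> y" if "y \<in> I" for y
    unfolding \<gamma>'[OF that] by (simp add: inner_add_left \<nu>1[OF that] \<nu>\<xi> \<nu>d)
  have p_eq: "p y = \<gamma>' y \<bullet> \<xi> y" if "y \<in> I" for y
    unfolding \<gamma>'[OF that] using \<xi>d[OF that] by (simp add: inner_add_left \<xi>1[OF that] \<nu>\<xi> inner_commute[of "d y" "\<xi> y"])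
  \<comment> \<open>Coplanarity gives \<delta> r = 0 and \<delta> is nonzero off 0; at 0 the
    continuity of r = \<gamma>' \<bullet> \<nu> takes over.\<close>
  have r0': "r y = 0" if y: "y \<in> I" "y \<noteq> 0" for y
  proof -
    have "\<gamma>' y \<bullet> cross3 (\<xi> y) (\<delta> y *\<^sub>R d y) = 0"
      using developable_imp_coplanar[OF assms(10) I y(1) d\<gamma> d\<xi>] .
    then have "\<delta> y * r y = 0" by (simp add: r_eq[OF y(1)] \<nu>_def cross_mult_right)
    then show ?thesis using y pc(3)[OF y(1)] \<delta>_eq[OF y(1)] by simp
  qed
  have r0: "r y = 0" if y: "y \<in> I" for y
  proof (cases "y = 0")
    case True
    have "isCont (\<lambda>y. \<gamma>' y \<bullet> \<nu> y) 0"
      unfolding \<nu>_def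
      by (intro isCont_inner continuous_cross smooth_at_imp_isCont s\<gamma>' s\<xi> sd assms(3))
    moreover have "\<forall>\<^sub>F y in nhds 0. y \<noteq> 0 \<longrightarrow> \<gamma>' y \<bullet> \<nu> y = 0"
      using evI[OF assms(3)] by eventually_elim (use r0' r_eq in auto)
    ultimately have "\<forall>\<^sub>F y in nhds 0. \<gamma>' y \<bullet> \<nu> y = 0" by (intro eq_0_limit_real)
    then have "\<gamma>' 0 \<bullet> \<nu> 0 = 0" by (rule eventually_nhds_x_imp_x)
    then show ?thesis using r_eq y True by simp
  qed (use r0' y in auto)
  \<comment> \<open>Holds at y = 0 as well, because y^Q = y^(Q - k) y^k by Q \<ge> k.\<close>
  have q_eq: "q y = - (t y * \<delta> y)" if "y \<in> I" for y
  proof -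
    have "y ^ Q = y ^ (Q - k) * y ^ k" using \<open>Q \<ge> k\<close> by (simp add: power_add[symmetric])
    then show ?thesis using pc(3)[OF that] assms(12) that
      by (simp add: t_def striction_param_def \<delta>_eq)
  qed
  have d\<gamma>2: "(\<gamma> has_vector_derivative p y *\<^sub>R \<xi> y - (t y * \<delta> y) *\<^sub>R d y) (at y)" if "y \<in> I" for y
    using d\<gamma>[OF that] unfolding \<gamma>'[OF that] r0[OF that] q_eq[OF that] by simp
  have ds: "((\<lambda>x. \<gamma> x + t x *\<^sub>R \<xi> x) has_vector_derivative a y *\<^sub>R \<xi> y) (at y)" if "y \<in> I" for y
  proof -
    have "((\<lambda>x. \<gamma> x + t x *\<^sub>R \<xi> x) has_vector_derivative
        (p y *\<^sub>R \<xi> y - (t y * \<delta> y) *\<^sub>R d y) + (t y *\<^sub>R (\<delta> y *\<^sub>R d y) + deriv t y *\<^sub>R \<xi> y)) (at y)"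
      by (intro has_vector_derivative_add has_vector_derivative_scaleR d\<gamma>2 d\<xi> dt that)
    then show ?thesis by (simp add: a_def algebra_simps)
  qed
  have cont_a: "isCont a y" if y: "y \<in> I" for y
  proof -
    have "\<forall>\<^sub>F z in nhds y. \<gamma>' z \<bullet> \<xi> z + vector_derivative t (at z) = a z"
      using evI[OF y]
    proof eventually_elim
      case (elim z)
      have "vector_derivative t (at z) = deriv t z"
        using dt[OF elim] by (simp add: vector_derivative_at has_real_derivative_iff_has_vector_derivative)
      then show ?case by (simp add: a_def p_eq[OF elim])
    qed
    then have "isCont (\<lambda>z. \<gamma>' z \<bullet> \<xi> z + vector_derivative t (at z)) y = isCont a y" by (rule isCont_cong)
    moreover have "isCont (\<lambda>z. \<gamma>' z \<bullet> \<xi> z + vector_derivative t (at z)) y"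
      by (intro smooth_at_imp_isCont smooth_at_add smooth_at_inner smooth_at_vector_derivative st s\<gamma>' s\<xi> y)
    ultimately show ?thesis by simp
  qed
  have d\<delta>: "(\<delta> has_field_derivative of_nat k * y ^ (k - 1) * norm (\<zeta> y) + deriv (\<lambda>z. norm (\<zeta> z)) y * y ^ k) (at y)"
    if y: "y \<in> I" for y
  proof (rule has_field_derivative_transform_within_open[OF _ I y \<delta>_eq[symmetric]])
    have dn: "((\<lambda>z. norm (\<zeta> z)) has_field_derivative deriv (\<lambda>z. norm (\<zeta> z)) y) (at y)"
      using smooth_at_imp_differentiable[OF sn[OF y]] real_differentiableE DERIV_imp_deriv by metis
    show "((\<lambda>y. y ^ k * norm (\<zeta> y)) has_field_derivative of_nat k * y ^ (k - 1) * norm (\<zeta> y) + deriv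
        (\<lambda>z. norm (\<zeta> z)) y * y ^ k) (at y)"
      using DERIV_mult[OF DERIV_pow[of k y] dn] by simp
  qed
  have d\<delta>': "(\<delta> has_field_derivative deriv \<delta> y) (at y)" if "y \<in> I" for y
    using d\<delta>[OF that] DERIV_imp_deriv by metis
  \<comment> \<open>\<sigma> = \<delta> a, so at a zero of \<delta> the condition \<sigma>' \<noteq>
    0 separates into \<delta>' \<noteq> 0 and a = p + t' \<noteq> 0.\<close>
  have d\<sigma>: "deriv (sigma \<xi> \<zeta> k p qt Q) x = deriv \<delta> x * a x" if "\<delta> x = 0"
  proof (rule DERIV_imp_deriv)
    have "((\<lambda>y. \<delta> y *\<^sub>R a y) has_derivative (\<lambda>h. (deriv \<delta> x * h) *\<^sub>R a x)) (at x)"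
      using d\<delta>'[OF xI] that cont_a[OF xI]
      by (intro has_derivative_scaleR_vanishing) (simp_all add: has_field_derivative_def)
    then have "((\<lambda>y. \<delta> y * a y) has_derivative (*) (deriv \<delta> x * a x)) (at x)"
      unfolding real_scaleR_def by (rule has_derivative_eq_rhs) (simp add: fun_eq_iff mult_ac)
    then show "(sigma \<xi> \<zeta> k p qt Q has_field_derivative deriv \<delta> x * a x) (at x)"
      unfolding has_field_derivative_def sigma_def[abs_def] a_def \<delta>_def t_def .
  qed
  have dd: "(d has_vector_derivative vector_derivative d (at x)) (at x)"
    by (rule smooth_at_has_vector_derivative[OF sd[OF xI]])
  have rho: "rho \<xi> \<zeta> x = \<xi> x \<bullet> cross3 (d x) (vector_derivative d (at x))"
    by (simp add: rho_def d_def dot_cross_det)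
  have F': "(ruled_surface \<gamma> \<xi> has_derivative (\<lambda>h. (fst h * p x + snd h) *\<^sub>R \<xi> x)) (at (x, t x))"
    by (rule has_derivative_eq_rhs[OF ruled_surface_has_derivative[OF d\<gamma>2[OF xI] d\<xi>[OF xI]]])
      (simp add: fun_eq_iff algebra_simps)
  have sing: "singular_point (ruled_surface \<gamma> \<xi>) (x, t x)"
  proof -
    have "\<not> inj (\<lambda>h. (fst h * p x + snd h) *\<^sub>R \<xi> x)"
    proof
      assume "inj (\<lambda>h. (fst h * p x + snd h) *\<^sub>R \<xi> x)"
      from injD[OF this, of "(1, - p x)" "(0, 0)"] show False by simp
    qed
    then show ?thesis
      using F' frechet_derivative_at[OF F'] by (auto simp: singular_point_def differentiable_def)
  qed
  have "A_equivalent (ruled_surface \<gamma> \<xi>) (x, t x) beaks_model (0, 0) \<longleftrightarrow>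
    \<delta> x = 0 \<and> deriv \<delta> x \<noteq> 0 \<and> rho \<xi> \<zeta> x \<noteq> 0 \<and> deriv (sigma \<xi> \<zeta> k p qt Q) x \<noteq> 0" (is "?A \<longleftrightarrow> ?R")
  proof
    assume A: ?A
    have "cross3 (\<xi> x) (d x) \<noteq> 0" using \<nu>1[OF xI] by (auto simp: \<nu>_def)
    moreover have "\<forall>\<^sub>F y in nhds x. (\<gamma> has_vector_derivative p y *\<^sub>R \<xi> y - (t y * \<delta> y) *\<^sub>R d y) (at y)"
      and "\<forall>\<^sub>F y in nhds x. (\<xi> has_vector_derivative \<delta> y *\<^sub>R d y) (at y)"
      using evI[OF xI] by (auto elim!: eventually_mono intro: d\<gamma>2 d\<xi>)
    ultimately have "\<delta> x = 0" "deriv \<delta> x \<noteq> 0" "p x + deriv t x \<noteq> 0" "\<xi> x \<bullet> cross3 (d x) (vector_derivative d (at x)) \<noteq> 0"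
      using A_equivalent_beaksD[OF A _ _ dd dt[OF xI] d\<delta>'[OF xI]] by blast+
    then show ?R using d\<sigma> rho by (simp add: a_def)
  next
    assume R: ?R
    \<comment> \<open>\<delta> = y^k |\<zeta>| vanishes only at 0, and only when k > 0.\<close>
    then have "x ^ k = 0" using \<delta>_eq[OF xI] pc(3)[OF xI] by simp
    then have x: "x = 0" and k: "k \<noteq> 0" by (auto intro: ccontr)
    have "deriv \<delta> 0 = of_nat k * 0 ^ (k - 1) * norm (\<zeta> 0) + deriv (\<lambda>z. norm (\<zeta> z)) 0 * 0 ^ k"
      by (rule DERIV_imp_deriv[OF d\<delta>[OF assms(3)]])
    then have "(0::real) ^ (k - 1) \<noteq> 0" using R k x by (auto simp: power_0_left)
    \<comment> \<open>The surviving term of \<delta>'(0) contains 0^(k - 1), which is 1 for k = 1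
      and 0 beyond.\<close>
    then have k1: "k = 1" using k by (cases "k - 1 = 0") (auto simp: power_0_left)
    have a0: "a 0 \<noteq> 0" using R d\<sigma> x by simp
    have d\<zeta>: "(\<zeta> has_vector_derivative vector_derivative \<zeta> (at 0)) (at 0)"
      by (rule smooth_at_has_vector_derivative[OF s\<zeta>[OF assms(3)]])
    obtain N' where N': "((\<lambda>z. 1 / norm (\<zeta> z)) has_field_derivative N') (at 0)"
      using smooth_at_imp_differentiable[OF smooth_at_divide[OF smooth_at_const sn[OF assms(3)]]]
          pc(3)[OF assms(3)] real_differentiableE
      by (metis norm_eq_zero)
    \<comment> \<open>d' differs from \<zeta>'/|\<zeta>| by a multiple of \<zeta>, which drops out
      of the triple product; so \<rho>(0) is a nonzero multiple of det(\<xi>, \<zeta>,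
      \<zeta>').\<close>
    have "(d has_vector_derivative (1 / norm (\<zeta> 0)) *\<^sub>R vector_derivative \<zeta> (at 0) + N' *\<^sub>R \<zeta> 0) (at 0)"
      unfolding d_def xi_d_def[abs_def] by (rule has_vector_derivative_scaleR[OF N' d\<zeta>])
    then have "vector_derivative d (at 0) = (1 / norm (\<zeta> 0)) *\<^sub>R vector_derivative \<zeta> (at 0) + N' *\<^sub>R \<zeta> 0"
      by (rule vector_derivative_at)
    then have "\<xi> 0 \<bullet> cross3 (\<zeta> 0) (vector_derivative \<zeta> (at 0)) \<noteq> 0"
      using R rho x by (auto simp: d_def xi_d_def cross_add_right cross_mult_right cross_mult_left)
    moreover have "\<forall>\<^sub>F y in nhds 0. (\<xi> has_vector_derivative y *\<^sub>R \<zeta> y) (at y)"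
      using evI[OF assms(3)]
      by eventually_elim (use smooth_at_has_vector_derivative[OF s\<xi>] pc(2) k1 in force)
    moreover have "\<forall>\<^sub>F y in nhds 0. ((\<lambda>x. \<gamma> x + t x *\<^sub>R \<xi> x) has_vector_derivative a y *\<^sub>R \<xi> y) (at y)"
      using evI[OF assms(3)] by eventually_elim (rule ds)
    ultimately have "A_equivalent (ruled_surface \<gamma> \<xi>) (0, t 0) beaks_model (0, 0)"
      using real_analytic_on_imp_real_ana[OF assms(4,3)] real_analytic_on_imp_real_ana[OF assms(6,3)]
        real_analytic_on_imp_real_ana[OF pc(1) assms(3)] at[OF assms(3)]
        smooth_at_imp_isCont[OF s\<gamma>[OF assms(3)]] smooth_at_imp_isCont[OF s\<xi>[OF assms(3)]] cont_a[OF assms(3)] a0 d\<zeta>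
      by (intro A_equivalent_beaksI[of \<gamma> \<xi> \<zeta> t a]) simp_all
    then show ?A by (simp add: x)
  qed
  then show ?thesis using sing by (simp add: cuspidal_beaks_def t_def \<delta>_def)
qed

end
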